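(* Let $\mathcal H$ be a multiplicative representation. There is a constant $A\ge0$ (depending only on $\mathcal H$) such that for every $K$-invariant $\alpha\in\mathcal H^{\mathrm{fin}}$, $$\|\alpha\|_{L^\infty}\le\|\exp(A\log_+^2\Delta)\alpha\|_{\mathcal H}.$$
   Context: $G=\mathrm{PSL}_2(\mathbf R)$, $K=\mathrm{PSO}_2(\mathbf R)$, $\mathfrak g=\mathfrak{sl}_2(\mathbf C)$, $H=\frac1{2i}\begin{pmatrix}0&1\\-1&0\end{pmatrix}$, $E=\frac12\begin{pmatrix}1&i\\i&-1\end{pmatrix}$, $\bar E$ its complex conjugate; the Casimir is $\Delta=-H^2-\frac12(E\bar E+\bar EE)$. A multiplicative representation is a unitary $G$-representation $\mathcal H$ with discrete spectrum (Hilbert sum of irreducibles, finitely many with Casimir eigenvalue in any bounded set), with $\mathcal H^{\rm fin}$ the algebraic sum of $K$-finite vectors of the summands, together with a bilinear map $\mathcal H^{\rm fin}\times\mathcal H^{\rm fin}\to\mathcal H^\infty$ (smooth vectors) that is commutative, has a unit $\mathbf 1$ of norm $1$ with $\mathcal H^G=\mathbf C\mathbf 1$, obeys the product rule for $\mathfrak g$, admits conjugates $\bar\alpha\in\mathcal H^{\rm fin}$ with $\langle\alpha\beta,\gamma\rangle=\langle\beta,\bar\alpha\gamma\rangle$, and satisfies crossing symmetry $\langle\alpha_1\alpha_2,\bar\alpha_3\bar\alpha_4\rangle=\langle\alpha_{\sigma(1)}\alpha_{\sigma(2)},\bar\alpha_{\sigma(3)}\bar\alpha_{\sigma(4)}\rangle$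 for $\sigma\in S_4$. $\|\alpha\|_{L^\infty}$ is the smallest $C\in[0,\infty]$ with $\|\alpha\beta\|\le C\|\beta\|$ for all $\beta\in\mathcal H^{\rm fin}$. $\mathcal H_{\Delta=\lambda}$ is the closure of the $\lambda$-eigenspace of $\Delta$ on $\mathcal H^\infty$, $\mathbf 1_{\Delta=\lambda}$ the orthogonal projection onto it; for $f:\mathbf R\to\mathbf C$, $\|f(\Delta)v\|=(\sum_\lambda|f(\lambda)|^2\|\mathbf 1_{\Delta=\lambda}v\|^2)^{1/2}$. $\log_+(x)=\log\max\{x,2\}$. *)

theory Defs
  imports "HOL-Analysis.Analysis"
begin

class mr_cvec = ab_group_add +
  fixes scC :: "complex \<Rightarrow> 'a \<Rightarrow> 'a"
  assumes scC_add_right: "scC a (x + y) = scC a x + scC a y"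
    and scC_add_left: "scC (a + b) x = scC a x + scC b x"
    and scC_scC: "scC a (scC b x) = scC (a * b) x"
    and scC_one: "scC 1 x = x"

class mr_cinner = mr_cvec +
  fixes cinner :: "'a \<Rightarrow> 'a \<Rightarrow> complex"
  assumes cinner_add_left: "cinner (x + y) z = cinner x z + cinner y z"
    and cinner_scC_left: "cinner (scC a x) y = a * cinner x y"
    and cinner_commute: "cinner y x = cnj (cinner x y)"
    and cinner_nonneg: "0 \<le> Re (cinner x x)"
    and cinner_eq_0: "cinner x x = 0 \<Longrightarrow> x = 0"

class mr_chilbert = mr_cinner +
  assumes cinner_complete:
    "(\<forall>e>0. \<exists>N. \<forall>m\<ge>N. \<forall>n\<ge>N. sqrt (Re (cinner (X m - X n) (X m - X n))) < e)
      \<Longrightarrow> \<exists>L. (\<lambda>n. sqrt (Re (cinner (X n - L) (X n - L)))) \<longlonglongrightarrow> 0"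

definition cnrm :: "'h::mr_chilbert \<Rightarrow> real" where
  "cnrm x = sqrt (Re (cinner x x))"

definition mr_cspan :: "'h::mr_chilbert set \<Rightarrow> 'h set" where
  "mr_cspan S = {x. \<exists>(n::nat) c s. (\<forall>j<n. s j \<in> S) \<and> x = (\<Sum>j<n. scC (c j) (s j))}"

definition mr_csubspace :: "'h::mr_chilbert set \<Rightarrow> bool" where
  "mr_csubspace S \<longleftrightarrow> 0 \<in> S \<and> (\<forall>x\<in>S. \<forall>y\<in>S. x + y \<in> S) \<and> (\<forall>c. \<forall>x\<in>S. scC c x \<in> S)"

definition cclosure :: "'h::mr_chilbert set \<Rightarrow> 'h set" where
  "cclosure S = {v. \<forall>e>0. \<exists>s\<in>S. cnrm (v - s) < e}"

definition cclosed :: "'h::mr_chilbert set \<Rightarrow> bool" where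
  "cclosed S \<longleftrightarrow> cclosure S \<subseteq> S"

definition cproj :: "'h::mr_chilbert set \<Rightarrow> 'h \<Rightarrow> 'h" where
  "cproj S v = (THE w. w \<in> S \<and> (\<forall>s\<in>S. cinner (v - w) s = 0))"

type_synonym sl2 = "real \<times> real \<times> real \<times> real"  \<comment> \<open>(a,b,c,d) = matrix [[a,b],[c,d]]\<close>

definition SL2 :: "sl2 set" where
  "SL2 = {(a, b, c, d). a * d - b * c = 1}"

fun sl2_mult :: "sl2 \<Rightarrow> sl2 \<Rightarrow> sl2" where
  "sl2_mult (a, b, c, d) (e, f, g, h) = (a*e + b*g, a*f + b*h, c*e + d*g, c*f + d*h)"

definition sl2_one :: sl2 where "sl2_one = (1, 0, 0, 1)"

fun sl2_neg :: "sl2 \<Rightarrow> sl2" where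
  "sl2_neg (a, b, c, d) = (-a, -b, -c, -d)"

text \<open>Rotations exp(t W), W = [[0,1],[-1,0]]; their image in PSL_2 is K = PSO_2.\<close>
definition sl2_rot :: "real \<Rightarrow> sl2" where
  "sl2_rot t = (cos t, sin t, - sin t, cos t)"

text \<open>A basis of sl_2(R): W = [[0,1],[-1,0]], Hd = [[1,0],[0,-1]], S = [[0,1],[1,0]],
  with their one-parameter subgroups exp(tX).\<close>
datatype sl2_basis = BW | BHd | BS

fun sl2_exp :: "sl2_basis \<Rightarrow> real \<Rightarrow> sl2" where
  "sl2_exp BW t = sl2_rot t"
| "sl2_exp BHd t = (exp t, 0, 0, exp (- t))"
| "sl2_exp BS t = (cosh t, sinh t, sinh t, cosh t)"

text \<open>Unitary (strongly continuous) representation of PSL_2(R) = SL_2(R)/{+-1}.\<close>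
definition unitary_rep :: "(sl2 \<Rightarrow> 'h::mr_chilbert \<Rightarrow> 'h) \<Rightarrow> bool" where
  "unitary_rep \<pi> \<longleftrightarrow>
     (\<forall>g\<in>SL2. \<forall>h\<in>SL2. \<forall>v. \<pi> (sl2_mult g h) v = \<pi> g (\<pi> h v))
   \<and> (\<forall>v. \<pi> sl2_one v = v)
   \<and> (\<forall>g\<in>SL2. \<pi> (sl2_neg g) = \<pi> g)
   \<and> (\<forall>g\<in>SL2. \<forall>v w. \<pi> g (v + w) = \<pi> g v + \<pi> g w)
   \<and> (\<forall>g\<in>SL2. \<forall>c v. \<pi> g (scC c v) = scC c (\<pi> g v))
   \<and> (\<forall>g\<in>SL2. \<forall>v w. cinner (\<pi> g v) (\<pi> g w) = cinner v w)
   \<and> (\<forall>v. \<forall>g\<in>SL2. \<forall>e>0. \<exists>d>0. \<forall>h\<in>SL2. dist h g < d \<longrightarrow> cnrm (\<pi> h v - \<pi> g v) < e)"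

definition has_dact :: "(sl2 \<Rightarrow> 'h::mr_chilbert \<Rightarrow> 'h) \<Rightarrow> sl2_basis \<Rightarrow> 'h \<Rightarrow> 'h \<Rightarrow> bool" where
  "has_dact \<pi> X v w \<longleftrightarrow>
     ((\<lambda>t. cnrm (scC (complex_of_real (1 / t)) (\<pi> (sl2_exp X t) v - v) - w)) \<longlongrightarrow> 0) (at 0)"

definition dact :: "(sl2 \<Rightarrow> 'h::mr_chilbert \<Rightarrow> 'h) \<Rightarrow> sl2_basis \<Rightarrow> 'h \<Rightarrow> 'h" where
  "dact \<pi> X v = (THE w. has_dact \<pi> X v w)"

fun smooth_word :: "(sl2 \<Rightarrow> 'h::mr_chilbert \<Rightarrow> 'h) \<Rightarrow> sl2_basis list \<Rightarrow> 'h \<Rightarrow> bool" where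
  "smooth_word \<pi> [] v = True"
| "smooth_word \<pi> (X # Xs) v = (\<exists>w. has_dact \<pi> X v w \<and> smooth_word \<pi> Xs w)"

definition Hinf :: "(sl2 \<Rightarrow> 'h::mr_chilbert \<Rightarrow> 'h) \<Rightarrow> 'h set" where
  "Hinf \<pi> = {v. \<forall>Xs. smooth_word \<pi> Xs v}"

definition opH :: "(sl2 \<Rightarrow> 'h::mr_chilbert \<Rightarrow> 'h) \<Rightarrow> 'h \<Rightarrow> 'h" where
  "opH \<pi> v = scC (1 / (2 * \<i>)) (dact \<pi> BW v)"

definition opE :: "(sl2 \<Rightarrow> 'h::mr_chilbert \<Rightarrow> 'h) \<Rightarrow> 'h \<Rightarrow> 'h" where
  "opE \<pi> v = scC (1 / 2) (dact \<pi> BHd v) + scC (\<i> / 2) (dact \<pi> BS v)"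

definition opEbar :: "(sl2 \<Rightarrow> 'h::mr_chilbert \<Rightarrow> 'h) \<Rightarrow> 'h \<Rightarrow> 'h" where
  "opEbar \<pi> v = scC (1 / 2) (dact \<pi> BHd v) - scC (\<i> / 2) (dact \<pi> BS v)"

definition casimir :: "(sl2 \<Rightarrow> 'h::mr_chilbert \<Rightarrow> 'h) \<Rightarrow> 'h \<Rightarrow> 'h" where
  "casimir \<pi> v = - opH \<pi> (opH \<pi> v)
      - scC (1 / 2) (opE \<pi> (opEbar \<pi> v) + opEbar \<pi> (opE \<pi> v))"

definition invariant_sub :: "(sl2 \<Rightarrow> 'h::mr_chilbert \<Rightarrow> 'h) \<Rightarrow> 'h set \<Rightarrow> bool" where
  "invariant_sub \<pi> V \<longleftrightarrow> mr_csubspace V \<and> cclosed V \<and> (\<forall>g\<in>SL2. \<forall>v\<in>V. \<pi> g v \<in> V)"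

definition irreducible_sub :: "(sl2 \<Rightarrow> 'h::mr_chilbert \<Rightarrow> 'h) \<Rightarrow> 'h set \<Rightarrow> bool" where
  "irreducible_sub \<pi> V \<longleftrightarrow> invariant_sub \<pi> V \<and> V \<noteq> {0}
     \<and> (\<forall>W. invariant_sub \<pi> W \<and> W \<subseteq> V \<longrightarrow> W = {0} \<or> W = V)"

definition discrete_spectrum :: "(sl2 \<Rightarrow> 'h::mr_chilbert \<Rightarrow> 'h) \<Rightarrow> nat set \<Rightarrow> (nat \<Rightarrow> 'h set) \<Rightarrow> bool" where
  "discrete_spectrum \<pi> I V \<longleftrightarrow>
     (\<forall>i\<in>I. irreducible_sub \<pi> (V i))
   \<and> (\<forall>i\<in>I. \<forall>j\<in>I. i \<noteq> j \<longrightarrow> (\<forall>v\<in>V i. \<forall>w\<in>V j. cinner v w = 0))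
   \<and> cclosure (mr_cspan (\<Union>i\<in>I. V i)) = UNIV
   \<and> (\<forall>B::real. finite {i\<in>I. \<exists>l v. cmod l \<le> B \<and> v \<in> V i \<inter> Hinf \<pi> \<and> v \<noteq> 0
                                   \<and> casimir \<pi> v = scC l v})"

definition Kfinite :: "(sl2 \<Rightarrow> 'h::mr_chilbert \<Rightarrow> 'h) \<Rightarrow> 'h \<Rightarrow> bool" where
  "Kfinite \<pi> v \<longleftrightarrow> (\<exists>F. finite F \<and> (\<forall>t. \<pi> (sl2_rot t) v \<in> mr_cspan F))"

definition Hfin :: "(sl2 \<Rightarrow> 'h::mr_chilbert \<Rightarrow> 'h) \<Rightarrow> nat set \<Rightarrow> (nat \<Rightarrow> 'h set) \<Rightarrow> 'h set" where
  "Hfin \<pi> I V = mr_cspan (\<Union>i\<in>I. {v \<in> V i. Kfinite \<pi> v})"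

definition mult_rep ::
  "(sl2 \<Rightarrow> 'h::mr_chilbert \<Rightarrow> 'h) \<Rightarrow> nat set \<Rightarrow> (nat \<Rightarrow> 'h set)
     \<Rightarrow> ('h \<Rightarrow> 'h \<Rightarrow> 'h) \<Rightarrow> 'h \<Rightarrow> ('h \<Rightarrow> 'h) \<Rightarrow> bool" where
  "mult_rep \<pi> I V mul one cj \<longleftrightarrow>
     unitary_rep \<pi> \<and> discrete_spectrum \<pi> I V
   \<and> (let F = Hfin \<pi> I V in
       (\<forall>a\<in>F. \<forall>b\<in>F. mul a b \<in> Hinf \<pi>)
     \<and> (\<forall>a\<in>F. \<forall>b\<in>F. \<forall>c\<in>F. mul (a + b) c = mul a c + mul b c)
     \<and> (\<forall>a\<in>F. \<forall>b\<in>F. \<forall>z. mul (scC z a) b = scC z (mul a b))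
     \<and> (\<forall>a\<in>F. \<forall>b\<in>F. mul a b = mul b a)
     \<and> one \<in> F \<and> (\<forall>a\<in>F. mul one a = a) \<and> cnrm one = 1
     \<and> {v. \<forall>g\<in>SL2. \<pi> g v = v} = range (\<lambda>z. scC z one)
     \<and> (\<forall>X. \<forall>a\<in>F. \<forall>b\<in>F. has_dact \<pi> X (mul a b)
                             (mul (dact \<pi> X a) b + mul a (dact \<pi> X b)))
     \<and> (\<forall>a\<in>F. cj a \<in> F \<and> (\<forall>b\<in>F. \<forall>c\<in>F. cinner (mul a b) c = cinner b (mul (cj a) c)))
     \<and> (\<forall>a. (\<forall>j<4. a j \<in> F) \<longrightarrow> (\<forall>\<sigma>::nat\<Rightarrow>nat. bij_betw \<sigma> {0..<4::nat} {0..<4} \<longrightarrow>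
           cinner (mul (a (\<sigma> 0)) (a (\<sigma> 1))) (mul (cj (a (\<sigma> 2))) (cj (a (\<sigma> 3)))) =
           cinner (mul (a 0) (a 1)) (mul (cj (a 2)) (cj (a 3))))))"

definition Linf_norm ::
  "(sl2 \<Rightarrow> 'h::mr_chilbert \<Rightarrow> 'h) \<Rightarrow> nat set \<Rightarrow> (nat \<Rightarrow> 'h set) \<Rightarrow> ('h \<Rightarrow> 'h \<Rightarrow> 'h) \<Rightarrow> 'h \<Rightarrow> ereal" where
  "Linf_norm \<pi> I V mul a = Inf {C::ereal. 0 \<le> C \<and>
      (\<forall>b\<in>Hfin \<pi> I V. ereal (cnrm (mul a b)) \<le> C * ereal (cnrm b))}"

definition eig_space :: "(sl2 \<Rightarrow> 'h::mr_chilbert \<Rightarrow> 'h) \<Rightarrow> real \<Rightarrow> 'h set" where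
  "eig_space \<pi> l = cclosure {v \<in> Hinf \<pi>. casimir \<pi> v = scC (complex_of_real l) v}"

definition fDelta_norm :: "(sl2 \<Rightarrow> 'h::mr_chilbert \<Rightarrow> 'h) \<Rightarrow> (real \<Rightarrow> complex) \<Rightarrow> 'h \<Rightarrow> real" where
  "fDelta_norm \<pi> f v = sqrt (infsum (\<lambda>l. (cmod (f l))\<^sup>2 * (cnrm (cproj (eig_space \<pi> l) v))\<^sup>2) UNIV)"

definition log_plus :: "real \<Rightarrow> real" where
  "log_plus x = ln (max x 2)"

end

theory Submission
  imports Defs
begin

text \<open>By Schur's lemma each irreducible summand contains at most one line of \<open>K\<close>-invariant vectors, spanned by
  a Casimir eigenvector \<open>e\<^sub>k\<close> with eigenvalue \<open>\<lambda>\<^sub>k \<ge> 0\<close>. For \<open>K\<close>-invariant \<open>u\<close> put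
  \<open>S\<^sub>n(u) = E\<^sup>n u \<cdot> cj (E\<^sup>n u) + \<bar>E\<^sup>n u \<cdot> cj (\<bar>E\<^sup>n u)\<close>. The product rule gives a three-term recursion expressing
  \<open>\<Delta> S\<^sub>n\<close> through \<open>S\<^bsub>n+1\<^esub>\<close>, \<open>S\<^sub>n\<close>, \<open>S\<^bsub>n-1\<^esub>\<close>; if the spectrum of \<open>u\<close> lies in a short window
  \<open>[L, (1 + \<delta>) L]\<close>, this says that \<open>S\<^sub>n\<close> is nearly \<open>L\<^sup>n T\<^sub>n(1 - \<Delta> / 2L) S\<^sub>0\<close>, with \<open>T\<^sub>n\<close> the Chebyshev polynomial.
  Crossing symmetry makes \<open>\<langle>S\<^sub>n(u), S\<^sub>0(u)\<rangle>\<close> a sum of squared norms, hence nonnegative. The combination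
  \<open>3 T\<^sub>1 + 2 T\<^sub>2 + T\<^sub>3\<close> is negative for \<open>\<Delta> \<ge> 9/10 L\<close>, so the part of \<open>u \<cdot> cj u\<close> with Casimir eigenvalue below \<open>9/10 L\<close>
  controls the whole of it. On geometric windows this becomes a recursion for \<open>Q\<^sub>n = sup \<parallel>u \<cdot> cj u\<parallel>\<close>
  which forces \<open>Q\<^sub>n\<close> to grow at most exponentially in \<open>n\<close>, that is, polynomially in \<open>L\<close>. Expanding
  \<open>\<parallel>u b\<parallel>\<^sup>2 = \<langle>u \<cdot> cj u, b \<cdot> cj b\<rangle>\<close> over the windows yields a quadratic inequality for the supremum of the suitably
  weighted norms \<open>\<parallel>u b\<parallel>\<close>, hence a bound on the \<open>L\<^sup>\<infinity>\<close> norm of \<open>u\<close> polynomial in \<open>L\<close>; summing over windows with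
  Cauchy--Schwarz loses far less than \<open>exp(A log\<^sub>+\<^sup>2 \<Delta>)\<close>.\<close>

section \<open>Hilbert space preliminaries\<close>

text \<open>Two obstacles shape the proof. First, Haar integration and unbounded spectral theory are
  avoided: K-finite vectors are smooth because \<open>mul one a = a\<close> and products are smooth
  by axiom. So the Casimir is everywhere defined on the closed space of K-invariant vectors of a
  summand, is bounded there by Hellinger-Toeplitz, and Schur's lemma needs only a square root of a
  bounded operator and Taylor's formula. Second, the decisive estimates absorb a term into their own
  left side, so each supremum must be finite beforehand; windows with finitely many spherical lines
  guarantee this. The constants form a chain. The Chebyshev errors add up to 601600 \<delta>, and
  \<delta> = 1/1203200 makes this one half. The bootstrap constant is then 1400, the growth rate of
  \<open>Q\<close> is 1401, and 2802 = 2 * 1401 leaves a geometric factor 1/2 to sum. The windows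
  start at 1/\<delta>, so that terms of relative size 1/L are at most of order \<delta>.\<close>

lemma scC_0_left [simp]: "scC 0 (x::'a::mr_cvec) = 0"
  using scC_add_left[of 0 0 x] by simp

lemma scC_0_right [simp]: "scC a (0::'a::mr_cvec) = 0"
  using scC_add_right[of a 0 0] by simp

lemma scC_minus_left: "scC (- a) (x::'a::mr_cvec) = - scC a x"
  using scC_add_left[of a "- a" x] by (simp add: add_eq_0_iff)

lemma scC_minus_right: "scC a (- x::'a::mr_cvec) = - scC a x"
  using scC_add_right[of a x "- x"] by (simp add: add_eq_0_iff)

lemma scC_diff_right: "scC a (x - y::'a::mr_cvec) = scC a x - scC a y"
  using scC_add_right[of a x "- y"] by (simp add: scC_minus_right)

lemma scC_diff_left: "scC (a - b) (x::'a::mr_cvec) = scC a x - scC b x"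
  using scC_add_left[of a "- b" x] by (simp add: scC_minus_left)

lemma scC_sum_right: "scC a (\<Sum>i\<in>S. f i) = (\<Sum>i\<in>S. scC a (f i :: 'a::mr_cvec))"
  by (induction S rule: infinite_finite_induct) (auto simp: scC_add_right)

lemma scC_eq_0_iff [simp]: "scC a (x::'a::mr_cvec) = 0 \<longleftrightarrow> a = 0 \<or> x = 0"
proof
  assume *: "scC a x = 0"
  show "a = 0 \<or> x = 0"
  proof (cases "a = 0")
    case False
    then have "x = scC (inverse a * a) x" by (simp add: scC_one)
    also have "\<dots> = 0" using * by (simp flip: scC_scC)
    finally show ?thesis by simp
  qed simp
qed auto

lemma cinner_0_left [simp]: "cinner (0::'a::mr_cinner) y = 0"
  using cinner_add_left[of 0 0 y] by simp

lemma cinner_0_right [simp]: "cinner x (0::'a::mr_cinner) = 0"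
  using cinner_commute[of 0 x] by simp

lemma cinner_add_right: "cinner x (y + z :: 'a::mr_cinner) = cinner x y + cinner x z"
  by (metis cinner_add_left cinner_commute complex_cnj_add)

lemma cinner_scC_right: "cinner x (scC a y :: 'a::mr_cinner) = cnj a * cinner x y"
  by (metis cinner_scC_left cinner_commute complex_cnj_mult)

lemma cinner_minus_left: "cinner (- x :: 'a::mr_cinner) y = - cinner x y"
  using cinner_add_left[of x "- x" y] by (simp add: add_eq_0_iff)

lemma cinner_minus_right: "cinner x (- y :: 'a::mr_cinner) = - cinner x y"
  using cinner_add_right[of x y "- y"] by (simp add: add_eq_0_iff)

lemma cinner_diff_left: "cinner (x - y :: 'a::mr_cinner) z = cinner x z - cinner y z"
  using cinner_add_left[of x "- y" z] by (simp add: cinner_minus_left)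

lemma cinner_diff_right: "cinner x (y - z :: 'a::mr_cinner) = cinner x y - cinner x z"
  using cinner_add_right[of x y "- z"] by (simp add: cinner_minus_right)

lemma cinner_sum_left: "cinner (\<Sum>i\<in>S. f i) (y :: 'a::mr_cinner) = (\<Sum>i\<in>S. cinner (f i) y)"
  by (induction S rule: infinite_finite_induct) (auto simp: cinner_add_left)

lemma cinner_sum_right: "cinner (y :: 'a::mr_cinner) (\<Sum>i\<in>S. f i) = (\<Sum>i\<in>S. cinner y (f i))"
  by (induction S rule: infinite_finite_induct) (auto simp: cinner_add_right)

lemmas cinner_simps = cinner_add_left cinner_add_right cinner_diff_left cinner_diff_right
  cinner_minus_left cinner_minus_right cinner_scC_left cinner_scC_right

lemma cnrm_nonneg [simp]: "0 \<le> cnrm x"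
  by (simp add: cnrm_def cinner_nonneg)

lemma cnrm_power2: "(cnrm x)\<^sup>2 = Re (cinner x x)"
  by (simp add: cnrm_def cinner_nonneg)

lemma cinner_self: "cinner x x = complex_of_real ((cnrm x)\<^sup>2)"
proof -
  have "Im (cinner x x) = 0"
    using arg_cong[OF cinner_commute[of x x], of Im] by simp
  then show ?thesis by (simp add: complex_eq_iff cnrm_power2)
qed

lemma cnrm_0 [simp]: "cnrm 0 = 0"
  by (simp add: cnrm_def)

lemma cnrm_eq_0_iff [simp]: "cnrm x = 0 \<longleftrightarrow> x = 0"
  using cinner_self[of x] cinner_eq_0[of x] by auto

lemma cnrm_scC: "cnrm (scC a x) = cmod a * cnrm x"
proof -
  have "cinner (scC a x) (scC a x) = (a * cnj a) * complex_of_real ((cnrm x)\<^sup>2)"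
    unfolding cinner_scC_left cinner_scC_right by (simp add: cinner_self)
  also have "\<dots> = complex_of_real ((cmod a * cnrm x)\<^sup>2)"
    by (simp add: power_mult_distrib flip: complex_norm_square)
  finally have "(cnrm (scC a x))\<^sup>2 = (cmod a * cnrm x)\<^sup>2"
    unfolding cnrm_power2[of "scC a x"] by simp
  then show ?thesis by (simp add: power2_eq_iff_nonneg)
qed

lemma cnrm_minus [simp]: "cnrm (- x) = cnrm x"
  using cnrm_scC[of "-1" x] by (simp add: scC_minus_left scC_one)

lemma cnrm_diff_commute: "cnrm (x - y) = cnrm (y - x)"
  using cnrm_minus[of "x - y"] by simp

text \<open>Both Cauchy-Schwarz and the orthogonality of the nearest point in
  \<open>orthogonal_projection_exists\<close> are read off from this norm of the component
  orthogonal to y.\<close>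

lemma cinner_residual:
  fixes x y :: "'h::mr_chilbert"
  assumes "y \<noteq> 0"
  shows "(cnrm (x - scC (cinner x y / cinner y y) y))\<^sup>2 = (cnrm x)\<^sup>2 - (cmod (cinner x y))\<^sup>2 / (cnrm y)\<^sup>2"
proof -
  define r where "r = (cnrm y)\<^sup>2"
  have r: "r \<noteq> 0" "cinner y y = complex_of_real r"
    using assms by (auto simp: r_def cinner_self)
  define p where "p = cinner x y"
  have yx: "cinner y x = cnj p" by (simp add: p_def flip: cinner_commute)
  have "cinner (x - scC (p / r) y) (x - scC (p / r) y) =
      cinner x x - p * cnj p / r"
    using r(1) by (simp add: cinner_simps yx r(2) p_def[symmetric] field_simps)
  then have "Re (cinner (x - scC (p / r) y) (x - scC (p / r) y)) = Re (cinner x x) - Re (p * cnj p) / r"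
    by simp
  moreover have "Re (p * cnj p) = (cmod p)\<^sup>2" by (simp flip: complex_norm_square)
  ultimately show ?thesis
    unfolding r(2) p_def[symmetric] by (simp add: cnrm_power2 r_def)
qed

lemma cinner_Cauchy_Schwarz: "cmod (cinner x y) \<le> cnrm x * cnrm y"
proof (cases "y = 0")
  case False
  have "0 \<le> (cnrm x)\<^sup>2 - (cmod (cinner x y))\<^sup>2 / (cnrm y)\<^sup>2"
    using cinner_residual[OF False, of x] zero_le_power2 by metis
  then have "(cmod (cinner x y))\<^sup>2 \<le> (cnrm x * cnrm y)\<^sup>2"
    using False by (simp add: field_simps power_mult_distrib)
  then show ?thesis by (rule power2_le_imp_le) simp
qed simp

lemma cnrm_triangle: "cnrm (x + y) \<le> cnrm x + cnrm y"
proof (rule power2_le_imp_le)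
  have "(cnrm (x + y))\<^sup>2 = (cnrm x)\<^sup>2 + (cnrm y)\<^sup>2 + Re (cinner x y) + Re (cinner y x)"
    unfolding cnrm_power2 by (simp add: cinner_simps)
  also have "\<dots> \<le> (cnrm x)\<^sup>2 + (cnrm y)\<^sup>2 + cnrm x * cnrm y + cnrm y * cnrm x"
    using cinner_Cauchy_Schwarz[of x y] cinner_Cauchy_Schwarz[of y x]
      complex_Re_le_cmod[of "cinner x y"] complex_Re_le_cmod[of "cinner y x"] by linarith
  finally show "(cnrm (x + y))\<^sup>2 \<le> (cnrm x + cnrm y)\<^sup>2"
    by (simp add: power2_eq_square algebra_simps)
qed simp

lemma cnrm_triangle_diff: "cnrm (x - y) \<le> cnrm x + cnrm y"
  using cnrm_triangle[of x "- y"] by simp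

lemma cnrm_triangle_3: "cnrm (x - z) \<le> cnrm (x - y) + cnrm (y - z)"
  using cnrm_triangle[of "x - y" "y - z"] by simp

lemma cnrm_reverse_triangle: "\<bar>cnrm x - cnrm y\<bar> \<le> cnrm (x - y)"
  using cnrm_triangle[of "x - y" y] cnrm_triangle[of "y - x" x] cnrm_diff_commute[of x y] by simp

lemma cnrm_sum_le: "cnrm (\<Sum>i\<in>S. f i) \<le> (\<Sum>i\<in>S. cnrm (f i))"
  by (induction S rule: infinite_finite_induct) (auto intro: order_trans[OF cnrm_triangle])

lemma cnrm_add_orthogonal:
  assumes "cinner x y = 0"
  shows "(cnrm (x + y))\<^sup>2 = (cnrm x)\<^sup>2 + (cnrm y)\<^sup>2"
proof -
  have "cinner y x = 0" using cinner_commute[of y x] assms by simp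
  then show ?thesis unfolding cnrm_power2 using assms by (simp add: cinner_simps)
qed

lemma cnrm_parallelogram: "(cnrm (x + y))\<^sup>2 + (cnrm (x - y))\<^sup>2 = 2 * (cnrm x)\<^sup>2 + 2 * (cnrm y)\<^sup>2"
  unfolding cnrm_power2 by (simp add: cinner_simps)

section \<open>Norm convergence along filters\<close>

definition clim :: "('t \<Rightarrow> 'h::mr_chilbert) \<Rightarrow> 'h \<Rightarrow> 't filter \<Rightarrow> bool" where
  "clim f l F \<longleftrightarrow> ((\<lambda>t. cnrm (f t - l)) \<longlongrightarrow> 0) F"

lemma clim_unique:
  assumes "clim f l F" "clim f m F" "F \<noteq> bot"
  shows "l = m"
proof -
  have "((\<lambda>t. cnrm (f t - l) + cnrm (f t - m)) \<longlongrightarrow> 0 + 0) F"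
    using assms unfolding clim_def by (intro tendsto_add)
  moreover have "cnrm (l - m) \<le> cnrm (f t - l) + cnrm (f t - m)" for t
    using cnrm_triangle_3[of l m "f t"] cnrm_diff_commute[of l "f t"] by simp
  ultimately have "cnrm (l - m) \<le> 0 + 0"
    by (intro tendsto_le[OF assms(3) _ tendsto_const]) auto
  then show ?thesis using cnrm_eq_0_iff[of "l - m"] cnrm_nonneg[of "l - m"] by simp
qed

lemma clim_bound:
  assumes "\<And>t. cnrm (f t - l) \<le> g t" "(g \<longlongrightarrow> 0) F"
  shows "clim f l F"
  unfolding clim_def using assms
  by (intro tendsto_sandwich[OF _ _ tendsto_const assms(2)]) auto

lemma clim_const [simp]: "clim (\<lambda>t. c) c F"
  by (simp add: clim_def)

lemma clim_add:
  assumes "clim f l F" "clim g m F"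
  shows "clim (\<lambda>t. f t + g t) (l + m) F"
proof (rule clim_bound)
  fix t show "cnrm (f t + g t - (l + m)) \<le> cnrm (f t - l) + cnrm (g t - m)"
    using cnrm_triangle[of "f t - l" "g t - m"] by (simp add: algebra_simps)
  show "((\<lambda>t. cnrm (f t - l) + cnrm (g t - m)) \<longlongrightarrow> 0) F"
    using tendsto_add[OF assms[unfolded clim_def]] by simp
qed

lemma clim_cnrm:
  assumes "clim f l F" shows "((\<lambda>t. cnrm (f t)) \<longlongrightarrow> cnrm l) F"
proof -
  have "((\<lambda>t. cnrm (f t) - cnrm l) \<longlongrightarrow> 0) F"
    by (rule Lim_null_comparison[OF _ assms[unfolded clim_def]]) (simp add: cnrm_reverse_triangle)
  then show ?thesis by (rule LIM_zero_cancel)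
qed

lemma clim_scC:
  assumes "clim f l F" "(c \<longlongrightarrow> d) F"
  shows "clim (\<lambda>t. scC (c t) (f t)) (scC d l) F"
proof (rule clim_bound)
  fix t
  have "scC (c t) (f t) - scC d l = scC (c t) (f t - l) + scC (c t - d) l"
    by (simp add: scC_diff_right scC_diff_left)
  then show "cnrm (scC (c t) (f t) - scC d l) \<le> cmod (c t) * cnrm (f t - l) + cmod (c t - d) * cnrm l"
    using cnrm_triangle[of "scC (c t) (f t - l)" "scC (c t - d) l"] by (simp add: cnrm_scC)
next
  have "((\<lambda>t. cmod (c t - d)) \<longlongrightarrow> 0) F"
    using tendsto_norm_zero[OF LIM_zero[OF assms(2)]] .
  then have "((\<lambda>t. cmod (c t) * cnrm (f t - l) + cmod (c t - d) * cnrm l) \<longlongrightarrow> cmod d * 0 + 0 * cnrm l) F"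
    using assms unfolding clim_def by (intro tendsto_intros)
  then show "((\<lambda>t. cmod (c t) * cnrm (f t - l) + cmod (c t - d) * cnrm l) \<longlongrightarrow> 0) F"
    by simp
qed

lemma clim_scC_const: "clim f l F \<Longrightarrow> clim (\<lambda>t. scC c (f t)) (scC c l) F"
  by (intro clim_scC tendsto_const)

lemma clim_minus: "clim f l F \<Longrightarrow> clim (\<lambda>t. - f t) (- l) F"
  using clim_scC_const[of f l F "-1"] by (simp add: scC_minus_left scC_one)

lemma clim_diff:
  assumes "clim f l F" "clim g m F"
  shows "clim (\<lambda>t. f t - g t) (l - m) F"
  using clim_add[OF assms(1) clim_minus[OF assms(2)]] by simp

lemma clim_cinner:
  assumes "clim f l F" "clim g m F"
  shows "((\<lambda>t. cinner (f t) (g t)) \<longlongrightarrow> cinner l m) F"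
proof -
  have "((\<lambda>t. cinner (f t) (g t) - cinner l m) \<longlongrightarrow> 0) F"
  proof (rule Lim_null_comparison)
    show "\<forall>\<^sub>F t in F. norm (cinner (f t) (g t) - cinner l m) \<le> cnrm (f t - l) * cnrm (g t) + cnrm l * cnrm (g t - m)"
    proof (intro always_eventually allI)
      fix t
      have "cinner (f t) (g t) - cinner l m = cinner (f t - l) (g t) + cinner l (g t - m)"
        by (simp add: cinner_simps)
      then show "norm (cinner (f t) (g t) - cinner l m) \<le> cnrm (f t - l) * cnrm (g t) + cnrm l * cnrm (g t - m)"
        using norm_triangle_ineq[of "cinner (f t - l) (g t)" "cinner l (g t - m)"]
          cinner_Cauchy_Schwarz[of "f t - l" "g t"] cinner_Cauchy_Schwarz[of l "g t - m"] by simp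
    qed
    have "((\<lambda>t. cnrm (f t - l) * cnrm (g t) + cnrm l * cnrm (g t - m)) \<longlongrightarrow> 0 * cnrm m + cnrm l * 0) F"
      using assms(1) assms(2)[THEN clim_cnrm] assms(2) unfolding clim_def by (intro tendsto_intros)
    then show "((\<lambda>t. cnrm (f t - l) * cnrm (g t) + cnrm l * cnrm (g t - m)) \<longlongrightarrow> 0) F" by simp
  qed
  then show ?thesis by (rule LIM_zero_cancel)
qed

lemma cclosed_clim:
  assumes "cclosed S" "clim f l F" "F \<noteq> bot" "eventually (\<lambda>t. f t \<in> S) F"
  shows "l \<in> S"
proof -
  have "\<exists>s\<in>S. cnrm (l - s) < e" if "e > 0" for e
  proof -
    have "eventually (\<lambda>t. cnrm (f t - l) < e) F"
      using assms(2) that order_tendstoD(2) unfolding clim_def by blast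
    from eventually_happens'[OF assms(3) eventually_conj[OF this assms(4)]]
    show ?thesis using cnrm_diff_commute by metis
  qed
  then show ?thesis using assms(1) unfolding cclosed_def cclosure_def by blast
qed

lemma cCauchy_clim:
  fixes X :: "nat \<Rightarrow> 'h::mr_chilbert"
  assumes "\<And>e. e > 0 \<Longrightarrow> \<exists>N. \<forall>m\<ge>N. \<forall>n\<ge>N. cnrm (X m - X n) < e"
  shows "\<exists>L. clim X L sequentially"
  using cinner_complete[of X] assms unfolding clim_def cnrm_def by blast

section \<open>Subspaces and orthogonal projections\<close>

lemma mr_csubspaceD:
  assumes "mr_csubspace S"
  shows "0 \<in> S" "x \<in> S \<Longrightarrow> y \<in> S \<Longrightarrow> x + y \<in> S" "x \<in> S \<Longrightarrow> scC c x \<in> S"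
    "x \<in> S \<Longrightarrow> - x \<in> S" "x \<in> S \<Longrightarrow> y \<in> S \<Longrightarrow> x - y \<in> S"
proof -
  show *: "0 \<in> S" "\<And>x y. x \<in> S \<Longrightarrow> y \<in> S \<Longrightarrow> x + y \<in> S" "\<And>x c. x \<in> S \<Longrightarrow> scC c x \<in> S"
    using assms unfolding mr_csubspace_def by auto
  show m: "\<And>x. x \<in> S \<Longrightarrow> - x \<in> S"
    using *(3)[of _ "-1"] by (simp add: scC_minus_left scC_one)
  show "x \<in> S \<Longrightarrow> y \<in> S \<Longrightarrow> x - y \<in> S" using *(2)[of x "- y"] m by simp
qed

lemma mr_csubspace_sum:
  assumes "mr_csubspace S" "\<And>i. i \<in> A \<Longrightarrow> f i \<in> S"
  shows "(\<Sum>i\<in>A. f i) \<in> S"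
  using assms(2) mr_csubspaceD[OF assms(1)]
  by (induction A rule: infinite_finite_induct) auto

text \<open>A minimising sequence is Cauchy by the parallelogram law. At its limit, a nonzero inner
  product with some s in V would allow a strictly closer point, by
  \<open>cinner_residual\<close>.\<close>

lemma orthogonal_projection_exists:
  fixes v :: "'h::mr_chilbert"
  assumes V: "mr_csubspace V" "cclosed V"
  shows "\<exists>p\<in>V. \<forall>s\<in>V. cinner (v - p) s = 0"
proof -
  define d where "d = Inf ((\<lambda>s. (cnrm (v - s))\<^sup>2) ` V)"
  have ne: "V \<noteq> {}" using mr_csubspaceD(1)[OF V(1)] by auto
  have d_le: "d \<le> (cnrm (v - s))\<^sup>2" if "s \<in> V" for s
    unfolding d_def by (rule cInf_lower) (use that in \<open>auto intro!: bdd_belowI[of _ 0]\<close>)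
  have "\<exists>s\<in>V. (cnrm (v - s))\<^sup>2 < d + 1 / real (Suc n)" for n
  proof -
    have "Inf ((\<lambda>s. (cnrm (v - s))\<^sup>2) ` V) < d + 1 / real (Suc n)"
      unfolding d_def[symmetric] by simp
    from cInf_lessD[OF _ this] ne show ?thesis by blast
  qed
  then obtain X where X: "\<And>n. X n \<in> V" "\<And>n. (cnrm (v - X n))\<^sup>2 < d + 1 / real (Suc n)"
    using choice[of "\<lambda>n s. s \<in> V \<and> (cnrm (v - s))\<^sup>2 < d + 1 / real (Suc n)"] by blast
  have key: "(cnrm (X m - X n))\<^sup>2 \<le> 2 / real (Suc m) + 2 / real (Suc n)" for m n
  proof -
    have mid: "scC (1/2) (X m + X n) \<in> V" by (intro mr_csubspaceD[OF V(1)] X(1))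
    have half: "scC (1/2) (v - X m + (v - X n)) = v - scC (1/2) (X m + X n)"
      using scC_add_left[of "1/2" "1/2" v]
      by (simp add: scC_add_right scC_diff_right scC_one algebra_simps)
    have "4 * d \<le> 4 * (cnrm (v - scC (1/2) (X m + X n)))\<^sup>2" using d_le[OF mid] by simp
    also have "\<dots> = (cnrm (v - X m + (v - X n)))\<^sup>2"
      unfolding half[symmetric] by (simp add: cnrm_scC power_mult_distrib power2_eq_square)
    finally have "4 * d \<le> (cnrm (v - X m + (v - X n)))\<^sup>2" .
    moreover have "v - X m - (v - X n) = X n - X m" by simp
    ultimately show ?thesis
      using cnrm_parallelogram[of "v - X m" "v - X n"] X(2)[of m] X(2)[of n] cnrm_diff_commute[of "X m" "X n"]
      by simp
  qed
  have "\<exists>L. clim X L sequentially"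
  proof (rule cCauchy_clim)
    fix e :: real assume e: "e > 0"
    obtain N where N: "4 / real (Suc N) < e\<^sup>2"
      using reals_Archimedean[of "e\<^sup>2 / 4"] e by (auto simp: field_simps)
    have "cnrm (X m - X n) < e" if "m \<ge> N" "n \<ge> N" for m n
    proof -
      have "2 / real (Suc m) \<le> 2 / real (Suc N)" "2 / real (Suc n) \<le> 2 / real (Suc N)"
        using that by (auto intro!: divide_left_mono)
      then have "(cnrm (X m - X n))\<^sup>2 < e\<^sup>2" using key[of m n] N by linarith
      then show ?thesis using e by (simp add: power2_less_imp_less)
    qed
    then show "\<exists>N. \<forall>m\<ge>N. \<forall>n\<ge>N. cnrm (X m - X n) < e" by blast
  qed
  then obtain p where p: "clim X p sequentially" by blast
  have pV: "p \<in> V" using cclosed_clim[OF V(2) p] X(1) by simp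
  have "(\<lambda>n. (cnrm (v - X n))\<^sup>2) \<longlonglongrightarrow> (cnrm (v - p))\<^sup>2"
    using clim_cnrm[OF clim_diff[OF clim_const p]] by (intro tendsto_intros)
  moreover have "(\<lambda>n. d + 1 / real (Suc n)) \<longlonglongrightarrow> d + 0"
    by (intro tendsto_intros LIMSEQ_Suc[OF lim_1_over_n])
  ultimately have "(cnrm (v - p))\<^sup>2 \<le> d + 0"
    by (rule LIMSEQ_le) (use X(2) in \<open>auto intro!: exI[of _ 0] less_imp_le\<close>)
  then have le: "(cnrm (v - p))\<^sup>2 \<le> d" by simp
  have "cinner (v - p) s = 0" if s: "s \<in> V" for s
  proof (cases "s = 0")
    case False
    define c where "c = cinner (v - p) s / cinner s s"
    have "p + scC c s \<in> V" by (intro mr_csubspaceD[OF V(1)] pV s)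
    from d_le[OF this] le have "(cnrm (v - p))\<^sup>2 \<le> (cnrm (v - p - scC c s))\<^sup>2"
      unfolding diff_diff_eq by linarith
    then have "(cmod (cinner (v - p) s))\<^sup>2 / (cnrm s)\<^sup>2 \<le> 0"
      unfolding c_def cinner_residual[OF False] by simp
    then show ?thesis using False by (simp add: divide_le_0_iff power2_less_0 zero_less_power2 not_less)
  qed simp
  with pV show ?thesis by blast
qed

lemma cclosure_subset: "S \<subseteq> cclosure S"
proof
  fix x assume "x \<in> S"
  then show "x \<in> cclosure S" unfolding cclosure_def by (intro CollectI allI impI bexI[of _ x]) auto
qed

text \<open>\<open>cproj\<close> is a definite description, so uniqueness must be supplied: closure
  under differences makes the difference of two candidates orthogonal to itself.\<close>

lemma cproj_eqI:
  fixes v :: "'h::mr_chilbert"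
  assumes w: "w \<in> S" "\<And>s. s \<in> S \<Longrightarrow> cinner (v - w) s = 0"
    and diff: "\<And>x y. x \<in> S \<Longrightarrow> y \<in> S \<Longrightarrow> x - y \<in> S"
  shows "cproj S v = w"
  unfolding cproj_def
proof (rule the_equality)
  show "w \<in> S \<and> (\<forall>s\<in>S. cinner (v - w) s = 0)" using w by blast
  fix x assume x: "x \<in> S \<and> (\<forall>s\<in>S. cinner (v - x) s = 0)"
  then have "x - w \<in> S" using diff w by blast
  then have "cinner ((v - w) - (v - x)) (x - w) = 0" using x w by (simp only: cinner_diff_left) simp
  then have "cinner (x - w) (x - w) = 0" by simp
  then show "x = w" using cinner_eq_0 by fastforce
qed

section \<open>Unitary representations and the Lie algebra action\<close>

fun sl2_inv :: "sl2 \<Rightarrow> sl2" where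
  "sl2_inv (a, b, c, d) = (d, - b, - c, a)"

lemma SL2_mult: "g \<in> SL2 \<Longrightarrow> h \<in> SL2 \<Longrightarrow> sl2_mult g h \<in> SL2"
proof (cases g, cases h)
  fix a b c d e f g' h' assume "g \<in> SL2" "h \<in> SL2" "g = (a, b, c, d)" "h = (e, f, g', h')"
  moreover have "(a*e + b*g') * (c*f + d*h') - (a*f + b*h') * (c*e + d*g') = (a*d - b*c) * (e*h' - f*g')"
    by algebra
  ultimately show ?thesis by (simp add: SL2_def)
qed

lemma SL2_inv: "g \<in> SL2 \<Longrightarrow> sl2_inv g \<in> SL2"
  by (cases g) (auto simp: SL2_def algebra_simps)

lemma SL2_one [simp]: "sl2_one \<in> SL2"
  by (simp add: SL2_def sl2_one_def)

lemma sl2_inv_mult: "g \<in> SL2 \<Longrightarrow> sl2_mult (sl2_inv g) g = sl2_one"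
  by (cases g) (auto simp: SL2_def sl2_one_def algebra_simps)

lemma sl2_mult_inv: "g \<in> SL2 \<Longrightarrow> sl2_mult g (sl2_inv g) = sl2_one"
  by (cases g) (auto simp: SL2_def sl2_one_def algebra_simps)

lemma sl2_mult_assoc: "sl2_mult (sl2_mult g h) k = sl2_mult g (sl2_mult h k)"
  by (cases g, cases h, cases k) (auto simp: algebra_simps)

lemma sl2_mult_one [simp]: "sl2_mult sl2_one g = g" "sl2_mult g sl2_one = g"
  by (cases g, auto simp: sl2_one_def)+

lemma SL2_exp [simp]: "sl2_exp X t \<in> SL2"
  by (cases X) (auto simp: SL2_def sl2_rot_def exp_minus power2_eq_square[symmetric] hyperbolic_pythagoras)

lemma SL2_rot [simp]: "sl2_rot t \<in> SL2"
  using SL2_exp[of BW t] by simp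

lemma sl2_exp_0 [simp]: "sl2_exp X 0 = sl2_one"
  by (cases X) (auto simp: sl2_one_def sl2_rot_def)

lemma sl2_exp_add: "sl2_exp X (s + t) = sl2_mult (sl2_exp X s) (sl2_exp X t)"
  by (cases X) (auto simp: sl2_rot_def exp_add cos_add sin_add cosh_add sinh_add exp_minus exp_diff divide_inverse algebra_simps)

lemma sl2_inv_exp: "sl2_inv (sl2_exp X t) = sl2_exp X (- t)"
  by (cases X) (auto simp: sl2_rot_def)

lemma tendsto_sl2_exp [tendsto_intros]:
  assumes "(f \<longlongrightarrow> x) F"
  shows "((\<lambda>t. sl2_exp X (f t)) \<longlongrightarrow> sl2_exp X x) F"
  using isCont_tendsto_compose[OF isCont_cos assms] isCont_tendsto_compose[OF isCont_sin assms] assms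
  by (cases X) (auto simp: sl2_rot_def intro!: tendsto_Pair tendsto_intros)

section \<open>Unitary operators and derivatives along one-parameter groups\<close>

locale urep =
  fixes \<pi> :: "sl2 \<Rightarrow> 'h::mr_chilbert \<Rightarrow> 'h"
  assumes unitary: "unitary_rep \<pi>"
begin

lemma rep_mult: "g \<in> SL2 \<Longrightarrow> h \<in> SL2 \<Longrightarrow> \<pi> (sl2_mult g h) v = \<pi> g (\<pi> h v)"
  and rep_one [simp]: "\<pi> sl2_one v = v"
  and rep_add: "g \<in> SL2 \<Longrightarrow> \<pi> g (v + w) = \<pi> g v + \<pi> g w"
  and rep_scC: "g \<in> SL2 \<Longrightarrow> \<pi> g (scC c v) = scC c (\<pi> g v)"
  and rep_cinner: "g \<in> SL2 \<Longrightarrow> cinner (\<pi> g v) (\<pi> g w) = cinner v w"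
  and rep_continuous: "g \<in> SL2 \<Longrightarrow> e > 0 \<Longrightarrow> \<exists>d>0. \<forall>h\<in>SL2. dist h g < d \<longrightarrow> cnrm (\<pi> h v - \<pi> g v) < e"
  using unitary unfolding unitary_rep_def by auto

lemma rep_cnrm [simp]: "g \<in> SL2 \<Longrightarrow> cnrm (\<pi> g v) = cnrm v"
  by (simp add: cnrm_def rep_cinner)

lemma rep_0 [simp]: "g \<in> SL2 \<Longrightarrow> \<pi> g 0 = 0"
  using rep_scC[of g 0 0] by simp

lemma rep_minus: "g \<in> SL2 \<Longrightarrow> \<pi> g (- v) = - \<pi> g v"
  using rep_scC[of g "-1" v] by (simp add: scC_minus_left scC_one)

lemma rep_diff: "g \<in> SL2 \<Longrightarrow> \<pi> g (v - w) = \<pi> g v - \<pi> g w"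
  using rep_add[of g v "- w"] by (simp add: rep_minus)

lemma rep_sum: "g \<in> SL2 \<Longrightarrow> \<pi> g (\<Sum>i\<in>S. f i) = (\<Sum>i\<in>S. \<pi> g (f i))"
  by (induction S rule: infinite_finite_induct) (auto simp: rep_add)

lemma rep_inv [simp]: "g \<in> SL2 \<Longrightarrow> \<pi> (sl2_inv g) (\<pi> g v) = v" "g \<in> SL2 \<Longrightarrow> \<pi> g (\<pi> (sl2_inv g) v) = v"
  by (simp_all flip: rep_mult add: SL2_inv sl2_inv_mult sl2_mult_inv)

lemma rep_adjoint: "g \<in> SL2 \<Longrightarrow> cinner (\<pi> g v) w = cinner v (\<pi> (sl2_inv g) w)"
  using rep_cinner[of g v "\<pi> (sl2_inv g) w"] by simp

lemma rep_clim:
  assumes "clim f l F" "(h \<longlongrightarrow> g) F" "g \<in> SL2" "\<And>t. h t \<in> SL2"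
  shows "clim (\<lambda>t. \<pi> (h t) (f t)) (\<pi> g l) F"
proof (rule clim_bound)
  fix t
  have "\<pi> (h t) (f t) - \<pi> g l = \<pi> (h t) (f t - l) + (\<pi> (h t) l - \<pi> g l)"
    by (simp add: rep_diff assms)
  then show "cnrm (\<pi> (h t) (f t) - \<pi> g l) \<le> cnrm (f t - l) + cnrm (\<pi> (h t) l - \<pi> g l)"
    using cnrm_triangle[of "\<pi> (h t) (f t - l)" "\<pi> (h t) l - \<pi> g l"]
    by (simp only: rep_cnrm[OF assms(4)])
next
  have "((\<lambda>t. cnrm (\<pi> (h t) l - \<pi> g l)) \<longlongrightarrow> 0) F"
  proof (rule tendstoI)
    fix e :: real assume "e > 0"
    then obtain d where d: "d > 0" "\<forall>h\<in>SL2. dist h g < d \<longrightarrow> cnrm (\<pi> h l - \<pi> g l) < e"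
      using rep_continuous[OF assms(3)] by blast
    then have "eventually (\<lambda>t. dist (h t) g < d) F" using assms(2) tendstoD by blast
    then show "eventually (\<lambda>t. dist (cnrm (\<pi> (h t) l - \<pi> g l)) 0 < e) F"
      by eventually_elim (use d assms(4) in auto)
  qed
  then show "((\<lambda>t. cnrm (f t - l) + cnrm (\<pi> (h t) l - \<pi> g l)) \<longlongrightarrow> 0) F"
    using tendsto_add[OF assms(1)[unfolded clim_def]] by fastforce
qed

lemma has_dact_clim:
  "has_dact \<pi> X v w \<longleftrightarrow> clim (\<lambda>t. scC (complex_of_real (1 / t)) (\<pi> (sl2_exp X t) v - v)) w (at 0)"
  unfolding has_dact_def clim_def ..

lemma has_dact_unique: "has_dact \<pi> X v w \<Longrightarrow> has_dact \<pi> X v w' \<Longrightarrow> w = w'"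
  unfolding has_dact_clim by (rule clim_unique) auto

lemma dact_eq: "has_dact \<pi> X v w \<Longrightarrow> dact \<pi> X v = w"
  unfolding dact_def using has_dact_unique by blast

lemma has_dact_add:
  assumes "has_dact \<pi> X v v'" "has_dact \<pi> X w w'"
  shows "has_dact \<pi> X (v + w) (v' + w')"
proof -
  have "scC z (\<pi> (sl2_exp X t) (v + w) - (v + w)) =
    scC z (\<pi> (sl2_exp X t) v - v) + scC z (\<pi> (sl2_exp X t) w - w)" for t z
    unfolding scC_add_right[symmetric] by (simp add: rep_add algebra_simps)
  then show ?thesis using clim_add[OF assms[unfolded has_dact_clim]] unfolding has_dact_clim by simp
qed

lemma has_dact_scC:
  assumes "has_dact \<pi> X v v'"
  shows "has_dact \<pi> X (scC c v) (scC c v')"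
proof -
  have "scC z (\<pi> (sl2_exp X t) (scC c v) - scC c v) = scC c (scC z (\<pi> (sl2_exp X t) v - v))" for t z
    by (simp add: rep_scC scC_diff_right scC_scC mult.commute)
  then show ?thesis using clim_scC_const[OF assms[unfolded has_dact_clim]] unfolding has_dact_clim by simp
qed

lemma has_dact_0: "has_dact \<pi> X 0 0"
  by (simp add: has_dact_clim)

lemma rep_exp_clim:
  assumes "(\<phi> \<longlongrightarrow> 0) F"
  shows "clim (\<lambda>t. \<pi> (sl2_exp X (\<phi> t)) v) v F"
  using rep_clim[OF clim_const tendsto_sl2_exp[OF assms, of X], of v] by simp

text \<open>Unitarity makes the corresponding identity for difference quotients exact for each t;
  only the limit remains to be taken.\<close>

lemma has_dact_skew:
  assumes "has_dact \<pi> X v v'" "has_dact \<pi> X w w'"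
  shows "cinner v' w = - cinner v w'"
proof -
  let ?p = "\<lambda>t. \<pi> (sl2_exp X t)"
  let ?q = "\<lambda>v t. scC (complex_of_real (1 / t)) (?p t v - v)"
  have "((\<lambda>t. cinner (?q v t) (?p t w) + cinner v (?q w t)) \<longlongrightarrow> cinner v' w + cinner v w') (at 0)"
    using assms[unfolded has_dact_clim]
    by (intro tendsto_add clim_cinner clim_const rep_exp_clim) auto
  moreover have "cinner (?q v t) (?p t w) + cinner v (?q w t) = 0" for t
    by (simp add: cinner_simps rep_cinner algebra_simps)
  ultimately have "((\<lambda>t::real. 0) \<longlongrightarrow> cinner v' w + cinner v w') (at 0)" by simp
  then have "cinner v' w + cinner v w' = 0" by (simp add: tendsto_const_iff)
  then show ?thesis by (simp add: add_eq_0_iff)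
qed

lemma rep_exp_deriv:
  assumes "has_dact \<pi> X v v'"
  shows "((\<lambda>t. Re (cinner (\<pi> (sl2_exp X t) v) w)) has_real_derivative Re (cinner (\<pi> (sl2_exp X t) v') w)) (at t)"
  unfolding DERIV_def
proof -
  let ?p = "\<lambda>t. \<pi> (sl2_exp X t)"
  have "clim (\<lambda>h. ?p t (scC (complex_of_real (1 / h)) (?p h v - v))) (?p t v') (at 0)"
    using rep_clim[OF assms[unfolded has_dact_clim] tendsto_const] by simp
  from clim_cinner[OF this clim_const]
  have "((\<lambda>h. Re (cinner (?p t (scC (complex_of_real (1 / h)) (?p h v - v))) w)) \<longlongrightarrow> Re (cinner (?p t v') w)) (at 0)"
    by (rule tendsto_Re)
  moreover have "Re (cinner (?p t (scC (complex_of_real (1 / h)) (?p h v - v))) w)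
     = (Re (cinner (?p (t + h) v) w) - Re (cinner (?p t v) w)) / h" for h
    by (simp add: sl2_exp_add rep_mult rep_scC rep_diff cinner_simps Re_divide_of_real diff_divide_distrib)
  ultimately show "((\<lambda>h. (Re (cinner (?p (t + h) v) w) - Re (cinner (?p t v) w)) / h) \<longlongrightarrow> Re (cinner (?p t v') w)) (at 0)"
    by simp
qed

lemma rep_exp_chain:
  assumes "has_dact \<pi> X v w" "DERIV \<phi> 0 :> d" "\<phi> 0 = 0"
  shows "clim (\<lambda>t. scC (complex_of_real (1 / t)) (\<pi> (sl2_exp X (\<phi> t)) v - v)) (scC (complex_of_real d) w) (at 0)"
proof -
  \<comment> \<open>The value \<open>w\<close> at 0 fills the removable singularity, so points t
    with \<open>\<phi> t = 0\<close> need no separate treatment.\<close>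
  define R where "R x = (if x = 0 then w else scC (complex_of_real (1 / x)) (\<pi> (sl2_exp X x) v - v))" for x
  have cont: "\<phi> \<midarrow>0\<rightarrow> 0" using DERIV_isCont[OF assms(2)] assms(3) unfolding isCont_def by simp
  have "((\<lambda>x. cnrm (R x - w)) \<longlongrightarrow> 0) (at 0)"
    using assms(1) unfolding has_dact_def R_def
    by (rule Lim_transform_eventually) (auto simp: eventually_at_filter)
  then have "isCont (\<lambda>x. cnrm (R x - w)) 0" unfolding isCont_def by (simp add: R_def)
  then have "((\<lambda>t. cnrm (R (\<phi> t) - w)) \<longlongrightarrow> cnrm (R 0 - w)) (at 0)"
    by (rule isCont_tendsto_compose) (rule cont)
  then have "clim (\<lambda>t. R (\<phi> t)) w (at 0)" unfolding clim_def by (simp add: R_def)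
  moreover have "((\<lambda>t. complex_of_real (\<phi> t / t)) \<longlongrightarrow> complex_of_real d) (at 0)"
    using assms(2,3) unfolding DERIV_def by (intro tendsto_of_real) simp
  ultimately have "clim (\<lambda>t. scC (complex_of_real (\<phi> t / t)) (R (\<phi> t))) (scC (complex_of_real d) w) (at 0)"
    by (rule clim_scC)
  moreover have "scC (complex_of_real (\<phi> t / t)) (R (\<phi> t)) = scC (complex_of_real (1 / t)) (\<pi> (sl2_exp X (\<phi> t)) v - v)" for t
    by (auto simp: R_def scC_scC)
  ultimately show ?thesis by simp
qed

end

text \<open>The decomposition \<open>G = K \<cdot> exp(\<real> Hd) \<cdot> exp(\<real> S)\<close>, read off the Gram matrix of the columns of \<open>g\<close>.\<close>

definition sl2_q :: "sl2 \<Rightarrow> real" where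
  "sl2_q g = (case g of (a, b, c, d) \<Rightarrow> a * b + c * d)"

definition sl2_h :: "sl2 \<Rightarrow> real" where
  "sl2_h g = (case g of (a, b, c, d) \<Rightarrow> arsinh ((a\<^sup>2 + c\<^sup>2 - (b\<^sup>2 + d\<^sup>2)) / 2) / 2)"

definition sl2_s :: "sl2 \<Rightarrow> real" where
  "sl2_s g = arsinh (sl2_q g / cosh (2 * sl2_h g)) / 2"

text \<open>In g = k exp(h Hd) exp(s S) the rotation k drops out of the Gram matrix, which gives p -
  r = 2 sinh 2h, q = cosh 2h sinh 2s and p + r = 2 cosh 2h cosh 2s for the p, q, r of the proof.
  Solving the first two by \<open>arsinh\<close> makes h and s smooth functions on the whole
  group.\<close>

lemma sl2_decompose:
  assumes "(a, b, c, d) \<in> SL2"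
  defines "h \<equiv> sl2_h (a, b, c, d)" and "s \<equiv> sl2_s (a, b, c, d)"
  defines "m \<equiv> (a * cosh s - b * sinh s) * exp (- h)" and "n \<equiv> (b * cosh s - a * sinh s) * exp h"
  shows "m\<^sup>2 + n\<^sup>2 = 1"
    and "(a, b, c, d) = sl2_mult (m, n, - n, m) (sl2_mult (sl2_exp BHd h) (sl2_exp BS s))"
proof -
  define p q r where "p = a\<^sup>2 + c\<^sup>2" and "q = a * b + c * d" and "r = b\<^sup>2 + d\<^sup>2"
  have det: "a * d - b * c = 1" using assms by (simp add: SL2_def)
  have sh: "sinh (2 * h) = (p - r) / 2" by (simp add: h_def sl2_h_def p_def r_def)
  have ss: "cosh (2 * h) * sinh (2 * s) = q" by (simp add: s_def sl2_s_def q_def sl2_q_def flip: h_def)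
  have pr: "p * r - q\<^sup>2 = 1"
  proof -
    have "p * r - q\<^sup>2 = (a * d - b * c)\<^sup>2" unfolding p_def q_def r_def by algebra
    then show ?thesis by (simp add: det)
  qed
  have cc: "cosh (2 * h) * cosh (2 * s) = (p + r) / 2"
  proof (rule power2_eq_imp_eq)
    have "(cosh (2 * h) * cosh (2 * s))\<^sup>2 = (cosh (2 * h))\<^sup>2 + (cosh (2 * h) * sinh (2 * s))\<^sup>2"
      unfolding power_mult_distrib cosh_square_eq[of "2 * s"] by (simp add: distrib_left)
    also have "\<dots> = ((p - r) / 2)\<^sup>2 + 1 + q\<^sup>2" unfolding ss cosh_square_eq[of "2 * h"] sh ..
    also have "\<dots> = ((p - r) / 2)\<^sup>2 + p * r" using pr by simp
    also have "\<dots> = ((p + r) / 2)\<^sup>2" by (simp add: power2_eq_square field_simps)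
    finally show "(cosh (2 * h) * cosh (2 * s))\<^sup>2 = ((p + r) / 2)\<^sup>2" .
    show "0 \<le> cosh (2 * h) * cosh (2 * s)" by simp
    show "0 \<le> (p + r) / 2" by (simp add: p_def r_def)
  qed
  define C S where "C = cosh s" and "S = sinh s"
  have CS: "C\<^sup>2 - S\<^sup>2 = 1" unfolding C_def S_def by (simp add: cosh_square_eq)
  have c2: "cosh (2 * s) = C\<^sup>2 + S\<^sup>2" and s2: "sinh (2 * s) = 2 * S * C"
    unfolding C_def S_def by (simp_all add: cosh_double sinh_double)
  define a1 b1 c1 d1 where "a1 = a * C - b * S" and "b1 = b * C - a * S"
    and "c1 = c * C - d * S" and "d1 = d * C - c * S"
  have q1: "a1 * b1 + c1 * d1 = 0"
  proof -
    have "a1 * b1 + c1 * d1 = q * (C\<^sup>2 + S\<^sup>2) - (p + r) * (S * C)"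
      unfolding a1_def b1_def c1_def d1_def p_def q_def r_def by algebra
    also have "\<dots> = q * cosh (2 * s) - (p + r) / 2 * sinh (2 * s)" by (simp add: c2 s2)
    also have "\<dots> = 0" unfolding ss[symmetric] cc[symmetric] by simp
    finally show ?thesis .
  qed
  have det1: "a1 * d1 - b1 * c1 = 1"
  proof -
    have "a1 * d1 - b1 * c1 = (a * d - b * c) * (C\<^sup>2 - S\<^sup>2)"
      unfolding a1_def b1_def c1_def d1_def by algebra
    then show ?thesis by (simp add: det CS)
  qed
  have p1: "a1\<^sup>2 + c1\<^sup>2 = exp (2 * h)"
  proof -
    have "2 * (a1\<^sup>2 + c1\<^sup>2) = (p + r) * (C\<^sup>2 + S\<^sup>2) + (p - r) * (C\<^sup>2 - S\<^sup>2) - 2 * q * (2 * S * C)"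
      unfolding a1_def b1_def c1_def d1_def p_def q_def r_def by algebra
    also have "\<dots> = (p + r) * cosh (2 * s) + (p - r) - 2 * q * sinh (2 * s)" by (simp add: c2 s2 CS)
    also have "\<dots> = 2 * (cosh (2 * h) * ((cosh (2 * s))\<^sup>2 - (sinh (2 * s))\<^sup>2) + sinh (2 * h))"
      using cc[symmetric] ss[symmetric] sh by (simp add: power2_eq_square algebra_simps)
    also have "\<dots> = 2 * exp (2 * h)" by (simp add: cosh_square_eq cosh_plus_sinh)
    finally show ?thesis by simp
  qed
  text \<open>Orthogonality and unimodularity determine the second column from the first.\<close>
  have b1: "b1 * exp (2 * h) = - c1" and d1: "d1 * exp (2 * h) = a1"
  proof -
    have "b1 * (a1\<^sup>2 + c1\<^sup>2) = a1 * (a1 * b1 + c1 * d1) - c1 * (a1 * d1 - b1 * c1)" by algebra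
    then show "b1 * exp (2 * h) = - c1" by (simp add: q1 det1 p1)
    have "d1 * (a1\<^sup>2 + c1\<^sup>2) = c1 * (a1 * b1 + c1 * d1) + a1 * (a1 * d1 - b1 * c1)" by algebra
    then show "d1 * exp (2 * h) = a1" by (simp add: q1 det1 p1)
  qed
  define e where "e = exp h"
  have e: "e > 0" "exp (- h) = 1 / e" "exp (2 * h) = e\<^sup>2"
    by (auto simp: e_def exp_minus inverse_eq_divide power2_eq_square simp flip: exp_add)
  have m: "m = a1 / e" and n: "n = b1 * e" unfolding m_def n_def a1_def b1_def C_def S_def e e_def[symmetric] by simp_all
  have mn: "m * e = a1" "n * e = - c1" "- (n / e) = - b1" "m / e = d1"
    using b1 d1 e unfolding m n by (auto simp: power2_eq_square field_simps)
  have c1': "c1 = - n * e" using mn by simp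
  show "m\<^sup>2 + n\<^sup>2 = 1"
  proof -
    have "(m\<^sup>2 + n\<^sup>2) * e\<^sup>2 = (m * e)\<^sup>2 + (n * e)\<^sup>2" by algebra
    also have "\<dots> = 1 * e\<^sup>2" unfolding mn using p1 e(3) by simp
    finally show ?thesis using e(1) by simp
  qed
  have inv_eqs: "a1 * C + b1 * S = a" "a1 * S + b1 * C = b" "c1 * C + d1 * S = c" "c1 * S + d1 * C = d"
  proof -
    have "a1 * C + b1 * S = a * (C\<^sup>2 - S\<^sup>2)" "a1 * S + b1 * C = b * (C\<^sup>2 - S\<^sup>2)"
      "c1 * C + d1 * S = c * (C\<^sup>2 - S\<^sup>2)" "c1 * S + d1 * C = d * (C\<^sup>2 - S\<^sup>2)"
      unfolding a1_def b1_def c1_def d1_def by algebra+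
    then show "a1 * C + b1 * S = a" "a1 * S + b1 * C = b" "c1 * C + d1 * S = c" "c1 * S + d1 * C = d"
      by (simp_all add: CS)
  qed
  have b1': "b1 = n / e" using mn by simp
  show "(a, b, c, d) = sl2_mult (m, n, - n, m) (sl2_mult (sl2_exp BHd h) (sl2_exp BS s))"
    unfolding sl2_exp.simps C_def[symmetric] S_def[symmetric] e(2) e_def[symmetric] sl2_mult.simps
    using inv_eqs unfolding c1' b1' mn(1)[symmetric] mn(4)[symmetric] by (simp add: algebra_simps)
qed

text \<open>Pairing with an arbitrary vector turns identities between scalar combinations of vectors
  into identities in the field of complex numbers; the operator relations below are proved in this
  form.\<close>

lemma cinner_ext:
  assumes "\<And>z. cinner (x::'h::mr_chilbert) z = cinner y z"
  shows "x = y"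
  using cinner_eq_0[of "x - y"] assms by (simp add: cinner_diff_left)

lemma clim_transform_eventually:
  assumes "clim f l F" "eventually (\<lambda>t. f t = g t) F"
  shows "clim g l F"
  unfolding clim_def
  by (rule Lim_transform_eventually[OF assms(1)[unfolded clim_def]])
    (use assms(2) in eventually_elim, simp)

text \<open>Right multiplication by a rotation of angle \<theta> turns the traceless part (x, y) of
  the Gram matrix by 2 \<theta>. Once the off-diagonal entry is gone, \<open>sl2_s\<close> vanishes
  and \<open>sl2_decompose\<close> loses its last factor.\<close>

lemma sl2_KAK:
  assumes "g \<in> SL2"
  obtains \<phi> h \<theta> where "g = sl2_mult (sl2_rot \<phi>) (sl2_mult (sl2_exp BHd h) (sl2_rot \<theta>))"
proof -
  obtain a b c d where g: "g = (a, b, c, d)" by (cases g)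
  define x y where "x = (a\<^sup>2 + c\<^sup>2 - (b\<^sup>2 + d\<^sup>2)) / 2" and "y = a * b + c * d"
  have "\<exists>\<theta>. x * sin (2 * \<theta>) + y * cos (2 * \<theta>) = 0"
  proof (cases "x = 0 \<and> y = 0")
    case False
    define \<rho> where "\<rho> = sqrt (x\<^sup>2 + y\<^sup>2)"
    have \<rho>: "\<rho> > 0" using False unfolding \<rho>_def real_sqrt_gt_0_iff sum_power2_gt_zero_iff by blast
    have \<rho>2: "x\<^sup>2 + y\<^sup>2 = \<rho>\<^sup>2" by (simp add: \<rho>_def)
    have "(x / \<rho>)\<^sup>2 + (- y / \<rho>)\<^sup>2 = 1"
      using \<rho> unfolding power_divide power2_minus add_divide_distrib[symmetric] \<rho>2 by simp
    then obtain t where "x / \<rho> = cos t" "- y / \<rho> = sin t" using sincos_total_2pi by metis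
    then have "x = \<rho> * cos t" "y = - \<rho> * sin t" using \<rho> by (auto simp: field_simps)
    then show ?thesis by (intro exI[of _ "t / 2"]) simp
  qed auto
  then obtain \<theta> where \<theta>: "x * sin (2 * \<theta>) + y * cos (2 * \<theta>) = 0" by blast
  define g1 where "g1 = sl2_mult g (sl2_rot \<theta>)"
  obtain a1 b1 c1 d1 where g1: "g1 = (a1, b1, c1, d1)" by (cases g1)
  have g1S: "(a1, b1, c1, d1) \<in> SL2" using SL2_mult[OF assms SL2_rot, of \<theta>] unfolding g1_def[symmetric] g1 .
  have eqs: "a1 = a * cos \<theta> - b * sin \<theta>" "b1 = a * sin \<theta> + b * cos \<theta>"
    "c1 = c * cos \<theta> - d * sin \<theta>" "d1 = c * sin \<theta> + d * cos \<theta>"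
    using g1[symmetric] unfolding g1_def g sl2_rot_def by auto
  have "a1 * b1 + c1 * d1 = x * (2 * sin \<theta> * cos \<theta>) + y * ((cos \<theta>)\<^sup>2 - (sin \<theta>)\<^sup>2)"
    unfolding eqs x_def y_def by (simp add: field_simps power2_eq_square)
  then have "sl2_q g1 = 0" unfolding g1 using \<theta> by (simp add: sl2_q_def sin_double cos_double)
  then have s0: "sl2_s (a1, b1, c1, d1) = 0" unfolding g1 by (simp add: sl2_s_def)
  note dec = sl2_decompose[OF g1S, unfolded s0]
  obtain h m n where mn: "m\<^sup>2 + n\<^sup>2 = 1"
    and eq: "g1 = sl2_mult (m, n, - n, m) (sl2_mult (sl2_exp BHd h) (sl2_exp BS 0))"
    using dec unfolding g1 by blast
  obtain \<phi> where "m = cos \<phi>" "n = sin \<phi>" using sincos_total_2pi[OF mn] by metis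
  then have "g1 = sl2_mult (sl2_rot \<phi>) (sl2_exp BHd h)" using eq by (simp add: sl2_rot_def del: sl2_mult.simps sl2_exp.simps)
  moreover have "g = sl2_mult g1 (sl2_rot (- \<theta>))"
    using sl2_exp_add[of BW \<theta> "- \<theta>"] unfolding g1_def sl2_mult_assoc by (simp del: sl2_mult.simps)
  ultimately have "g = sl2_mult (sl2_rot \<phi>) (sl2_mult (sl2_exp BHd h) (sl2_rot (- \<theta>)))"
    by (simp only: sl2_mult_assoc)
  then show ?thesis by (rule that)
qed

section \<open>Curves in the group and the adjoint action\<close>

context urep
begin

text \<open>\<open>has_dact\<close> differentiates along three subgroups only. A curve through the
  identity is factored by \<open>sl2_decompose\<close> into reparametrised subgroups, each covered
  by \<open>rep_exp_chain\<close>. The coefficients are the coordinates of the tangent matrix in the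
  basis W, Hd, S.\<close>

lemma rep_curve_deriv:
  assumes \<gamma>: "\<And>t. \<gamma> t = (a t, b t, c t, d t)" "\<And>t. \<gamma> t \<in> SL2" "\<gamma> 0 = sl2_one"
    and der: "DERIV a 0 :> a'" "DERIV b 0 :> b'" "DERIV c 0 :> c'" "DERIV d 0 :> d'"
    and dact: "has_dact \<pi> BW v w1" "has_dact \<pi> BHd v w2" "has_dact \<pi> BS v w3"
  shows "clim (\<lambda>t. scC (complex_of_real (1 / t)) (\<pi> (\<gamma> t) v - v))
    (scC (complex_of_real ((b' - c') / 2)) w1 + scC (complex_of_real ((a' - d') / 2)) w2
      + scC (complex_of_real ((b' + c') / 2)) w3) (at 0)"
proof -
  have at0: "a 0 = 1" "b 0 = 0" "c 0 = 0" "d 0 = 1" using \<gamma>(1,3) by (auto simp: sl2_one_def)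
  define H where "H t = sl2_h (\<gamma> t)" for t
  define S where "S t = sl2_s (\<gamma> t)" for t
  define m where "m t = (a t * cosh (S t) - b t * sinh (S t)) * exp (- H t)" for t
  define n where "n t = (b t * cosh (S t) - a t * sinh (S t)) * exp (H t)" for t
  have H: "H = (\<lambda>t. arsinh (((a t)\<^sup>2 + (c t)\<^sup>2 - ((b t)\<^sup>2 + (d t)\<^sup>2)) / 2) / 2)"
    by (simp add: H_def sl2_h_def \<gamma>(1) fun_eq_iff)
  have S: "S = (\<lambda>t. arsinh ((a t * b t + c t * d t) / cosh (2 * H t)) / 2)"
    by (simp add: S_def sl2_s_def sl2_q_def \<gamma>(1) fun_eq_iff H_def)
  have H0: "H 0 = 0" and S0: "S 0 = 0" by (auto simp: H S at0)
  have dH: "DERIV H 0 :> (a' - d') / 2"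
  proof -
    have "DERIV (\<lambda>t. ((a t)\<^sup>2 + (c t)\<^sup>2 - ((b t)\<^sup>2 + (d t)\<^sup>2)) / 2) 0 :> a' - d'"
      by (rule derivative_eq_intros der refl | simp add: at0)+
    from DERIV_cdivide[OF DERIV_chain2[OF arsinh_real_has_field_derivative this], of 2]
    show ?thesis unfolding H by (simp add: at0)
  qed
  have dS: "DERIV S 0 :> (b' + c') / 2"
  proof -
    have "DERIV (\<lambda>t. (a t * b t + c t * d t) / cosh (2 * H t)) 0 :> b' + c'"
      by (rule derivative_eq_intros der dH refl | simp add: at0 H0)+
    from DERIV_cdivide[OF DERIV_chain2[OF arsinh_real_has_field_derivative this], of 2]
    show ?thesis unfolding S by (simp add: at0 H0)
  qed
  have dm: "DERIV m 0 :> a' - (a' - d') / 2"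
    unfolding m_def by (rule derivative_eq_intros der dH dS refl | simp add: at0 H0 S0)+
  have dn: "DERIV n 0 :> (b' - c') / 2"
    unfolding n_def by (rule derivative_eq_intros der dH dS refl | simp add: at0 H0 S0 field_simps)+
  have m0: "m 0 = 1" and n0: "n 0 = 0" by (auto simp: m_def n_def at0 H0 S0)
  \<comment> \<open>\<open>arcsin\<close> recovers the angle only where its cosine
    \<open>m t\<close> is positive, which holds near 0.\<close>
  define \<theta> where "\<theta> t = arcsin (n t)" for t
  have th0: "\<theta> 0 = 0" by (simp add: \<theta>_def n0)
  have dth: "DERIV \<theta> 0 :> (b' - c') / 2"
    unfolding \<theta>_def by (rule derivative_eq_intros dn refl | simp add: n0)+
  have mpos: "eventually (\<lambda>t. m t > 0) (at 0)"
  proof -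
    have "(m \<longlongrightarrow> 1) (at 0)" using DERIV_isCont[OF dm] unfolding isCont_def m0 .
    then show ?thesis by (rule order_tendstoD(1)) simp
  qed
  have lim0: "H \<midarrow>0\<rightarrow> 0" "S \<midarrow>0\<rightarrow> 0" "\<theta> \<midarrow>0\<rightarrow> 0"
    using DERIV_isCont[OF dH] DERIV_isCont[OF dS] DERIV_isCont[OF dth]
    unfolding isCont_def by (simp_all add: H0 S0 th0)
  have eq: "\<gamma> t = sl2_mult (sl2_exp BW (\<theta> t)) (sl2_mult (sl2_exp BHd (H t)) (sl2_exp BS (S t)))"
    if "m t > 0" for t
  proof -
    have g: "(a t, b t, c t, d t) \<in> SL2" using \<gamma>(2)[of t] \<gamma>(1)[of t] by simp
    note dec = sl2_decompose[OF g, folded \<gamma>(1), folded H_def S_def, folded m_def n_def]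
    have "sin (\<theta> t) = n t" "cos (\<theta> t) = m t"
    proof -
      have "(n t)\<^sup>2 \<le> 1" using dec(1) by (metis add.commute le_add_same_cancel1 zero_le_power2)
      then have "- 1 \<le> n t" "n t \<le> 1" by (auto simp: abs_square_le_1 abs_le_iff)
      then show "sin (\<theta> t) = n t" "cos (\<theta> t) = m t"
        using that dec(1) by (auto simp: \<theta>_def cos_arcsin intro!: real_sqrt_unique)
    qed
    then show ?thesis using dec(2) by (simp add: sl2_rot_def del: sl2_mult.simps)
  qed
  let ?q = "\<lambda>t. complex_of_real (1 / t)"
  \<comment> \<open>Telescoping of the difference quotient of a product k a s: k a (s v - v) + k (a
    v - v) + (k v - v).\<close>
  define G where "G t = \<pi> (sl2_exp BW (\<theta> t)) (\<pi> (sl2_exp BHd (H t)) (scC (?q t) (\<pi> (sl2_exp BS (S t)) v - v)))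
     + \<pi> (sl2_exp BW (\<theta> t)) (scC (?q t) (\<pi> (sl2_exp BHd (H t)) v - v))
     + scC (?q t) (\<pi> (sl2_exp BW (\<theta> t)) v - v)" for t
  have one: "((\<lambda>t. sl2_exp X (f t)) \<longlongrightarrow> sl2_one) (at 0)" if "f \<midarrow>0\<rightarrow> 0" for X and f :: "real \<Rightarrow> real"
    using tendsto_sl2_exp[OF that, of X] by simp
  have act: "clim (\<lambda>t. \<pi> (sl2_exp X (f t)) (u t)) l (at 0)"
    if "f \<midarrow>0\<rightarrow> 0" "clim u l (at 0)" for X and f :: "real \<Rightarrow> real" and u l
    using rep_clim[OF that(2) one[OF that(1), of X]] by simp
  have "clim G (scC (complex_of_real ((b' + c') / 2)) w3 + scC (complex_of_real ((a' - d') / 2)) w2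
      + scC (complex_of_real ((b' - c') / 2)) w1) (at 0)"
    unfolding G_def
    by (intro clim_add act lim0 rep_exp_chain[OF dact(3) dS S0] rep_exp_chain[OF dact(2) dH H0]
        rep_exp_chain[OF dact(1) dth th0])
  moreover have "eventually (\<lambda>t. G t = scC (?q t) (\<pi> (\<gamma> t) v - v)) (at 0)"
    using mpos
  proof eventually_elim
    case (elim t)
    show ?case unfolding eq[OF elim] G_def
      by (simp add: rep_mult SL2_mult rep_scC rep_diff scC_diff_right del: sl2_exp.simps)
  qed
  ultimately have "clim (\<lambda>t. scC (?q t) (\<pi> (\<gamma> t) v - v)) (scC (complex_of_real ((b' + c') / 2)) w3 + scC (complex_of_real ((a' - d') / 2)) w2
      + scC (complex_of_real ((b' - c') / 2)) w1) (at 0)"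
    by (rule clim_transform_eventually)
  then show ?thesis by (simp only: add_ac)
qed

text \<open>The derivative at \<pi>(g) v is transported from the conjugated curve g^-1 exp(tY) g,
  which in general is no longer one of the three basis subgroups; hence the need for
  \<open>rep_curve_deriv\<close>.\<close>

lemma has_dact_conj:
  assumes g: "g \<in> SL2"
    and "clim (\<lambda>t. scC (complex_of_real (1 / t)) (\<pi> (sl2_mult (sl2_inv g) (sl2_mult (sl2_exp Y t) g)) v - v)) z (at 0)"
  shows "has_dact \<pi> Y (\<pi> g v) (\<pi> g z)"
proof -
  have "\<pi> g (scC c (\<pi> (sl2_mult (sl2_inv g) (sl2_mult (sl2_exp Y t) g)) v - v)) = scC c (\<pi> (sl2_exp Y t) (\<pi> g v) - \<pi> g v)" for t c
    using g by (simp add: rep_scC rep_diff rep_mult SL2_mult SL2_inv del: sl2_exp.simps)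
  then show ?thesis
    unfolding has_dact_clim using rep_clim[OF assms(2) tendsto_const g g] by simp
qed

context
  fixes v w1 w2 w3
  assumes d: "has_dact \<pi> BW v w1" "has_dact \<pi> BHd v w2" "has_dact \<pi> BS v w3"
begin

lemma has_dact_rot_W: "has_dact \<pi> BW (\<pi> (sl2_rot s) v) (\<pi> (sl2_rot s) w1)"
proof (rule has_dact_conj)
  have "sl2_mult (sl2_inv (sl2_rot s)) (sl2_mult (sl2_exp BW t) (sl2_rot s)) = sl2_exp BW t" for t
    using sl2_exp_add[of BW t s] sl2_exp_add[of BW "- s" "s + t"] sl2_inv_exp[of BW s] by (simp add: add.commute del: sl2_mult.simps)
  then show "clim (\<lambda>t. scC (complex_of_real (1 / t)) (\<pi> (sl2_mult (sl2_inv (sl2_rot s)) (sl2_mult (sl2_exp BW t) (sl2_rot s))) v - v)) w1 (at 0)"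
    using d(1) unfolding has_dact_clim by (simp del: sl2_mult.simps)
qed simp

lemma has_dact_rot_Hd: "has_dact \<pi> BHd (\<pi> (sl2_rot s) v)
   (\<pi> (sl2_rot s) (scC (complex_of_real (cos (2 * s))) w2 + scC (complex_of_real (sin (2 * s))) w3))"
proof (rule has_dact_conj)
  let ?\<gamma> = "\<lambda>t. sl2_mult (sl2_inv (sl2_rot s)) (sl2_mult (sl2_exp BHd t) (sl2_rot s))"
  have coef: "(2 * sin s * cos s - 2 * sin s * cos s) / 2 = 0"
    "((cos s)\<^sup>2 - (sin s)\<^sup>2 - ((sin s)\<^sup>2 - (cos s)\<^sup>2)) / 2 = cos (2 * s)"
    "(2 * sin s * cos s + 2 * sin s * cos s) / 2 = sin (2 * s)"
    by (simp_all add: cos_double sin_double)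
  have "clim (\<lambda>t. scC (complex_of_real (1 / t)) (\<pi> (?\<gamma> t) v - v))
    (scC (complex_of_real ((2 * sin s * cos s - 2 * sin s * cos s) / 2)) w1
     + scC (complex_of_real (((cos s)\<^sup>2 - (sin s)\<^sup>2 - ((sin s)\<^sup>2 - (cos s)\<^sup>2)) / 2)) w2
     + scC (complex_of_real ((2 * sin s * cos s + 2 * sin s * cos s) / 2)) w3) (at 0)"
  proof (rule rep_curve_deriv[OF _ _ _ _ _ _ _ d])
    show "?\<gamma> t = (exp t * (cos s)\<^sup>2 + exp (- t) * (sin s)\<^sup>2, (exp t - exp (- t)) * sin s * cos s,
        (exp t - exp (- t)) * sin s * cos s, exp t * (sin s)\<^sup>2 + exp (- t) * (cos s)\<^sup>2)" for t
      by (simp add: sl2_rot_def power2_eq_square algebra_simps)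
    show "?\<gamma> t \<in> SL2" for t by (intro SL2_mult SL2_inv SL2_rot SL2_exp)
    show "?\<gamma> 0 = sl2_one" using sl2_inv_mult[OF SL2_rot] by (simp del: sl2_mult.simps sl2_exp.simps)
  qed (rule derivative_eq_intros refl | simp)+
  then show "clim (\<lambda>t. scC (complex_of_real (1 / t)) (\<pi> (?\<gamma> t) v - v))
      (scC (complex_of_real (cos (2 * s))) w2 + scC (complex_of_real (sin (2 * s))) w3) (at 0)"
    unfolding coef by (simp del: sl2_mult.simps sl2_exp.simps)
qed simp

lemma has_dact_rot_S: "has_dact \<pi> BS (\<pi> (sl2_rot s) v)
   (\<pi> (sl2_rot s) (scC (complex_of_real (- sin (2 * s))) w2 + scC (complex_of_real (cos (2 * s))) w3))"
proof (rule has_dact_conj)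
  let ?\<gamma> = "\<lambda>t. sl2_mult (sl2_inv (sl2_rot s)) (sl2_mult (sl2_exp BS t) (sl2_rot s))"
  have coef: "((cos s)\<^sup>2 - (sin s)\<^sup>2 - ((cos s)\<^sup>2 - (sin s)\<^sup>2)) / 2 = 0"
    "(- 2 * sin s * cos s - 2 * sin s * cos s) / 2 = - sin (2 * s)"
    "((cos s)\<^sup>2 - (sin s)\<^sup>2 + ((cos s)\<^sup>2 - (sin s)\<^sup>2)) / 2 = cos (2 * s)"
    by (simp_all add: cos_double sin_double)
  have "clim (\<lambda>t. scC (complex_of_real (1 / t)) (\<pi> (?\<gamma> t) v - v))
    (scC (complex_of_real (((cos s)\<^sup>2 - (sin s)\<^sup>2 - ((cos s)\<^sup>2 - (sin s)\<^sup>2)) / 2)) w1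
     + scC (complex_of_real ((- 2 * sin s * cos s - 2 * sin s * cos s) / 2)) w2
     + scC (complex_of_real (((cos s)\<^sup>2 - (sin s)\<^sup>2 + ((cos s)\<^sup>2 - (sin s)\<^sup>2)) / 2)) w3) (at 0)"
  proof (rule rep_curve_deriv[OF _ _ _ _ _ _ _ d])
    show "?\<gamma> t = (cosh t * ((cos s)\<^sup>2 + (sin s)\<^sup>2) - 2 * sinh t * sin s * cos s, sinh t * ((cos s)\<^sup>2 - (sin s)\<^sup>2),
        sinh t * ((cos s)\<^sup>2 - (sin s)\<^sup>2), cosh t * ((cos s)\<^sup>2 + (sin s)\<^sup>2) + 2 * sinh t * sin s * cos s)" for t
      by (simp add: sl2_rot_def power2_eq_square algebra_simps del: sin_cos_squared_add sin_cos_squared_add2 sin_cos_squared_add3)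
    show "?\<gamma> t \<in> SL2" for t by (intro SL2_mult SL2_inv SL2_rot SL2_exp)
    show "?\<gamma> 0 = sl2_one" using sl2_inv_mult[OF SL2_rot] by (simp del: sl2_mult.simps sl2_exp.simps)
  qed (rule derivative_eq_intros refl | simp)+
  then show "clim (\<lambda>t. scC (complex_of_real (1 / t)) (\<pi> (?\<gamma> t) v - v))
      (scC (complex_of_real (- sin (2 * s))) w2 + scC (complex_of_real (cos (2 * s))) w3) (at 0)"
    unfolding coef by (simp del: sl2_mult.simps sl2_exp.simps)
qed simp

lemma has_dact_Hd_S: "has_dact \<pi> BS (\<pi> (sl2_exp BHd s) v)
   (\<pi> (sl2_exp BHd s) (scC (complex_of_real (- sinh (2 * s))) w1 + scC (complex_of_real (cosh (2 * s))) w3))"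
proof (rule has_dact_conj)
  let ?\<gamma> = "\<lambda>t. sl2_mult (sl2_inv (sl2_exp BHd s)) (sl2_mult (sl2_exp BS t) (sl2_exp BHd s))"
  have coef: "(exp (- (2 * s)) - exp (2 * s)) / 2 = - sinh (2 * s)"
    "(exp (- (2 * s)) + exp (2 * s)) / 2 = cosh (2 * s)"
    by (simp_all add: sinh_def cosh_def field_simps)
  have "clim (\<lambda>t. scC (complex_of_real (1 / t)) (\<pi> (?\<gamma> t) v - v))
    (scC (complex_of_real ((exp (- (2 * s)) - exp (2 * s)) / 2)) w1
     + scC (complex_of_real ((0 - 0) / 2)) w2
     + scC (complex_of_real ((exp (- (2 * s)) + exp (2 * s)) / 2)) w3) (at 0)"
  proof (rule rep_curve_deriv[OF _ _ _ _ _ _ _ d])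
    show "?\<gamma> t = (cosh t, sinh t * exp (- (2 * s)), sinh t * exp (2 * s), cosh t)" for t
      by (simp add: algebra_simps flip: exp_add)
    show "?\<gamma> t \<in> SL2" for t by (intro SL2_mult SL2_inv SL2_rot SL2_exp)
    show "?\<gamma> 0 = sl2_one" using sl2_inv_mult[OF SL2_exp] by (simp del: sl2_mult.simps sl2_exp.simps sl2_inv.simps)
  qed (rule derivative_eq_intros refl | simp)+
  then show "clim (\<lambda>t. scC (complex_of_real (1 / t)) (\<pi> (?\<gamma> t) v - v))
      (scC (complex_of_real (- sinh (2 * s))) w1 + scC (complex_of_real (cosh (2 * s))) w3) (at 0)"
    unfolding coef by (simp del: sl2_mult.simps sl2_exp.simps)
qed (rule SL2_exp)

end

end

section \<open>Smooth vectors and commutation relations\<close>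

context urep
begin

lemma Hinf_dact: "v \<in> Hinf \<pi> \<Longrightarrow> has_dact \<pi> X v (dact \<pi> X v)"
proof -
  assume "v \<in> Hinf \<pi>"
  then have "smooth_word \<pi> [X] v" unfolding Hinf_def by blast
  then obtain w where "has_dact \<pi> X v w" by auto
  then show ?thesis using dact_eq by metis
qed

lemma dact_Hinf: "v \<in> Hinf \<pi> \<Longrightarrow> dact \<pi> X v \<in> Hinf \<pi>"
  unfolding Hinf_def
proof (intro CollectI allI)
  fix Xs assume "v \<in> {v. \<forall>Xs. smooth_word \<pi> Xs v}"
  then have "smooth_word \<pi> (X # Xs) v" by blast
  then obtain w where "has_dact \<pi> X v w" "smooth_word \<pi> Xs w" by auto
  then show "smooth_word \<pi> Xs (dact \<pi> X v)" using dact_eq by metis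
qed

lemma smooth_word_add: "smooth_word \<pi> Xs v \<Longrightarrow> smooth_word \<pi> Xs w \<Longrightarrow> smooth_word \<pi> Xs (v + w)"
  by (induction Xs arbitrary: v w) (auto intro: has_dact_add)

lemma smooth_word_scC: "smooth_word \<pi> Xs v \<Longrightarrow> smooth_word \<pi> Xs (scC c v)"
  by (induction Xs arbitrary: v) (auto intro: has_dact_scC)

lemma smooth_word_0: "smooth_word \<pi> Xs 0"
  by (induction Xs) (auto intro: has_dact_0)

lemma Hinf_subspace: "mr_csubspace (Hinf \<pi>)"
  unfolding mr_csubspace_def Hinf_def
  by (auto intro: smooth_word_add smooth_word_scC smooth_word_0)

lemmas Hinf_0 = mr_csubspaceD(1)[OF Hinf_subspace]
  and Hinf_add = mr_csubspaceD(2)[OF Hinf_subspace]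
  and Hinf_scC = mr_csubspaceD(3)[OF Hinf_subspace]
  and Hinf_minus = mr_csubspaceD(4)[OF Hinf_subspace]
  and Hinf_diff = mr_csubspaceD(5)[OF Hinf_subspace]

lemma dact_add: "v \<in> Hinf \<pi> \<Longrightarrow> w \<in> Hinf \<pi> \<Longrightarrow> dact \<pi> X (v + w) = dact \<pi> X v + dact \<pi> X w"
  by (intro dact_eq has_dact_add Hinf_dact)

lemma dact_scC: "v \<in> Hinf \<pi> \<Longrightarrow> dact \<pi> X (scC c v) = scC c (dact \<pi> X v)"
  by (intro dact_eq has_dact_scC Hinf_dact)

lemma dact_0 [simp]: "dact \<pi> X 0 = 0"
  by (intro dact_eq has_dact_0)

lemma dact_minus: "v \<in> Hinf \<pi> \<Longrightarrow> dact \<pi> X (- v) = - dact \<pi> X v"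
  using dact_scC[of v X "-1"] by (simp add: scC_minus_left scC_one)

lemma dact_diff: "v \<in> Hinf \<pi> \<Longrightarrow> w \<in> Hinf \<pi> \<Longrightarrow> dact \<pi> X (v - w) = dact \<pi> X v - dact \<pi> X w"
  using dact_add[of v "- w" X] by (simp add: dact_minus Hinf_minus)

lemma dact_skew: "v \<in> Hinf \<pi> \<Longrightarrow> w \<in> Hinf \<pi> \<Longrightarrow> cinner (dact \<pi> X v) w = - cinner v (dact \<pi> X w)"
  by (intro has_dact_skew[OF Hinf_dact Hinf_dact])

text \<open>The commutator identity is first obtained weakly, by differentiating
  \<open>\<langle>\<pi>(exp sX) v, Y w\<rangle> = - \<langle>Ad(exp -sX)Y v, \<pi>(exp -sX) w\<rangle>\<close>; testing it against the defect itself makes it strong.\<close>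

lemma dact_commutator:
  assumes v: "v \<in> Hinf \<pi>" and z: "\<And>i. i < 3 \<Longrightarrow> z i \<in> Hinf \<pi>"
    and conj: "\<And>s. has_dact \<pi> Y (\<pi> (sl2_exp X s) v) (\<pi> (sl2_exp X s) (\<Sum>i<3::nat. scC (complex_of_real (c i s)) (z i)))"
    and der: "\<And>i. i < 3 \<Longrightarrow> DERIV (c i) 0 :> c' i"
  shows "dact \<pi> X (dact \<pi> Y v) = dact \<pi> Y (dact \<pi> X v) - (\<Sum>i<3::nat. scC (complex_of_real (c' i)) (z i))"
proof -
  define E where "E = dact \<pi> X (dact \<pi> Y v) - dact \<pi> Y (dact \<pi> X v) + (\<Sum>i<3::nat. scC (complex_of_real (c' i)) (z i))"
  have sumH: "(\<Sum>i<3::nat. scC (complex_of_real (c' i)) (z i)) \<in> Hinf \<pi>"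
    by (intro mr_csubspace_sum[OF Hinf_subspace] Hinf_scC z) simp
  have E: "E \<in> Hinf \<pi>" unfolding E_def by (intro Hinf_add Hinf_diff dact_Hinf v sumH)
  have vY: "dact \<pi> Y v = (\<Sum>i<3::nat. scC (complex_of_real (c i 0)) (z i))"
    using conj[of 0] by (simp add: dact_eq del: sl2_exp.simps)
  have "Re (cinner E w) = 0" if w: "w \<in> Hinf \<pi>" for w
  proof -
    define f where "f s = Re (cinner (\<pi> (sl2_exp X s) v) (dact \<pi> Y w))" for s
    have f1: "DERIV f 0 :> Re (cinner (dact \<pi> X v) (dact \<pi> Y w))"
      using rep_exp_deriv[OF Hinf_dact[OF v], of X "dact \<pi> Y w" 0] unfolding f_def by (simp del: sl2_exp.simps)
    have f2: "f s = - (\<Sum>i<3::nat. c i s * Re (cinner (\<pi> (sl2_exp X (- s)) w) (z i)))" for s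
    proof -
      have "f s = - Re (cinner (\<pi> (sl2_exp X s) (\<Sum>i<3::nat. scC (complex_of_real (c i s)) (z i))) w)"
        unfolding f_def using has_dact_skew[OF conj[of s] Hinf_dact[OF w]] by simp
      also have "\<dots> = - (\<Sum>i<3::nat. c i s * Re (cinner (\<pi> (sl2_exp X s) (z i)) w))"
        by (simp add: rep_sum rep_scC cinner_sum_left cinner_scC_left del: sl2_exp.simps)
      also have "\<dots> = - (\<Sum>i<3::nat. c i s * Re (cinner (z i) (\<pi> (sl2_exp X (- s)) w)))"
        by (simp add: rep_adjoint sl2_inv_exp del: sl2_exp.simps)
      also have "\<dots> = - (\<Sum>i<3::nat. c i s * Re (cinner (\<pi> (sl2_exp X (- s)) w) (z i)))"
        by (intro arg_cong[where f=uminus] sum.cong refl) (subst cinner_commute, simp)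
      finally show ?thesis .
    qed
    have g: "DERIV (\<lambda>s. Re (cinner (\<pi> (sl2_exp X (- s)) w) (z i))) 0 :> - Re (cinner (dact \<pi> X w) (z i))" for i
    proof -
      have "DERIV (\<lambda>s. Re (cinner (\<pi> (sl2_exp X s) w) (z i))) (- 0) :> Re (cinner (dact \<pi> X w) (z i))"
        using rep_exp_deriv[OF Hinf_dact[OF w], of X "z i" 0] by (simp del: sl2_exp.simps)
      from DERIV_chain2[where g=uminus and x=0, OF this DERIV_minus[OF DERIV_ident]] show ?thesis by simp
    qed
    have "DERIV f 0 :> - (\<Sum>i<3::nat. c' i * Re (cinner (\<pi> (sl2_exp X (- 0)) w) (z i)) + - Re (cinner (dact \<pi> X w) (z i)) * c i 0)"
      unfolding f2[abs_def] by (intro DERIV_minus DERIV_sum DERIV_mult der g) simp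
    from DERIV_unique[OF f1 this]
    have "Re (cinner (dact \<pi> X v) (dact \<pi> Y w)) =
       - (\<Sum>i<3::nat. c' i * Re (cinner w (z i))) + (\<Sum>i<3::nat. c i 0 * Re (cinner (dact \<pi> X w) (z i)))"
      by (simp add: sum.distrib sum_subtractf mult.commute del: sl2_exp.simps)
    also have "(\<Sum>i<3::nat. c i 0 * Re (cinner (dact \<pi> X w) (z i))) = Re (cinner (dact \<pi> X w) (dact \<pi> Y v))"
      unfolding vY by (simp add: cinner_sum_right cinner_scC_right)
    also have "(\<Sum>i<3::nat. c' i * Re (cinner w (z i))) = Re (cinner w (\<Sum>i<3::nat. scC (complex_of_real (c' i)) (z i)))"
      by (simp add: cinner_sum_right cinner_scC_right)
    finally have main: "Re (cinner (dact \<pi> X v) (dact \<pi> Y w)) =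
      - Re (cinner w (\<Sum>i<3::nat. scC (complex_of_real (c' i)) (z i))) + Re (cinner (dact \<pi> X w) (dact \<pi> Y v))" .
    have sym: "Re (cinner x y) = Re (cinner y x)" for x y :: 'h
      using arg_cong[OF cinner_commute[of x y], of Re] by simp
    have "Re (cinner E w) = - Re (cinner (dact \<pi> Y v) (dact \<pi> X w)) + Re (cinner (dact \<pi> X v) (dact \<pi> Y w))
        + Re (cinner (\<Sum>i<3::nat. scC (complex_of_real (c' i)) (z i)) w)"
      unfolding E_def cinner_add_left cinner_diff_left
        dact_skew[OF dact_Hinf[OF v, of Y] w, of X] dact_skew[OF dact_Hinf[OF v, of X] w, of Y] by simp
    also have "\<dots> = 0"
      unfolding main sym[of "dact \<pi> Y v"] sym[of "\<Sum>i<3::nat. scC (complex_of_real (c' i)) (z i)"] by linarith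
    finally show ?thesis .
  qed
  from this[OF E] have "(cnrm E)\<^sup>2 = 0" unfolding cnrm_power2 .
  then have "E = 0" by simp
  then show ?thesis unfolding E_def by (simp add: algebra_simps)
qed

lemma sum_lessThan_3: "(\<Sum>i<3::nat. f i) = f 0 + f 1 + (f 2 :: 'x::comm_monoid_add)"
  by (simp add: eval_nat_numeral)

lemma dact_W_Hd: "v \<in> Hinf \<pi> \<Longrightarrow> dact \<pi> BW (dact \<pi> BHd v) = dact \<pi> BHd (dact \<pi> BW v) - scC 2 (dact \<pi> BS v)"
proof -
  assume v: "v \<in> Hinf \<pi>"
  let ?z = "\<lambda>i::nat. if i = 0 then dact \<pi> BW v else if i = 1 then dact \<pi> BHd v else dact \<pi> BS v"
  let ?c = "\<lambda>i::nat. if i = 0 then (\<lambda>s. 0) else if i = 1 then (\<lambda>s. cos (2 * s)) else (\<lambda>s::real. sin (2 * s))"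
  let ?c' = "\<lambda>i::nat. if i = 2 then 2 else 0"
  have "dact \<pi> BW (dact \<pi> BHd v) = dact \<pi> BHd (dact \<pi> BW v) - (\<Sum>i<3. scC (complex_of_real (?c' i)) (?z i))"
  proof (rule dact_commutator[OF v])
    show "has_dact \<pi> BHd (\<pi> (sl2_exp BW s) v) (\<pi> (sl2_exp BW s) (\<Sum>i<3. scC (complex_of_real (?c i s)) (?z i)))" for s
      using has_dact_rot_Hd[OF Hinf_dact Hinf_dact Hinf_dact, OF v v v, of s] by (simp add: sum_lessThan_3)
    show "DERIV (?c i) 0 :> ?c' i" if "i < 3" for i
      using that by (auto intro!: derivative_eq_intros)
  qed (auto intro: dact_Hinf v)
  then show ?thesis by (simp add: sum_lessThan_3)
qed

lemma dact_W_S: "v \<in> Hinf \<pi> \<Longrightarrow> dact \<pi> BW (dact \<pi> BS v) = dact \<pi> BS (dact \<pi> BW v) + scC 2 (dact \<pi> BHd v)"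
proof -
  assume v: "v \<in> Hinf \<pi>"
  let ?z = "\<lambda>i::nat. if i = 0 then dact \<pi> BW v else if i = 1 then dact \<pi> BHd v else dact \<pi> BS v"
  let ?c = "\<lambda>i::nat. if i = 0 then (\<lambda>s. 0) else if i = 1 then (\<lambda>s. - sin (2 * s)) else (\<lambda>s::real. cos (2 * s))"
  let ?c' = "\<lambda>i::nat. if i = 1 then - 2 else 0"
  have "dact \<pi> BW (dact \<pi> BS v) = dact \<pi> BS (dact \<pi> BW v) - (\<Sum>i<3. scC (complex_of_real (?c' i)) (?z i))"
  proof (rule dact_commutator[OF v])
    show "has_dact \<pi> BS (\<pi> (sl2_exp BW s) v) (\<pi> (sl2_exp BW s) (\<Sum>i<3. scC (complex_of_real (?c i s)) (?z i)))" for s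
      using has_dact_rot_S[OF Hinf_dact Hinf_dact Hinf_dact, OF v v v, of s] by (simp add: sum_lessThan_3)
    show "DERIV (?c i) 0 :> ?c' i" if "i < 3" for i
      using that by (auto intro!: derivative_eq_intros)
  qed (auto intro: dact_Hinf v)
  then show ?thesis by (simp add: sum_lessThan_3 scC_minus_left)
qed

lemma dact_Hd_S: "v \<in> Hinf \<pi> \<Longrightarrow> dact \<pi> BHd (dact \<pi> BS v) = dact \<pi> BS (dact \<pi> BHd v) + scC 2 (dact \<pi> BW v)"
proof -
  assume v: "v \<in> Hinf \<pi>"
  let ?z = "\<lambda>i::nat. if i = 0 then dact \<pi> BW v else if i = 1 then dact \<pi> BHd v else dact \<pi> BS v"
  let ?c = "\<lambda>i::nat. if i = 0 then (\<lambda>s. - sinh (2 * s)) else if i = 1 then (\<lambda>s. 0) else (\<lambda>s::real. cosh (2 * s))"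
  let ?c' = "\<lambda>i::nat. if i = 0 then - 2 else 0"
  have "dact \<pi> BHd (dact \<pi> BS v) = dact \<pi> BS (dact \<pi> BHd v) - (\<Sum>i<3. scC (complex_of_real (?c' i)) (?z i))"
  proof (rule dact_commutator[OF v])
    show "has_dact \<pi> BS (\<pi> (sl2_exp BHd s) v) (\<pi> (sl2_exp BHd s) (\<Sum>i<3. scC (complex_of_real (?c i s)) (?z i)))" for s
      using has_dact_Hd_S[OF Hinf_dact Hinf_dact Hinf_dact, OF v v v, of s]
      by (simp add: sum_lessThan_3 del: sl2_exp.simps)
    show "DERIV (?c i) 0 :> ?c' i" if "i < 3" for i
      using that by (auto intro!: derivative_eq_intros)
  qed (auto intro: dact_Hinf v)
  then show ?thesis by (simp add: sum_lessThan_3 scC_minus_left)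
qed

section \<open>Ladder operators and the Casimir\<close>

abbreviation "opHH \<equiv> opH \<pi>"
abbreviation "EE \<equiv> opE \<pi>"
abbreviation "EB \<equiv> opEbar \<pi>"
abbreviation "Cas \<equiv> casimir \<pi>"

lemma op_Hinf:
  assumes "v \<in> Hinf \<pi>"
  shows "opHH v \<in> Hinf \<pi>" "EE v \<in> Hinf \<pi>" "EB v \<in> Hinf \<pi>" "Cas v \<in> Hinf \<pi>"
proof -
  have *: "opHH v \<in> Hinf \<pi>" "EE v \<in> Hinf \<pi>" "EB v \<in> Hinf \<pi>" if "v \<in> Hinf \<pi>" for v
    unfolding opH_def opE_def opEbar_def by (intro Hinf_add Hinf_diff Hinf_scC dact_Hinf that)+
  show "opHH v \<in> Hinf \<pi>" "EE v \<in> Hinf \<pi>" "EB v \<in> Hinf \<pi>" by (rule *[OF assms])+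
  show "Cas v \<in> Hinf \<pi>" unfolding casimir_def by (intro Hinf_add Hinf_diff Hinf_scC Hinf_minus * assms)
qed

lemma op_add:
  assumes "v \<in> Hinf \<pi>" "w \<in> Hinf \<pi>"
  shows "opHH (v + w) = opHH v + opHH w" "EE (v + w) = EE v + EE w" "EB (v + w) = EB v + EB w"
    "Cas (v + w) = Cas v + Cas w"
proof -
  have *: "opHH (v + w) = opHH v + opHH w" "EE (v + w) = EE v + EE w" "EB (v + w) = EB v + EB w"
    if "v \<in> Hinf \<pi>" "w \<in> Hinf \<pi>" for v w
    using that unfolding opH_def opE_def opEbar_def by (simp_all add: dact_add scC_add_right)
  show "opHH (v + w) = opHH v + opHH w" "EE (v + w) = EE v + EE w" "EB (v + w) = EB v + EB w" by (rule *[OF assms])+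
  show "Cas (v + w) = Cas v + Cas w"
    unfolding casimir_def using assms by (simp add: * op_Hinf scC_add_right)
qed

lemma op_scC:
  assumes "v \<in> Hinf \<pi>"
  shows "opHH (scC c v) = scC c (opHH v)" "EE (scC c v) = scC c (EE v)" "EB (scC c v) = scC c (EB v)"
    "Cas (scC c v) = scC c (Cas v)"
proof -
  have *: "opHH (scC c v) = scC c (opHH v)" "EE (scC c v) = scC c (EE v)" "EB (scC c v) = scC c (EB v)"
    if "v \<in> Hinf \<pi>" for v c
    using that unfolding opH_def opE_def opEbar_def
    by (simp_all add: dact_scC scC_add_right scC_diff_right scC_scC mult.commute)
  show "opHH (scC c v) = scC c (opHH v)" "EE (scC c v) = scC c (EE v)" "EB (scC c v) = scC c (EB v)" by (rule *[OF assms])+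
  show "Cas (scC c v) = scC c (Cas v)"
    unfolding casimir_def using assms
    by (simp add: * op_Hinf scC_add_right scC_diff_right scC_minus_right scC_scC mult.commute)
qed

lemma op_minus:
  assumes "v \<in> Hinf \<pi>"
  shows "opHH (- v) = - opHH v" "EE (- v) = - EE v" "EB (- v) = - EB v" "Cas (- v) = - Cas v"
  using op_scC[OF assms, of "-1"] by (simp_all add: scC_minus_left scC_one)

lemma op_diff:
  assumes "v \<in> Hinf \<pi>" "w \<in> Hinf \<pi>"
  shows "opHH (v - w) = opHH v - opHH w" "EE (v - w) = EE v - EE w" "EB (v - w) = EB v - EB w"
    "Cas (v - w) = Cas v - Cas w"
  using op_add[OF assms(1) Hinf_minus[OF assms(2)]] op_minus[OF assms(2)] by simp_all

lemma op_0 [simp]: "opHH 0 = 0" "EE 0 = 0" "EB 0 = 0" "Cas 0 = 0"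
  using op_scC[OF Hinf_0, of 0] by simp_all

lemma op_adjoint:
  assumes "v \<in> Hinf \<pi>" "w \<in> Hinf \<pi>"
  shows "cinner (opHH v) w = cinner v (opHH w)" "cinner (EE v) w = - cinner v (EB w)"
    "cinner (EB v) w = - cinner v (EE w)" "cinner (Cas v) w = cinner v (Cas w)"
proof -
  have *: "cinner (opHH v) w = cinner v (opHH w)" "cinner (EE v) w = - cinner v (EB w)"
    "cinner (EB v) w = - cinner v (EE w)" if "v \<in> Hinf \<pi>" "w \<in> Hinf \<pi>" for v w
    using that unfolding opH_def opE_def opEbar_def
    by (simp_all add: cinner_simps dact_skew field_simps)
  show "cinner (opHH v) w = cinner v (opHH w)" "cinner (EE v) w = - cinner v (EB w)"
    "cinner (EB v) w = - cinner v (EE w)" by (rule *[OF assms])+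
  show "cinner (Cas v) w = cinner v (Cas w)"
    unfolding casimir_def using assms by (simp add: cinner_simps * op_Hinf)
qed

lemma op_H_E: "v \<in> Hinf \<pi> \<Longrightarrow> opHH (EE v) = EE (opHH v) + EE v"
  unfolding opH_def opE_def
  by (rule cinner_ext) (simp add: dact_add dact_scC Hinf_scC dact_Hinf dact_W_Hd dact_W_S cinner_simps field_simps)

lemma op_H_EB: "v \<in> Hinf \<pi> \<Longrightarrow> opHH (EB v) = EB (opHH v) - EB v"
  unfolding opH_def opEbar_def
  by (rule cinner_ext) (simp add: dact_diff dact_scC Hinf_scC dact_Hinf dact_W_Hd dact_W_S cinner_simps field_simps)

lemma op_E_EB: "v \<in> Hinf \<pi> \<Longrightarrow> EE (EB v) = EB (EE v) + scC 2 (opHH v)"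
  unfolding opH_def opE_def opEbar_def
  by (rule cinner_ext) (simp add: dact_add dact_diff dact_scC Hinf_scC dact_Hinf dact_Hd_S cinner_simps field_simps)

text \<open>The commutator of E and EB is 2 H, so the symmetric definition of the Casimir can be
  rewritten with a single ordered product; in this form it acts directly on weight vectors.\<close>

lemma casimir_EB_E: "v \<in> Hinf \<pi> \<Longrightarrow> EB (EE v) = - (Cas v + opHH (opHH v) + opHH v)"
  unfolding casimir_def by (rule cinner_ext) (simp add: op_E_EB cinner_simps field_simps)

lemma casimir_E_EB: "v \<in> Hinf \<pi> \<Longrightarrow> EE (EB v) = - (Cas v + opHH (opHH v) - opHH v)"
  unfolding casimir_def by (rule cinner_ext) (simp add: op_E_EB cinner_simps field_simps)

lemma casimir_eq: "v \<in> Hinf \<pi> \<Longrightarrow> Cas v = - opHH (opHH v) - opHH v - EB (EE v)"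
  by (rule cinner_ext) (simp add: casimir_EB_E cinner_simps)

lemma casimir_E: "v \<in> Hinf \<pi> \<Longrightarrow> Cas (EE v) = EE (Cas v)"
  by (rule cinner_ext)
    (simp add: casimir_eq op_Hinf op_diff op_minus op_add op_H_E op_E_EB op_scC Hinf_minus Hinf_diff Hinf_add Hinf_scC cinner_simps)

lemma casimir_EB: "v \<in> Hinf \<pi> \<Longrightarrow> Cas (EB v) = EB (Cas v)"
  by (rule cinner_ext)
    (simp add: casimir_eq op_Hinf op_diff op_minus op_add op_H_EB op_E_EB op_scC Hinf_minus Hinf_diff Hinf_add Hinf_scC cinner_simps)

lemma casimir_H: "v \<in> Hinf \<pi> \<Longrightarrow> Cas (opHH v) = opHH (Cas v)"
proof -
  assume v: "v \<in> Hinf \<pi>"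
  have "opHH (EB (EE v)) = EB (EE (opHH v))" using v by (simp add: op_H_EB op_H_E op_Hinf op_add)
  then show ?thesis using v by (simp add: casimir_eq op_Hinf op_diff op_minus Hinf_minus Hinf_diff)
qed

end

section \<open>Symmetric operators on a closed subspace\<close>

locale sym_op =
  fixes U :: "'h::mr_chilbert set" and T :: "'h \<Rightarrow> 'h"
  assumes U: "mr_csubspace U" "cclosed U"
    and T_in: "u \<in> U \<Longrightarrow> T u \<in> U"
    and T_add: "u \<in> U \<Longrightarrow> v \<in> U \<Longrightarrow> T (u + v) = T u + T v"
    and T_scC: "u \<in> U \<Longrightarrow> T (scC c u) = scC c (T u)"
    and T_sym: "u \<in> U \<Longrightarrow> v \<in> U \<Longrightarrow> cinner (T u) v = cinner u (T v)"
begin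

lemmas U_0 = mr_csubspaceD(1)[OF U(1)] and U_add = mr_csubspaceD(2)[OF U(1)]
  and U_scC = mr_csubspaceD(3)[OF U(1)] and U_minus = mr_csubspaceD(4)[OF U(1)]
  and U_diff = mr_csubspaceD(5)[OF U(1)]

lemma T_minus: "u \<in> U \<Longrightarrow> T (- u) = - T u"
  using T_scC[of u "-1"] by (simp add: scC_minus_left scC_one)

lemma T_diff: "u \<in> U \<Longrightarrow> v \<in> U \<Longrightarrow> T (u - v) = T u - T v"
  using T_add[of u "- v"] by (simp add: T_minus U_minus)

lemma T_0 [simp]: "T 0 = 0"
  using T_scC[OF U_0, of 0] by simp

text \<open>Hellinger--Toeplitz. The gliding hump construction produces a vector \<open>\<xi>\<close>
  with \<open>\<bar>\<langle>T u\<^sub>n, \<xi>\<rangle>\<bar>\<close> unbounded while \<open>\<parallel>u\<^sub>n\<parallel> \<le> 1\<close>.\<close>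

lemma bounded: "\<exists>M>0. \<forall>u\<in>U. cnrm (T u) \<le> M * cnrm u"
proof (rule ccontr)
  assume neg: "\<not> ?thesis"
  have "\<exists>u\<in>U. cnrm u \<le> 1 \<and> cnrm (T u) \<ge> 4 ^ n" for n :: nat
  proof -
    obtain u where u: "u \<in> U" "cnrm (T u) > 4 ^ n * cnrm u"
      using neg by (meson not_le zero_less_numeral zero_less_power)
    have "u \<noteq> 0" using u by auto
    then have c: "cnrm u > 0" using cnrm_nonneg[of u] by (simp add: less_le)
    define w where "w = scC (complex_of_real (1 / cnrm u)) u"
    have "w \<in> U" unfolding w_def by (intro U_scC u)
    moreover have "cnrm w \<le> 1" unfolding w_def cnrm_scC norm_of_real using c by simp
    moreover have "cnrm (T w) \<ge> 4 ^ n" unfolding w_def T_scC[OF u(1)] cnrm_scC norm_of_real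
      using c u(2) by (simp add: field_simps)
    ultimately show ?thesis by blast
  qed
  then obtain u where u: "\<And>n. u n \<in> U" "\<And>n. cnrm (u n) \<le> 1" "\<And>n::nat. cnrm (T (u n)) \<ge> 4 ^ n" by metis
  define N where "N n = cnrm (T (u n))" for n
  have Npos: "N n > 0" for n using u(3)[of n] unfolding N_def by (meson less_le_trans zero_less_numeral zero_less_power)
  define y where "y n = scC (complex_of_real ((1/3) ^ n / N n)) (T (u n))" for n
  have yU: "y n \<in> U" for n unfolding y_def by (intro U_scC T_in u)
  have ynorm: "cnrm (y n) = (1/3) ^ n" for n
    using Npos[of n] unfolding y_def cnrm_scC norm_of_real N_def[symmetric] by simp
  have yinner: "cinner (T (u n)) (y n) = complex_of_real ((1/3) ^ n * N n)" for n
    using Npos[of n] unfolding y_def cinner_scC_right cinner_self N_def[symmetric]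
    by (simp add: power2_eq_square)
  \<comment> \<open>The two candidates differ by \<open>2 y n\<close>, so at least one choice of
    sign keeps the pairing with \<open>T (u n)\<close> at size
    \<open>(1/3) ^ n * N n\<close>.\<close>
  define x where "x = rec_nat 0 (\<lambda>n xn. if cmod (cinner (T (u n)) (xn + y n)) \<ge> (1/3) ^ n * N n then xn + y n else xn - y n)"
  have x0: "x 0 = 0" and xS: "x (Suc n) = (if cmod (cinner (T (u n)) (x n + y n)) \<ge> (1/3) ^ n * N n then x n + y n else x n - y n)" for n
    by (simp_all add: x_def)
  have xU: "x n \<in> U" for n
    by (induction n) (auto simp: x0 xS U_0 intro!: U_add U_diff yU)
  have step: "cnrm (x (Suc n) - x n) = (1/3) ^ n" for n
    by (simp add: xS ynorm)
  have big: "cmod (cinner (T (u n)) (x (Suc n))) \<ge> (1/3) ^ n * N n" for n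
  proof (cases "cmod (cinner (T (u n)) (x n + y n)) \<ge> (1/3) ^ n * N n")
    case False
    have "2 * ((1/3) ^ n * N n) = cmod (2 * cinner (T (u n)) (y n))"
      unfolding yinner norm_mult norm_of_real using Npos[of n] by simp
    also have "2 * cinner (T (u n)) (y n) = cinner (T (u n)) (x n + y n) - cinner (T (u n)) (x n - y n)"
      by (simp add: cinner_simps)
    also have "cmod \<dots> \<le> cmod (cinner (T (u n)) (x n + y n)) + cmod (cinner (T (u n)) (x n - y n))"
      by (rule norm_triangle_ineq4)
    finally show ?thesis using False by (simp add: xS)
  qed (simp add: xS)
  \<comment> \<open>All later steps together move the point by at most \<open>(1/3) ^ n / 2\<close>,
    half of what step n has secured. Since \<open>N n\<close> is at least \<open>4 ^ n\<close>, the
    lower bound \<open>(4/3) ^ n / 2\<close> survives in the limit.\<close>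
  have tail: "cnrm (x (Suc n + k) - x (Suc n)) \<le> (1/3) ^ n / 2 - (1/3) ^ (n + k) / 2" for n k
  proof (induction k)
    case (Suc k)
    have "cnrm (x (Suc n + Suc k) - x (Suc n)) \<le> cnrm (x (Suc (Suc n + k)) - x (Suc n + k)) + cnrm (x (Suc n + k) - x (Suc n))"
      using cnrm_triangle_3[of "x (Suc n + Suc k)" "x (Suc n)" "x (Suc n + k)"] by simp
    moreover have "(1/3::real) ^ (Suc n + k) = (1/3) ^ (n + k) / 3" "(1/3::real) ^ (n + Suc k) = (1/3) ^ (n + k) / 3" by simp_all
    ultimately show ?case using Suc.IH unfolding step by linarith
  qed simp
  have tail': "cnrm (x m - x (Suc n)) \<le> (1/3) ^ n / 2" if le: "Suc n \<le> m" for m n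
  proof -
    obtain k where m: "m = Suc n + k" using le_Suc_ex[OF le] by blast
    have "(1/3::real) ^ (n + k) \<ge> 0" by simp
    then show ?thesis unfolding m using tail[of n k] by linarith
  qed
  have "\<exists>L. clim x L sequentially"
  proof (rule cCauchy_clim)
    fix e :: real assume e: "e > 0"
    obtain n where n: "(1/3::real) ^ n < e" using real_arch_pow_inv[OF e, of "1/3"] by auto
    have "cnrm (x m - x k) < e" if "m \<ge> Suc n" "k \<ge> Suc n" for m k
    proof -
      have "cnrm (x m - x k) \<le> cnrm (x m - x (Suc n)) + cnrm (x (Suc n) - x k)" by (rule cnrm_triangle_3)
      also have "\<dots> \<le> (1/3) ^ n" using tail'[OF that(1)] tail'[OF that(2)] cnrm_diff_commute[of "x k" "x (Suc n)"] by linarith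
      finally show ?thesis using n by linarith
    qed
    then show "\<exists>N. \<forall>m\<ge>N. \<forall>n\<ge>N. cnrm (x m - x n) < e" by blast
  qed
  then obtain \<xi> where \<xi>: "clim x \<xi> sequentially" by blast
  have \<xi>U: "\<xi> \<in> U" by (rule cclosed_clim[OF U(2) \<xi>]) (auto simp: xU)
  have close: "cnrm (\<xi> - x (Suc n)) \<le> (1/3) ^ n / 2" for n
  proof (rule tendsto_upperbound)
    show "(\<lambda>m. cnrm (x m - x (Suc n))) \<longlonglongrightarrow> cnrm (\<xi> - x (Suc n))"
      by (intro clim_cnrm clim_diff \<xi> clim_const)
    show "\<forall>\<^sub>F m in sequentially. cnrm (x m - x (Suc n)) \<le> (1/3) ^ n / 2"
      using tail' by (auto simp: eventually_sequentially)
  qed simp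
  have lower: "(4/3) ^ n / 2 \<le> cnrm (T \<xi>)" for n
  proof -
    have "(1/3) ^ n * N n \<le> cmod (cinner (T (u n)) \<xi>) + cmod (cinner (T (u n)) (\<xi> - x (Suc n)))"
      using big[of n] norm_triangle_ineq4[of "cinner (T (u n)) \<xi>" "cinner (T (u n)) (\<xi> - x (Suc n))"]
      by (simp add: cinner_diff_right)
    also have "cmod (cinner (T (u n)) (\<xi> - x (Suc n))) \<le> N n * ((1/3) ^ n / 2)"
      unfolding N_def by (rule order_trans[OF cinner_Cauchy_Schwarz]) (intro mult_left_mono close cnrm_nonneg)
    also have "cmod (cinner (T (u n)) \<xi>) = cmod (cinner (u n) (T \<xi>))" using T_sym[OF u(1) \<xi>U] by simp
    also have "\<dots> \<le> cnrm (u n) * cnrm (T \<xi>)" by (rule cinner_Cauchy_Schwarz)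
    also have "\<dots> \<le> 1 * cnrm (T \<xi>)" by (intro mult_right_mono u cnrm_nonneg)
    finally have "(1/3) ^ n * N n \<le> 1 * cnrm (T \<xi>) + N n * ((1/3) ^ n / 2)" by simp
    moreover have "(1/3) ^ n * N n = N n * ((1/3) ^ n / 2) + (1/3) ^ n * N n / 2" by simp
    ultimately have "(1/3) ^ n * N n / 2 \<le> cnrm (T \<xi>)" by linarith
    moreover have "(1/3) ^ n * 4 ^ n \<le> (1/3) ^ n * N n" unfolding N_def by (intro mult_left_mono u) simp
    moreover have "(1/3) ^ n * 4 ^ n = (4/3::real) ^ n" by (simp flip: power_mult_distrib)
    ultimately show ?thesis by linarith
  qed
  obtain n where "2 * cnrm (T \<xi>) < (4/3) ^ n" using real_arch_pow[of "4/3" "2 * cnrm (T \<xi>)"] by auto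
  with lower[of n] show False by simp
qed

end

section \<open>The absolute value of a symmetric contraction\<close>

locale sym_contraction = sym_op U A for U :: "'h::mr_chilbert set" and A +
  assumes contr: "u \<in> U \<Longrightarrow> cnrm (A u) \<le> cnrm u"
begin

definition C :: "'h \<Rightarrow> 'h" where "C u = u - A (A u)"

text \<open>Operators that are polynomials in \<open>C\<close> with nonnegative coefficients of sum \<open>r\<close>.\<close>

inductive pos :: "real \<Rightarrow> ('h \<Rightarrow> 'h) \<Rightarrow> bool" where
  pos_zero: "pos 0 (\<lambda>u. 0)"
| pos_C: "pos 1 C"
| pos_add: "pos r P \<Longrightarrow> pos s Q \<Longrightarrow> pos (r + s) (\<lambda>u. P u + Q u)"
| pos_scale: "pos r P \<Longrightarrow> 0 \<le> a \<Longrightarrow> pos (a * r) (\<lambda>u. scC (complex_of_real a) (P u))"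
| pos_comp: "pos r P \<Longrightarrow> pos s Q \<Longrightarrow> pos (r * s) (\<lambda>u. P (Q u))"

lemma C_contr: assumes u: "u \<in> U" shows "cnrm (C u) \<le> cnrm u"
proof (rule power2_le_imp_le)
  have *: "cinner (A (A u)) u = cinner (A u) (A u)" "cinner u (A (A u)) = cinner (A u) (A u)"
    using T_sym[of "A u" u] T_sym[of u "A u"] T_in u by simp_all
  have "(cnrm (C u))\<^sup>2 = (cnrm u)\<^sup>2 - 2 * (cnrm (A u))\<^sup>2 + (cnrm (A (A u)))\<^sup>2"
    unfolding C_def cnrm_power2 by (simp add: cinner_simps *)
  also have "\<dots> \<le> (cnrm u)\<^sup>2 - 2 * (cnrm (A u))\<^sup>2 + (cnrm (A u))\<^sup>2"
    using contr[OF T_in[OF u]] by (intro add_left_mono power_mono) auto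
  also have "\<dots> \<le> (cnrm u)\<^sup>2" by simp
  finally show "(cnrm (C u))\<^sup>2 \<le> (cnrm u)\<^sup>2" .
qed simp

lemma C_in: "u \<in> U \<Longrightarrow> C u \<in> U"
  unfolding C_def by (intro U_diff T_in)

lemma pos_linear:
  assumes "pos r P"
  shows "0 \<le> r" "u \<in> U \<Longrightarrow> P u \<in> U" "u \<in> U \<Longrightarrow> v \<in> U \<Longrightarrow> P (u + v) = P u + P v"
    "u \<in> U \<Longrightarrow> P (scC c u) = scC c (P u)" "u \<in> U \<Longrightarrow> cnrm (P u) \<le> r * cnrm u"
proof -
  have "0 \<le> r \<and> (\<forall>u\<in>U. P u \<in> U \<and> (\<forall>v\<in>U. P (u + v) = P u + P v) \<and> (\<forall>c. P (scC c u) = scC c (P u)) \<and>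
     cnrm (P u) \<le> r * cnrm u)"
    using assms
  proof (induction)
    case pos_zero then show ?case by (auto simp: U_0)
  next
    case pos_C
    show ?case
      by (auto simp: C_in C_contr) (auto simp: C_def T_add T_in T_scC scC_diff_right)
  next
    case (pos_add r P s Q)
    then show ?case
      by (auto simp: U_add scC_add_right distrib_right intro!: order_trans[OF cnrm_triangle] add_mono)
  next
    case (pos_scale r P a)
    then show ?case
      by (auto simp: U_scC scC_add_right scC_scC cnrm_scC mult.assoc intro!: mult_left_mono) (simp add: mult.commute)
  next
    case (pos_comp r P s Q)
    have "cnrm (P (Q u)) \<le> r * s * cnrm u" if "u \<in> U" for u
    proof -
      have "cnrm (P (Q u)) \<le> r * cnrm (Q u)" using pos_comp that by blast
      also have "\<dots> \<le> r * (s * cnrm u)" using pos_comp that by (intro mult_left_mono) auto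
      finally show ?thesis by simp
    qed
    with pos_comp show ?case by auto
  qed
  then show "0 \<le> r" "u \<in> U \<Longrightarrow> P u \<in> U" "u \<in> U \<Longrightarrow> v \<in> U \<Longrightarrow> P (u + v) = P u + P v"
    "u \<in> U \<Longrightarrow> P (scC c u) = scC c (P u)" "u \<in> U \<Longrightarrow> cnrm (P u) \<le> r * cnrm u" by auto
qed

lemma pos_commute:
  assumes "pos r P"
    and S: "\<And>u. u \<in> U \<Longrightarrow> S u \<in> U" "\<And>u v. u \<in> U \<Longrightarrow> v \<in> U \<Longrightarrow> S (u + v) = S u + S v"
      "\<And>u c. u \<in> U \<Longrightarrow> S (scC c u) = scC c (S u)" "\<And>u. u \<in> U \<Longrightarrow> S (C u) = C (S u)"
    and u: "u \<in> U"
  shows "S (P u) = P (S u)"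
  using assms(1) u
proof (induction arbitrary: u)
  case pos_zero then show ?case using S(3)[OF U_0, of 0] by simp
qed (auto simp: S pos_linear(2))

lemma pos_commute_pos: "pos r P \<Longrightarrow> pos s Q \<Longrightarrow> u \<in> U \<Longrightarrow> Q (P u) = P (Q u)"
  by (rule pos_commute[where r=r])
    (auto simp: pos_linear pos_commute[of s Q C] C_in pos_linear[OF pos_C])

lemma pos_props:
  assumes "pos r P"
  shows "0 \<le> r" "u \<in> U \<Longrightarrow> P u \<in> U" "u \<in> U \<Longrightarrow> v \<in> U \<Longrightarrow> P (u + v) = P u + P v"
    "u \<in> U \<Longrightarrow> P (scC c u) = scC c (P u)" "u \<in> U \<Longrightarrow> v \<in> U \<Longrightarrow> cinner (P u) v = cinner u (P v)"
    "u \<in> U \<Longrightarrow> cnrm (P u) \<le> r * cnrm u" "u \<in> U \<Longrightarrow> P (A u) = A (P u)"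
proof -
  show "u \<in> U \<Longrightarrow> v \<in> U \<Longrightarrow> cinner (P u) v = cinner u (P v)"
    using assms
  proof (induction arbitrary: u v)
    case pos_C then show ?case by (simp add: C_def T_in T_sym cinner_simps)
  next
    case (pos_comp r P s Q)
    have "cinner (P (Q u)) v = cinner (Q u) (P v)" "cinner (Q u) (P v) = cinner u (Q (P v))"
      using pos_comp by (simp_all add: pos_linear(2))
    then show ?case using pos_commute_pos[of r P s Q v] pos_comp by simp
  qed (auto simp: cinner_simps)
  show "u \<in> U \<Longrightarrow> P (A u) = A (P u)"
    by (rule pos_commute[OF assms, symmetric]) (auto simp: T_in T_add T_scC C_def T_diff)
qed (use pos_linear[OF assms] in auto)

lemma pos_diff: "pos r P \<Longrightarrow> u \<in> U \<Longrightarrow> v \<in> U \<Longrightarrow> P (u - v) = P u - P v"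
  using pos_props(3)[of r P u "- v"] pos_props(4)[of r P v "-1"] U_minus by (simp add: scC_minus_left scC_one)

text \<open>Iteration for the equation Y = (C + Y^2) / 2. A solution satisfies (1 - Y)^2 = 1 - C =
  A^2, so 1 - Y is a square root of A^2.\<close>

primrec Y :: "nat \<Rightarrow> 'h \<Rightarrow> 'h" where
  "Y 0 = (\<lambda>u. 0)"
| "Y (Suc k) = (\<lambda>u. scC (1/2) (C u + Y k (Y k u)))"

text \<open>The same iteration with C replaced by the number 1, that is, the coefficient sum of the
  polynomial \<open>Y k\<close>; it serves as scalar majorant.\<close>

primrec t :: "nat \<Rightarrow> real" where
  "t 0 = 0"
| "t (Suc k) = (1 + t k * t k) / 2"

lemma pos_Y: "pos (t k) (Y k)"
proof (induction k)
  case (Suc k)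
  from pos_scale[OF pos_add[OF pos_C pos_comp[OF Suc Suc]], of "1/2"] show ?case by simp
qed (simp add: pos_zero)

text \<open>Increments again have nonnegative coefficients, by the factorisation Y^2 - Z^2 = Y (Y -
  Z) + (Y - Z) Z for commuting Y, Z. Their norms are therefore at most the increments of
  \<open>t\<close>, and convergence of a scalar sequence gives convergence of the operators.\<close>

lemma Y_diff: "\<exists>D. pos (t (Suc k) - t k) D \<and> (\<forall>u\<in>U. Y (Suc k) u - Y k u = D u)"
proof (induction k)
  case 0
  from pos_scale[OF pos_C, of "1/2"] show ?case by (intro exI[of _ "\<lambda>u. scC (complex_of_real (1/2)) (C u)"]) simp
next
  case (Suc k)
  then obtain D where D: "pos (t (Suc k) - t k) D" "\<And>u. u \<in> U \<Longrightarrow> Y (Suc k) u - Y k u = D u" by blast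
  let ?D = "\<lambda>u. scC (complex_of_real (1/2)) (Y (Suc k) (D u) + D (Y k u))"
  have "pos (1/2 * (t (Suc k) * (t (Suc k) - t k) + (t (Suc k) - t k) * t k)) ?D"
    by (intro pos_scale pos_add pos_comp pos_Y D) simp
  also have "1/2 * (t (Suc k) * (t (Suc k) - t k) + (t (Suc k) - t k) * t k) = t (Suc (Suc k)) - t (Suc k)"
    by (simp only: t.simps(2)[of "Suc k"]) (simp add: field_simps)
  finally have "pos (t (Suc (Suc k)) - t (Suc k)) ?D" .
  moreover have "Y (Suc (Suc k)) u - Y (Suc k) u = ?D u" if u: "u \<in> U" for u
  proof -
    have in1: "Y (Suc k) u \<in> U" "Y k u \<in> U" using pos_props(2)[OF pos_Y] u by blast+
    have "Y (Suc k) (D u) + D (Y k u) = Y (Suc k) (Y (Suc k) u) - Y k (Y k u)"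
      unfolding D(2)[OF u, symmetric] D(2)[OF in1(2), symmetric] pos_diff[OF pos_Y in1] by simp
    moreover have "Y (Suc (Suc k)) u - Y (Suc k) u = scC (1/2) (Y (Suc k) (Y (Suc k) u) - Y k (Y k u))"
      by (simp add: scC_add_right scC_diff_right)
    ultimately show ?thesis by simp
  qed
  ultimately show ?case by blast
qed

lemma t_le: "0 \<le> t k" "t k \<le> 1"
proof -
  have "0 \<le> t k \<and> t k \<le> 1"
  proof (induction k)
    case (Suc k)
    then have "t k * t k \<le> 1 * 1" by (intro mult_mono) auto
    then show ?case using Suc by simp
  qed simp
  then show "0 \<le> t k" "t k \<le> 1" by auto
qed

lemma t_convergent: "\<exists>l. t \<longlonglongrightarrow> l"
proof -
  have "t k \<le> t (Suc k)" for k using Y_diff[of k] pos_props(1) by force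
  then have "incseq t" by (simp add: incseq_SucI)
  moreover have "bdd_above (range t)" using t_le(2) by (intro bdd_aboveI[of _ 1]) auto
  ultimately show ?thesis using LIMSEQ_incseq_SUP by blast
qed

lemma Y_Cauchy: "u \<in> U \<Longrightarrow> m \<le> n \<Longrightarrow> cnrm (Y n u - Y m u) \<le> (t n - t m) * cnrm u"
proof (induction n rule: nat_induct)
  case (Suc n)
  show ?case
  proof (cases "m = Suc n")
    case False
    then have IH: "cnrm (Y n u - Y m u) \<le> (t n - t m) * cnrm u" using Suc by simp
    obtain D where D: "pos (t (Suc n) - t n) D" "\<forall>u\<in>U. Y (Suc n) u - Y n u = D u" using Y_diff by blast
    have "cnrm (Y (Suc n) u - Y n u) \<le> (t (Suc n) - t n) * cnrm u" using D pos_props(6)[OF D(1)] Suc by metis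
    then show ?thesis using IH cnrm_triangle_3[of "Y (Suc n) u" "Y m u" "Y n u"]
      by (simp add: algebra_simps del: Y.simps t.simps)
  qed simp
qed simp

lemma Y_clim: "u \<in> U \<Longrightarrow> \<exists>L. clim (\<lambda>k. Y k u) L sequentially"
proof (rule cCauchy_clim)
  fix e :: real assume u: "u \<in> U" and e: "e > 0"
  have "Cauchy t" using t_convergent LIMSEQ_imp_Cauchy by blast
  moreover have "e / (cnrm u + 1) > 0" using e by (intro divide_pos_pos add_nonneg_pos) auto
  ultimately obtain N where N: "\<And>m n. m \<ge> N \<Longrightarrow> n \<ge> N \<Longrightarrow> \<bar>t m - t n\<bar> < e / (cnrm u + 1)"
    unfolding Cauchy_def dist_real_def by meson
  have *: "cnrm (Y n u - Y m u) < e" if "m \<ge> N" "m \<le> n" for m n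
  proof -
    have "cnrm (Y n u - Y m u) \<le> (t n - t m) * cnrm u" using Y_Cauchy[OF u that(2)] .
    also have "\<dots> \<le> e / (cnrm u + 1) * cnrm u"
      using N[of n m] that by (intro mult_right_mono) auto
    also have "\<dots> < e" using e add_nonneg_pos[OF cnrm_nonneg[of u] zero_less_one] by (simp add: divide_less_eq)
    finally show ?thesis .
  qed
  have "cnrm (Y m u - Y n u) < e" if "m \<ge> N" "n \<ge> N" for m n
    using *[of m n] *[of n m] that cnrm_diff_commute[of "Y m u" "Y n u"] by (cases "m \<le> n") auto
  then show "\<exists>N. \<forall>m\<ge>N. \<forall>n\<ge>N. cnrm (Y m u - Y n u) < e" by blast
qed

definition Yl :: "'h \<Rightarrow> 'h" where "Yl u = (SOME L. clim (\<lambda>k. Y k u) L sequentially)"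

lemma Yl: "u \<in> U \<Longrightarrow> clim (\<lambda>k. Y k u) (Yl u) sequentially"
  unfolding Yl_def using Y_clim by (rule someI_ex)

lemma Yl_in: "u \<in> U \<Longrightarrow> Yl u \<in> U"
  by (rule cclosed_clim[OF U(2) Yl]) (auto simp: pos_props(2)[OF pos_Y])

lemma Yl_add: "u \<in> U \<Longrightarrow> v \<in> U \<Longrightarrow> Yl (u + v) = Yl u + Yl v"
  using clim_unique[OF Yl[of "u + v"], of "Yl u + Yl v"] clim_add[OF Yl[of u] Yl[of v]]
  by (simp add: U_add pos_props(3)[OF pos_Y])

lemma Yl_scC: "u \<in> U \<Longrightarrow> Yl (scC c u) = scC c (Yl u)"
  using clim_unique[OF Yl[of "scC c u"], of "scC c (Yl u)"] clim_scC_const[OF Yl[of u], of c]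
  by (simp add: U_scC pos_props(4)[OF pos_Y])

lemma Yl_sym: "u \<in> U \<Longrightarrow> v \<in> U \<Longrightarrow> cinner (Yl u) v = cinner u (Yl v)"
proof -
  assume uv: "u \<in> U" "v \<in> U"
  have "(\<lambda>k. cinner (Y k u) v) \<longlonglongrightarrow> cinner (Yl u) v" by (intro clim_cinner Yl uv clim_const)
  moreover have "(\<lambda>k. cinner u (Y k v)) \<longlonglongrightarrow> cinner u (Yl v)" by (intro clim_cinner Yl uv clim_const)
  ultimately show ?thesis using uv by (simp add: pos_props(5)[OF pos_Y] LIMSEQ_unique)
qed

lemma Yl_bound: "u \<in> U \<Longrightarrow> cnrm (Yl u) \<le> cnrm u"
proof (rule tendsto_upperbound[OF clim_cnrm[OF Yl]])
  assume u: "u \<in> U"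
  have "cnrm (Y k u) \<le> cnrm u" for k
    using pos_props(6)[OF pos_Y u, of k] t_le(2)[of k] mult_right_mono[OF t_le(2)[of k] cnrm_nonneg[of u]] by simp
  then show "\<forall>\<^sub>F k in sequentially. cnrm (Y k u) \<le> cnrm u" by simp
qed auto

lemma Yl_comm: "u \<in> U \<Longrightarrow> Yl (A u) = A (Yl u)"
proof -
  assume u: "u \<in> U"
  have "clim (\<lambda>k. A (Y k u)) (A (Yl u)) sequentially"
  proof (rule clim_bound)
    fix k
    have "cnrm (A (Y k u - Yl u)) \<le> cnrm (Y k u - Yl u)" by (intro contr U_diff Yl_in u pos_props(2)[OF pos_Y])
    then show "cnrm (A (Y k u) - A (Yl u)) \<le> cnrm (Y k u - Yl u)"
      using u by (simp add: T_diff Yl_in pos_props(2)[OF pos_Y])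
    show "(\<lambda>k. cnrm (Y k u - Yl u)) \<longlonglongrightarrow> 0" using Yl[OF u] unfolding clim_def .
  qed
  then show ?thesis using clim_unique[OF Yl[OF T_in[OF u]], of "A (Yl u)"] u by (simp add: pos_props(7)[OF pos_Y])
qed

lemma Yl_square: "u \<in> U \<Longrightarrow> scC 2 (Yl u) = C u + Yl (Yl u)"
proof -
  assume u: "u \<in> U"
  have "clim (\<lambda>k. Y k (Y k u)) (Yl (Yl u)) sequentially"
  proof (rule clim_bound)
    fix k
    have "Y k (Y k u) - Yl (Yl u) = Y k (Y k u - Yl u) + (Y k (Yl u) - Yl (Yl u))"
      using u by (simp add: pos_diff[OF pos_Y] Yl_in pos_props(2)[OF pos_Y])
    then have "cnrm (Y k (Y k u) - Yl (Yl u)) \<le> cnrm (Y k (Y k u - Yl u)) + cnrm (Y k (Yl u) - Yl (Yl u))"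
      using cnrm_triangle by metis
    also have "cnrm (Y k (Y k u - Yl u)) \<le> t k * cnrm (Y k u - Yl u)"
      by (intro pos_props(6)[OF pos_Y] U_diff Yl_in u pos_props(2)[OF pos_Y])
    also have "\<dots> \<le> 1 * cnrm (Y k u - Yl u)" by (intro mult_right_mono t_le cnrm_nonneg)
    finally show "cnrm (Y k (Y k u) - Yl (Yl u)) \<le> cnrm (Y k u - Yl u) + cnrm (Y k (Yl u) - Yl (Yl u))" by simp
    show "(\<lambda>k. cnrm (Y k u - Yl u) + cnrm (Y k (Yl u) - Yl (Yl u))) \<longlonglongrightarrow> 0"
      using tendsto_add[OF Yl[OF u, unfolded clim_def] Yl[OF Yl_in[OF u], unfolded clim_def]] by simp
  qed
  then have lim1: "clim (\<lambda>k. Y (Suc k) u) (scC (1/2) (C u + Yl (Yl u))) sequentially"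
    by (simp add: clim_scC_const clim_add)
  have lim2: "clim (\<lambda>k. Y (Suc k) u) (Yl u) sequentially"
    using Yl[OF u] unfolding clim_def by (rule LIMSEQ_Suc)
  have "Yl u = scC (1/2) (C u + Yl (Yl u))" by (rule clim_unique[OF lim2 lim1]) simp
  then have "scC 2 (Yl u) = scC 2 (scC (1/2) (C u + Yl (Yl u)))" by simp
  then show ?thesis by (simp add: scC_scC scC_one)
qed

text \<open>\<open>B = 1 - Yl\<close> is the absolute value of \<open>A\<close>.\<close>

lemma abs_exists:
  "\<exists>B. (\<forall>u\<in>U. B u \<in> U \<and> B (B u) = A (A u) \<and> B (A u) = A (B u) \<and> 0 \<le> Re (cinner (B u) u)
     \<and> (\<forall>v\<in>U. B (u + v) = B u + B v \<and> cinner (B u) v = cinner u (B v)) \<and> (\<forall>c. B (scC c u) = scC c (B u)))"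
proof (rule exI[of _ "\<lambda>u. u - Yl u"], intro ballI conjI allI)
  fix u assume u: "u \<in> U"
  note i = Yl_in[OF u]
  show "u - Yl u \<in> U" by (intro U_diff u i)
  have e: "Yl (u - Yl u) = Yl u - Yl (Yl u)"
    using Yl_add[OF u U_minus[OF i]] Yl_scC[OF i, of "-1"] by (simp add: scC_minus_left scC_one)
  show "u - Yl u - Yl (u - Yl u) = A (A u)"
    unfolding e using Yl_square[OF u] scC_add_left[of 1 1 "Yl u"] unfolding C_def by (simp add: scC_one algebra_simps)
  show "A u - Yl (A u) = A (u - Yl u)" by (simp add: T_diff u i Yl_comm)
  have "Re (cinner (Yl u) u) \<le> cnrm u * cnrm u"
    using complex_Re_le_cmod[of "cinner (Yl u) u"] cinner_Cauchy_Schwarz[of "Yl u" u]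
      mult_right_mono[OF Yl_bound[OF u] cnrm_nonneg[of u]] by linarith
  then show "0 \<le> Re (cinner (u - Yl u) u)"
    using cnrm_power2[of u] by (simp add: cinner_simps power2_eq_square)
  show "u + v - Yl (u + v) = u - Yl u + (v - Yl v)" if "v \<in> U" for v by (simp add: Yl_add u that)
  show "cinner (u - Yl u) v = cinner u (v - Yl v)" if "v \<in> U" for v by (simp add: cinner_simps Yl_sym u that)
  show "scC c u - Yl (scC c u) = scC c (u - Yl u)" for c by (simp add: Yl_scC u scC_diff_right)
qed

end

text \<open>A substitute for the spectral projections of T at the level c. With A the rescaled T - c
  and B its absolute value, (B + A)(B - A) = B^2 - A^2 = 0, so the ranges of B + A and B - A are
  orthogonal, and the first is stable under T. By hypothesis one of them is zero, so A equals -B or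
  B.\<close>

lemma (in sym_op) split_or_form_comparable:
  assumes nosplit: "\<And>u1 u2. u1 \<in> U \<Longrightarrow> u2 \<in> U \<Longrightarrow> (\<And>n. cinner ((T ^^ n) u1) u2 = 0) \<Longrightarrow> u1 = 0 \<or> u2 = 0"
  shows "(\<forall>u\<in>U. Re (cinner (T u) u) \<le> c * (cnrm u)\<^sup>2) \<or> (\<forall>u\<in>U. Re (cinner (T u) u) \<ge> c * (cnrm u)\<^sup>2)"
proof -
  obtain M where M: "M > 0" "\<And>u. u \<in> U \<Longrightarrow> cnrm (T u) \<le> M * cnrm u" using bounded by blast
  define R where "R = M + \<bar>c\<bar>"
  have R: "R > 0" using M by (simp add: R_def)
  define A where "A u = scC (complex_of_real (1 / R)) (T u - scC (complex_of_real c) u)" for u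
  interpret A: sym_contraction U A
  proof
    fix u v assume u: "u \<in> U"
    show "A u \<in> U" unfolding A_def by (intro U_scC U_diff T_in u)
    show "A (scC a u) = scC a (A u)" for a
      by (simp add: A_def T_scC u scC_diff_right scC_scC mult.commute mult.left_commute)
    have "cnrm (T u - scC (complex_of_real c) u) \<le> M * cnrm u + \<bar>c\<bar> * cnrm u"
      using cnrm_triangle_diff[of "T u" "scC (complex_of_real c) u"] M(2)[OF u] by (simp add: cnrm_scC)
    also have "\<dots> = R * cnrm u" by (simp add: R_def algebra_simps)
    finally show "cnrm (A u) \<le> cnrm u" unfolding A_def cnrm_scC norm_of_real using R by (simp add: field_simps)
    assume v: "v \<in> U"
    show "A (u + v) = A u + A v" by (simp add: A_def T_add u v scC_add_right scC_diff_right)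
    show "cinner (A u) v = cinner u (A v)" by (simp add: A_def cinner_simps T_sym u v)
  qed (use U in auto)
  have TA: "T u = scC (complex_of_real R) (A u) + scC (complex_of_real c) u" for u
    unfolding A_def scC_scC using R by (simp add: scC_one flip: of_real_mult)
  obtain B where B: "\<And>u. u \<in> U \<Longrightarrow> B u \<in> U" "\<And>u. u \<in> U \<Longrightarrow> B (B u) = A (A u)"
    "\<And>u. u \<in> U \<Longrightarrow> B (A u) = A (B u)" "\<And>u. u \<in> U \<Longrightarrow> 0 \<le> Re (cinner (B u) u)"
    "\<And>u v. u \<in> U \<Longrightarrow> v \<in> U \<Longrightarrow> B (u + v) = B u + B v"
    "\<And>u v. u \<in> U \<Longrightarrow> v \<in> U \<Longrightarrow> cinner (B u) v = cinner u (B v)"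
    "\<And>u a. u \<in> U \<Longrightarrow> B (scC a u) = scC a (B u)"
    using A.abs_exists by blast
  define P where "P u = B u + A u" for u
  have P_in: "P u \<in> U" if "u \<in> U" for u unfolding P_def by (intro U_add B(1) A.T_in that)
  have TP: "T (P u) = P (T u)" if "u \<in> U" for u
    unfolding TA P_def using that
    by (simp add: B A.T_in A.T_add A.T_scC U_scC U_add scC_add_right)
  have TnP: "(T ^^ n) (P u) = P ((T ^^ n) u) \<and> (T ^^ n) u \<in> U" if "u \<in> U" for n u
    by (induction n) (auto simp: that TP T_in)
  have orth: "cinner (P x) (B y - A y) = 0" if "x \<in> U" "y \<in> U" for x y
  proof -
    have "cinner (P x) (B y - A y) = cinner (B (P x)) y - cinner (A (P x)) y"
      using that by (simp add: cinner_diff_right B A.T_sym P_in)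
    also have "B (P x) = A (P x)" unfolding P_def using that by (simp add: B A.T_in A.T_add)
    finally show ?thesis by simp
  qed
  have "P x = 0 \<or> B y - A y = 0" if xy: "x \<in> U" "y \<in> U" for x y
  proof (rule nosplit)
    show "P x \<in> U" "B y - A y \<in> U" using xy by (auto intro!: P_in U_diff B(1) A.T_in)
    show "cinner ((T ^^ n) (P x)) (B y - A y) = 0" for n using TnP[OF xy(1), of n] orth xy(2) by simp
  qed
  then have "(\<forall>x\<in>U. P x = 0) \<or> (\<forall>y\<in>U. B y = A y)" by (metis eq_iff_diff_eq_0)
  moreover have form: "Re (cinner (T u) u) = R * Re (cinner (A u) u) + c * (cnrm u)\<^sup>2" for u
    unfolding TA by (simp add: cinner_simps cnrm_power2)
  have "Re (cinner (T u) u) \<le> c * (cnrm u)\<^sup>2" if "u \<in> U" "P u = 0" for u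
  proof -
    have "A u = - B u" using that(2) unfolding P_def by (simp add: add_eq_0_iff)
    then have "Re (cinner (A u) u) \<le> 0" using B(4)[OF that(1)] by (simp add: cinner_minus_left)
    then show ?thesis unfolding form using R by (simp add: mult_nonneg_nonpos)
  qed
  moreover have "Re (cinner (T u) u) \<ge> c * (cnrm u)\<^sup>2" if "u \<in> U" "B u = A u" for u
    unfolding form using R B(4)[OF that(1)] that(2) by simp
  ultimately show ?thesis by blast
qed

text \<open>If two Rayleigh quotients differed, a level strictly between them would contradict the
  dichotomy. So the quadratic form of S = T - c vanishes, and evaluating it at u + S u gives twice
  the squared norm of S u.\<close>

lemma (in sym_op) scalar_if_no_split:
  assumes nosplit: "\<And>u1 u2. u1 \<in> U \<Longrightarrow> u2 \<in> U \<Longrightarrow> (\<And>n. cinner ((T ^^ n) u1) u2 = 0) \<Longrightarrow> u1 = 0 \<or> u2 = 0"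
  shows "\<exists>c::real. \<forall>u\<in>U. T u = scC (complex_of_real c) u"
proof (cases "\<exists>v\<in>U. v \<noteq> 0")
  case True
  then obtain v where v: "v \<in> U" "v \<noteq> 0" by blast
  define f where "f u = Re (cinner (T u) u) / (cnrm u)\<^sup>2" for u
  have f: "Re (cinner (T u) u) = f u * (cnrm u)\<^sup>2" if "u \<in> U" for u
    by (cases "u = 0") (auto simp: f_def)
  have mono: "\<not> f u < f w" if "u \<in> U" "w \<in> U" "u \<noteq> 0" "w \<noteq> 0" for u w
  proof
    assume less: "f u < f w"
    define c where "c = (f u + f w) / 2"
    have pos: "(cnrm u)\<^sup>2 > 0" "(cnrm w)\<^sup>2 > 0" using that by simp_all
    have "f u * (cnrm u)\<^sup>2 < c * (cnrm u)\<^sup>2" "c * (cnrm w)\<^sup>2 < f w * (cnrm w)\<^sup>2"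
      using less pos unfolding c_def by simp_all
    with split_or_form_comparable[OF nosplit, of c] show False using f that by fastforce
  qed
  define c where "c = f v"
  have eq: "Re (cinner (T u) u) = c * (cnrm u)\<^sup>2" if "u \<in> U" for u
    using mono[OF that v(1)] mono[OF v(1) that] v(2) f[OF that] unfolding c_def by (cases "u = 0") auto
  have "T u = scC (complex_of_real c) u" if u: "u \<in> U" for u
  proof -
    define S where "S x = T x - scC (complex_of_real c) x" for x
    have S_in: "S x \<in> U" if "x \<in> U" for x unfolding S_def by (intro U_diff T_in U_scC that)
    have zero: "Re (cinner (S x) x) = 0" if "x \<in> U" for x
      unfolding S_def using eq[OF that] by (simp add: cinner_simps cnrm_power2)
    have S_add: "S (x + y) = S x + S y" if "x \<in> U" "y \<in> U" for x y
      unfolding S_def by (simp add: T_add that scC_add_right)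
    have "cinner (S (S u)) u = cinner (S u) (S u)"
      unfolding S_def[of "S u"] using S_in[OF u] by (simp add: cinner_simps T_sym u S_def[of u])
    then have "Re (cinner (S (u + S u)) (u + S u)) = 2 * (cnrm (S u))\<^sup>2"
      using zero[OF u] zero[OF S_in[OF u]] S_add[OF u S_in[OF u]]
      by (simp add: cinner_add_left cinner_add_right cnrm_power2)
    with zero[OF U_add[OF u S_in[OF u]]] have "S u = 0" by simp
    then show ?thesis unfolding S_def by simp
  qed
  then show ?thesis by blast
next
  case False
  then show ?thesis using T_0 by (intro exI[of _ 0]) auto
qed

text \<open>The bounds are Cauchy estimates for a Taylor radius of at least 1/R at every point.
  Vanishing of all derivatives at a point spreads to distance 1/(4 R), and then along the line in
  steps of that length.\<close>

lemma analytic_zero: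
  fixes f :: "nat \<Rightarrow> real \<Rightarrow> real"
  assumes der: "\<And>n t. DERIV (f n) t :> f (Suc n) t"
    and bound: "\<And>n t. \<bar>f n t\<bar> \<le> C * R ^ n * fact n"
    and zero: "\<And>n. f n 0 = 0" and R: "R > 0"
  shows "f n t = 0"
proof -
  have C: "C \<ge> 0" using bound[of 0 0] abs_ge_zero[of "f 0 0"] by (metis fact_0 mult.right_neutral order_trans power_0)
  have step: "f n t = 0" if a: "\<And>n. f n a = 0" and t: "\<bar>t - a\<bar> \<le> 1 / (4 * R)" for n a t
  proof -
    define x where "x = t - a"
    define K where "K = C * (2 * R) ^ n * fact n"
    have "\<bar>f n t\<bar> \<le> K * (1/2) ^ m" for m
    proof -
      define diff where "diff k y = f (n + k) (a + y)" for k y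
      have "\<forall>k y. DERIV (diff k) y :> diff (Suc k) y"
        unfolding diff_def add.commute[of a] add_Suc_right
        by (intro allI DERIV_shift[THEN iffD1] der)
      then obtain s where s: "diff 0 x = (\<Sum>k<m. diff k 0 / fact k * x ^ k) + diff m s / fact m * x ^ m"
        using Maclaurin_all_le[of diff "diff 0" x m] by blast
      have "f n t = f (n + m) (a + s) / fact m * x ^ m"
        using s a unfolding diff_def x_def by simp
      then have "\<bar>f n t\<bar> = \<bar>f (n + m) (a + s)\<bar> * (\<bar>x\<bar> ^ m / fact m)"
        by (simp add: abs_mult power_abs)
      also have "\<dots> \<le> (C * R ^ (n + m) * fact (n + m)) * (\<bar>x\<bar> ^ m / fact m)"
        by (intro mult_right_mono bound) simp
      \<comment> \<open>The binomial coefficient is at most 2^(n+m), which separates the factorials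
        and doubles the rate to 2 R; on steps of length 1/(4 R) the remainder has ratio 1/2.\<close>
      also have "\<dots> \<le> (C * R ^ (n + m) * (2 ^ (n + m) * fact n * fact m)) * (\<bar>x\<bar> ^ m / fact m)"
      proof (intro mult_right_mono mult_left_mono)
        have "real ((n + m) choose n) \<le> 2 ^ (n + m)"
          using binomial_le_pow2[of "n + m" n] by (metis of_nat_le_iff of_nat_numeral of_nat_power)
        moreover have "fact (n + m) = real ((n + m) choose n) * (fact n * fact m)"
          by (simp add: binomial_fact)
        ultimately show "(fact (n + m) :: real) \<le> 2 ^ (n + m) * fact n * fact m"
          by (simp add: mult.assoc mult_right_mono)
      qed (use C R in auto)
      also have "\<dots> = K * (2 * R * \<bar>x\<bar>) ^ m"
        unfolding K_def by (simp add: power_add power_mult_distrib)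
      also have "\<dots> \<le> K * (1/2) ^ m"
        using t R C unfolding x_def[symmetric] K_def by (intro mult_left_mono power_mono) (auto simp: field_simps)
      finally show ?thesis .
    qed
    moreover have "(\<lambda>m. K * (1/2) ^ m) \<longlonglongrightarrow> K * 0" by (intro tendsto_intros LIMSEQ_realpow_zero) auto
    ultimately have "\<bar>f n t\<bar> \<le> K * 0" by (intro LIMSEQ_le_const) auto
    then show ?thesis by simp
  qed
  have "\<forall>t n. \<bar>t\<bar> \<le> real k / (4 * R) \<longrightarrow> f n t = 0" for k
  proof (induction k)
    case (Suc k)
    show ?case
    proof (intro allI impI)
      fix t n assume t: "\<bar>t\<bar> \<le> real (Suc k) / (4 * R)"
      define a where "a = t * (real k / real (Suc k))"
      have "\<bar>a\<bar> = \<bar>t\<bar> * (real k / real (Suc k))" by (simp add: a_def abs_mult)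
      also have "\<dots> \<le> real (Suc k) / (4 * R) * (real k / real (Suc k))" by (intro mult_right_mono t) simp
      also have "\<dots> = real k / (4 * R)" by simp
      finally have "\<bar>a\<bar> \<le> real k / (4 * R)" .
      moreover have "t - a = t / real (Suc k)" unfolding a_def by (simp add: field_simps)
      then have "\<bar>t - a\<bar> = \<bar>t\<bar> / real (Suc k)" by simp
      then have "\<bar>t - a\<bar> \<le> 1 / (4 * R)" using divide_right_mono[OF t, of "real (Suc k)"] by simp
      ultimately show "f n t = 0" using Suc step by blast
    qed
  qed (use zero in auto)
  moreover obtain k where "\<bar>t\<bar> * (4 * R) \<le> real k" using real_arch_simple by blast
  ultimately show ?thesis using R by (simp add: field_simps)
qed

section \<open>Spherical vectors of an irreducible representation\<close>

context urep
begin

definition Kinv :: "'h set" where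
  "Kinv = {v. \<forall>t. \<pi> (sl2_rot t) v = v}"

lemma Kinv_subspace: "mr_csubspace Kinv"
  unfolding mr_csubspace_def Kinv_def by (auto simp: rep_add rep_scC)

lemma Kinv_closed: "cclosed Kinv"
  unfolding cclosed_def
proof
  fix v assume v: "v \<in> cclosure Kinv"
  show "v \<in> Kinv" unfolding Kinv_def
  proof (intro CollectI allI)
    fix t
    have "cnrm (\<pi> (sl2_rot t) v - v) \<le> 0 + e" if e: "e > 0" for e
    proof -
      have "e / 2 > 0" using e by simp
      then obtain s where s: "s \<in> Kinv" "cnrm (v - s) < e / 2" using v unfolding cclosure_def by blast
      have "\<pi> (sl2_rot t) v - v = \<pi> (sl2_rot t) (v - s) - (v - s)"
        using s(1) by (simp add: rep_diff Kinv_def)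
      then have "cnrm (\<pi> (sl2_rot t) v - v) \<le> cnrm (\<pi> (sl2_rot t) (v - s)) + cnrm (v - s)"
        by (simp only: cnrm_triangle_diff)
      then show ?thesis using s(2) by simp
    qed
    then have "cnrm (\<pi> (sl2_rot t) v - v) \<le> 0" by (rule field_le_epsilon)
    then have "cnrm (\<pi> (sl2_rot t) v - v) = 0" using cnrm_nonneg[of "\<pi> (sl2_rot t) v - v"] by linarith
    then show "\<pi> (sl2_rot t) v = v" by simp
  qed
qed

lemma cclosed_Int: "cclosed A \<Longrightarrow> cclosed B \<Longrightarrow> cclosed (A \<inter> B)"
  unfolding cclosed_def cclosure_def by blast

lemma mr_csubspace_Int: "mr_csubspace A \<Longrightarrow> mr_csubspace B \<Longrightarrow> mr_csubspace (A \<inter> B)"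
  unfolding mr_csubspace_def by blast

lemma Kinv_has_dact: "v \<in> Kinv \<Longrightarrow> has_dact \<pi> BW v 0"
  by (simp add: has_dact_clim Kinv_def)

lemma Kinv_opH: "v \<in> Kinv \<Longrightarrow> opHH v = 0"
  using dact_eq[OF Kinv_has_dact] by (simp add: opH_def)

text \<open>Matrix coefficients along the rotations have derivative zero and are therefore
  constant.\<close>

lemma Kinv_if_opH:
  assumes v: "v \<in> Hinf \<pi>" and H: "opHH v = 0"
  shows "v \<in> Kinv"
proof -
  have d: "dact \<pi> BW v = 0" using H by (simp add: opH_def)
  have "Re (cinner (\<pi> (sl2_rot t) v) w) = Re (cinner v w)" for t w
  proof -
    have "\<forall>t. DERIV (\<lambda>t. Re (cinner (\<pi> (sl2_exp BW t) v) w)) t :> 0"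
      using rep_exp_deriv[OF Hinf_dact[OF v, of BW], of w] by (simp add: d)
    from DERIV_isconst_all[OF this, of t 0] show ?thesis using sl2_exp_0[of BW] by simp
  qed
  then have "Re (cinner (\<pi> (sl2_rot t) v - v) w) = 0" for t w by (simp add: cinner_simps)
  then have "(cnrm (\<pi> (sl2_rot t) v - v))\<^sup>2 = 0" for t unfolding cnrm_power2 .
  then show ?thesis by (simp add: Kinv_def)
qed

lemma Kinv_iff: "v \<in> Hinf \<pi> \<Longrightarrow> v \<in> Kinv \<longleftrightarrow> opHH v = 0"
  using Kinv_if_opH Kinv_opH by blast

lemma casimir_Kinv: "v \<in> Hinf \<pi> \<Longrightarrow> v \<in> Kinv \<Longrightarrow> Cas v \<in> Kinv"
  using casimir_H[of v] by (simp add: Kinv_iff op_Hinf)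

text \<open>On K-invariant vectors the Casimir is -EB E, and -EB is the adjoint of E.\<close>

lemma casimir_Kinv_nonneg:
  assumes "v \<in> Hinf \<pi>" "v \<in> Kinv"
  shows "0 \<le> Re (cinner (Cas v) v)"
proof -
  have "cinner (Cas v) v = cinner (EE v) (EE v)"
    using assms op_adjoint(3)[of "EE v" v] by (simp add: casimir_eq Kinv_opH op_Hinf cinner_minus_left)
  then show ?thesis by (simp add: cinner_nonneg)
qed

section \<open>Invariant subspaces and weight vectors\<close>

lemma invariant_subD:
  assumes "invariant_sub \<pi> V"
  shows "mr_csubspace V" "cclosed V" "g \<in> SL2 \<Longrightarrow> v \<in> V \<Longrightarrow> \<pi> g v \<in> V"
  using assms unfolding invariant_sub_def by auto

lemma invariant_dact:
  assumes V: "invariant_sub \<pi> V" and "v \<in> V" "has_dact \<pi> X v w"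
  shows "w \<in> V"
  by (rule cclosed_clim[OF invariant_subD(2)[OF V] assms(3)[unfolded has_dact_clim]])
    (auto intro!: always_eventually mr_csubspaceD[OF invariant_subD(1)[OF V]] invariant_subD(3)[OF V] assms(2) simp del: sl2_exp.simps)

lemma invariant_op:
  assumes V: "invariant_sub \<pi> V" and v: "v \<in> V" "v \<in> Hinf \<pi>"
  shows "EE v \<in> V" "EB v \<in> V" "opHH v \<in> V" "Cas v \<in> V"
proof -
  note sub = mr_csubspaceD[OF invariant_subD(1)[OF V]]
  have *: "EE v \<in> V" "EB v \<in> V" "opHH v \<in> V" if v: "v \<in> V" "v \<in> Hinf \<pi>" for v
    unfolding opE_def opEbar_def opH_def
    by (intro sub invariant_dact[OF V v(1) Hinf_dact[OF v(2)]])+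
  show "EE v \<in> V" "EB v \<in> V" "opHH v \<in> V" using *[OF v] by auto
  show "Cas v \<in> V" unfolding casimir_eq[OF v(2)] by (intro sub * v op_Hinf)
qed

lemma powE_Hinf: "w \<in> Hinf \<pi> \<Longrightarrow> (EE ^^ k) w \<in> Hinf \<pi>"
  by (induction k) (auto simp: op_Hinf)

lemma powEB_Hinf: "w \<in> Hinf \<pi> \<Longrightarrow> (EB ^^ k) w \<in> Hinf \<pi>"
  by (induction k) (auto simp: op_Hinf)

lemma powE_weight:
  assumes "w \<in> Hinf \<pi>" "w \<in> Kinv"
  shows "opHH ((EE ^^ k) w) = scC (of_nat k) ((EE ^^ k) w)"
proof (induction k)
  case (Suc k)
  have "opHH (EE ((EE ^^ k) w)) = EE (scC (of_nat k) ((EE ^^ k) w)) + EE ((EE ^^ k) w)"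
    using op_H_E[OF powE_Hinf[OF assms(1)], of k] Suc by simp
  then show ?case by (simp add: op_scC powE_Hinf assms(1) scC_add_left scC_one)
qed (simp add: Kinv_opH assms)

lemma powEB_weight:
  assumes "w \<in> Hinf \<pi>" "w \<in> Kinv"
  shows "opHH ((EB ^^ k) w) = - scC (of_nat k) ((EB ^^ k) w)"
proof (induction k)
  case (Suc k)
  have "opHH (EB ((EB ^^ k) w)) = EB (- scC (of_nat k) ((EB ^^ k) w)) - EB ((EB ^^ k) w)"
    using op_H_EB[OF powEB_Hinf[OF assms(1)], of k] Suc by simp
  then show ?case by (simp add: op_scC op_minus Hinf_scC powEB_Hinf assms(1) scC_add_left scC_one)
qed (simp add: Kinv_opH assms)

lemma powE_add: "v \<in> Hinf \<pi> \<Longrightarrow> w \<in> Hinf \<pi> \<Longrightarrow> (EE ^^ k) (v + w) = (EE ^^ k) v + (EE ^^ k) w"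
  by (induction k) (auto simp: op_add powE_Hinf)

lemma powE_linear:
  assumes "v \<in> Hinf \<pi>"
  shows "(EE ^^ k) (scC c v) = scC c ((EE ^^ k) v)"
    "(EE ^^ k) (- v) = - (EE ^^ k) v" "(EE ^^ k) (Cas v) = Cas ((EE ^^ k) v)"
  by (induction k) (auto simp: op_scC op_minus casimir_E powE_Hinf assms)

lemma powEB_add: "v \<in> Hinf \<pi> \<Longrightarrow> w \<in> Hinf \<pi> \<Longrightarrow> (EB ^^ k) (v + w) = (EB ^^ k) v + (EB ^^ k) w"
  by (induction k) (auto simp: op_add powEB_Hinf)

lemma powEB_linear:
  assumes "v \<in> Hinf \<pi>"
  shows "(EB ^^ k) (scC c v) = scC c ((EB ^^ k) v)"
    "(EB ^^ k) (- v) = - (EB ^^ k) v" "(EB ^^ k) (Cas v) = Cas ((EB ^^ k) v)"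
  by (induction k) (auto simp: op_scC op_minus casimir_EB powEB_Hinf assms)

text \<open>On weight k one has EB E = -(Cas + k^2 + k); so \<open>lower k\<close> is, up to sign,
  what remains after EB undoes one E.\<close>

definition lower :: "nat \<Rightarrow> 'h \<Rightarrow> 'h" where
  "lower k w = Cas w + scC (of_nat (k * (k + 1))) w"

lemma lower_Hinf: "w \<in> Hinf \<pi> \<Longrightarrow> lower k w \<in> Hinf \<pi>"
  unfolding lower_def by (intro Hinf_add Hinf_scC op_Hinf)

lemma EB_powE_Suc:
  assumes "w \<in> Hinf \<pi>" "w \<in> Kinv"
  shows "EB ((EE ^^ Suc k) w) = - (EE ^^ k) (lower k w)"
proof -
  have "opHH (opHH ((EE ^^ k) w)) = scC (of_nat k * of_nat k) ((EE ^^ k) w)"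
    by (simp add: powE_weight assms op_scC powE_Hinf scC_scC)
  then show ?thesis
    by (simp add: casimir_EB_E powE_Hinf assms powE_weight powE_add powE_linear op_Hinf Hinf_scC Hinf_add lower_def scC_add_left algebra_simps)
qed

lemma E_powEB_Suc:
  assumes "w \<in> Hinf \<pi>" "w \<in> Kinv"
  shows "EE ((EB ^^ Suc k) w) = - (EB ^^ k) (lower k w)"
proof -
  have "opHH (opHH ((EB ^^ k) w)) = scC (of_nat k * of_nat k) ((EB ^^ k) w)"
    by (simp add: powEB_weight assms op_scC op_minus Hinf_scC powEB_Hinf scC_scC scC_minus_right)
  then show ?thesis
    by (simp add: casimir_E_EB powEB_Hinf assms powEB_weight powEB_add powEB_linear op_Hinf Hinf_scC Hinf_add lower_def scC_add_left algebra_simps)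
qed

lemma powE_orthogonal_Kinv:
  assumes "w \<in> Hinf \<pi>" "w \<in> Kinv" "u \<in> Hinf \<pi>" "u \<in> Kinv" "k > 0"
  shows "cinner ((EE ^^ k) w) u = 0" "cinner ((EB ^^ k) w) u = 0"
proof -
  have "of_nat k * cinner ((EE ^^ k) w) u = cinner (opHH ((EE ^^ k) w)) u"
    using assms by (simp add: powE_weight cinner_scC_left)
  also have "\<dots> = 0" using assms by (simp add: op_adjoint powE_Hinf Kinv_opH)
  finally show "cinner ((EE ^^ k) w) u = 0" using assms(5) by simp
  have "- of_nat k * cinner ((EB ^^ k) w) u = cinner (opHH ((EB ^^ k) w)) u"
    using assms by (simp add: powEB_weight cinner_scC_left cinner_minus_left)
  also have "\<dots> = 0" using assms by (simp add: op_adjoint powEB_Hinf Kinv_opH)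
  finally show "cinner ((EB ^^ k) w) u = 0" using assms(5) by simp
qed

lemma dact_Hd_eq: "dact \<pi> BHd v = EE v + EB v"
  unfolding opE_def opEbar_def using scC_add_left[of "1/2" "1/2" "dact \<pi> BHd v"] by (simp add: scC_one)

end

text \<open>Analyticity of spherical vectors: \<open>Hd\<^sup>n u\<close> is a combination of the weight vectors \<open>E\<^sup>k w\<close>, \<open>\<bar>E\<^sup>k w\<close> with \<open>k \<le> n\<close>,
  where \<open>w\<close> runs through the Casimir-stable space \<open>A\<close> of vectors of \<open>U\<close> whose Casimir orbit is orthogonal to \<open>u2\<close>.\<close>

locale sph = urep \<pi> for \<pi> :: "sl2 \<Rightarrow> 'h::mr_chilbert \<Rightarrow> 'h" +
  fixes U :: "'h set" and u2 :: 'h and \<Lambda> :: real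
  assumes USub: "mr_csubspace U"
    and UH: "u \<in> U \<Longrightarrow> u \<in> Hinf \<pi>" and UK: "u \<in> U \<Longrightarrow> u \<in> Kinv"
    and UCas: "u \<in> U \<Longrightarrow> Cas u \<in> U" and Ubd: "u \<in> U \<Longrightarrow> cnrm (Cas u) \<le> \<Lambda> * cnrm u"
    and L1: "\<Lambda> \<ge> 1" and u2: "u2 \<in> U"
begin

text \<open>Growth constants for the powers of E and EB: the square of the factor j + 1 + \<Lambda>
  dominates \<open>lower j\<close> in \<open>lower_bound\<close>.\<close>

definition e :: "nat \<Rightarrow> real" where "e k = (\<Prod>j<k. real j + 1 + \<Lambda>)"

lemma e_pos: "e k > 0"
  unfolding e_def using L1 by (intro prod_pos) (auto intro: add_nonneg_pos)

lemma e_Suc: "e (Suc k) = e k * (real k + 1 + \<Lambda>)"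
  by (simp add: e_def)

lemma lower_U: "w \<in> U \<Longrightarrow> lower k w \<in> U"
  unfolding lower_def by (intro mr_csubspaceD[OF USub] UCas)

lemma lower_bound: "w \<in> U \<Longrightarrow> cnrm (lower k w) \<le> (real k + 1 + \<Lambda>)\<^sup>2 * cnrm w"
proof -
  assume w: "w \<in> U"
  have "cnrm (lower k w) \<le> \<Lambda> * cnrm w + real (k * (k + 1)) * cnrm w"
    unfolding lower_def using Ubd[OF w] cnrm_triangle[of "Cas w" "scC (of_nat (k * (k + 1))) w"]
    unfolding cnrm_scC norm_of_nat by linarith
  also have "\<dots> = (\<Lambda> + real (k * (k + 1))) * cnrm w" by (simp add: algebra_simps)
  also have "\<dots> \<le> (real k + 1 + \<Lambda>)\<^sup>2 * cnrm w"
  proof (rule mult_right_mono)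
    have "0 \<le> real k * \<Lambda> + \<Lambda> * \<Lambda>" using L1 by auto
    then show "\<Lambda> + real (k * (k + 1)) \<le> (real k + 1 + \<Lambda>)\<^sup>2" using L1 by (simp add: power2_eq_square algebra_simps)
  qed simp
  finally show ?thesis .
qed

text \<open>Moving one E across the inner product turns it into -EB, and EB after E^(k+1) is -E^k
  after \<open>lower k\<close>. So the squared norm at level k + 1 is a pairing of two vectors at
  level k.\<close>

lemma pow_bound: "w \<in> U \<Longrightarrow> cnrm ((EE ^^ k) w) \<le> e k * cnrm w \<and> cnrm ((EB ^^ k) w) \<le> e k * cnrm w"
proof (induction k arbitrary: w)
  case (Suc k)
  note w = UH[OF Suc.prems] UK[OF Suc.prems]
  have aux: "cnrm x \<le> e (Suc k) * cnrm w"
    if "(cnrm x)\<^sup>2 = Re (cinner y z)" "cnrm y \<le> e k * cnrm (lower k w)" "cnrm z \<le> e k * cnrm w" for x y z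
  proof (rule power2_le_imp_le)
    have "Re (cinner y z) \<le> cnrm y * cnrm z"
      using complex_Re_le_cmod[of "cinner y z"] cinner_Cauchy_Schwarz[of y z] by linarith
    also have "\<dots> \<le> (e k * ((real k + 1 + \<Lambda>)\<^sup>2 * cnrm w)) * (e k * cnrm w)"
      using that(2,3) lower_bound[OF Suc.prems, of k] e_pos[of k]
      by (intro mult_mono order_trans[OF that(2)] mult_left_mono) (auto intro!: mult_nonneg_nonneg less_imp_le)
    also have "\<dots> = (e (Suc k) * cnrm w)\<^sup>2" by (simp add: e_Suc power2_eq_square)
    finally show "(cnrm x)\<^sup>2 \<le> (e (Suc k) * cnrm w)\<^sup>2" using that(1) by simp
    show "0 \<le> e (Suc k) * cnrm w" using e_pos[of "Suc k"] by simp
  qed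
  have "(cnrm ((EE ^^ Suc k) w))\<^sup>2 = Re (cinner ((EE ^^ k) (lower k w)) ((EE ^^ k) w))"
    unfolding cnrm_power2
    using op_adjoint(3)[OF powE_Hinf[OF w(1), of "Suc k"] powE_Hinf[OF w(1), of k]] EB_powE_Suc[OF w, of k]
    by (simp add: cinner_minus_left)
  moreover have "(cnrm ((EB ^^ Suc k) w))\<^sup>2 = Re (cinner ((EB ^^ k) (lower k w)) ((EB ^^ k) w))"
    unfolding cnrm_power2
    using op_adjoint(2)[OF powEB_Hinf[OF w(1), of "Suc k"] powEB_Hinf[OF w(1), of k]] E_powEB_Suc[OF w, of k]
    by (simp add: cinner_minus_left)
  ultimately show ?case using aux Suc.IH[OF Suc.prems] Suc.IH[OF lower_U[OF Suc.prems]] by blast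
qed (simp add: e_def)

definition A :: "'h set" where
  "A = {w \<in> U. \<forall>n. cinner ((Cas ^^ n) w) u2 = 0}"

lemma Cas_pow: "w \<in> U \<Longrightarrow> (Cas ^^ n) w \<in> U"
  by (induction n) (auto intro: UCas)

lemma Cas_pow_linear:
  "v \<in> U \<Longrightarrow> w \<in> U \<Longrightarrow> (Cas ^^ n) (v + w) = (Cas ^^ n) v + (Cas ^^ n) w"
  "v \<in> U \<Longrightarrow> (Cas ^^ n) (scC c v) = scC c ((Cas ^^ n) v)"
  by (induction n) (auto simp: op_add op_scC UH Cas_pow)

lemma A_U: "w \<in> A \<Longrightarrow> w \<in> U" by (simp add: A_def)

lemma A_lower: "w \<in> A \<Longrightarrow> - lower k w \<in> A"
proof -
  assume w: "w \<in> A"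
  have "cinner ((Cas ^^ n) (lower k w)) u2 = 0" for n
  proof -
    have "(Cas ^^ n) (lower k w) = (Cas ^^ Suc n) w + scC (of_nat (k * (k + 1))) ((Cas ^^ n) w)"
      unfolding lower_def using A_U[OF w]
      by (simp add: Cas_pow_linear UCas mr_csubspaceD[OF USub] funpow_swap1)
    then show ?thesis using w unfolding A_def by (simp add: cinner_simps del: funpow.simps)
  qed
  moreover have "(Cas ^^ n) (- lower k w) = - (Cas ^^ n) (lower k w)" for n
    using Cas_pow_linear(2)[of "lower k w" n "-1"] lower_U[OF A_U[OF w]] by (simp add: scC_minus_left scC_one)
  ultimately show ?thesis
    using A_U[OF w] unfolding A_def by (simp add: cinner_minus_left mr_csubspaceD(4)[OF USub] lower_U)
qed

text \<open>An expansion into weight vectors with a norm budget c, kept as a relation so that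
  coefficients never have to be named; E and EB act on it term by term.\<close>

inductive bnd :: "nat \<Rightarrow> real \<Rightarrow> 'h \<Rightarrow> bool" where
  bE: "k \<le> n \<Longrightarrow> w \<in> A \<Longrightarrow> bnd n (e k * cnrm w) ((EE ^^ k) w)"
| bB: "k \<le> n \<Longrightarrow> w \<in> A \<Longrightarrow> bnd n (e k * cnrm w) ((EB ^^ k) w)"
| bAdd: "bnd n c v \<Longrightarrow> bnd n c' v' \<Longrightarrow> bnd n (c + c') (v + v')"

lemma bnd_props:
  assumes "bnd n c v"
  shows "v \<in> Hinf \<pi> \<and> cnrm v \<le> c \<and> cinner v u2 = 0"
  using assms
proof induction
  case (bE k n w)
  have "cinner w u2 = 0" using bE unfolding A_def by (auto dest: spec[of _ 0])
  then show ?case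
    using bE pow_bound[of w k] powE_orthogonal_Kinv[of w u2 k] u2
    by (cases "k = 0") (auto simp: A_U UH UK powE_Hinf e_def)
next
  case (bB k n w)
  have "cinner w u2 = 0" using bB unfolding A_def by (auto dest: spec[of _ 0])
  then show ?case
    using bB pow_bound[of w k] powE_orthogonal_Kinv[of w u2 k] u2
    by (cases "k = 0") (auto simp: A_U UH UK powEB_Hinf e_def)
next
  case (bAdd n c v c' v')
  then show ?case using cnrm_triangle[of v v'] by (auto simp: cinner_simps Hinf_add)
qed

text \<open>Raising and lowering cost the same factor n + 1 + \<Lambda>: when lowering, the passage
  from e k to e (k - 1) pays for one of the two factors in \<open>lower_bound\<close>.\<close>

lemma bnd_step_aux:
  assumes "k \<le> n" "w \<in> A"
  shows "e (Suc k) * cnrm w \<le> (real n + 1 + \<Lambda>) * (e k * cnrm w)"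
    "k = Suc j \<Longrightarrow> e j * cnrm (- lower j w) \<le> (real n + 1 + \<Lambda>) * (e k * cnrm w)"
proof -
  have "(real k + 1 + \<Lambda>) * (e k * cnrm w) \<le> (real n + 1 + \<Lambda>) * (e k * cnrm w)"
    using assms(1) e_pos[of k] by (intro mult_right_mono) auto
  then show "e (Suc k) * cnrm w \<le> (real n + 1 + \<Lambda>) * (e k * cnrm w)" by (simp add: e_Suc algebra_simps)
  assume k: "k = Suc j"
  have "e j * cnrm (- lower j w) \<le> e j * ((real j + 1 + \<Lambda>)\<^sup>2 * cnrm w)"
    using lower_bound[OF A_U[OF assms(2)], of j] e_pos[of j] by (intro mult_left_mono) auto
  also have "\<dots> = (real j + 1 + \<Lambda>) * (e k * cnrm w)" by (simp add: k e_Suc power2_eq_square)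
  also have "\<dots> \<le> (real n + 1 + \<Lambda>) * (e k * cnrm w)"
    using assms(1) e_pos[of k] k by (intro mult_right_mono) auto
  finally show "e j * cnrm (- lower j w) \<le> (real n + 1 + \<Lambda>) * (e k * cnrm w)" .
qed

lemma bnd_step:
  assumes "bnd n c v"
  shows "\<exists>c'. bnd (Suc n) c' (dact \<pi> BHd v) \<and> c' \<le> 2 * (real n + 1 + \<Lambda>) * c"
  using assms
proof induction
  case (bE k n w)
  have 1: "bnd (Suc n) (e (Suc k) * cnrm w) (EE ((EE ^^ k) w))" using bnd.bE[of "Suc k" "Suc n" w] bE by simp
  \<comment> \<open>At k = 0 the operator EB also moves outwards, into the negative weights; for k >
    0 it lowers the exponent of E.\<close>
  have "\<exists>c'. bnd (Suc n) c' (EB ((EE ^^ k) w)) \<and> c' \<le> (real n + 1 + \<Lambda>) * (e k * cnrm w)"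
  proof (cases k)
    case 0
    then show ?thesis using bnd.bB[of 1 "Suc n" w] bE bnd_step_aux(1)[OF bE] by auto
  next
    case (Suc j)
    have "bnd (Suc n) (e j * cnrm (- lower j w)) ((EE ^^ j) (- lower j w))"
      by (rule bnd.bE) (use bE Suc in \<open>auto intro: A_lower\<close>)
    moreover have "(EE ^^ j) (- lower j w) = EB ((EE ^^ k) w)"
      using bE unfolding Suc by (simp add: EB_powE_Suc A_U UH UK powE_linear lower_Hinf del: funpow.simps)
    ultimately show ?thesis using bnd_step_aux(2)[OF bE Suc] by auto
  qed
  then obtain c' where "bnd (Suc n) c' (EB ((EE ^^ k) w))" "c' \<le> (real n + 1 + \<Lambda>) * (e k * cnrm w)" by blast
  then show ?case using bnd.bAdd[OF 1] bnd_step_aux(1)[OF bE] unfolding dact_Hd_eq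
    by (intro exI[of _ "e (Suc k) * cnrm w + c'"] conjI) (blast, simp add: algebra_simps)
next
  case (bB k n w)
  have 1: "bnd (Suc n) (e (Suc k) * cnrm w) (EB ((EB ^^ k) w))" using bnd.bB[of "Suc k" "Suc n" w] bB by simp
  have "\<exists>c'. bnd (Suc n) c' (EE ((EB ^^ k) w)) \<and> c' \<le> (real n + 1 + \<Lambda>) * (e k * cnrm w)"
  proof (cases k)
    case 0
    then show ?thesis using bnd.bE[of 1 "Suc n" w] bB bnd_step_aux(1)[OF bB] by auto
  next
    case (Suc j)
    have "bnd (Suc n) (e j * cnrm (- lower j w)) ((EB ^^ j) (- lower j w))"
      by (rule bnd.bB) (use bB Suc in \<open>auto intro: A_lower\<close>)
    moreover have "(EB ^^ j) (- lower j w) = EE ((EB ^^ k) w)"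
      using bB unfolding Suc by (simp add: E_powEB_Suc A_U UH UK powEB_linear lower_Hinf del: funpow.simps)
    ultimately show ?thesis using bnd_step_aux(2)[OF bB Suc] by auto
  qed
  then obtain c' where "bnd (Suc n) c' (EE ((EB ^^ k) w))" "c' \<le> (real n + 1 + \<Lambda>) * (e k * cnrm w)" by blast
  then show ?case using bnd.bAdd[OF _ 1] bnd_step_aux(1)[OF bB] unfolding dact_Hd_eq
    by (intro exI[of _ "c' + e (Suc k) * cnrm w"] conjI) (blast, simp add: algebra_simps)
next
  case (bAdd n c v c' v')
  then obtain d d' where "bnd (Suc n) d (dact \<pi> BHd v)" "d \<le> 2 * (real n + 1 + \<Lambda>) * c"
    "bnd (Suc n) d' (dact \<pi> BHd v')" "d' \<le> 2 * (real n + 1 + \<Lambda>) * c'" by blast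
  moreover have "dact \<pi> BHd (v + v') = dact \<pi> BHd v + dact \<pi> BHd v'"
    using bAdd bnd_props by (simp add: dact_add)
  ultimately show ?case using bnd.bAdd by (intro exI[of _ "d + d'"]) (auto simp: distrib_left)
qed

lemma Hd_pow_bound:
  assumes u: "u \<in> A"
  shows "(dact \<pi> BHd ^^ n) u \<in> Hinf \<pi> \<and> cinner ((dact \<pi> BHd ^^ n) u) u2 = 0 \<and>
    cnrm ((dact \<pi> BHd ^^ n) u) \<le> cnrm u * (2 * (1 + \<Lambda>)) ^ n * fact n"
proof -
  have "\<exists>c. bnd n c ((dact \<pi> BHd ^^ n) u) \<and> c \<le> cnrm u * (2 * (1 + \<Lambda>)) ^ n * fact n"
  proof (induction n)
    case 0
    show ?case using bnd.bE[of 0 0 u] u by (auto simp: e_def)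
  next
    case (Suc n)
    then obtain c where c: "bnd n c ((dact \<pi> BHd ^^ n) u)" "c \<le> cnrm u * (2 * (1 + \<Lambda>)) ^ n * fact n" by blast
    obtain c' where c': "bnd (Suc n) c' (dact \<pi> BHd ((dact \<pi> BHd ^^ n) u))" "c' \<le> 2 * (real n + 1 + \<Lambda>) * c"
      using bnd_step[OF c(1)] by blast
    note c'(2)
    also have "2 * (real n + 1 + \<Lambda>) * c \<le> 2 * (real n + 1 + \<Lambda>) * (cnrm u * (2 * (1 + \<Lambda>)) ^ n * fact n)"
      using c(2) L1 by (intro mult_left_mono) auto
    also have "\<dots> \<le> (2 * (1 + \<Lambda>) * (real n + 1)) * (cnrm u * (2 * (1 + \<Lambda>)) ^ n * fact n)"
      using L1 by (intro mult_right_mono) (auto simp: algebra_simps)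
    also have "\<dots> = cnrm u * (2 * (1 + \<Lambda>)) ^ Suc n * fact (Suc n)" by (simp add: algebra_simps)
    finally show ?case using c'(1) by auto
  qed
  then show ?thesis using bnd_props order_trans by blast
qed

lemma matrix_coeff_zero:
  assumes u: "u \<in> A"
  shows "cinner (\<pi> (sl2_exp BHd t) u) u2 = 0"
proof -
  \<comment> \<open>\<open>analytic_zero\<close> is real; testing with z = 1 and z = \<i> recovers
    both parts of the complex coefficient.\<close>
  have Re0: "Re (cinner (\<pi> (sl2_exp BHd t) u) (scC z u2)) = 0" for z
  proof -
    define f where "f n t = Re (cinner (\<pi> (sl2_exp BHd t) ((dact \<pi> BHd ^^ n) u)) (scC z u2))" for n t
    have "f 0 t = 0"
    proof (rule analytic_zero[where f = f and C = "cnrm u * cnrm (scC z u2)" and R = "2 * (1 + \<Lambda>)"])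
      show "(f n has_real_derivative f (Suc n) t) (at t)" for n t
        unfolding f_def using rep_exp_deriv[OF Hinf_dact, of "(dact \<pi> BHd ^^ n) u" BHd "scC z u2" t] Hd_pow_bound[OF u]
        by simp
      show "f n 0 = 0" for n
        unfolding f_def sl2_exp_0 using Hd_pow_bound[OF u, of n] by (simp add: cinner_scC_right)
      show "2 * (1 + \<Lambda>) > 0" using L1 by simp
      fix n t
      show "\<bar>f n t\<bar> \<le> cnrm u * cnrm (scC z u2) * (2 * (1 + \<Lambda>)) ^ n * fact n"
      proof -
        have "\<bar>f n t\<bar> \<le> cnrm ((dact \<pi> BHd ^^ n) u) * cnrm (scC z u2)"
          unfolding f_def using order_trans[OF abs_Re_le_cmod cinner_Cauchy_Schwarz] rep_cnrm[OF SL2_exp] by metis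
        also have "\<dots> \<le> (cnrm u * (2 * (1 + \<Lambda>)) ^ n * fact n) * cnrm (scC z u2)"
          using Hd_pow_bound[OF u, of n] by (intro mult_right_mono) auto
        finally show ?thesis by (simp add: mult_ac)
      qed
    qed
    then show ?thesis by (simp add: f_def)
  qed
  from Re0[of 1] Re0[of "\<i>"] show ?thesis
    by (simp add: complex_eq_iff cinner_scC_right scC_one del: sl2_exp.simps)
qed

end

section \<open>Schur's lemma for spherical vectors\<close>

context urep
begin

text \<open>Orthogonality of the Casimir orbit makes the matrix coefficient of u1 and u2 vanish
  along exp(t Hd), by analyticity, and then on the whole group by \<open>sl2_KAK\<close>, as both
  vectors are K-invariant. The vectors with this property form a closed invariant subspace
  \<open>W\<close> that contains u1 but cannot contain a nonzero u2, against irreducibility.\<close>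

lemma schur_split:
  assumes irr: "irreducible_sub \<pi> V" and sm: "V \<inter> Kinv \<subseteq> Hinf \<pi>"
    and u: "u1 \<in> V \<inter> Kinv" "u2 \<in> V \<inter> Kinv" "\<And>n. cinner ((Cas ^^ n) u1) u2 = 0"
  shows "u1 = 0 \<or> u2 = 0"
proof (rule ccontr)
  assume "\<not> ?thesis"
  then have nz: "u1 \<noteq> 0" "u2 \<noteq> 0" by auto
  have inv: "invariant_sub \<pi> V" using irr unfolding irreducible_sub_def by blast
  note sub = invariant_subD(1,2)[OF inv]
  interpret T: sym_op "V \<inter> Kinv" Cas
  proof
    show "mr_csubspace (V \<inter> Kinv)" by (intro mr_csubspace_Int sub Kinv_subspace)
    show "cclosed (V \<inter> Kinv)" by (intro cclosed_Int sub Kinv_closed)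
    fix u assume u: "u \<in> V \<inter> Kinv"
    then have uH: "u \<in> Hinf \<pi>" using sm by blast
    show "Cas u \<in> V \<inter> Kinv" using u uH invariant_op(4)[OF inv] casimir_Kinv by blast
    show "Cas (scC c u) = scC c (Cas u)" for c using uH by (simp add: op_scC)
    fix v assume "v \<in> V \<inter> Kinv"
    then have vH: "v \<in> Hinf \<pi>" using sm by blast
    show "Cas (u + v) = Cas u + Cas v" "cinner (Cas u) v = cinner u (Cas v)" using uH vH by (simp_all add: op_add op_adjoint)
  qed
  obtain M where M: "M > 0" "\<And>u. u \<in> V \<inter> Kinv \<Longrightarrow> cnrm (Cas u) \<le> M * cnrm u" using T.bounded by blast
  interpret S: sph \<pi> "V \<inter> Kinv" u2 "max 1 M"
  proof
    show "cnrm (Cas u) \<le> max 1 M * cnrm u" if "u \<in> V \<inter> Kinv" for u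
      using M(2)[OF that] mult_right_mono[of M "max 1 M" "cnrm u"] by simp
  qed (use sm u T.U T.T_in in auto)
  have u1A: "u1 \<in> S.A" unfolding S.A_def using u by blast
  have zero: "cinner (\<pi> g u1) u2 = 0" if g: "g \<in> SL2" for g
  proof -
    obtain \<phi> h \<theta> where dec: "g = sl2_mult (sl2_rot \<phi>) (sl2_mult (sl2_exp BHd h) (sl2_rot \<theta>))"
      using sl2_KAK[OF g] by blast
    have "\<pi> (sl2_rot \<theta>) u1 = u1" "\<pi> (sl2_inv (sl2_rot \<phi>)) u2 = u2"
      using u sl2_inv_exp[of BW \<phi>] unfolding Kinv_def by auto
    then have "cinner (\<pi> g u1) u2 = cinner (\<pi> (sl2_exp BHd h) u1) u2"
      unfolding dec by (simp add: rep_mult SL2_mult rep_adjoint[of "sl2_rot \<phi>"] del: sl2_exp.simps)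
    then show ?thesis using S.matrix_coeff_zero[OF u1A] by simp
  qed
  define W where "W = {w \<in> V. \<forall>g\<in>SL2. cinner (\<pi> g w) u2 = 0}"
  have "invariant_sub \<pi> W"
    unfolding invariant_sub_def
  proof (intro conjI ballI)
    show "mr_csubspace W"
      unfolding mr_csubspace_def W_def
      by (auto simp: rep_add rep_scC cinner_simps intro: mr_csubspaceD[OF sub(1)])
    show "\<pi> g w \<in> W" if "g \<in> SL2" "w \<in> W" for g w
      using that unfolding W_def by (auto simp: SL2_mult invariant_subD(3)[OF inv] simp flip: rep_mult)
    show "cclosed W"
      unfolding cclosed_def
    proof
      fix v assume v: "v \<in> cclosure W"
      then have "v \<in> cclosure V" unfolding cclosure_def W_def by blast
      then have "v \<in> V" using sub(2) unfolding cclosed_def by blast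
      moreover have "cinner (\<pi> g v) u2 = 0" if g: "g \<in> SL2" for g
      proof -
        have "cmod (cinner (\<pi> g v) u2) \<le> 0 + e" if e: "e > 0" for e
        proof -
          have "e / (cnrm u2 + 1) > 0" using e by (intro divide_pos_pos add_nonneg_pos) auto
          then obtain s where s: "s \<in> W" "cnrm (v - s) < e / (cnrm u2 + 1)" using v unfolding cclosure_def by blast
          have "cinner (\<pi> g v) u2 = cinner (\<pi> g (v - s)) u2"
            using s(1) g unfolding W_def by (simp add: rep_diff cinner_diff_left)
          also have "cmod \<dots> \<le> cnrm (v - s) * cnrm u2"
            using cinner_Cauchy_Schwarz[of "\<pi> g (v - s)" u2] g by simp
          also have "\<dots> \<le> e / (cnrm u2 + 1) * cnrm u2" using s(2) by (intro mult_right_mono) auto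
          also have "\<dots> \<le> e" using e add_nonneg_pos[OF cnrm_nonneg[of u2] zero_less_one]
            by (simp add: divide_le_eq)
          finally show ?thesis by simp
        qed
        then have "cmod (cinner (\<pi> g v) u2) \<le> 0" by (rule field_le_epsilon)
        then show ?thesis by simp
      qed
      ultimately show "v \<in> W" unfolding W_def by blast
    qed
  qed
  moreover have "W \<subseteq> V" "u1 \<in> W" using zero u(1) unfolding W_def by auto
  ultimately have "W = V" using irr nz(1) unfolding irreducible_sub_def by blast
  then have "u2 \<in> W" using u(2) by blast
  then have "cinner (\<pi> sl2_one u2) u2 = 0" unfolding W_def using SL2_one by blast
  then have "cinner u2 u2 = 0" by simp
  then show False using nz(2) cinner_eq_0[of u2] by blast
qed

lemma spherical_casimir_scalar:
  assumes irr: "irreducible_sub \<pi> V" and sm: "V \<inter> Kinv \<subseteq> Hinf \<pi>"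
  obtains lam :: real where "lam \<ge> 0" "\<And>u. u \<in> V \<inter> Kinv \<Longrightarrow> Cas u = scC (complex_of_real lam) u"
proof -
  have inv: "invariant_sub \<pi> V" using irr unfolding irreducible_sub_def by blast
  note sub = invariant_subD(1,2)[OF inv]
  interpret T: sym_op "V \<inter> Kinv" Cas
  proof
    show "mr_csubspace (V \<inter> Kinv)" by (intro mr_csubspace_Int sub Kinv_subspace)
    show "cclosed (V \<inter> Kinv)" by (intro cclosed_Int sub Kinv_closed)
    fix u assume u: "u \<in> V \<inter> Kinv"
    then have uH: "u \<in> Hinf \<pi>" using sm by blast
    show "Cas u \<in> V \<inter> Kinv" using u uH invariant_op(4)[OF inv] casimir_Kinv by blast
    show "Cas (scC c u) = scC c (Cas u)" for c using uH by (simp add: op_scC)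
    fix v assume "v \<in> V \<inter> Kinv"
    then have vH: "v \<in> Hinf \<pi>" using sm by blast
    show "Cas (u + v) = Cas u + Cas v" "cinner (Cas u) v = cinner u (Cas v)" using uH vH by (simp_all add: op_add op_adjoint)
  qed
  obtain c :: real where c: "\<And>u. u \<in> V \<inter> Kinv \<Longrightarrow> Cas u = scC (complex_of_real c) u"
    using T.scalar_if_no_split[OF schur_split[OF irr sm]] by blast
  show ?thesis
  proof (cases "c \<ge> 0")
    case True then show ?thesis using c that by blast
  next
    \<comment> \<open>A negative scalar forces the spherical space to be zero, by positivity of the
      Casimir there, and then 0 serves as well.\<close>
    case False
    have z: "u = 0" if u: "u \<in> V \<inter> Kinv" for u
    proof -
      have "0 \<le> Re (cinner (Cas u) u)" using u sm by (intro casimir_Kinv_nonneg) auto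
      then have "0 \<le> c * (cnrm u)\<^sup>2" unfolding c[OF u] by (simp add: cinner_scC_left cnrm_power2)
      then have "(cnrm u)\<^sup>2 \<le> 0" using False by (simp add: zero_le_mult_iff)
      then show ?thesis by simp
    qed
    show ?thesis
    proof (rule that[of 0])
      fix u assume "u \<in> V \<inter> Kinv"
      then have "u = 0" by (rule z)
      then show "Cas u = scC (complex_of_real 0) u" by simp
    qed simp
  qed
qed

text \<open>The Casimir orbit of e stays on the line of e, so the component of u orthogonal to e is
  orthogonal to that orbit and \<open>schur_split\<close> kills it.\<close>

lemma spherical_unique:
  assumes irr: "irreducible_sub \<pi> V" and sm: "V \<inter> Kinv \<subseteq> Hinf \<pi>"
    and e: "e \<in> V \<inter> Kinv" "cnrm e = 1" and u: "u \<in> V \<inter> Kinv"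
  shows "u = scC (cinner u e) e"
proof -
  obtain lam where lam: "\<And>u. u \<in> V \<inter> Kinv \<Longrightarrow> Cas u = scC (complex_of_real lam) u"
    using spherical_casimir_scalar[OF irr sm] by blast
  have "invariant_sub \<pi> V" using irr unfolding irreducible_sub_def by blast
  note sub = mr_csubspaceD[OF mr_csubspace_Int[OF invariant_subD(1)[OF this] Kinv_subspace]]
  define w where "w = u - scC (cinner u e) e"
  have w: "w \<in> V \<inter> Kinv" unfolding w_def by (intro sub u e)
  have ee: "cinner e e = 1" using e(2) by (simp add: cinner_self)
  have "cinner e w = 0"
    unfolding w_def cinner_diff_right cinner_scC_right ee using cinner_commute[of e u] by simp
  moreover have "(Cas ^^ n) e = scC (complex_of_real lam ^ n) e" for n
  proof (induction n)
    case (Suc n)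
    have "e \<in> Hinf \<pi>" using e sm by blast
    then show ?case using Suc by (simp add: op_scC lam[OF e(1)] scC_scC mult.commute)
  qed (simp add: scC_one)
  ultimately have "e = 0 \<or> w = 0" by (intro schur_split[OF irr sm e(1) w]) (simp add: cinner_scC_left)
  then show ?thesis using e(2) unfolding w_def by auto
qed

end

section \<open>Multiplicative representations\<close>

lemma sum_lessThan_add: "(\<Sum>j<n + m. f j) = (\<Sum>j<n. f j) + (\<Sum>j<m. f (n + j) :: 'x::comm_monoid_add)" for n m :: nat
  by (induction m) (auto simp: add.assoc)

lemma mr_cspan_subspace: "mr_csubspace (mr_cspan S)"
  unfolding mr_csubspace_def
proof (intro conjI ballI allI)
  show "0 \<in> mr_cspan S" unfolding mr_cspan_def by (auto intro!: exI[of _ 0])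
next
  fix x y assume "x \<in> mr_cspan S" "y \<in> mr_cspan S"
  then obtain n c s m d t where x: "\<forall>j<n::nat. s j \<in> S" "x = (\<Sum>j<n. scC (c j) (s j))"
    and y: "\<forall>j<m::nat. t j \<in> S" "y = (\<Sum>j<m. scC (d j) (t j))"
    unfolding mr_cspan_def by blast
  define c' s' where "c' j = (if j < n then c j else d (j - n))" and "s' j = (if j < n then s j else t (j - n))" for j
  have "x + y = (\<Sum>j<n + m. scC (c' j) (s' j))"
    unfolding sum_lessThan_add x y c'_def s'_def by simp
  moreover have "\<forall>j<n + m. s' j \<in> S" using x y by (auto simp: s'_def)
  ultimately show "x + y \<in> mr_cspan S" unfolding mr_cspan_def by blast
next
  fix c x assume "x \<in> mr_cspan S"
  then obtain n d s where x: "\<forall>j<n::nat. s j \<in> S" "x = (\<Sum>j<n. scC (d j) (s j))"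
    unfolding mr_cspan_def by blast
  have "scC c x = (\<Sum>j<n. scC (c * d j) (s j))" unfolding x scC_sum_right scC_scC ..
  with x(1) show "scC c x \<in> mr_cspan S" unfolding mr_cspan_def by (intro CollectI exI[of _ n] exI conjI) auto
qed

lemma mr_cspan_base: "x \<in> S \<Longrightarrow> x \<in> mr_cspan S"
  unfolding mr_cspan_def
  by (intro CollectI exI[of _ "1::nat"] exI[of _ "\<lambda>_. 1"] exI[of _ "\<lambda>_. x"]) (auto simp: scC_one)

lemma mr_cspan_minimal:
  assumes "mr_csubspace T" "S \<subseteq> T"
  shows "mr_cspan S \<subseteq> T"
  unfolding mr_cspan_def using assms(2)
  by (auto intro!: mr_csubspace_sum[OF assms(1)] mr_csubspaceD(3)[OF assms(1)])

text \<open>\<open>Kfinite\<close> supplies an arbitrary finite spanning set, whose members need not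
  be smooth. A basis chosen inside the orbit consists of vectors that can be differentiated.\<close>

lemma finite_orbit_basis:
  fixes B :: "'h::mr_chilbert set"
  assumes "finite B" "S \<subseteq> mr_cspan B"
  obtains B' where "B' \<subseteq> S" "finite B'" "S \<subseteq> mr_cspan B'"
proof -
  interpret vs: vector_space "scC :: complex \<Rightarrow> 'h \<Rightarrow> 'h"
    by unfold_locales (auto simp: scC_add_right scC_add_left scC_scC scC_one)
  have span_eq: "vs.span T = mr_cspan T" for T
  proof
    have "vs.subspace (mr_cspan T)"
      unfolding vs.subspace_def using mr_cspan_subspace[of T] unfolding mr_csubspace_def by blast
    then show "vs.span T \<subseteq> mr_cspan T" by (intro vs.span_minimal) (auto intro: mr_cspan_base)
    show "mr_cspan T \<subseteq> vs.span T"
      by (rule mr_cspan_minimal) (auto simp: mr_csubspace_def vs.span_zero vs.span_add vs.span_scale vs.span_base)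
  qed
  obtain B' where B': "B' \<subseteq> S" "vs.independent B'" "S \<subseteq> vs.span B'"
    using vs.maximal_independent_subset[of S] by blast
  have "finite B'" using vs.independent_span_bound[OF assms(1) B'(2)] B'(1) assms(2) span_eq by auto
  then show ?thesis using that B' span_eq by auto
qed

locale mrep =
  fixes \<pi> :: "sl2 \<Rightarrow> 'h::mr_chilbert \<Rightarrow> 'h" and I :: "nat set" and V :: "nat \<Rightarrow> 'h set"
    and mul :: "'h \<Rightarrow> 'h \<Rightarrow> 'h" and one :: 'h and cj :: "'h \<Rightarrow> 'h"
  assumes mult_rep: "mult_rep \<pi> I V mul one cj"

sublocale mrep \<subseteq> urep
  using mult_rep by unfold_locales (simp add: mult_rep_def)

section \<open>The product, the Lie algebra action and conjugation\<close>

context mrep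
begin

definition F :: "'h set" where "F = Hfin \<pi> I V"

lemma disc: "discrete_spectrum \<pi> I V"
  using mult_rep by (simp add: mult_rep_def)

lemma V_irr: "i \<in> I \<Longrightarrow> irreducible_sub \<pi> (V i)"
  and V_orth: "i \<in> I \<Longrightarrow> j \<in> I \<Longrightarrow> i \<noteq> j \<Longrightarrow> v \<in> V i \<Longrightarrow> w \<in> V j \<Longrightarrow> cinner v w = 0"
  and V_dense: "cclosure (mr_cspan (\<Union>i\<in>I. V i)) = UNIV"
  using disc by (simp_all add: discrete_spectrum_def)

lemma V_finite: "finite {i\<in>I. \<exists>l v. cmod l \<le> B \<and> v \<in> V i \<inter> Hinf \<pi> \<and> v \<noteq> 0 \<and> casimir \<pi> v = scC l v}"
  using disc unfolding discrete_spectrum_def by (elim conjE) (erule spec)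

lemma V_inv: "i \<in> I \<Longrightarrow> invariant_sub \<pi> (V i)"
  using V_irr unfolding irreducible_sub_def by blast

lemma mult_rep_unfolded:
  "\<forall>a\<in>F. \<forall>b\<in>F. mul a b \<in> Hinf \<pi>"
  "\<forall>a\<in>F. \<forall>b\<in>F. \<forall>c\<in>F. mul (a + b) c = mul a c + mul b c"
  "\<forall>a\<in>F. \<forall>b\<in>F. \<forall>z. mul (scC z a) b = scC z (mul a b)"
  "\<forall>a\<in>F. \<forall>b\<in>F. mul a b = mul b a"
  "one \<in> F" "\<forall>a\<in>F. mul one a = a" "cnrm one = 1"
  "{v. \<forall>g\<in>SL2. \<pi> g v = v} = range (\<lambda>z. scC z one)"
  "\<forall>X. \<forall>a\<in>F. \<forall>b\<in>F. has_dact \<pi> X (mul a b) (mul (dact \<pi> X a) b + mul a (dact \<pi> X b))"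
  "\<forall>a\<in>F. cj a \<in> F \<and> (\<forall>b\<in>F. \<forall>c\<in>F. cinner (mul a b) c = cinner b (mul (cj a) c))"
  "\<forall>a. (\<forall>j<4. a j \<in> F) \<longrightarrow> (\<forall>\<sigma>::nat\<Rightarrow>nat. bij_betw \<sigma> {0..<4::nat} {0..<4} \<longrightarrow>
           cinner (mul (a (\<sigma> 0)) (a (\<sigma> 1))) (mul (cj (a (\<sigma> 2))) (cj (a (\<sigma> 3)))) =
           cinner (mul (a 0) (a 1)) (mul (cj (a 2)) (cj (a 3))))"
  using mult_rep unfolding mult_rep_def Let_def F_def by - (elim conjE, assumption)+

lemma mul_Hinf: "a \<in> F \<Longrightarrow> b \<in> F \<Longrightarrow> mul a b \<in> Hinf \<pi>"
  and mul_add_left: "a \<in> F \<Longrightarrow> b \<in> F \<Longrightarrow> c \<in> F \<Longrightarrow> mul (a + b) c = mul a c + mul b c"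
  and mul_scC_left: "a \<in> F \<Longrightarrow> b \<in> F \<Longrightarrow> mul (scC z a) b = scC z (mul a b)"
  and mul_commute: "a \<in> F \<Longrightarrow> b \<in> F \<Longrightarrow> mul a b = mul b a"
  and one_F: "one \<in> F"
  and mul_one: "a \<in> F \<Longrightarrow> mul one a = a"
  and G_fixed: "{v. \<forall>g\<in>SL2. \<pi> g v = v} = range (\<lambda>z. scC z one)"
  and product_rule: "a \<in> F \<Longrightarrow> b \<in> F \<Longrightarrow> has_dact \<pi> X (mul a b) (mul (dact \<pi> X a) b + mul a (dact \<pi> X b))"
  and cj_F: "a \<in> F \<Longrightarrow> cj a \<in> F"
  and cj_adjoint: "a \<in> F \<Longrightarrow> b \<in> F \<Longrightarrow> c \<in> F \<Longrightarrow> cinner (mul a b) c = cinner b (mul (cj a) c)"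
  using mult_rep_unfolded(1-10) by simp_all

lemma crossing_perm:
  fixes a :: "nat \<Rightarrow> 'h" and \<sigma> :: "nat \<Rightarrow> nat"
  assumes "\<forall>j<4. a j \<in> F" "bij_betw \<sigma> {0..<4::nat} {0..<4}"
  shows "cinner (mul (a (\<sigma> 0)) (a (\<sigma> 1))) (mul (cj (a (\<sigma> 2))) (cj (a (\<sigma> 3)))) =
           cinner (mul (a 0) (a 1)) (mul (cj (a 2)) (cj (a 3)))"
  using spec[OF mult_rep_unfolded(11), of a] assms by simp

lemma F_subspace: "mr_csubspace F"
  unfolding F_def Hfin_def by (rule mr_cspan_subspace)

lemmas F_0 = mr_csubspaceD(1)[OF F_subspace] and F_add = mr_csubspaceD(2)[OF F_subspace]
  and F_scC = mr_csubspaceD(3)[OF F_subspace] and F_minus = mr_csubspaceD(4)[OF F_subspace]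
  and F_diff = mr_csubspaceD(5)[OF F_subspace] and F_sum = mr_csubspace_sum[OF F_subspace]

text \<open>The unit exhibits a as a product, and products are smooth by axiom.\<close>

lemma F_Hinf: "a \<in> F \<Longrightarrow> a \<in> Hinf \<pi>"
  using mul_Hinf[OF one_F] mul_one by metis

lemma F_generator: "i \<in> I \<Longrightarrow> v \<in> V i \<Longrightarrow> Kfinite \<pi> v \<Longrightarrow> v \<in> F"
  unfolding F_def Hfin_def by (intro mr_cspan_base) blast

lemma mul_add_right: "a \<in> F \<Longrightarrow> b \<in> F \<Longrightarrow> c \<in> F \<Longrightarrow> mul a (b + c) = mul a b + mul a c"
  using mul_add_left[of b c a] by (simp add: mul_commute F_add)

lemma mul_scC_right: "a \<in> F \<Longrightarrow> b \<in> F \<Longrightarrow> mul a (scC z b) = scC z (mul a b)"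
  using mul_scC_left[of b a z] by (simp add: mul_commute F_scC)

lemma mul_minus_left: "a \<in> F \<Longrightarrow> b \<in> F \<Longrightarrow> mul (- a) b = - mul a b"
  using mul_scC_left[of a b "-1"] by (simp add: scC_minus_left scC_one)

lemma mul_minus_right: "a \<in> F \<Longrightarrow> b \<in> F \<Longrightarrow> mul a (- b) = - mul a b"
  using mul_scC_right[of a b "-1"] by (simp add: scC_minus_left scC_one)

lemma mul_diff_left: "a \<in> F \<Longrightarrow> b \<in> F \<Longrightarrow> c \<in> F \<Longrightarrow> mul (a - b) c = mul a c - mul b c"
  using mul_add_left[of a "- b" c] by (simp add: mul_minus_left F_minus)

lemma mul_diff_right: "a \<in> F \<Longrightarrow> b \<in> F \<Longrightarrow> c \<in> F \<Longrightarrow> mul a (b - c) = mul a b - mul a c"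
  using mul_add_right[of a b "- c"] by (simp add: mul_minus_right F_minus)

lemma mul_0_left [simp]: "b \<in> F \<Longrightarrow> mul 0 b = 0"
  using mul_scC_left[OF F_0, of b 0] by simp

lemma mul_0_right [simp]: "b \<in> F \<Longrightarrow> mul b 0 = 0"
  using mul_scC_right[OF _ F_0, of b 0] by simp

lemma mul_sum_left: "(\<And>i. i \<in> A \<Longrightarrow> f i \<in> F) \<Longrightarrow> b \<in> F \<Longrightarrow> mul (\<Sum>i\<in>A. f i) b = (\<Sum>i\<in>A. mul (f i) b)"
  by (induction A rule: infinite_finite_induct) (auto simp: mul_add_left F_sum)

lemma Kfinite_rot:
  assumes "Kfinite \<pi> v"
  shows "Kfinite \<pi> (\<pi> (sl2_rot s) v)"
proof -
  obtain B where "finite B" "\<And>t. \<pi> (sl2_rot t) v \<in> mr_cspan B" using assms unfolding Kfinite_def by blast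
  moreover have "\<pi> (sl2_rot t) (\<pi> (sl2_rot s) v) = \<pi> (sl2_rot (t + s)) v" for t
    using sl2_exp_add[of BW t s] by (simp add: rep_mult)
  ultimately show ?thesis unfolding Kfinite_def by auto
qed

text \<open>By the adjoint action, rotating a derivative gives a combination of derivatives of the
  rotated vector. These lie in the span of \<open>D\<close>, the derivatives of a finite basis taken
  inside the orbit.\<close>

lemma Kfinite_dact:
  assumes i: "i \<in> I" and v: "v \<in> V i" "Kfinite \<pi> v"
  shows "dact \<pi> X v \<in> V i" "Kfinite \<pi> (dact \<pi> X v)"
proof -
  have orbit: "\<pi> (sl2_rot s) v \<in> Hinf \<pi>" for s
    using F_Hinf[OF F_generator[OF i invariant_subD(3)[OF V_inv[OF i] SL2_rot v(1)] Kfinite_rot[OF v(2)]]] .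
  have vH: "v \<in> Hinf \<pi>" by (rule F_Hinf[OF F_generator[OF i v]])
  show "dact \<pi> X v \<in> V i" by (rule invariant_dact[OF V_inv[OF i] v(1) Hinf_dact[OF vH]])
  define S where "S = range (\<lambda>t. \<pi> (sl2_rot t) v)"
  obtain B where "finite B" "S \<subseteq> mr_cspan B" using v(2) unfolding Kfinite_def S_def by blast
  then obtain B' where B': "B' \<subseteq> S" "finite B'" "S \<subseteq> mr_cspan B'" by (rule finite_orbit_basis)
  define D where "D = (\<Union>Y\<in>{BW, BHd, BS}. dact \<pi> Y ` B')"
  have D: "finite D" using B' by (simp add: D_def)
  have BH: "B' \<subseteq> Hinf \<pi>" using B'(1) orbit unfolding S_def by blast
  have "{w \<in> Hinf \<pi>. \<forall>Y. dact \<pi> Y w \<in> mr_cspan D} \<supseteq> mr_cspan B'"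
  proof (rule mr_cspan_minimal)
    show "mr_csubspace {w \<in> Hinf \<pi>. \<forall>Y. dact \<pi> Y w \<in> mr_cspan D}"
      unfolding mr_csubspace_def
      by (auto simp: dact_add dact_scC Hinf_0 Hinf_add Hinf_scC intro: mr_csubspaceD[OF mr_cspan_subspace])
    have "dact \<pi> Y b \<in> D" if "b \<in> B'" for Y b using that by (cases Y) (auto simp: D_def)
    then show "B' \<subseteq> {w \<in> Hinf \<pi>. \<forall>Y. dact \<pi> Y w \<in> mr_cspan D}" using BH by (auto intro: mr_cspan_base)
  qed
  then have dD: "dact \<pi> Y (\<pi> (sl2_rot s) v) \<in> mr_cspan D" for Y s using B'(3) unfolding S_def by blast
  have *: "\<pi> (sl2_rot s) (dact \<pi> Y v) \<in> mr_cspan D" for s Y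
  proof -
    let ?u = "\<pi> (sl2_rot s) v"
    let ?c = "complex_of_real (cos (2 * s))" and ?s = "complex_of_real (sin (2 * s))"
    let ?Hd = "\<pi> (sl2_rot s) (dact \<pi> BHd v)" and ?S = "\<pi> (sl2_rot s) (dact \<pi> BS v)"
    note d = Hinf_dact[OF vH]
    have 1: "dact \<pi> BW ?u = \<pi> (sl2_rot s) (dact \<pi> BW v)" by (rule dact_eq[OF has_dact_rot_W[OF d d d]])
    have 2: "dact \<pi> BHd ?u = scC ?c ?Hd + scC ?s ?S"
      using dact_eq[OF has_dact_rot_Hd[OF d d d, of s]] by (simp add: rep_add rep_scC)
    have 3: "dact \<pi> BS ?u = scC (- ?s) ?Hd + scC ?c ?S"
      using dact_eq[OF has_dact_rot_S[OF d d d, of s]] by (simp add: rep_add rep_scC)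
    \<comment> \<open>The relations 2 and 3 form a rotation by the angle 2 s; its determinant 1
      allows solving them for the two rotated derivatives.\<close>
    have "?c * ?c + ?s * ?s = complex_of_real ((cos (2 * s))\<^sup>2 + (sin (2 * s))\<^sup>2)"
      by (simp only: of_real_add of_real_mult power2_eq_square)
    then have cs: "?c * ?c + ?s * ?s = 1" by simp
    have "?Hd = scC (?c * ?c + ?s * ?s) ?Hd" unfolding cs by (simp add: scC_one)
    also have "\<dots> = scC ?c (dact \<pi> BHd ?u) - scC ?s (dact \<pi> BS ?u)"
      unfolding 2 3 by (rule cinner_ext) (simp add: cinner_simps algebra_simps)
    finally have Hd: "?Hd \<in> mr_cspan D" using dD by (simp add: mr_csubspaceD[OF mr_cspan_subspace])
    have "?S = scC (?c * ?c + ?s * ?s) ?S" unfolding cs by (simp add: scC_one)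
    also have "\<dots> = scC ?s (dact \<pi> BHd ?u) + scC ?c (dact \<pi> BS ?u)"
      unfolding 2 3 by (rule cinner_ext) (simp add: cinner_simps algebra_simps)
    finally have S: "?S \<in> mr_cspan D" using dD by (simp add: mr_csubspaceD[OF mr_cspan_subspace])
    show ?thesis using dD[of BW s] Hd S unfolding 1 by (cases Y) auto
  qed
  then show "Kfinite \<pi> (dact \<pi> X v)" unfolding Kfinite_def using D by blast
qed

lemma dact_F: "a \<in> F \<Longrightarrow> dact \<pi> X a \<in> F"
proof -
  have "F \<subseteq> {a \<in> F. dact \<pi> X a \<in> F}"
    unfolding F_def Hfin_def
  proof (rule mr_cspan_minimal, fold Hfin_def, fold F_def)
    show "mr_csubspace {a \<in> F. dact \<pi> X a \<in> F}"
      unfolding mr_csubspace_def by (auto simp: F_0 F_add F_scC dact_add dact_scC F_Hinf)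
    show "(\<Union>i\<in>I. {v \<in> V i. Kfinite \<pi> v}) \<subseteq> {a \<in> F. dact \<pi> X a \<in> F}"
      by (auto intro: F_generator Kfinite_dact)
  qed
  then show "a \<in> F \<Longrightarrow> dact \<pi> X a \<in> F" by blast
qed

lemma op_F: "a \<in> F \<Longrightarrow> opHH a \<in> F" "a \<in> F \<Longrightarrow> EE a \<in> F" "a \<in> F \<Longrightarrow> EB a \<in> F" "a \<in> F \<Longrightarrow> Cas a \<in> F"
proof -
  have *: "opHH a \<in> F" "EE a \<in> F" "EB a \<in> F" if "a \<in> F" for a
    unfolding opH_def opE_def opEbar_def using that by (intro F_add F_diff F_scC dact_F; simp)+
  then show "a \<in> F \<Longrightarrow> opHH a \<in> F" "a \<in> F \<Longrightarrow> EE a \<in> F" "a \<in> F \<Longrightarrow> EB a \<in> F" by auto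
  show "a \<in> F \<Longrightarrow> Cas a \<in> F" unfolding casimir_def by (intro F_diff F_minus F_scC F_add *)
qed

lemma powE_F: "a \<in> F \<Longrightarrow> (EE ^^ k) a \<in> F"
  by (induction k) (auto intro: op_F)

lemma powEB_F: "a \<in> F \<Longrightarrow> (EB ^^ k) a \<in> F"
  by (induction k) (auto intro: op_F)

lemma rep_one_vec: "g \<in> SL2 \<Longrightarrow> \<pi> g one = one"
proof -
  have "one \<in> range (\<lambda>z. scC z one)" by (rule range_eqI[of _ _ 1]) (simp add: scC_one)
  then show "g \<in> SL2 \<Longrightarrow> \<pi> g one = one" unfolding G_fixed[symmetric] by blast
qed

lemma dact_one: "dact \<pi> X one = 0"
  by (rule dact_eq) (simp add: has_dact_clim rep_one_vec)

lemma dact_mul: "a \<in> F \<Longrightarrow> b \<in> F \<Longrightarrow> dact \<pi> X (mul a b) = mul (dact \<pi> X a) b + mul a (dact \<pi> X b)"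
  by (rule dact_eq[OF product_rule])

lemma op_mul:
  assumes "a \<in> F" "b \<in> F"
  shows "opHH (mul a b) = mul (opHH a) b + mul a (opHH b)" "EE (mul a b) = mul (EE a) b + mul a (EE b)"
    "EB (mul a b) = mul (EB a) b + mul a (EB b)"
  unfolding opH_def opE_def opEbar_def using assms
  by (simp_all add: dact_mul dact_F F_scC mul_add_left mul_add_right mul_diff_left mul_diff_right
      mul_scC_left mul_scC_right scC_add_right scC_diff_right algebra_simps)

text \<open>\<open>cj a\<close> represents the functional sending b to <a b, one>. The axioms give
  only the adjoint property of \<open>cj\<close>; additivity, the involution law and compatibility
  with the Lie algebra are derived from this characterisation.\<close>

lemma cj_eqI:
  assumes "a \<in> F" "x \<in> F" "\<And>b. b \<in> F \<Longrightarrow> cinner (mul a b) one = cinner b x"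
  shows "cj a = x"
proof -
  have "cinner b (cj a) = cinner b x" if "b \<in> F" for b
    using cj_adjoint[OF assms(1) that one_F] mul_commute[OF cj_F[OF assms(1)] one_F] mul_one[OF cj_F[OF assms(1)]]
      assms(3)[OF that] by simp
  then have "cinner (cj a - x) (cj a - x) = 0"
    using F_diff[OF cj_F[OF assms(1)] assms(2)] by (simp add: cinner_diff_right)
  then show ?thesis using cinner_eq_0 by fastforce
qed

lemma cj_char: "a \<in> F \<Longrightarrow> b \<in> F \<Longrightarrow> cinner (mul a b) one = cinner b (cj a)"
  using cj_adjoint[OF _ _ one_F] mul_commute[OF cj_F one_F] mul_one[OF cj_F] by simp

lemma cj_scC: "a \<in> F \<Longrightarrow> cj (scC z a) = scC (cnj z) (cj a)"
  by (intro cj_eqI F_scC cj_F) (auto simp: mul_scC_left cj_char cinner_simps)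

lemma cj_add: "a \<in> F \<Longrightarrow> b \<in> F \<Longrightarrow> cj (a + b) = cj a + cj b"
  by (intro cj_eqI F_add cj_F) (auto simp: mul_add_left cj_char cinner_simps)

lemma cj_minus: "a \<in> F \<Longrightarrow> cj (- a) = - cj a"
  using cj_scC[of a "-1"] by (simp add: scC_minus_left scC_one)

lemma cj_diff: "a \<in> F \<Longrightarrow> b \<in> F \<Longrightarrow> cj (a - b) = cj a - cj b"
  using cj_add[of a "- b"] by (simp add: cj_minus F_minus)

lemma cj_cj: "a \<in> F \<Longrightarrow> cj (cj a) = a"
proof (rule cj_eqI)
  fix b assume a: "a \<in> F" and b: "b \<in> F"
  have "cinner (mul a one) b = cinner one (mul (cj a) b)" by (rule cj_adjoint[OF a one_F b])
  then have "cinner a b = cinner one (mul (cj a) b)" using mul_commute[OF a one_F] mul_one[OF a] by simp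
  then show "cinner (mul (cj a) b) one = cinner b a"
    using cinner_commute[of "mul (cj a) b" one] cinner_commute[of b a] by simp
qed (auto intro: cj_F)

text \<open>The functional <., one> is invariant, since \<open>one\<close> is annihilated by the Lie
  algebra; applying it to the product rule moves X from a to b, and skewness then moves it to
  \<open>cj a\<close>.\<close>

lemma cj_dact:
  assumes a: "a \<in> F"
  shows "cj (dact \<pi> X a) = dact \<pi> X (cj a)"
proof (rule cj_eqI)
  fix b assume b: "b \<in> F"
  note H = F_Hinf
  have "cinner (mul (dact \<pi> X a) b) one = cinner (dact \<pi> X (mul a b)) one - cinner (mul a (dact \<pi> X b)) one"
    using a b by (simp add: dact_mul cinner_add_left)
  also have "cinner (dact \<pi> X (mul a b)) one = 0"
    using dact_skew[OF mul_Hinf[OF a b] H[OF one_F], of X] by (simp add: dact_one)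
  also have "cinner (mul a (dact \<pi> X b)) one = cinner (dact \<pi> X b) (cj a)" by (intro cj_char a dact_F b)
  also have "\<dots> = - cinner b (dact \<pi> X (cj a))" by (intro dact_skew H b cj_F a)
  finally show "cinner (mul (dact \<pi> X a) b) one = cinner b (dact \<pi> X (cj a))" by simp
qed (auto intro: dact_F cj_F a)

lemma cj_op:
  assumes a: "a \<in> F"
  shows "cj (opHH a) = - opHH (cj a)" "cj (EE a) = EB (cj a)" "cj (EB a) = EE (cj a)" "cj (Cas a) = Cas (cj a)"
proof -
  have *: "cj (opHH a) = - opHH (cj a)" "cj (EE a) = EB (cj a)" "cj (EB a) = EE (cj a)" if "a \<in> F" for a
    unfolding opH_def opE_def opEbar_def using that
    by (simp_all add: cj_scC cj_add cj_diff cj_minus dact_F F_scC cj_dact scC_minus_left)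
  show "cj (opHH a) = - opHH (cj a)" "cj (EE a) = EB (cj a)" "cj (EB a) = EE (cj a)" using *[OF a] by auto
  have "cj (Cas a) = - opHH (opHH (cj a)) + opHH (cj a) - EE (EB (cj a))"
    using a by (simp add: casimir_eq F_Hinf op_F cj_diff cj_minus F_diff F_minus cj_F * op_minus)
  also have "\<dots> = Cas (cj a)"
    using casimir_E_EB[OF F_Hinf[OF cj_F[OF a]]] by simp
  finally show "cj (Cas a) = Cas (cj a)" .
qed

lemma cj_powE: "a \<in> F \<Longrightarrow> cj ((EE ^^ k) a) = (EB ^^ k) (cj a)"
  by (induction k) (auto simp: cj_op powE_F)

lemma cj_powEB: "a \<in> F \<Longrightarrow> cj ((EB ^^ k) a) = (EE ^^ k) (cj a)"
  by (induction k) (auto simp: cj_op powEB_F)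

lemma cj_Kinv: "a \<in> F \<Longrightarrow> a \<in> Kinv \<Longrightarrow> cj a \<in> Kinv"
proof -
  assume a: "a \<in> F" "a \<in> Kinv"
  have "cj 0 = 0" using cj_scC[OF F_0, of 0] by simp
  then have "opHH (cj a) = 0" using cj_op(1)[OF a(1)] Kinv_opH[OF a(2)] by simp
  then show ?thesis by (rule Kinv_if_opH[OF F_Hinf[OF cj_F[OF a(1)]]])
qed

text \<open>The transposition of the two middle entries. Feeding \<open>cj c\<close> and
  \<open>cj d\<close> into the axiom and using that \<open>cj\<close> is an involution frees the
  right-hand product of conjugates.\<close>

lemma crossing:
  assumes "a \<in> F" "b \<in> F" "c \<in> F" "d \<in> F"
  shows "cinner (mul a b) (mul c d) = cinner (mul a (cj c)) (mul (cj b) d)"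
proof -
  define x where "x j = (if j = 0 then a else if j = 1 then b else if j = 2 then cj c else cj d)" for j :: nat
  define \<sigma> :: "nat \<Rightarrow> nat" where "\<sigma> j = (if j = 1 then 2 else if j = 2 then 1 else j)" for j
  have "bij_betw \<sigma> {0..<4} {0..<4}"
    by (rule bij_betwI[where g = \<sigma>]) (auto simp: \<sigma>_def)
  from crossing_perm[OF _ this, of x] show ?thesis
    using assms by (simp add: x_def \<sigma>_def cj_F cj_cj)
qed

text \<open>The exchange of the middle factors in the squared norm of a b. All positivity in the
  bootstrap comes from this identity.\<close>

lemma cnrm_mul: 
  assumes "a \<in> F" "b \<in> F"
  shows "cinner (mul a (cj a)) (mul b (cj b)) = complex_of_real ((cnrm (mul a b))\<^sup>2)"
  using crossing[OF assms assms] mul_commute[OF cj_F[OF assms(2)] assms(2)] by (simp add: cinner_self)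

lemma cnrm_mul_le: 
  assumes "a \<in> F" "b \<in> F"
  shows "(cnrm (mul a b))\<^sup>2 \<le> cnrm (mul a (cj a)) * cnrm (mul b (cj b))"
proof -
  have "(cnrm (mul a b))\<^sup>2 = cmod (cinner (mul a (cj a)) (mul b (cj b)))"
    unfolding cnrm_mul[OF assms] norm_of_real by simp
  then show ?thesis using cinner_Cauchy_Schwarz by simp
qed

end

section \<open>The spherical spectrum and products of spherical vectors\<close>

lemma mr_cspan_Union_decompose:
  assumes "s \<in> mr_cspan (\<Union>i\<in>I. V i)" and V: "\<And>i. i \<in> I \<Longrightarrow> mr_csubspace (V i)"
  shows "\<exists>A v. finite A \<and> A \<subseteq> I \<and> (\<forall>i\<in>A. v i \<in> V i) \<and> s = (\<Sum>i\<in>A. v i)"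
proof -
  \<comment> \<open>The family lives on all of \<open>I\<close> and is zero off \<open>A\<close>, so
    that two decompositions can be added over the union of their supports.\<close>
  define T where "T = {s. \<exists>A v. finite A \<and> A \<subseteq> I \<and> (\<forall>i\<in>I. v i \<in> V i) \<and> (\<forall>i. i \<notin> A \<longrightarrow> v i = 0) \<and> s = (\<Sum>i\<in>A. v i)}"
  note V' = mr_csubspaceD[OF V]
  have "mr_cspan (\<Union>i\<in>I. V i) \<subseteq> T"
  proof (rule mr_cspan_minimal)
    show "mr_csubspace T"
      unfolding mr_csubspace_def
    proof (intro conjI ballI allI)
      show "0 \<in> T" unfolding T_def using V'(1) by (intro CollectI exI[of _ "{}"] exI[of _ "\<lambda>_. 0"]) auto
    next
      fix x y assume "x \<in> T" "y \<in> T"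
      then obtain A v B w where x: "finite A" "A \<subseteq> I" "\<forall>i\<in>I. v i \<in> V i" "\<forall>i. i \<notin> A \<longrightarrow> v i = 0" "x = (\<Sum>i\<in>A. v i)"
        and y: "finite B" "B \<subseteq> I" "\<forall>i\<in>I. w i \<in> V i" "\<forall>i. i \<notin> B \<longrightarrow> w i = 0" "y = (\<Sum>i\<in>B. w i)"
        unfolding T_def by blast
      have "x = (\<Sum>i\<in>A \<union> B. v i)" unfolding x(5) by (rule sum.mono_neutral_left) (use x y in auto)
      moreover have "y = (\<Sum>i\<in>A \<union> B. w i)" unfolding y(5) by (rule sum.mono_neutral_left) (use x y in auto)
      ultimately have "x + y = (\<Sum>i\<in>A \<union> B. v i + w i)" by (simp add: sum.distrib)
      then show "x + y \<in> T" unfolding T_def using x y V'(2)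
        by (intro CollectI exI[of _ "A \<union> B"] exI[of _ "\<lambda>i. v i + w i"]) auto
    next
      fix c x assume "x \<in> T"
      then obtain A v where x: "finite A" "A \<subseteq> I" "\<forall>i\<in>I. v i \<in> V i" "\<forall>i. i \<notin> A \<longrightarrow> v i = 0" "x = (\<Sum>i\<in>A. v i)"
        unfolding T_def by blast
      then show "scC c x \<in> T" unfolding T_def using V'(3)
        by (intro CollectI exI[of _ "A"] exI[of _ "\<lambda>i. scC c (v i)"]) (auto simp: scC_sum_right)
    qed
    show "(\<Union>i\<in>I. V i) \<subseteq> T"
    proof
      fix x assume "x \<in> (\<Union>i\<in>I. V i)"
      then obtain i where "i \<in> I" "x \<in> V i" by blast
      then show "x \<in> T" unfolding T_def using V'(1)
        by (intro CollectI exI[of _ "{i}"] exI[of _ "\<lambda>j. if j = i then x else 0"]) auto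
    qed
  qed
  then have "s \<in> T" using assms(1) by blast
  then show ?thesis unfolding T_def by blast
qed

section \<open>Orthonormal spherical vectors and Parseval\<close>

context mrep
begin

definition J :: "nat set" where "J = {i \<in> I. \<exists>v \<in> V i \<inter> Kinv. v \<noteq> 0}"

text \<open>Determined up to a phase, by \<open>spherical_unique\<close>.\<close>

definition ev :: "nat \<Rightarrow> 'h" where "ev i = (SOME v. v \<in> V i \<inter> Kinv \<and> cnrm v = 1)"

definition lam :: "nat \<Rightarrow> real" where
  "lam i = (SOME l. l \<ge> 0 \<and> (\<forall>u \<in> V i \<inter> Kinv. Cas u = scC (complex_of_real l) u))"

definition coef :: "'h \<Rightarrow> nat \<Rightarrow> complex" where "coef Y i = cinner Y (ev i)"

lemma J_I: "i \<in> J \<Longrightarrow> i \<in> I" by (simp add: J_def)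

lemma V_Kinv_F: "i \<in> I \<Longrightarrow> v \<in> V i \<inter> Kinv \<Longrightarrow> v \<in> F"
proof (rule F_generator)
  assume v: "v \<in> V i \<inter> Kinv"
  have "\<pi> (sl2_rot t) v \<in> mr_cspan {v}" for t using v unfolding Kinv_def by (auto intro: mr_cspan_base)
  then show "Kfinite \<pi> v" unfolding Kfinite_def by (intro exI[of _ "{v}"]) auto
qed auto

lemma V_Kinv_Hinf: "i \<in> I \<Longrightarrow> V i \<inter> Kinv \<subseteq> Hinf \<pi>"
  using V_Kinv_F F_Hinf by blast

lemma ev: "i \<in> J \<Longrightarrow> ev i \<in> V i \<inter> Kinv \<and> cnrm (ev i) = 1"
  unfolding ev_def
proof (rule someI_ex)
  assume "i \<in> J"
  then obtain v where v: "i \<in> I" "v \<in> V i \<inter> Kinv" "v \<noteq> 0" unfolding J_def by blast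
  have "cnrm v > 0" using v(3) cnrm_nonneg[of v] by (simp add: less_le)
  then have "cnrm (scC (complex_of_real (1 / cnrm v)) v) = 1" unfolding cnrm_scC norm_of_real by (simp add: v(3))
  moreover have "scC c v \<in> V i \<inter> Kinv" for c
    by (intro mr_csubspaceD(3)[OF mr_csubspace_Int[OF invariant_subD(1)[OF V_inv[OF v(1)]] Kinv_subspace]] v)
  ultimately show "\<exists>v. v \<in> V i \<inter> Kinv \<and> cnrm v = 1" by blast
qed

lemma ev_V: "i \<in> J \<Longrightarrow> ev i \<in> V i" and ev_Kinv: "i \<in> J \<Longrightarrow> ev i \<in> Kinv" and ev_norm: "i \<in> J \<Longrightarrow> cnrm (ev i) = 1"
  and ev_F: "i \<in> J \<Longrightarrow> ev i \<in> F" and ev_Hinf: "i \<in> J \<Longrightarrow> ev i \<in> Hinf \<pi>"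
  using ev V_Kinv_F[OF J_I] F_Hinf by blast+

lemma lam: "i \<in> I \<Longrightarrow> lam i \<ge> 0 \<and> (\<forall>u \<in> V i \<inter> Kinv. Cas u = scC (complex_of_real (lam i)) u)"
  unfolding lam_def
proof (rule someI_ex)
  assume i: "i \<in> I"
  show "\<exists>l\<ge>0. \<forall>u\<in>V i \<inter> Kinv. Cas u = scC (complex_of_real l) u"
    by (rule spherical_casimir_scalar[OF V_irr[OF i] V_Kinv_Hinf[OF i]]) blast
qed

lemma lam_nonneg: "i \<in> J \<Longrightarrow> lam i \<ge> 0"
  using lam J_I by blast

lemma casimir_ev: "i \<in> J \<Longrightarrow> Cas (ev i) = scC (complex_of_real (lam i)) (ev i)"
  using lam[OF J_I] ev by blast

lemma ev_orthonormal: "i \<in> J \<Longrightarrow> j \<in> J \<Longrightarrow> cinner (ev i) (ev j) = (if i = j then 1 else 0)"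
  using V_orth[OF J_I J_I _ ev_V ev_V] by (auto simp: cinner_self ev_norm)

lemma lam_finite: "finite {i \<in> J. lam i \<le> B}"
proof (rule finite_subset[OF _ V_finite[of B]], rule subsetI)
  fix i assume i: "i \<in> {i \<in> J. lam i \<le> B}"
  then have iJ: "i \<in> J" by simp
  have "cmod (complex_of_real (lam i)) \<le> B" using i lam_nonneg by simp
  moreover have "ev i \<in> V i \<inter> Hinf \<pi>" "ev i \<noteq> 0" using ev_V[OF iJ] ev_Hinf[OF iJ] ev_norm[OF iJ] by auto
  ultimately show "i \<in> {i\<in>I. \<exists>l v. cmod l \<le> B \<and> v \<in> V i \<inter> Hinf \<pi> \<and> v \<noteq> 0 \<and> casimir \<pi> v = scC l v}"
    using casimir_ev[OF iJ] J_I[OF iJ] by blast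
qed

lemma coef_sum_ev:
  assumes "finite A" "A \<subseteq> J" "j \<in> J"
  shows "coef (\<Sum>i\<in>A. scC (c i) (ev i)) j = (if j \<in> A then c j else 0)"
proof -
  have "coef (\<Sum>i\<in>A. scC (c i) (ev i)) j = (\<Sum>i\<in>A. if i = j then c i else 0)"
    unfolding coef_def cinner_sum_left cinner_scC_left
    by (intro sum.cong refl) (use assms ev_orthonormal in auto)
  then show ?thesis using assms(1) by simp
qed

text \<open>The projection onto an invariant subspace commutes with rotations, so p is again
  K-invariant and lies on the spherical line of the summand, if there is one.\<close>

lemma projection_Kinv:
  assumes Y: "Y \<in> Kinv" and i: "i \<in> I" and p: "p \<in> V i" "\<And>s. s \<in> V i \<Longrightarrow> cinner (Y - p) s = 0"
  shows "p = (if i \<in> J then scC (coef Y i) (ev i) else 0)"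
proof -
  note inv = V_inv[OF i]
  have "\<pi> (sl2_rot t) p = p" for t
  proof -
    let ?k = "sl2_rot t" and ?d = "\<pi> (sl2_rot t) p - p"
    have d: "?d \<in> V i" by (intro mr_csubspaceD[OF invariant_subD(1)[OF inv]] invariant_subD(3)[OF inv] p SL2_rot)
    have "\<pi> ?k Y = Y" using Y unfolding Kinv_def by blast
    then have "cinner (Y - \<pi> ?k p) ?d = cinner (\<pi> ?k (Y - p)) ?d" by (simp add: rep_diff)
    also have "\<dots> = cinner (Y - p) (\<pi> (sl2_inv ?k) ?d)" by (rule rep_adjoint) simp
    also have "\<dots> = 0" by (intro p invariant_subD(3)[OF inv] SL2_inv SL2_rot d)
    finally have "cinner (Y - p) ?d - cinner (Y - \<pi> ?k p) ?d = 0" using p(2)[OF d] by simp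
    then have "cinner ((Y - p) - (Y - \<pi> ?k p)) ?d = 0" unfolding cinner_diff_left[of "Y - p"] .
    then have "cinner ?d ?d = 0" by simp
    then show ?thesis using cinner_eq_0 by fastforce
  qed
  then have pK: "p \<in> V i \<inter> Kinv" using p(1) unfolding Kinv_def by blast
  show ?thesis
  proof (cases "i \<in> J")
    case True
    have "p = scC (cinner p (ev i)) (ev i)"
      by (rule spherical_unique[OF V_irr[OF i] V_Kinv_Hinf[OF i] _ _ pK]) (use ev[OF True] in auto)
    moreover have "cinner p (ev i) = coef Y i" using p(2)[OF ev_V[OF True]] by (simp add: coef_def cinner_diff_left)
    ultimately show ?thesis using True by simp
  next
    case False
    then show ?thesis using pK i unfolding J_def by auto
  qed
qed

text \<open>Spherical components approximate a K-invariant vector at least as well as any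
  competitors from the same summands, invariant or not. Thus density of the span of all summands
  already gives completeness of the \<open>ev i\<close> among K-invariant vectors.\<close>

lemma Kinv_approx:
  assumes Y: "Y \<in> Kinv" and A: "finite A" "A \<subseteq> I" "\<And>i. i \<in> A \<Longrightarrow> s i \<in> V i"
  shows "cnrm (Y - (\<Sum>i\<in>A \<inter> J. scC (coef Y i) (ev i))) \<le> cnrm (Y - (\<Sum>i\<in>A. s i))"
proof -
  have "\<forall>i\<in>I. \<exists>p\<in>V i. \<forall>s\<in>V i. cinner (Y - p) s = 0"
    using orthogonal_projection_exists invariant_subD(1,2)[OF V_inv] by blast
  then obtain p where p: "\<And>i. i \<in> I \<Longrightarrow> p i \<in> V i" "\<And>i s. i \<in> I \<Longrightarrow> s \<in> V i \<Longrightarrow> cinner (Y - p i) s = 0"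
    by metis
  have pe: "p i = (if i \<in> J then scC (coef Y i) (ev i) else 0)" if "i \<in> I" for i
    by (rule projection_Kinv[OF Y that p[OF that]])
  have sum_eq: "(\<Sum>i\<in>A \<inter> J. scC (coef Y i) (ev i)) = (\<Sum>i\<in>A. p i)"
    using A pe by (simp add: sum.inter_restrict subset_iff)
  define R where "R = Y - (\<Sum>i\<in>A. p i)"
  have orth: "cinner R v = 0" if j: "j \<in> A" and v: "v \<in> V j" for j v
  proof -
    have "cinner (\<Sum>i\<in>A. p i) v = (\<Sum>i\<in>A. if i = j then cinner (p j) v else 0)"
      unfolding cinner_sum_left using V_orth[OF _ _ _ p(1) v] A j by (intro sum.cong refl) auto
    also have "\<dots> = cinner (p j) v" using A(1) j by simp
    finally show ?thesis unfolding R_def using p(2)[OF _ v] A j by (auto simp: cinner_diff_left)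
  qed
  have "cinner R (\<Sum>i\<in>A. p i - s i) = 0"
    unfolding cinner_sum_right
    by (intro sum.neutral ballI orth) (use A p(1) in \<open>auto intro!: mr_csubspaceD(5)[OF invariant_subD(1)[OF V_inv]]\<close>)
  from cnrm_add_orthogonal[OF this]
  have "(cnrm R)\<^sup>2 \<le> (cnrm (R + (\<Sum>i\<in>A. p i - s i)))\<^sup>2" by simp
  moreover have "R + (\<Sum>i\<in>A. p i - s i) = Y - (\<Sum>i\<in>A. s i)" unfolding R_def by (simp add: sum_subtractf)
  ultimately have "(cnrm R)\<^sup>2 \<le> (cnrm (Y - (\<Sum>i\<in>A. s i)))\<^sup>2" by simp
  then show ?thesis unfolding sum_eq R_def[symmetric] by (rule power2_le_imp_le) simp
qed

lemma cnrm_residual_coef: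
  assumes "finite A" "A \<subseteq> J"
  shows "(cnrm (Y - (\<Sum>i\<in>A. scC (coef Y i) (ev i))))\<^sup>2 = (cnrm Y)\<^sup>2 - (\<Sum>i\<in>A. (cmod (coef Y i))\<^sup>2)"
proof -
  let ?P = "\<Sum>i\<in>A. scC (coef Y i) (ev i)"
  have YP: "cinner Y ?P = complex_of_real (\<Sum>i\<in>A. (cmod (coef Y i))\<^sup>2)"
    unfolding cinner_sum_right cinner_scC_right coef_def[symmetric] of_real_sum
    by (intro sum.cong refl) (simp only: complex_norm_square mult.commute)
  have PP: "cinner ?P ?P = complex_of_real (\<Sum>i\<in>A. (cmod (coef Y i))\<^sup>2)"
  proof -
    have "cinner ?P ?P = (\<Sum>i\<in>A. cnj (coef Y i) * coef ?P i)"
      unfolding cinner_sum_right[of ?P] cinner_scC_right coef_def[of ?P] ..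
    also have "\<dots> = (\<Sum>i\<in>A. cnj (coef Y i) * coef Y i)"
      by (intro sum.cong refl) (use assms coef_sum_ev[OF assms] in auto)
    finally show ?thesis by (simp only: complex_norm_square of_real_sum mult.commute)
  qed
  have PY: "cinner ?P Y = complex_of_real (\<Sum>i\<in>A. (cmod (coef Y i))\<^sup>2)"
    using YP cinner_commute[of ?P Y] by simp
  show ?thesis unfolding cnrm_power2 using YP PP PY by (simp add: cinner_simps)
qed

lemma Kinv_F_expand:
  assumes u: "u \<in> F" "u \<in> Kinv"
  obtains A where "finite A" "A \<subseteq> J" "u = (\<Sum>i\<in>A. scC (coef u i) (ev i))"
proof -
  have "F \<subseteq> mr_cspan (\<Union>i\<in>I. V i)"
    unfolding F_def Hfin_def by (rule mr_cspan_minimal[OF mr_cspan_subspace]) (auto intro: mr_cspan_base)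
  then have s: "u \<in> mr_cspan (\<Union>i\<in>I. V i)" using u by blast
  obtain A v where A: "finite A" "A \<subseteq> I" "\<And>i. i \<in> A \<Longrightarrow> v i \<in> V i" "u = (\<Sum>i\<in>A. v i)"
    using mr_cspan_Union_decompose[OF s invariant_subD(1)[OF V_inv]] by blast
  have "cnrm (u - (\<Sum>i\<in>A \<inter> J. scC (coef u i) (ev i))) \<le> 0"
    using Kinv_approx[OF u(2) A(1-3)] A(4) by simp
  then have "cnrm (u - (\<Sum>i\<in>A \<inter> J. scC (coef u i) (ev i))) = 0"
    using cnrm_nonneg[of "u - (\<Sum>i\<in>A \<inter> J. scC (coef u i) (ev i))"] by linarith
  then have "u = (\<Sum>i\<in>A \<inter> J. scC (coef u i) (ev i))" by simp
  then show ?thesis using that[of "A \<inter> J"] A(1) by simp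
qed

text \<open>Parseval. Density yields one finite set with small residual, and by
  \<open>cnrm_residual_coef\<close> the residual only shrinks when the set grows.\<close>

lemma coef_has_sum:
  assumes Y: "Y \<in> Kinv"
  shows "((\<lambda>i. coef Y i * cnj (coef Z i)) has_sum cinner Y Z) J"
  unfolding has_sum_def
proof (rule tendstoI)
  fix e :: real assume e: "e > 0"
  define d where "d = e / (cnrm Z + 1)"
  have d: "d > 0" unfolding d_def using e by (intro divide_pos_pos add_nonneg_pos) auto
  have "Y \<in> cclosure (mr_cspan (\<Union>i\<in>I. V i))" using V_dense by simp
  then obtain s where s: "s \<in> mr_cspan (\<Union>i\<in>I. V i)" "cnrm (Y - s) < d" using d unfolding cclosure_def by blast
  obtain A v where A: "finite A" "A \<subseteq> I" "\<And>i. i \<in> A \<Longrightarrow> v i \<in> V i" "s = (\<Sum>i\<in>A. v i)"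
    using mr_cspan_Union_decompose[OF s(1) invariant_subD(1)[OF V_inv]] by blast
  have X: "cnrm (Y - (\<Sum>i\<in>A \<inter> J. scC (coef Y i) (ev i))) < d"
    using Kinv_approx[OF Y A(1-3)] A(4) s(2) by simp
  show "\<forall>\<^sub>F B in finite_subsets_at_top J. dist (\<Sum>i\<in>B. coef Y i * cnj (coef Z i)) (cinner Y Z) < e"
    unfolding eventually_finite_subsets_at_top
  proof (intro exI[of _ "A \<inter> J"] conjI allI impI)
    fix B assume B: "finite B \<and> A \<inter> J \<subseteq> B \<and> B \<subseteq> J"
    have "(\<Sum>i\<in>A \<inter> J. (cmod (coef Y i))\<^sup>2) \<le> (\<Sum>i\<in>B. (cmod (coef Y i))\<^sup>2)"
      using B by (intro sum_mono2) auto
    then have "(cnrm (Y - (\<Sum>i\<in>B. scC (coef Y i) (ev i))))\<^sup>2 \<le> (cnrm (Y - (\<Sum>i\<in>A \<inter> J. scC (coef Y i) (ev i))))\<^sup>2"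
      using A(1) B by (simp add: cnrm_residual_coef)
    then have le: "cnrm (Y - (\<Sum>i\<in>B. scC (coef Y i) (ev i))) < d" using X power2_le_imp_le[OF _ cnrm_nonneg] by fastforce
    have "cinner Y Z - (\<Sum>i\<in>B. coef Y i * cnj (coef Z i)) = cinner (Y - (\<Sum>i\<in>B. scC (coef Y i) (ev i))) Z"
      unfolding cinner_diff_left cinner_sum_left cinner_scC_left coef_def[of Z]
      by (simp flip: cinner_commute)
    then have "dist (\<Sum>i\<in>B. coef Y i * cnj (coef Z i)) (cinner Y Z) = cmod (cinner (Y - (\<Sum>i\<in>B. scC (coef Y i) (ev i))) Z)"
      by (simp add: dist_commute dist_norm)
    also have "\<dots> \<le> cnrm (Y - (\<Sum>i\<in>B. scC (coef Y i) (ev i))) * cnrm Z" by (rule cinner_Cauchy_Schwarz)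
    also have "\<dots> \<le> d * cnrm Z" using le by (intro mult_right_mono) auto
    also have "\<dots> < e" unfolding d_def using e add_nonneg_pos[OF cnrm_nonneg[of Z] zero_less_one] by (simp add: divide_less_eq)
    finally show "dist (\<Sum>i\<in>B. coef Y i * cnj (coef Z i)) (cinner Y Z) < e" .
  qed (use A in auto)
qed

lemma coef_norm_has_sum:
  assumes Y: "Y \<in> Kinv"
  shows "((\<lambda>i. (cmod (coef Y i))\<^sup>2) has_sum (cnrm Y)\<^sup>2) J"
proof -
  have "((\<lambda>i. Re (coef Y i * cnj (coef Y i))) has_sum Re (cinner Y Y)) J"
    by (intro has_sum_Re coef_has_sum Y)
  moreover have "Re (coef Y i * cnj (coef Y i)) = (cmod (coef Y i))\<^sup>2" for i
    by (simp flip: complex_norm_square)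
  ultimately show ?thesis by (simp add: cnrm_power2)
qed

lemma coef_add: "coef (x + y) i = coef x i + coef y i"
  and coef_diff: "coef (x - y) i = coef x i - coef y i"
  and coef_scC: "coef (scC c x) i = c * coef x i"
  by (simp_all add: coef_def cinner_simps)

lemma coef_casimir: "i \<in> J \<Longrightarrow> Y \<in> Hinf \<pi> \<Longrightarrow> coef (Cas Y) i = complex_of_real (lam i) * coef Y i"
  unfolding coef_def by (simp add: op_adjoint ev_Hinf casimir_ev cinner_scC_right)

lemma casimir_pow_Kinv: "Y \<in> Hinf \<pi> \<Longrightarrow> Y \<in> Kinv \<Longrightarrow> (Cas ^^ n) Y \<in> Hinf \<pi> \<and> (Cas ^^ n) Y \<in> Kinv"
  by (induction n) (auto simp: op_Hinf casimir_Kinv)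

lemma coef_casimir_pow: "i \<in> J \<Longrightarrow> Y \<in> Hinf \<pi> \<Longrightarrow> Y \<in> Kinv \<Longrightarrow> coef ((Cas ^^ n) Y) i = complex_of_real (lam i) ^ n * coef Y i"
  by (induction n) (simp_all add: coef_casimir casimir_pow_Kinv)

text \<open>Here smoothness enters: each power of the Casimir gives a vector, and Parseval for the
  k-th power is the moment of order 2 k.\<close>

lemma coef_moment_summable:
  assumes Y: "Y \<in> Hinf \<pi>" "Y \<in> Kinv"
  shows "(\<lambda>i. (1 + lam i) ^ n * (cmod (coef Y i))\<^sup>2) summable_on J"
proof -
  have p: "(\<lambda>i. lam i ^ (2 * k) * (cmod (coef Y i))\<^sup>2) summable_on J" for k
  proof -
    have "(\<lambda>i. (cmod (coef ((Cas ^^ k) Y) i))\<^sup>2) summable_on J"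
      using coef_norm_has_sum casimir_pow_Kinv[OF Y] by (metis has_sum_imp_summable)
    then show ?thesis
      by (rule summable_on_cong[THEN iffD1, rotated])
        (simp add: coef_casimir_pow[OF _ Y] norm_mult norm_power lam_nonneg power_mult_distrib power_mult power2_eq_square)
  qed
  have "(\<lambda>i. 2 ^ n * ((cmod (coef Y i))\<^sup>2 + lam i ^ (2 * n) * (cmod (coef Y i))\<^sup>2)) summable_on J"
    using p[of 0] p[of n] by (intro summable_on_cmult_right summable_on_add) simp_all
  then show ?thesis
  proof (rule summable_on_comparison_test)
    fix i assume i: "i \<in> J"
    have l: "lam i \<ge> 0" by (rule lam_nonneg[OF i])
    have "(1 + lam i) ^ n \<le> 2 ^ n * (1 + lam i ^ (2 * n))"
    proof (cases "lam i \<le> 1")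
      case True
      then have "(1 + lam i) ^ n \<le> 2 ^ n" using l by (intro power_mono) auto
      also have "\<dots> \<le> 2 ^ n * (1 + lam i ^ (2 * n))" using l by simp
      finally show ?thesis .
    next
      case False
      then have "(1 + lam i) ^ n \<le> (2 * lam i) ^ n" by (intro power_mono) auto
      also have "\<dots> = 2 ^ n * lam i ^ n" by (simp add: power_mult_distrib)
      also have "lam i ^ n \<le> lam i ^ (2 * n)" using False by (intro power_increasing) auto
      finally have "(1 + lam i) ^ n \<le> 2 ^ n * lam i ^ (2 * n)" by simp
      moreover have "0 \<le> (2::real) ^ n" by simp
      ultimately show ?thesis unfolding distrib_left by linarith
    qed
    from mult_right_mono[OF this, of "(cmod (coef Y i))\<^sup>2"]
    show "(1 + lam i) ^ n * (cmod (coef Y i))\<^sup>2 \<le> 2 ^ n * ((cmod (coef Y i))\<^sup>2 + lam i ^ (2 * n) * (cmod (coef Y i))\<^sup>2)"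
      by (simp add: algebra_simps)
    show "0 \<le> (1 + lam i) ^ n * (cmod (coef Y i))\<^sup>2" using l by simp
  qed
qed

subsection \<open>Products of weight vectors\<close>

abbreviation U0 :: "'h set" where "U0 \<equiv> F \<inter> Kinv"

lemma U0_subspace: "mr_csubspace U0"
  by (intro mr_csubspace_Int F_subspace Kinv_subspace)

lemma casimir_U0: "u \<in> U0 \<Longrightarrow> Cas u \<in> U0"
  using op_F(4) casimir_Kinv F_Hinf by blast

lemma lower_U0: "u \<in> U0 \<Longrightarrow> lower k u \<in> U0"
  unfolding lower_def by (intro mr_csubspaceD[OF U0_subspace] casimir_U0)

lemma cj_U0: "u \<in> U0 \<Longrightarrow> cj u \<in> U0"
  using cj_F cj_Kinv by blast

lemma cj_lower: "u \<in> U0 \<Longrightarrow> cj (lower k u) = lower k (cj u)"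
  unfolding lower_def by (simp add: cj_add cj_op cj_scC op_F F_scC)

text \<open>The weights m and -m cancel, so H annihilates the product and the Casimir acts on it as
  -EB E. The formula is the product rule applied twice, with EB E on each factor expressed by the
  Casimir.\<close>

lemma casimir_mul_weight:
  assumes ab: "a \<in> F" "b \<in> F" and w: "opHH a = scC m a" "opHH b = - scC m b"
  shows "Cas (mul a b) = scC (2 * m\<^sup>2) (mul a b) + mul (Cas a) b + mul a (Cas b)
     - mul (EE a) (EB b) - mul (EB a) (EE b)"
proof -
  note aH = F_Hinf[OF ab(1)] and bH = F_Hinf[OF ab(2)]
  have H0: "opHH (mul a b) = 0" using ab w by (simp add: op_mul mul_scC_left mul_minus_right mul_scC_right F_scC)
  have "EB (EE a) = - (Cas a + scC (m * m) a + scC m a)"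
    using aH w by (simp add: casimir_EB_E op_scC scC_scC)
  moreover have "opHH (opHH b) = scC (m * m) b" using bH w by (simp add: op_minus op_scC Hinf_scC scC_scC scC_minus_right)
  then have "EB (EE b) = - (Cas b + scC (m * m) b - scC m b)"
    using bH w by (simp add: casimir_EB_E)
  ultimately have *: "mul (EB (EE a)) b = - (mul (Cas a) b + scC (m * m) (mul a b) + scC m (mul a b))"
    "mul a (EB (EE b)) = - (mul a (Cas b) + scC (m * m) (mul a b) - scC m (mul a b))"
    using ab by (simp_all add: mul_minus_left mul_minus_right mul_add_left mul_add_right mul_diff_left mul_diff_right mul_scC_left mul_scC_right
       F_add F_scC F_minus F_diff op_F)
  have 1: "Cas (mul a b) = - EB (EE (mul a b))"
    using casimir_eq[OF mul_Hinf[OF ab]] H0 by simp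
  have 2: "EB (EE (mul a b)) = mul (EB (EE a)) b + mul (EE a) (EB b) + (mul (EB a) (EE b) + mul a (EB (EE b)))"
    using ab by (simp add: op_mul op_add mul_Hinf op_F)
  show ?thesis
    unfolding 1 2 * by (rule cinner_ext) (simp add: cinner_simps power2_eq_square algebra_simps)
qed

text \<open>Polarised, linear in f and conjugate linear in g, because the perturbation terms have
  different arguments. E and EB are added because the Casimir of f times \<open>cj g\<close>
  produces both products of weight one together.\<close>

definition SS :: "nat \<Rightarrow> 'h \<Rightarrow> 'h \<Rightarrow> 'h" where
  "SS n f g = mul ((EE ^^ n) f) (cj ((EE ^^ n) g)) + mul ((EB ^^ n) f) (cj ((EB ^^ n) g))"

lemma SS_0: "SS 0 f g = scC 2 (mul f (cj g))"
  unfolding SS_def using scC_add_left[of 1 1 "mul f (cj g)"] by (simp add: scC_one)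

lemma weights_mul:
  assumes fg: "f \<in> U0" "g \<in> U0"
  shows "opHH ((EE ^^ n) f) = scC (of_nat n) ((EE ^^ n) f)" "opHH (cj ((EE ^^ n) g)) = - scC (of_nat n) (cj ((EE ^^ n) g))"
    "opHH ((EB ^^ n) f) = scC (- of_nat n) ((EB ^^ n) f)" "opHH (cj ((EB ^^ n) g)) = - scC (- of_nat n) (cj ((EB ^^ n) g))"
  using fg cj_U0[OF fg(2)]
  by (simp_all add: powE_weight powEB_weight F_Hinf cj_powE cj_powEB scC_minus_left)

lemma SS_Hinf: "f \<in> U0 \<Longrightarrow> g \<in> U0 \<Longrightarrow> SS n f g \<in> Hinf \<pi>"
  unfolding SS_def by (intro Hinf_add mul_Hinf powE_F powEB_F cj_F) auto

lemma SS_Kinv: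
  assumes fg: "f \<in> U0" "g \<in> U0"
  shows "SS n f g \<in> Kinv"
proof (rule Kinv_if_opH[OF SS_Hinf[OF fg]])
  have F: "(EE ^^ n) f \<in> F" "cj ((EE ^^ n) g) \<in> F" "(EB ^^ n) f \<in> F" "cj ((EB ^^ n) g) \<in> F"
    using fg by (auto intro: powE_F powEB_F cj_F)
  show "opHH (SS n f g) = 0"
    unfolding SS_def using F
    by (simp add: op_add mul_Hinf op_mul weights_mul[OF fg] mul_scC_left mul_scC_right mul_minus_right F_scC)
qed

lemma SS_add_left: "f \<in> U0 \<Longrightarrow> f' \<in> U0 \<Longrightarrow> g \<in> U0 \<Longrightarrow> SS n (f + f') g = SS n f g + SS n f' g"
  unfolding SS_def by (simp add: powE_add powEB_add F_Hinf mul_add_left powE_F powEB_F cj_F)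

lemma SS_add_right: "f \<in> U0 \<Longrightarrow> g \<in> U0 \<Longrightarrow> g' \<in> U0 \<Longrightarrow> SS n f (g + g') = SS n f g + SS n f g'"
  unfolding SS_def by (simp add: powE_add powEB_add F_Hinf cj_add mul_add_right powE_F powEB_F cj_F)

lemma SS_scC_left: "f \<in> U0 \<Longrightarrow> g \<in> U0 \<Longrightarrow> SS n (scC c f) g = scC c (SS n f g)"
  unfolding SS_def by (simp add: powE_linear powEB_linear F_Hinf mul_scC_left powE_F powEB_F cj_F scC_add_right)

lemma SS_scC_right: "f \<in> U0 \<Longrightarrow> g \<in> U0 \<Longrightarrow> SS n f (scC c g) = scC (cnj c) (SS n f g)"
  unfolding SS_def by (simp add: powE_linear powEB_linear F_Hinf cj_scC mul_scC_right powE_F powEB_F cj_F scC_add_right)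

lemma casimir_SS_0:
  assumes fg: "f \<in> U0" "g \<in> U0"
  shows "Cas (SS 0 f g) = SS 0 (Cas f) g + SS 0 f (Cas g) - scC 2 (SS 1 f g)"
proof -
  have F: "f \<in> F" "g \<in> F" "cj g \<in> F" using fg cj_F by auto
  have w: "opHH f = scC 0 f" "opHH (cj g) = - scC 0 (cj g)" using weights_mul[OF fg, of 0] by simp_all
  have "Cas (mul f (cj g)) = mul (Cas f) (cj g) + mul f (cj (Cas g)) - SS 1 f g"
    using casimir_mul_weight[OF F(1) F(3) w] F by (simp add: SS_def cj_op algebra_simps)
  then show ?thesis
    using F unfolding SS_0 by (simp add: op_scC mul_Hinf scC_add_right scC_diff_right)
qed

text \<open>Of the two mixed terms in \<open>casimir_mul_weight\<close>, one raises both exponents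
  and the other lowers both, the latter through \<open>EB_powE_Suc\<close> and
  \<open>E_powEB_Suc\<close>.\<close>

lemma casimir_SS_Suc:
  assumes fg: "f \<in> U0" "g \<in> U0"
  shows "Cas (SS (Suc n) f g) = scC (2 * (of_nat (Suc n))\<^sup>2) (SS (Suc n) f g) + SS (Suc n) (Cas f) g + SS (Suc n) f (Cas g)
     - SS (Suc (Suc n)) f g - SS n (lower n f) (lower n g)"
proof -
  let ?n = "Suc n"
  have H: "f \<in> Hinf \<pi>" "f \<in> Kinv" "g \<in> Hinf \<pi>" "g \<in> Kinv" "cj g \<in> Hinf \<pi>" "cj g \<in> Kinv"
    using fg cj_U0[OF fg(2)] F_Hinf by auto
  have F: "(EE ^^ k) f \<in> F" "cj ((EE ^^ k) g) \<in> F" "(EB ^^ k) f \<in> F" "cj ((EB ^^ k) g) \<in> F"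
    "(EE ^^ k) (lower n f) \<in> F" "(EB ^^ k) (lower n f) \<in> F" 
    "cj ((EE ^^ k) (lower n g)) \<in> F" "cj ((EB ^^ k) (lower n g)) \<in> F" for k
    using fg lower_U0[OF fg(1)] lower_U0[OF fg(2)] by (auto intro: powE_F powEB_F cj_F)
  have lg: "lower n (cj g) = cj (lower n g)" using cj_lower[OF fg(2)] by simp
  have e1: "EB ((EE ^^ ?n) f) = - (EE ^^ n) (lower n f)" by (rule EB_powE_Suc[OF H(1,2)])
  have e2: "EE ((EB ^^ ?n) f) = - (EB ^^ n) (lower n f)" by (rule E_powEB_Suc[OF H(1,2)])
  have e3: "EE (cj ((EE ^^ ?n) g)) = - cj ((EE ^^ n) (lower n g))"
    using E_powEB_Suc[OF H(5,6), of n] fg lower_U0[OF fg(2), of n] by (simp add: cj_powE lg del: funpow.simps)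
  have e4: "EB (cj ((EB ^^ ?n) g)) = - cj ((EB ^^ n) (lower n g))"
    using EB_powE_Suc[OF H(5,6), of n] fg lower_U0[OF fg(2), of n] by (simp add: cj_powEB lg del: funpow.simps)
  have e5: "EB (cj ((EE ^^ ?n) g)) = cj ((EE ^^ Suc ?n) g)" "EE (cj ((EB ^^ ?n) g)) = cj ((EB ^^ Suc ?n) g)"
    "EE ((EE ^^ ?n) f) = (EE ^^ Suc ?n) f" "EB ((EB ^^ ?n) f) = (EB ^^ Suc ?n) f"
    using fg by (simp_all add: cj_op powE_F powEB_F op_F)
  have e6: "Cas ((EE ^^ ?n) f) = (EE ^^ ?n) (Cas f)" "Cas ((EB ^^ ?n) f) = (EB ^^ ?n) (Cas f)"
    "Cas (cj ((EE ^^ ?n) g)) = cj ((EE ^^ ?n) (Cas g))" "Cas (cj ((EB ^^ ?n) g)) = cj ((EB ^^ ?n) (Cas g))"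
    using H fg powE_linear(3)[OF H(1), of ?n] powEB_linear(3)[OF H(1), of ?n]
      powE_linear(3)[OF H(3), of ?n] powEB_linear(3)[OF H(3), of ?n]
      cj_op(4)[OF powE_F, of g ?n] cj_op(4)[OF powEB_F, of g ?n] by (simp_all del: funpow.simps)
  have m1: "Cas (mul ((EE ^^ ?n) f) (cj ((EE ^^ ?n) g))) = scC (2 * (of_nat ?n)\<^sup>2) (mul ((EE ^^ ?n) f) (cj ((EE ^^ ?n) g)))
      + mul ((EE ^^ ?n) (Cas f)) (cj ((EE ^^ ?n) g)) + mul ((EE ^^ ?n) f) (cj ((EE ^^ ?n) (Cas g)))
      - mul ((EE ^^ Suc ?n) f) (cj ((EE ^^ Suc ?n) g)) - mul ((EE ^^ n) (lower n f)) (cj ((EE ^^ n) (lower n g)))"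
    using casimir_mul_weight[OF F(1,2) weights_mul(1,2)[OF fg], of ?n, unfolded e1 e3 e5 e6]
    by (simp add: mul_minus_left mul_minus_right F F_minus del: funpow.simps)
  have m2: "Cas (mul ((EB ^^ ?n) f) (cj ((EB ^^ ?n) g))) = scC (2 * (of_nat ?n)\<^sup>2) (mul ((EB ^^ ?n) f) (cj ((EB ^^ ?n) g)))
      + mul ((EB ^^ ?n) (Cas f)) (cj ((EB ^^ ?n) g)) + mul ((EB ^^ ?n) f) (cj ((EB ^^ ?n) (Cas g)))
      - mul ((EB ^^ n) (lower n f)) (cj ((EB ^^ n) (lower n g))) - mul ((EB ^^ Suc ?n) f) (cj ((EB ^^ Suc ?n) g))"
    using casimir_mul_weight[OF F(3,4) weights_mul(3,4)[OF fg], of ?n, unfolded e2 e4 e5 e6 power2_minus]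
    by (simp add: mul_minus_left mul_minus_right F F_minus del: funpow.simps)
  have "Cas (SS ?n f g) = Cas (mul ((EE ^^ ?n) f) (cj ((EE ^^ ?n) g))) + Cas (mul ((EB ^^ ?n) f) (cj ((EB ^^ ?n) g)))"
    unfolding SS_def by (intro op_add mul_Hinf F)
  then show ?thesis
    unfolding m1 m2 unfolding SS_def scC_add_right by (simp only: algebra_simps)
qed

lemma SS_positive:
  assumes "u \<in> F" "w \<in> F"
  shows "0 \<le> Re (cinner (SS n u u) (mul w (cj w)))"
  unfolding SS_def cinner_add_left cnrm_mul[OF powE_F[OF assms(1)] assms(2)] cnrm_mul[OF powEB_F[OF assms(1)] assms(2)]
  by simp

end

section \<open>The local bootstrap inequality\<close>

subsection \<open>Chebyshev polynomials in the variable \<open>1 - y/2\<close>\<close>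

fun TT :: "nat \<Rightarrow> real \<Rightarrow> real" where
  "TT 0 y = 1"
| "TT (Suc 0) y = 1 - y / 2"
| "TT (Suc (Suc n)) y = (2 - y) * TT (Suc n) y - TT n y"

text \<open>\<open>3 T\<^sub>1 + 2 T\<^sub>2 + T\<^sub>3\<close> is, up to a constant, a Fejer kernel.\<close>

lemma TT_fejer:
  assumes "y \<ge> 0"
  shows "3 * TT 1 y + 2 * TT 2 y + TT 3 y \<le> (if y < 9/10 then 7 else 0) - (1 + y) ^ 3 / 100"
proof -
  define c where "c = 1 - y / 2"
  have y: "y = 2 - 2 * c" and y2: "2 - y = 2 * c" by (simp_all add: c_def)
  have t1: "TT (Suc 0) y = c" by (simp add: c_def)
  have t2: "TT (Suc (Suc 0)) y = 2 * c * c - 1" unfolding TT.simps(3) y2 t1 by simp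
  have t3: "TT (Suc (Suc (Suc 0))) y = 2 * c * (2 * c * c - 1) - c" unfolding TT.simps(3)[of "Suc 0"] y2 t1 t2 by simp
  have T: "3 * TT 1 y + 2 * TT 2 y + TT 3 y = 4 * c ^ 3 + 4 * c\<^sup>2 - 2"
    unfolding numeral_2_eq_2 numeral_3_eq_3 One_nat_def t1 t2 t3 by (simp add: algebra_simps)
  \<comment> \<open>The polynomial 4 c^3 + 4 c^2 - 2 changes sign near c = 0.565, that is, y = 0.87.
    The cut 9/10 leaves room for (1 + y)^3 / 100 and stays below 1, so that the low modes lie under
    the window.\<close>
  have "4 * c ^ 3 + 4 * c\<^sup>2 - 2 + (3 - 2 * c) ^ 3 / 100 \<le> (if y < 9/10 then 7 else 0)"
  proof (cases "y < 9/10")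
    case True
    then have c: "c \<ge> 55/100" "c \<le> 1" using assms unfolding c_def by auto
    then have "c ^ 3 \<le> 1" "c\<^sup>2 \<le> 1" by (auto intro!: power_le_one)
    moreover have "(3 - 2 * c) ^ 3 \<le> 2 ^ 3" using c by (intro power_mono) auto
    ultimately show ?thesis using True by simp
  next
    case False
    then have c: "c \<le> 55/100" unfolding c_def by auto
    have e: "100 * (4 * c ^ 3 + 4 * c\<^sup>2 - 2) + (3 - 2 * c) ^ 3 = 392 * c ^ 3 + 436 * c\<^sup>2 - 54 * c - 173"
      by (simp add: power2_eq_square power3_eq_cube algebra_simps)
    have "392 * c ^ 3 + 436 * c\<^sup>2 - 54 * c - 173 \<le> 0"
    proof (cases "c \<ge> 0")
      case True
      have "c\<^sup>2 \<le> (55/100)\<^sup>2" "c ^ 3 \<le> (55/100) ^ 3" using c True by (intro power_mono; simp)+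
      moreover have "0 \<le> c * (55/100 - c)" using c True by simp
      ultimately show ?thesis using c by (simp add: power2_eq_square power3_eq_cube algebra_simps)
    next
      case False
      define s where "s = - c"
      have s: "s > 0" using False by (simp add: s_def)
      \<comment> \<open>4/5 is close to the local minimum of the cubic in s. The linear factor
        matches its two top coefficients and leaves the positive remainder 1.04 s + 50.632.\<close>
      have "0 \<le> (s - 4/5)\<^sup>2 * (392 * s + 956/5)" using s by simp
      then have "0 \<le> 392 * s ^ 3 - 436 * s\<^sup>2 - 54 * s + 173"
        using s by (simp add: power2_eq_square power3_eq_cube algebra_simps)
      then show ?thesis unfolding s_def by (simp add: power2_eq_square power3_eq_cube)
    qed
    then show ?thesis using e False by simp
  qed
  then show ?thesis unfolding T unfolding y by (simp add: algebra_simps)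
qed

text \<open>Each recursion step multiplies the leading term by -y, and the factor 2 removes the 1/2
  in T_1. The negative sign at odd index is what \<open>high_moments\<close> exploits.\<close>

lemma TT_leading: "\<exists>C\<ge>0. \<forall>y\<ge>0. \<bar>2 * TT (Suc n) y - (- y) ^ Suc n\<bar> \<le> C * (1 + y) ^ n"
proof (induction n rule: induct_nat_012)
  case 0
  show ?case by (intro exI[of _ 2]) simp
next
  case 1
  have "2 * TT (Suc (Suc 0)) y - (- y) ^ Suc (Suc 0) = 2 - 4 * y" for y
    by (simp add: field_simps power2_eq_square)
  then have "\<bar>2 * TT (Suc (Suc 0)) y - (- y) ^ Suc (Suc 0)\<bar> \<le> 4 * (1 + y) ^ Suc 0" if "y \<ge> 0" for y
    using that by (simp only:) (simp add: abs_le_iff)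
  then show ?case by (intro exI[of _ 4]) auto
next
  case (ge2 n)
  then obtain C1 C2 where C: "C1 \<ge> 0" "C2 \<ge> 0"
    "\<And>y. y \<ge> 0 \<Longrightarrow> \<bar>2 * TT (Suc n) y - (- y) ^ Suc n\<bar> \<le> C1 * (1 + y) ^ n"
    "\<And>y. y \<ge> 0 \<Longrightarrow> \<bar>2 * TT (Suc (Suc n)) y - (- y) ^ Suc (Suc n)\<bar> \<le> C2 * (1 + y) ^ Suc n" by blast
  have "\<bar>2 * TT (Suc (Suc (Suc n))) y - (- y) ^ Suc (Suc (Suc n))\<bar> \<le> (2 * C2 + C1 + 3) * (1 + y) ^ Suc (Suc n)" if y: "y \<ge> 0" for y
  proof -
    let ?A = "2 * TT (Suc (Suc n)) y - (- y) ^ Suc (Suc n)" and ?B = "2 * TT (Suc n) y - (- y) ^ Suc n"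
    have "2 * TT (Suc (Suc (Suc n))) y - (- y) ^ Suc (Suc (Suc n)) = (2 - y) * ?A - ?B + 2 * (- y) ^ Suc (Suc n) - (- y) ^ Suc n"
      by (simp add: algebra_simps)
    also have "\<bar>\<dots>\<bar> \<le> \<bar>2 - y\<bar> * \<bar>?A\<bar> + \<bar>?B\<bar> + 2 * y ^ Suc (Suc n) + y ^ Suc n"
    proof -
      have "\<bar>a - b + 2 * p - q\<bar> \<le> \<bar>a\<bar> + \<bar>b\<bar> + 2 * \<bar>p\<bar> + \<bar>q\<bar>" for a b p q :: real by arith
      from this[of "(2 - y) * ?A" ?B "(- y) ^ Suc (Suc n)" "(- y) ^ Suc n"]
      show ?thesis unfolding abs_mult[of "2 - y"] power_abs abs_minus_cancel abs_of_nonneg[OF y] .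
    qed
    also have "\<dots> \<le> (2 * (1 + y)) * (C2 * (1 + y) ^ Suc n) + C1 * (1 + y) ^ n + 2 * (1 + y) ^ Suc (Suc n) + (1 + y) ^ Suc n"
      using y C by (intro add_mono mult_mono mult_left_mono power_mono C) auto
    also have "\<dots> \<le> (2 * (1 + y)) * (C2 * (1 + y) ^ Suc n) + C1 * (1 + y) ^ Suc (Suc n) + 2 * (1 + y) ^ Suc (Suc n) + (1 + y) ^ Suc (Suc n)"
      using y C by (intro add_mono mult_left_mono power_increasing order_refl) auto
    also have "\<dots> = (2 * C2 + C1 + 3) * (1 + y) ^ Suc (Suc n)" by (simp add: algebra_simps)
    finally show ?thesis .
  qed
  then show ?case using C by (intro exI[of _ "2 * C2 + C1 + 3"]) auto
qed

text \<open>The constants bounding the weight-\<open>n\<close> product against its Chebyshev approximation.\<close>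

fun KK :: "nat \<Rightarrow> real" where
  "KK 0 = 2"
| "KK (Suc 0) = 4"
| "KK (Suc (Suc n)) = (6 + 2 * (real (Suc n))\<^sup>2) * KK (Suc n) + (1 + (2 + real (n * (n + 1)))\<^sup>2) * KK n"

lemma KK_nonneg: "KK n \<ge> 0"
  by (induction n rule: KK.induct) auto

section \<open>Bounded sums and window subspaces\<close>

context mrep
begin

text \<open>For nonnegative f this is summability with total at most B. Finite partial sums allow
  termwise comparison and addition without convergence conditions.\<close>

definition bs :: "(nat \<Rightarrow> real) \<Rightarrow> real \<Rightarrow> bool" where
  "bs f B \<longleftrightarrow> (\<forall>A. finite A \<and> A \<subseteq> J \<longrightarrow> sum f A \<le> B)"

lemma bs_mono: "bs f B \<Longrightarrow> (\<And>k. k \<in> J \<Longrightarrow> g k \<le> f k) \<Longrightarrow> B \<le> B' \<Longrightarrow> bs g B'"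
  unfolding bs_def by (meson order_trans subsetD sum_mono)

lemma bs_add: "bs f B \<Longrightarrow> bs g C \<Longrightarrow> bs (\<lambda>k. f k + g k) (B + C)"
  unfolding bs_def by (auto simp: sum.distrib intro: add_mono)

lemma bs_cmult: "bs f B \<Longrightarrow> 0 \<le> c \<Longrightarrow> bs (\<lambda>k. c * f k) (c * B)"
  unfolding bs_def by (auto simp flip: sum_distrib_left intro: mult_left_mono)

lemma bs_0: "bs (\<lambda>k. 0) 0"
  unfolding bs_def by simp

lemma bs_nonneg: "bs f B \<Longrightarrow> 0 \<le> B"
  unfolding bs_def by (metis empty_subsetI finite.emptyI sum.empty)

lemma bs_summable:
  assumes "bs f B" "\<And>k. k \<in> J \<Longrightarrow> f k \<ge> 0"
  shows "f summable_on J" "infsum f J \<le> B"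
proof -
  have "bdd_above (sum f ` {A. A \<subseteq> J \<and> finite A})"
    using assms(1) unfolding bs_def by (intro bdd_aboveI[of _ B]) auto
  then show s: "f summable_on J" by (intro nonneg_bdd_above_summable_on assms(2)) auto
  show "infsum f J \<le> B" using assms(1) unfolding bs_def by (intro infsum_le_finite_sums s) auto
qed

lemma bs_infsum:
  assumes "f summable_on J" "\<And>k. k \<in> J \<Longrightarrow> f k \<ge> 0"
  shows "bs f (infsum f J)"
  unfolding bs_def using finite_sum_le_infsum[OF assms(1)] assms(2) by auto

text \<open>The total of G is nonnegative and may be dropped from the summed inequality; this is how
  positivity of a pairing becomes an estimate.\<close>

lemma bs_from_has_sum:
  assumes G: "(G has_sum s) J" "s \<ge> 0" and q: "bs q Q" "\<And>k. k \<in> J \<Longrightarrow> q k \<ge> 0"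
    and f: "\<And>k. k \<in> J \<Longrightarrow> 0 \<le> f k" "\<And>k. k \<in> J \<Longrightarrow> f k + G k \<le> q k"
  shows "bs f Q"
proof -
  note qs = bs_summable[OF q]
  have d: "((\<lambda>k. q k + - G k) has_sum (infsum q J + - s)) J"
    by (intro has_sum_add has_sum_infsum qs has_sum_uminusI G)
  then have ds: "(\<lambda>k. q k + - G k) summable_on J" by (rule has_sum_imp_summable)
  have le: "0 \<le> f k" "f k \<le> q k + - G k" if "k \<in> J" for k using f that by force+
  have "bs (\<lambda>k. q k + - G k) (infsum q J + - s)"
    using bs_infsum[OF ds] le infsumI[OF d] by force
  then show ?thesis by (rule bs_mono) (use le qs G(2) in auto)
qed

definition wspan :: "nat set \<Rightarrow> 'h set" where "wspan S = {u \<in> U0. \<forall>i\<in>J - S. coef u i = 0}"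

lemma wspan_U0: "u \<in> wspan S \<Longrightarrow> u \<in> U0" "u \<in> wspan S \<Longrightarrow> u \<in> F" "u \<in> wspan S \<Longrightarrow> u \<in> Kinv" "u \<in> wspan S \<Longrightarrow> u \<in> Hinf \<pi>"
  using F_Hinf unfolding wspan_def by auto

lemma wspan_subspace: "mr_csubspace (wspan S)"
  using mr_csubspaceD[OF U0_subspace] unfolding mr_csubspace_def wspan_def
  by (auto simp: coef_def cinner_simps)

lemma wspan_expand:
  assumes S: "finite S" "S \<subseteq> J" and u: "u \<in> wspan S"
  shows "u = (\<Sum>i\<in>S. scC (coef u i) (ev i))"
proof -
  obtain A where A: "finite A" "A \<subseteq> J" "u = (\<Sum>i\<in>A. scC (coef u i) (ev i))"
    using Kinv_F_expand[OF wspan_U0(2,3)[OF u]] by blast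
  have nz: "coef u i = 0" if "i \<in> J" "i \<notin> A" for i
    using coef_sum_ev[OF A(1,2) that(1), of "coef u"] that(2) A(3) by simp
  have 1: "(\<Sum>i\<in>A. scC (coef u i) (ev i)) = (\<Sum>i\<in>A \<union> S. scC (coef u i) (ev i))"
    using A(1,2) S nz by (intro sum.mono_neutral_left) auto
  have "(\<Sum>i\<in>S. scC (coef u i) (ev i)) = (\<Sum>i\<in>A \<union> S. scC (coef u i) (ev i))"
    using A(1,2) S u unfolding wspan_def by (intro sum.mono_neutral_left) auto
  then show ?thesis using A(3) 1 by simp
qed

lemma wspan_norm: "finite S \<Longrightarrow> S \<subseteq> J \<Longrightarrow> u \<in> wspan S \<Longrightarrow> (cnrm u)\<^sup>2 = (\<Sum>i\<in>S. (cmod (coef u i))\<^sup>2)"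
  using cnrm_residual_coef[of S u] wspan_expand[of S u] by simp

end

text \<open>The Casimir on the window is L (1 + O(\<delta>)), and
  \<open>1 \<le> \<delta> * L\<close> lets the weight-dependent terms of relative size 1/L be
  charged to \<delta> as well.\<close>

locale window = mrep +
  fixes S :: "nat set" and L \<delta> :: real
  assumes S: "finite S" "S \<subseteq> J" and d: "0 < \<delta>" "\<delta> \<le> 1" and L: "1 \<le> \<delta> * L"
    and range: "i \<in> S \<Longrightarrow> L \<le> lam i" "i \<in> S \<Longrightarrow> lam i \<le> (1 + \<delta>) * L"
begin

lemma Lpos: "L > 0"
  using L d by (smt (verit) mult_nonneg_nonpos)

definition win :: "'a set" where "win = wspan S"

definition win1 :: "'a set" where "win1 = {u \<in> win. cnrm u \<le> 1}"

definition y :: "nat \<Rightarrow> real" where "y k = lam k / L"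

lemma y_nonneg: "k \<in> J \<Longrightarrow> y k \<ge> 0"
  unfolding y_def using lam_nonneg Lpos by simp

lemmas win_U0 = wspan_U0[of _ S, folded win_def]

lemma win_subspace: "mr_csubspace win"
  unfolding win_def by (rule wspan_subspace)

lemmas win_expand = wspan_expand[OF S, folded win_def]
  and win_norm = wspan_norm[OF S, folded win_def]

lemma win_Cas: "u \<in> win \<Longrightarrow> Cas u \<in> win"
  using casimir_U0 unfolding win_def wspan_def by (auto simp: coef_casimir F_Hinf)

lemma win_mult_norm:
  assumes u: "u \<in> win" "v \<in> win" and le: "\<And>i. i \<in> S \<Longrightarrow> cmod (coef v i) \<le> r * cmod (coef u i)" and r: "r \<ge> 0"
  shows "cnrm v \<le> r * cnrm u"
proof (rule power2_le_imp_le)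
  have "(cnrm v)\<^sup>2 \<le> (\<Sum>i\<in>S. (r * cmod (coef u i))\<^sup>2)"
    unfolding win_norm[OF u(2)] by (intro sum_mono power_mono le) auto
  also have "\<dots> = (r * cnrm u)\<^sup>2"
    unfolding power_mult_distrib win_norm[OF u(1)] sum_distrib_left ..
  finally show "(cnrm v)\<^sup>2 \<le> (r * cnrm u)\<^sup>2" .
qed (use r in simp)

text \<open>On the window, Cas = L (1 + \<delta> DD) with \<open>DD\<close> a contraction; likewise
  \<open>lower n\<close> becomes L (1 + \<delta> GG n).\<close>

definition DD :: "'a \<Rightarrow> 'a" where
  "DD u = scC (complex_of_real (1 / (\<delta> * L))) (Cas u - scC (complex_of_real L) u)"

definition GG :: "nat \<Rightarrow> 'a \<Rightarrow> 'a" where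
  "GG n u = DD u + scC (complex_of_real (real (n * (n + 1)) / (\<delta> * L))) u"

lemma DD_win: "u \<in> win \<Longrightarrow> DD u \<in> win"
  unfolding DD_def by (intro mr_csubspaceD[OF win_subspace] win_Cas)

lemma GG_win: "u \<in> win \<Longrightarrow> GG n u \<in> win"
  unfolding GG_def by (intro mr_csubspaceD[OF win_subspace] DD_win)

lemma DD_norm: "u \<in> win \<Longrightarrow> cnrm (DD u) \<le> cnrm u"
proof -
  assume u: "u \<in> win"
  have "cmod (coef (DD u) i) \<le> 1 * cmod (coef u i)" if i: "i \<in> S" for i
  proof -
    have "coef (DD u) i = complex_of_real ((lam i - L) / (\<delta> * L)) * coef u i"
      unfolding DD_def using S(2) i win_U0[OF u] by (simp add: coef_scC coef_diff coef_casimir subset_iff field_simps)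
    moreover have "\<bar>(lam i - L) / (\<delta> * L)\<bar> \<le> 1"
      using range[OF i] d Lpos by (simp add: field_simps)
    ultimately show ?thesis by (simp only: norm_mult norm_of_real) (intro mult_right_mono; simp)
  qed
  from win_mult_norm[OF u DD_win[OF u] this] show ?thesis by simp
qed

lemma GG_norm: "u \<in> win \<Longrightarrow> cnrm (GG n u) \<le> (1 + real (n * (n + 1))) * cnrm u"
proof -
  assume u: "u \<in> win"
  have "1 / (\<delta> * L) \<le> 1" using L by simp
  then have "real (n * (n + 1)) * (1 / (\<delta> * L)) \<le> real (n * (n + 1)) * 1" by (intro mult_left_mono) auto
  then have "real (n * (n + 1)) / (\<delta> * L) * cnrm u \<le> real (n * (n + 1)) * cnrm u" by (intro mult_right_mono) auto
  moreover have "cnrm (GG n u) \<le> cnrm (DD u) + real (n * (n + 1)) / (\<delta> * L) * cnrm u"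
    unfolding GG_def using cnrm_triangle[of "DD u" "scC (complex_of_real (real (n * (n + 1)) / (\<delta> * L))) u"] L
    by (simp only: cnrm_scC norm_of_real) simp
  ultimately show ?thesis using DD_norm[OF u] by (simp add: distrib_right)
qed

lemma Cas_DD: "u \<in> win \<Longrightarrow> Cas u = scC (complex_of_real L) u + scC (complex_of_real (\<delta> * L)) (DD u)"
  unfolding DD_def scC_scC using Lpos d by (simp add: scC_one flip: of_real_mult)

lemma lower_GG: "u \<in> win \<Longrightarrow> lower n u = scC (complex_of_real L) u + scC (complex_of_real (\<delta> * L)) (GG n u)"
proof -
  assume u: "u \<in> win"
  have "\<delta> * L * (real (n * (n + 1)) / (\<delta> * L)) = real (n * (n + 1))" using Lpos d by simp
  then have "complex_of_real (\<delta> * L) * complex_of_real (real (n * (n + 1)) / (\<delta> * L)) = of_nat (n * (n + 1))"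
    by (metis of_real_mult of_real_of_nat_eq)
  then show ?thesis
    unfolding lower_def GG_def by (simp only: scC_add_right scC_scC Cas_DD[OF u] add.assoc)
qed

definition pr :: "'a \<Rightarrow> 'a \<Rightarrow> nat \<Rightarrow> complex" where
  "pr f g k = coef (mul f (cj g)) k"

definition hat :: "nat \<Rightarrow> 'a \<Rightarrow> 'a \<Rightarrow> nat \<Rightarrow> complex" where
  "hat n f g k = coef (SS n f g) k / complex_of_real (L ^ n)"

lemma coef_SS: "coef (SS n f g) k = complex_of_real (L ^ n) * hat n f g k"
  unfolding hat_def using Lpos by simp

lemma hat_0: "hat 0 f g k = 2 * pr f g k"
  by (simp add: hat_def pr_def SS_0 coef_scC)

lemma SS_Cas_left: "f \<in> win \<Longrightarrow> g \<in> win \<Longrightarrow>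
    SS n (Cas f) g = scC (complex_of_real L) (SS n f g) + scC (complex_of_real (\<delta> * L)) (SS n (DD f) g)"
  unfolding Cas_DD by (simp add: SS_add_left SS_scC_left win_U0(1) DD_win mr_csubspaceD[OF U0_subspace] del: of_real_mult Int_iff)

lemma SS_Cas_right: "f \<in> win \<Longrightarrow> g \<in> win \<Longrightarrow>
    SS n f (Cas g) = scC (complex_of_real L) (SS n f g) + scC (complex_of_real (\<delta> * L)) (SS n f (DD g))"
  unfolding Cas_DD by (simp add: SS_add_right SS_scC_right win_U0(1) DD_win mr_csubspaceD[OF U0_subspace] del: of_real_mult Int_iff)

lemma SS_lower: "f \<in> win \<Longrightarrow> g \<in> win \<Longrightarrow>
    SS n (lower n f) (lower n g) = scC (complex_of_real (L * L)) (SS n f g + scC (complex_of_real \<delta>) (SS n (GG n f) g)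
      + scC (complex_of_real \<delta>) (SS n f (GG n g)) + scC (complex_of_real (\<delta> * \<delta>)) (SS n (GG n f) (GG n g)))"
  unfolding lower_GG
  by (simp add: SS_add_left SS_add_right SS_scC_left SS_scC_right win_U0(1) GG_win mr_csubspaceD[OF U0_subspace] scC_add_right scC_scC
      add_ac mult_ac del: Int_iff)

lemma lam_y: "complex_of_real (lam k) = complex_of_real L * complex_of_real (y k)"
  unfolding y_def using Lpos by simp

lemma hat_1:
  assumes f: "f \<in> win" and g: "g \<in> win" and k: "k \<in> J"
  shows "hat 1 f g k = complex_of_real (1 - y k / 2) * hat 0 f g k + complex_of_real (\<delta> / 2) * (hat 0 (DD f) g k + hat 0 f (DD g) k)"
proof -
  note U = win_U0(1)[OF f] win_U0(1)[OF g]
  have "coef (Cas (SS 0 f g)) k = coef (SS 0 (Cas f) g + SS 0 f (Cas g) - scC 2 (SS 1 f g)) k"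
    using casimir_SS_0[OF U] by simp
  then have "complex_of_real L * (complex_of_real (y k) * hat 0 f g k) = complex_of_real L * (2 * hat 0 f g k
     + complex_of_real \<delta> * (hat 0 (DD f) g k + hat 0 f (DD g) k) - 2 * hat 1 f g k)"
    unfolding coef_casimir[OF k SS_Hinf[OF U]] SS_Cas_left[OF f g] SS_Cas_right[OF f g] coef_add coef_diff coef_scC coef_SS lam_y
    by (simp add: algebra_simps)
  then have "complex_of_real (y k) * hat 0 f g k = 2 * hat 0 f g k
     + complex_of_real \<delta> * (hat 0 (DD f) g k + hat 0 f (DD g) k) - 2 * hat 1 f g k"
    unfolding mult_cancel_left using Lpos by simp
  then have "hat 1 f g k = (2 * hat 0 f g k + complex_of_real \<delta> * (hat 0 (DD f) g k + hat 0 f (DD g) k)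
      - complex_of_real (y k) * hat 0 f g k) / 2" by simp
  then show ?thesis by (simp only:) (simp add: field_simps)
qed

text \<open>Spectral coefficients of \<open>casimir_SS_Suc\<close>, divided by L^(n+2). At \<delta>
  = 0 this would be the Chebyshev recursion in 1 - y/2; every deviation is gathered behind the
  factor \<delta>.\<close>

lemma hat_Suc_Suc:
  assumes f: "f \<in> win" and g: "g \<in> win" and k: "k \<in> J"
  shows "hat (Suc (Suc n)) f g k = complex_of_real (2 - y k) * hat (Suc n) f g k - hat n f g k
     + complex_of_real \<delta> * (complex_of_real (2 * (real (Suc n))\<^sup>2 / (\<delta> * L)) * hat (Suc n) f g k + hat (Suc n) (DD f) g k + hat (Suc n) f (DD g) k
     - hat n (GG n f) g k - hat n f (GG n g) k - complex_of_real \<delta> * hat n (GG n f) (GG n g) k)"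
proof -
  note U = win_U0(1)[OF f] win_U0(1)[OF g]
  define M where "M = complex_of_real (2 * (real (Suc n))\<^sup>2 / (\<delta> * L))"
  have M: "2 * (of_nat (Suc n))\<^sup>2 = complex_of_real L * (complex_of_real \<delta> * M)"
    unfolding M_def using Lpos d by (simp del: of_nat_Suc)
  have "coef (Cas (SS (Suc n) f g)) k = coef (scC (2 * (of_nat (Suc n))\<^sup>2) (SS (Suc n) f g) + SS (Suc n) (Cas f) g + SS (Suc n) f (Cas g)
     - SS (Suc (Suc n)) f g - SS n (lower n f) (lower n g)) k"
    using casimir_SS_Suc[OF U, of n] by simp
  then have "complex_of_real (L ^ Suc (Suc n)) * (complex_of_real (y k) * hat (Suc n) f g k)
     = complex_of_real (L ^ Suc (Suc n)) * (complex_of_real \<delta> * M * hat (Suc n) f g k + 2 * hat (Suc n) f g k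
     + complex_of_real \<delta> * (hat (Suc n) (DD f) g k + hat (Suc n) f (DD g) k) - hat (Suc (Suc n)) f g k
     - (hat n f g k + complex_of_real \<delta> * hat n (GG n f) g k + complex_of_real \<delta> * hat n f (GG n g) k
        + complex_of_real (\<delta> * \<delta>) * hat n (GG n f) (GG n g) k))"
    unfolding coef_casimir[OF k SS_Hinf[OF U]] SS_Cas_left[OF f g] SS_Cas_right[OF f g] SS_lower[OF f g] coef_add coef_diff coef_scC coef_SS lam_y M
    by (simp add: algebra_simps)
  then have "complex_of_real (y k) * hat (Suc n) f g k
     = complex_of_real \<delta> * M * hat (Suc n) f g k + 2 * hat (Suc n) f g k
     + complex_of_real \<delta> * (hat (Suc n) (DD f) g k + hat (Suc n) f (DD g) k) - hat (Suc (Suc n)) f g k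
     - (hat n f g k + complex_of_real \<delta> * hat n (GG n f) g k + complex_of_real \<delta> * hat n f (GG n g) k
        + complex_of_real (\<delta> * \<delta>) * hat n (GG n f) (GG n g) k)"
    unfolding mult_cancel_left using Lpos by simp
  then show ?thesis unfolding M_def[symmetric] by (simp add: algebra_simps)
qed

text \<open>Sequences of degree at most \<open>d\<close> in \<open>y\<close> over products of unit window vectors, with total mass \<open>c\<close>.\<close>

inductive Dom :: "nat \<Rightarrow> real \<Rightarrow> (nat \<Rightarrow> complex) \<Rightarrow> bool" where
  Dom_base: "f \<in> win1 \<Longrightarrow> g \<in> win1 \<Longrightarrow> (\<And>k. k \<in> J \<Longrightarrow> \<bar>m k\<bar> \<le> (1 + y k) ^ d) \<Longrightarrow> Dom d 1 (\<lambda>k. complex_of_real (m k) * pr f g k)"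
| Dom_add: "Dom d c G \<Longrightarrow> Dom d c' G' \<Longrightarrow> Dom d (c + c') (\<lambda>k. G k + G' k)"
| Dom_scale: "Dom d c G \<Longrightarrow> Dom d (\<bar>z\<bar> * c) (\<lambda>k. complex_of_real z * G k)"
| Dom_weak: "Dom d c G \<Longrightarrow> d \<le> d' \<Longrightarrow> c \<le> c' \<Longrightarrow> (\<And>k. k \<in> J \<Longrightarrow> G' k = G k) \<Longrightarrow> Dom d' c' G'"

lemma Dom_nonneg: "Dom d c G \<Longrightarrow> 0 \<le> c"
  by (induction rule: Dom.induct) auto

lemma Dom_scale': "Dom d c G \<Longrightarrow> \<bar>z\<bar> \<le> r \<Longrightarrow> Dom d (r * c) (\<lambda>k. complex_of_real z * G k)"
  by (rule Dom_weak[OF Dom_scale]) (auto intro: mult_right_mono Dom_nonneg)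

lemma Dom_diff: "Dom d c G \<Longrightarrow> Dom d c' G' \<Longrightarrow> Dom d (c + c') (\<lambda>k. G k - G' k)"
  by (rule Dom_weak[OF Dom_add[OF _ Dom_scale[of _ _ _ "-1"]]]) auto

lemma Dom_mult:
  assumes "Dom d c G" "\<And>k. k \<in> J \<Longrightarrow> \<bar>q k\<bar> \<le> (1 + y k) ^ e"
  shows "Dom (d + e) c (\<lambda>k. complex_of_real (q k) * G k)"
  using assms(1)
proof (induction rule: Dom.induct)
  case (Dom_base f g m d)
  have "Dom (d + e) 1 (\<lambda>k. complex_of_real (q k * m k) * pr f g k)"
  proof (rule Dom.Dom_base)
    fix k assume k: "k \<in> J"
    show "\<bar>q k * m k\<bar> \<le> (1 + y k) ^ (d + e)"
      unfolding abs_mult power_add mult.commute[of "(1 + y k) ^ d"]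
      using assms(2)[OF k] Dom_base(3)[OF k] y_nonneg[OF k] by (intro mult_mono) auto
  qed (use Dom_base in auto)
  then show ?case by (simp add: mult.assoc)
next
  case (Dom_add d c G c' G')
  then show ?case using Dom.Dom_add by (fastforce simp: distrib_left)
next
  case (Dom_scale d c G z)
  from Dom.Dom_scale[OF Dom_scale.IH, of z] show ?case by (simp add: mult.left_commute)
next
  case (Dom_weak d c G d' c' G')
  from Dom.Dom_weak[OF Dom_weak.IH, of "d' + e" c' "\<lambda>k. complex_of_real (q k) * G' k"] Dom_weak.hyps show ?case by simp
qed

lemma Dom_mult_2:
  assumes "Dom d c G"
  shows "Dom (Suc d) (2 * c) (\<lambda>k. complex_of_real (2 - y k) * G k)"
proof -
  have "\<bar>(2 - y k) / 2\<bar> \<le> (1 + y k) ^ 1" if "k \<in> J" for k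
    using y_nonneg[OF that] by (simp add: abs_le_iff)
  from Dom_scale[OF Dom_mult[OF assms this], of 2] show ?thesis
    by (rule Dom_weak) (auto simp: field_simps)
qed

lemma hat_scale:
  assumes "f \<in> win" "g \<in> win"
  shows "hat n (scC (complex_of_real r) f) g k = complex_of_real r * hat n f g k"
    "hat n f (scC (complex_of_real r) g) k = complex_of_real r * hat n f g k"
  using win_U0(1)[OF assms(1)] win_U0(1)[OF assms(2)]
  by (simp_all add: hat_def SS_scC_left SS_scC_right coef_scC del: Int_iff)

lemma win1_scale:
  assumes "f \<in> win" "cnrm f \<le> r" "r > 0"
  shows "scC (complex_of_real (1 / r)) f \<in> win1" "f = scC (complex_of_real r) (scC (complex_of_real (1 / r)) f)"
proof -
  have "scC (complex_of_real (1 / r)) f \<in> win" by (intro mr_csubspaceD[OF win_subspace] assms)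
  moreover have "cnrm (scC (complex_of_real (1 / r)) f) \<le> 1" unfolding cnrm_scC norm_of_real using assms by simp
  ultimately show "scC (complex_of_real (1 / r)) f \<in> win1" unfolding win1_def by blast
  show "f = scC (complex_of_real r) (scC (complex_of_real (1 / r)) f)"
    unfolding scC_scC using assms(3) by (simp add: scC_one flip: of_real_mult)
qed

lemma win1_win: "f \<in> win1 \<Longrightarrow> f \<in> win" "f \<in> win1 \<Longrightarrow> cnrm f \<le> 1"
  by (auto simp: win1_def)

lemma Dom_hat_scaled:
  assumes H: "\<And>f g. f \<in> win1 \<Longrightarrow> g \<in> win1 \<Longrightarrow> Dom n (KK n) (hat n f g)"
    and f: "f \<in> win" "cnrm f \<le> r" "r > 0" and g: "g \<in> win" "cnrm g \<le> r'" "r' > 0"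
  shows "Dom n (r * r' * KK n) (hat n f g)"
proof -
  let ?f = "scC (complex_of_real (1 / r)) f" and ?g = "scC (complex_of_real (1 / r')) g"
  note sf = win1_scale[OF f] and sg = win1_scale[OF g]
  have e: "hat n f g k = complex_of_real (r * r') * hat n ?f ?g k" for k
    using hat_scale(1)[OF win1_win(1)[OF sf(1)] g(1), of n r k, folded sf(2)]
      hat_scale(2)[OF win1_win(1)[OF sf(1)] win1_win(1)[OF sg(1)], of n r' k, folded sg(2)] by simp
  have "Dom n (\<bar>r * r'\<bar> * KK n) (\<lambda>k. complex_of_real (r * r') * hat n ?f ?g k)"
    by (intro Dom_scale H sf sg)
  then show ?thesis by (rule Dom_weak) (use f(3) g(3) e in auto)
qed

text \<open>Size and error are bounded together and uniformly over the window: the error at step n +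
  2 contains \<open>hat\<close> at perturbed arguments such as \<open>DD f\<close> and
  \<open>GG n f\<close>, and thanks to the factor \<delta> only their size matters. The
  perturbations stop at \<open>hat (Suc n)\<close>, so the error has one degree less in y, which
  later keeps it below the moment being bounded.\<close>

lemma Dom_hat:
  "f \<in> win1 \<Longrightarrow> g \<in> win1 \<Longrightarrow> Dom n (KK n) (hat n f g) \<and>
     Dom (n - 1) (\<delta> * KK n) (\<lambda>k. hat n f g k - complex_of_real (2 * TT n (y k)) * pr f g k)"
proof (induction n arbitrary: f g rule: KK.induct)
  case 1
  have b: "Dom 0 1 (\<lambda>k. complex_of_real 1 * pr f g k)" by (rule Dom_base[OF 1]) simp
  have "Dom 0 (KK 0) (hat 0 f g)" by (rule Dom_weak[OF Dom_scale[OF b, of 2]]) (auto simp: hat_0)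
  \<comment> \<open>Truncated subtraction gives degree 0 here; the error itself vanishes, since
    \<open>hat 0\<close> is exactly twice \<open>pr\<close>.\<close>
  moreover have "Dom (0 - 1) (\<delta> * KK 0) (\<lambda>k. hat 0 f g k - complex_of_real (2 * TT 0 (y k)) * pr f g k)"
    by (rule Dom_weak[OF Dom_scale[OF b, of 0]]) (use d in \<open>auto simp: hat_0\<close>)
  ultimately show ?case by blast
next
  case 2
  note w = win1_win[OF 2(1)] win1_win[OF 2(2)]
  have H0: "Dom 0 (KK 0) (hat 0 f' g')" if "f' \<in> win1" "g' \<in> win1" for f' g'
    by (rule Dom_weak[OF Dom_scale[OF Dom_base[OF that, where d=0 and m="\<lambda>_. 1"], of 2]]) (auto simp: hat_0)
  have dd: "DD f \<in> win1" "DD g \<in> win1"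
    using DD_win DD_norm w unfolding win1_def by (auto intro: order_trans)
  have e: "hat 1 f g k - complex_of_real (2 * TT 1 (y k)) * pr f g k = complex_of_real (\<delta> / 2) * (hat 0 (DD f) g k + hat 0 f (DD g) k)"
    if "k \<in> J" for k
    unfolding hat_1[OF w(1) w(3) that] by (simp add: hat_0)
  have s: "Dom 0 (\<bar>\<delta> / 2\<bar> * (KK 0 + KK 0)) (\<lambda>k. complex_of_real (\<delta> / 2) * (hat 0 (DD f) g k + hat 0 f (DD g) k))"
    by (intro Dom_scale Dom_add H0 dd 2)
  have err: "Dom 0 (\<delta> * 2) (\<lambda>k. hat 1 f g k - complex_of_real (2 * TT 1 (y k)) * pr f g k)"
    by (rule Dom_weak[OF s]) (use d e in auto)
  have "Dom 1 1 (\<lambda>k. complex_of_real (TT 1 (y k)) * pr f g k)"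
  proof (rule Dom_base[OF 2])
    fix k assume "k \<in> J"
    from y_nonneg[OF this] show "\<bar>TT 1 (y k)\<bar> \<le> (1 + y k) ^ 1" by (simp add: abs_le_iff)
  qed
  from Dom_add[OF Dom_scale[OF this, of 2] Dom_weak[OF err, of 1 "\<delta> * 2", OF _ _ refl]]
  have h: "Dom 1 (2 + \<delta> * 2) (\<lambda>k. complex_of_real 2 * (complex_of_real (TT 1 (y k)) * pr f g k) + (hat 1 f g k - complex_of_real (2 * TT 1 (y k)) * pr f g k))"
    by simp
  have "Dom 1 (KK 1) (hat 1 f g)" by (rule Dom_weak[OF h]) (use d in auto)
  moreover have "Dom 0 (\<delta> * KK 1) (\<lambda>k. hat 1 f g k - complex_of_real (2 * TT 1 (y k)) * pr f g k)"
    by (rule Dom_weak[OF err]) (use d in auto)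
  ultimately show ?case by simp
next
  case (3 n)
  note w = win1_win[OF 3(3)] win1_win[OF 3(4)]
  define \<gamma> where "\<gamma> = 1 + real (n * (n + 1))"
  have \<gamma>: "\<gamma> > 0" unfolding \<gamma>_def by (simp add: add_pos_nonneg)
  have dd: "DD f \<in> win1" "DD g \<in> win1"
    using DD_win DD_norm w unfolding win1_def by (auto intro: order_trans)
  have gg: "cnrm (GG n f) \<le> \<gamma>" "cnrm (GG n g) \<le> \<gamma>"
    using GG_norm[OF w(1), of n] GG_norm[OF w(3), of n] mult_left_mono[OF w(2) less_imp_le[OF \<gamma>]]
      mult_left_mono[OF w(4) less_imp_le[OF \<gamma>]]
    unfolding \<gamma>_def[symmetric] by linarith+
  have H1: "Dom (Suc n) (KK (Suc n)) (hat (Suc n) f' g')" if "f' \<in> win1" "g' \<in> win1" for f' g'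
    using 3(1)[OF that] by blast
  have H2: "Dom n (KK n) (hat n f' g')" if "f' \<in> win1" "g' \<in> win1" for f' g'
    using 3(2)[OF that] by blast
  let ?M = "2 * (real (Suc n))\<^sup>2 / (\<delta> * L)"
  have M: "\<bar>?M\<bar> \<le> 2 * (real (Suc n))\<^sup>2"
  proof -
    have "(2 * (real (Suc n))\<^sup>2) * (1 / (\<delta> * L)) \<le> (2 * (real (Suc n))\<^sup>2) * 1" using L by (intro mult_left_mono) auto
    then show ?thesis using L by simp
  qed
  define R1 where "R1 k = complex_of_real ?M * hat (Suc n) f g k + hat (Suc n) (DD f) g k + hat (Suc n) f (DD g) k" for k
  define R2 where "R2 k = hat n (GG n f) g k + hat n f (GG n g) k + complex_of_real \<delta> * hat n (GG n f) (GG n g) k" for k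
  define R where "R k = complex_of_real \<delta> * (R1 k - R2 k)" for k
  have r1: "Dom (Suc n) (2 * (real (Suc n))\<^sup>2 * KK (Suc n) + KK (Suc n) + KK (Suc n)) R1"
    unfolding R1_def by (intro Dom_add Dom_scale' H1 dd 3 M)
  have r2: "Dom n (\<gamma> * 1 * KK n + 1 * \<gamma> * KK n + 1 * (\<gamma> * \<gamma> * KK n)) R2"
    unfolding R2_def using d by (intro Dom_add Dom_scale' Dom_hat_scaled[OF H2] GG_win w gg \<gamma>) auto
  have r2': "Dom (Suc n) (\<gamma> * 1 * KK n + 1 * \<gamma> * KK n + 1 * (\<gamma> * \<gamma> * KK n)) R2"
    by (rule Dom_weak[OF r2]) auto
  have R: "Dom (Suc n) (\<delta> * ((2 * (real (Suc n))\<^sup>2 * KK (Suc n) + KK (Suc n) + KK (Suc n)) + (\<gamma> * 1 * KK n + 1 * \<gamma> * KK n + 1 * (\<gamma> * \<gamma> * KK n)))) R"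
    unfolding R_def using d by (intro Dom_scale' Dom_diff r1 r2') auto
  define Q where "Q = (2 * (real (Suc n))\<^sup>2 * KK (Suc n) + KK (Suc n) + KK (Suc n)) + (\<gamma> * 1 * KK n + 1 * \<gamma> * KK n + 1 * (\<gamma> * \<gamma> * KK n))"
  note R = R[folded Q_def]
  have KKS: "KK (Suc (Suc n)) = 2 * KK (Suc n) + KK n + Q
     + 2 * KK (Suc n) + KK n"
    unfolding Q_def \<gamma>_def by (simp add: power2_eq_square algebra_simps)
  have Q0: "Q \<ge> 0" unfolding Q_def using KK_nonneg[of n] KK_nonneg[of "Suc n"] \<gamma> by (intro add_nonneg_nonneg mult_nonneg_nonneg) auto
  have hatS: "hat (Suc (Suc n)) f g k = complex_of_real (2 - y k) * hat (Suc n) f g k - hat n f g k + R k" if "k \<in> J" for k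
    unfolding hat_Suc_Suc[OF w(1,3) that] R_def R1_def R2_def by (simp add: algebra_simps)
  have "Dom (Suc (Suc n)) (2 * KK (Suc n) + KK n + \<delta> * Q) (\<lambda>k. complex_of_real (2 - y k) * hat (Suc n) f g k - hat n f g k + R k)"
  proof (intro Dom_add Dom_diff)
    show "Dom (Suc (Suc n)) (2 * KK (Suc n)) (\<lambda>k. complex_of_real (2 - y k) * hat (Suc n) f g k)"
      by (rule Dom_mult_2[OF H1[OF 3(3,4)]])
    show "Dom (Suc (Suc n)) (KK n) (hat n f g)" by (rule Dom_weak[OF H2[OF 3(3,4)]]) auto
    show "Dom (Suc (Suc n)) (\<delta> * Q) R" by (rule Dom_weak[OF R]) auto
  qed
  moreover have "2 * KK (Suc n) + KK n + \<delta> * Q \<le> KK (Suc (Suc n))"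
    unfolding KKS using Q0 mult_right_mono[OF d(2) Q0] KK_nonneg[of n] KK_nonneg[of "Suc n"] by linarith
  ultimately have c1: "Dom (Suc (Suc n)) (KK (Suc (Suc n))) (hat (Suc (Suc n)) f g)"
    by (rule Dom_weak[OF _ order_refl]) (use hatS in auto)
  let ?e = "\<lambda>n k. hat n f g k - complex_of_real (2 * TT n (y k)) * pr f g k"
  have errS: "?e (Suc (Suc n)) k = complex_of_real (2 - y k) * ?e (Suc n) k - ?e n k + R k" if "k \<in> J" for k
    unfolding hatS[OF that] by (simp add: algebra_simps)
  have "Dom (Suc n) (2 * (\<delta> * KK (Suc n)) + \<delta> * KK n + \<delta> * Q) (\<lambda>k. complex_of_real (2 - y k) * ?e (Suc n) k - ?e n k + R k)"
  proof (intro Dom_add Dom_diff)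
    show "Dom (Suc n) (2 * (\<delta> * KK (Suc n))) (\<lambda>k. complex_of_real (2 - y k) * ?e (Suc n) k)"
      by (rule Dom_mult_2) (use 3(1)[OF 3(3,4)] in simp)
    have "Dom (n - 1) (\<delta> * KK n) (?e n)" using 3(2)[OF 3(3,4)] by blast
    then show "Dom (Suc n) (\<delta> * KK n) (?e n)" by (rule Dom_weak) auto
    show "Dom (Suc n) (\<delta> * Q) R" by (rule R)
  qed
  moreover have "2 * (\<delta> * KK (Suc n)) + \<delta> * KK n + \<delta> * Q \<le> \<delta> * KK (Suc (Suc n))"
  proof -
    have "2 * KK (Suc n) + KK n + Q \<le> KK (Suc (Suc n))"
      unfolding KKS using KK_nonneg[of n] KK_nonneg[of "Suc n"] by linarith
    from mult_left_mono[OF this, of \<delta>] show ?thesis using d by (simp add: algebra_simps)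
  qed
  ultimately have c2: "Dom (Suc n) (\<delta> * KK (Suc (Suc n))) (?e (Suc (Suc n)))"
    by (rule Dom_weak[OF _ order_refl]) (use errS in auto)
  show ?case using c1 c2 by simp
qed

text \<open>The arithmetic-geometric mean inequality splits products of two different coefficients,
  leaving only weighted square sums.\<close>

lemma Dom_pairing:
  assumes "Dom d c G" "d \<le> D" and Q: "\<And>f g. f \<in> win1 \<Longrightarrow> g \<in> win1 \<Longrightarrow> bs (\<lambda>k. (1 + y k) ^ D * (cmod (pr f g k))\<^sup>2) Q"
    and fg: "f' \<in> win1" "g' \<in> win1"
  shows "bs (\<lambda>k. cmod (G k) * cmod (pr f' g' k)) (c * Q)"
  using assms(1,2)
proof (induction rule: Dom.induct)
  case (Dom_base f g m d)
  have "bs (\<lambda>k. 1/2 * ((1 + y k) ^ D * (cmod (pr f g k))\<^sup>2 + (1 + y k) ^ D * (cmod (pr f' g' k))\<^sup>2)) (1/2 * (Q + Q))"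
    by (intro bs_cmult bs_add Q fg Dom_base) simp
  then show ?case
  proof (rule bs_mono)
    fix k assume k: "k \<in> J"
    let ?a = "cmod (pr f g k)" and ?b = "cmod (pr f' g' k)"
    have "\<bar>m k\<bar> \<le> (1 + y k) ^ d" using Dom_base k by blast
    also have "\<dots> \<le> (1 + y k) ^ D" using y_nonneg[OF k] Dom_base by (intro power_increasing) auto
    finally have m: "\<bar>m k\<bar> \<le> (1 + y k) ^ D" .
    have ab: "?a * ?b \<le> 1/2 * (?a\<^sup>2 + ?b\<^sup>2)" using sum_squares_bound[of ?a ?b] by simp
    have "\<bar>m k\<bar> * (?a * ?b) \<le> (1 + y k) ^ D * (1/2 * (?a\<^sup>2 + ?b\<^sup>2))"
      by (rule mult_mono[OF m ab]) (use y_nonneg[OF k] in auto)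
    then show "cmod (complex_of_real (m k) * pr f g k) * ?b \<le> 1/2 * ((1 + y k) ^ D * ?a\<^sup>2 + (1 + y k) ^ D * ?b\<^sup>2)"
      by (simp add: norm_mult algebra_simps)
  qed simp
next
  case (Dom_add d c G c' G')
  then have "bs (\<lambda>k. cmod (G k) * cmod (pr f' g' k) + cmod (G' k) * cmod (pr f' g' k)) (c * Q + c' * Q)"
    by (intro bs_add) auto
  then show ?case
    by (rule bs_mono) (auto simp: distrib_right[symmetric] intro: mult_right_mono norm_triangle_ineq)
next
  case (Dom_scale d c G z)
  then have "bs (\<lambda>k. \<bar>z\<bar> * (cmod (G k) * cmod (pr f' g' k))) (\<bar>z\<bar> * (c * Q))" by (intro bs_cmult) auto
  then show ?case by (rule bs_mono) (auto simp: norm_mult)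
next
  case (Dom_weak d c G d' c' G')
  have q: "0 \<le> Q" using bs_nonneg[OF Q[OF fg]] .
  have "bs (\<lambda>k. cmod (G k) * cmod (pr f' g' k)) (c * Q)" using Dom_weak by simp
  then show ?case by (rule bs_mono) (use Dom_weak.hyps q in \<open>simp_all add: mult_right_mono\<close>)
qed

end

section \<open>A priori finiteness of spectral moments\<close>

context mrep
begin

lemma mul_sum_right: "(\<And>i. i \<in> A \<Longrightarrow> f i \<in> F) \<Longrightarrow> b \<in> F \<Longrightarrow> mul b (\<Sum>i\<in>A. f i) = (\<Sum>i\<in>A. mul b (f i))"
  by (induction A rule: infinite_finite_induct) (auto simp: mul_add_right F_sum)

lemma cj_0 [simp]: "cj 0 = 0"
  using cj_scC[OF F_0, of 0] by simp

lemma cj_sum: "(\<And>i. i \<in> A \<Longrightarrow> f i \<in> F) \<Longrightarrow> cj (\<Sum>i\<in>A. f i) = (\<Sum>i\<in>A. cj (f i))"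
  by (induction A rule: infinite_finite_induct) (auto simp: cj_add F_sum)

lemma coef_sum: "coef (\<Sum>i\<in>A. f i) k = (\<Sum>i\<in>A. coef (f i) k)"
  by (simp add: coef_def cinner_sum_left)

lemma mul_cj_Kinv: "f \<in> U0 \<Longrightarrow> g \<in> U0 \<Longrightarrow> mul f (cj g) \<in> Kinv"
  using mr_csubspaceD(3)[OF Kinv_subspace SS_Kinv[of f g 0], of "1/2"] by (simp add: SS_0 scC_scC scC_one)

lemma mul_cj_Hinf: "f \<in> U0 \<Longrightarrow> g \<in> U0 \<Longrightarrow> mul f (cj g) \<in> Hinf \<pi>"
  by (intro mul_Hinf cj_F) auto

lemma bs_sum: "finite A \<Longrightarrow> (\<And>x. x \<in> A \<Longrightarrow> bs (f x) (B x)) \<Longrightarrow> bs (\<lambda>k. \<Sum>x\<in>A. f x k) (\<Sum>x\<in>A. B x)"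
  by (induction A rule: finite_induct) (auto intro: bs_add simp: bs_0)

lemma sum_cmod_square_le:
  assumes "finite A"
  shows "(cmod (\<Sum>x\<in>A. f x))\<^sup>2 \<le> card A * (\<Sum>x\<in>A. (cmod (f x))\<^sup>2)"
proof -
  have "(cmod (\<Sum>x\<in>A. f x))\<^sup>2 \<le> (\<Sum>x\<in>A. cmod (f x))\<^sup>2" by (intro power_mono norm_sum) auto
  also have "\<dots> \<le> (\<Sum>x\<in>A. (cmod (f x))\<^sup>2) * card A" by (rule sum_squared_le_sum_of_squares)
  finally show ?thesis by (simp add: mult.commute)
qed

lemma bs_spectral:
  assumes f: "f \<in> U0" "g \<in> U0"
  shows "\<exists>B. bs (\<lambda>k. (1 + lam k) ^ n * (cmod (coef (mul f (cj g)) k))\<^sup>2) B"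
  using bs_infsum[OF coef_moment_summable[OF mul_cj_Hinf[OF f] mul_cj_Kinv[OF f], of n]] lam_nonneg by auto

text \<open>Products expand into the finitely many \<open>mul (ev i) (cj (ev j))\<close>, each with
  finite moments. The bound is crude, but it makes the suprema \<open>Z\<close> and \<open>Q\<close>
  finite.\<close>

lemma bs_spectral_uniform:
  assumes S: "finite S" "S \<subseteq> J"
  shows "\<exists>B. \<forall>c. (\<forall>i\<in>S. cmod (c i) \<le> 1) \<longrightarrow> bs (\<lambda>k. (1 + lam k) ^ n *
    (cmod (coef (mul (\<Sum>i\<in>S. scC (c i) (ev i)) (cj (\<Sum>i\<in>S. scC (c i) (ev i)))) k))\<^sup>2) B"
proof -
  define p where "p x k = coef (mul (ev (fst x)) (cj (ev (snd x)))) k" for x k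
  have eF: "ev i \<in> F" "ev i \<in> Kinv" if "i \<in> S" for i using S that ev_F ev_Kinv by blast+
  have "\<forall>x\<in>S \<times> S. \<exists>B. bs (\<lambda>k. (1 + lam k) ^ n * (cmod (p x k))\<^sup>2) B"
    unfolding p_def using eF by (intro ballI bs_spectral) auto
  then obtain B where B: "\<And>x. x \<in> S \<times> S \<Longrightarrow> bs (\<lambda>k. (1 + lam k) ^ n * (cmod (p x k))\<^sup>2) (B x)" by metis
  have fin: "finite (S \<times> S)" using S by simp
  show ?thesis
  proof (intro exI allI impI)
    fix c :: "nat \<Rightarrow> complex" assume c: "\<forall>i\<in>S. cmod (c i) \<le> 1"
    let ?u = "\<Sum>i\<in>S. scC (c i) (ev i)"
    have ex: "coef (mul ?u (cj ?u)) k = (\<Sum>x\<in>S \<times> S. c (fst x) * cnj (c (snd x)) * p x k)" for k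
    proof -
      have "mul ?u (cj ?u) = (\<Sum>i\<in>S. \<Sum>j\<in>S. scC (c i) (scC (cnj (c j)) (mul (ev i) (cj (ev j)))))"
      proof -
        have uF: "?u \<in> F" using eF by (intro F_sum F_scC) auto
        have cu: "cj ?u = (\<Sum>j\<in>S. scC (cnj (c j)) (cj (ev j)))" using eF by (simp add: cj_sum cj_scC F_scC)
        have "mul (ev i) (cj ?u) = (\<Sum>j\<in>S. scC (cnj (c j)) (mul (ev i) (cj (ev j))))" if "i \<in> S" for i
          unfolding cu using eF that by (simp add: mul_sum_right mul_scC_right F_scC cj_F)
        then show ?thesis using eF uF by (simp add: mul_sum_left mul_scC_left F_scC cj_F scC_sum_right)
      qed
      then show ?thesis
        by (simp add: coef_sum coef_scC p_def sum.cartesian_product split_beta mult.assoc)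
    qed
    have "bs (\<lambda>k. real (card (S \<times> S)) * (\<Sum>x\<in>S \<times> S. (1 + lam k) ^ n * (cmod (p x k))\<^sup>2)) (real (card (S \<times> S)) * (\<Sum>x\<in>S \<times> S. B x))"
      by (intro bs_cmult bs_sum B fin) auto
    then show "bs (\<lambda>k. (1 + lam k) ^ n * (cmod (coef (mul ?u (cj ?u)) k))\<^sup>2) (real (card (S \<times> S)) * (\<Sum>x\<in>S \<times> S. B x))"
    proof (rule bs_mono)
      fix k assume k: "k \<in> J"
      have "(cmod (coef (mul ?u (cj ?u)) k))\<^sup>2 \<le> card (S \<times> S) * (\<Sum>x\<in>S \<times> S. (cmod (c (fst x) * cnj (c (snd x)) * p x k))\<^sup>2)"
        unfolding ex by (rule sum_cmod_square_le[OF fin])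
      also have "\<dots> \<le> card (S \<times> S) * (\<Sum>x\<in>S \<times> S. (cmod (p x k))\<^sup>2)"
      proof (intro mult_left_mono sum_mono power_mono)
        fix x assume "x \<in> S \<times> S"
        then have "cmod (c (fst x)) * cmod (c (snd x)) \<le> 1 * 1" using c by (intro mult_mono) auto
        then have "cmod (c (fst x)) * cmod (c (snd x)) * cmod (p x k) \<le> 1 * cmod (p x k)" by (intro mult_right_mono) auto
        then show "cmod (c (fst x) * cnj (c (snd x)) * p x k) \<le> cmod (p x k)" by (simp add: norm_mult)
      qed auto
      finally have "(1 + lam k) ^ n * (cmod (coef (mul ?u (cj ?u)) k))\<^sup>2 \<le> (1 + lam k) ^ n * (card (S \<times> S) * (\<Sum>x\<in>S \<times> S. (cmod (p x k))\<^sup>2))"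
        using lam_nonneg[OF k] by (intro mult_left_mono) auto
      then show "(1 + lam k) ^ n * (cmod (coef (mul ?u (cj ?u)) k))\<^sup>2 \<le> real (card (S \<times> S)) * (\<Sum>x\<in>S \<times> S. (1 + lam k) ^ n * (cmod (p x k))\<^sup>2)"
        by (simp add: sum_distrib_left mult.left_commute)
    qed simp
  qed
qed

end

section \<open>Window suprema and consequences of positivity\<close>

context window
begin

definition sq :: "nat \<Rightarrow> 'a \<Rightarrow> 'a \<Rightarrow> nat \<Rightarrow> real" where
  "sq D f g k = (1 + y k) ^ D * (cmod (pr f g k))\<^sup>2"

definition Z :: "nat \<Rightarrow> real" where
  "Z D = Sup ((\<lambda>u. infsum (sq D u u) J) ` win1)"

lemma sq_nonneg: "k \<in> J \<Longrightarrow> 0 \<le> sq D f g k"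
  unfolding sq_def using y_nonneg by simp

lemma win1_coef: "u \<in> win1 \<Longrightarrow> i \<in> S \<Longrightarrow> cmod (coef u i) \<le> 1"
  using cinner_Cauchy_Schwarz[of u "ev i"] ev_norm[of i] S(2) win1_win(2)[of u] unfolding coef_def by auto

lemma y_le_lam: "k \<in> J \<Longrightarrow> y k \<le> lam k"
proof -
  assume k: "k \<in> J"
  have "\<delta> * L \<le> 1 * L" using d Lpos by (intro mult_right_mono) auto
  then have "1 \<le> L" using L by simp
  then show ?thesis unfolding y_def using lam_nonneg[OF k] using mult_left_mono[of 1 L "lam k"] Lpos by (simp add: divide_le_eq)
qed

lemma sq_bound: "\<exists>B. \<forall>u\<in>win1. bs (sq D u u) B"
proof -
  obtain B where B: "\<And>c. \<forall>i\<in>S. cmod (c i) \<le> 1 \<Longrightarrow> bs (\<lambda>k. (1 + lam k) ^ D *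
    (cmod (coef (mul (\<Sum>i\<in>S. scC (c i) (ev i)) (cj (\<Sum>i\<in>S. scC (c i) (ev i)))) k))\<^sup>2) B"
    using bs_spectral_uniform[OF S] by blast
  have "bs (sq D u u) B" if u: "u \<in> win1" for u
  proof -
    have "bs (\<lambda>k. (1 + lam k) ^ D * (cmod (coef (mul u (cj u)) k))\<^sup>2) B"
      using B[of "coef u"] win1_coef[OF u] win_expand[OF win1_win(1)[OF u], symmetric] by simp
    then show ?thesis
      by (rule bs_mono) (auto simp: sq_def pr_def y_nonneg y_le_lam intro!: mult_right_mono power_mono)
  qed
  then show ?thesis by blast
qed

lemma sq_summable: "u \<in> win1 \<Longrightarrow> sq D u u summable_on J"
  using sq_bound[of D] bs_summable(1)[of "sq D u u"] sq_nonneg by blast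

lemma zero_win1: "0 \<in> win1"
  unfolding win1_def using mr_csubspaceD(1)[OF win_subspace] by simp

lemma Z_upper: "u \<in> win1 \<Longrightarrow> bs (sq D u u) (Z D)"
proof -
  assume u: "u \<in> win1"
  obtain B where B: "\<And>u. u \<in> win1 \<Longrightarrow> bs (sq D u u) B" using sq_bound by blast
  have "infsum (sq D u u) J \<le> Z D"
    unfolding Z_def
  proof (rule cSup_upper)
    show "bdd_above ((\<lambda>u. infsum (sq D u u) J) ` win1)"
      using bs_summable(2)[OF B] sq_nonneg by (intro bdd_aboveI[of _ B]) auto
  qed (use u in blast)
  moreover have "bs (sq D u u) (infsum (sq D u u) J)" by (rule bs_infsum[OF sq_summable[OF u]]) (rule sq_nonneg)
  ultimately show ?thesis by (auto intro: bs_mono)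
qed

lemma Z_least: "(\<And>u. u \<in> win1 \<Longrightarrow> bs (sq D u u) B) \<Longrightarrow> Z D \<le> B"
  unfolding Z_def using zero_win1 bs_summable(2) sq_nonneg by (intro cSup_least) auto

lemma Z_nonneg: "0 \<le> Z D"
  using bs_nonneg[OF Z_upper[OF zero_win1]] .

lemma Z_mono: "d \<le> D \<Longrightarrow> Z d \<le> Z D"
proof (rule Z_least)
  fix u assume "d \<le> D" and u: "u \<in> win1"
  then show "bs (sq d u u) (Z D)"
    by (intro bs_mono[OF Z_upper[OF u, of D]])
      (auto simp: sq_def y_nonneg intro!: mult_right_mono power_increasing)
qed

text \<open>Polarisation over the fourth roots of unity, with halved vectors so that they stay in
  the unit ball. The 16 is four summands times the factor 4 from Cauchy-Schwarz.\<close>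

lemma polarization:
  assumes f: "f \<in> win1" and g: "g \<in> win1"
  shows "bs (sq D f g) (16 * Z D)"
proof -
  define w where "w j = \<i> ^ j" for j :: nat
  have w1: "w j * cnj (w j) = 1" for j unfolding w_def by (simp flip: power_mult_distrib)
  have wn: "cmod (w j) = 1" for j by (simp add: w_def norm_power)
  define v where "v j = scC (1/2) (f + scC (w j) g)" for j :: nat
  note sub = mr_csubspaceD[OF win_subspace]
  have vw: "v j \<in> win1" for j
  proof -
    have "v j \<in> win" unfolding v_def by (intro sub win1_win f g)
    moreover have "cnrm (v j) \<le> 1/2 * (cnrm f + cnrm g)"
      unfolding v_def cnrm_scC using cnrm_triangle[of f "scC (w j) g"] by (simp add: cnrm_scC wn)
    ultimately show ?thesis using win1_win(2)[OF f] win1_win(2)[OF g] unfolding win1_def by simp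
  qed
  note fF = win_U0(2)[OF win1_win(1)[OF f]] and gF = win_U0(2)[OF win1_win(1)[OF g]]
  have "pr (v j) (v j) k = 1/4 * (pr f f k + (w j * cnj (w j)) * pr g g k + cnj (w j) * pr f g k + w j * pr g f k)" for j k
    unfolding pr_def v_def using fF gF
    by (simp add: cj_scC cj_add F_add F_scC cj_F mul_add_left mul_add_right mul_scC_left mul_scC_right coef_add coef_scC algebra_simps)
  then have ex: "pr f g k = (\<Sum>j<4. w j * pr (v j) (v j) k)" for k
    unfolding w1 by (simp add: eval_nat_numeral w_def algebra_simps)
  have "bs (\<lambda>k. 4 * (\<Sum>j<4. sq D (v j) (v j) k)) (4 * (\<Sum>j<(4::nat). Z D))"
    by (intro bs_cmult bs_sum Z_upper vw) auto
  then show ?thesis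
  proof (rule bs_mono)
    fix k assume k: "k \<in> J"
    have "(cmod (pr f g k))\<^sup>2 \<le> 4 * (\<Sum>j<4. (cmod (w j * pr (v j) (v j) k))\<^sup>2)"
      unfolding ex using sum_cmod_square_le[of "{..<4::nat}" "\<lambda>j. w j * pr (v j) (v j) k"] by simp
    then have "(1 + y k) ^ D * (cmod (pr f g k))\<^sup>2 \<le> (1 + y k) ^ D * (4 * (\<Sum>j<4. (cmod (pr (v j) (v j) k))\<^sup>2))"
      using y_nonneg[OF k] by (intro mult_left_mono) (auto simp: norm_mult wn)
    then show "sq D f g k \<le> 4 * (\<Sum>j<4. sq D (v j) (v j) k)"
      unfolding sq_def by (simp add: sum_distrib_left mult.left_commute)
  qed simp
qed

text \<open>Parseval writes the nonnegative pairing of \<open>SS n u u\<close> with u times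
  \<open>cj u\<close> as a sum over the spectrum; up to \<open>err\<close> its summands are 2 T_n(y)
  times the squared coefficient. The factor \<delta> and the lower order n - 1 in the error come
  from \<open>Dom_hat\<close>, the 16 from \<open>polarization\<close>.\<close>

lemma positivity:
  assumes u: "u \<in> win1"
  obtains G s err where "(G has_sum s) J" "s \<ge> 0" "bs err (\<delta> * KK n * (16 * Z (n - 1)))" "\<And>k. k \<in> J \<Longrightarrow> 0 \<le> err k"
    "\<And>k. k \<in> J \<Longrightarrow> \<bar>G k - 2 * TT n (y k) * (cmod (pr u u k))\<^sup>2\<bar> \<le> err k"
proof -
  note uF = win_U0[OF win1_win(1)[OF u]]
  define e where "e k = hat n u u k - complex_of_real (2 * TT n (y k)) * pr u u k" for k
  have De: "Dom (n - 1) (\<delta> * KK n) e" unfolding e_def using Dom_hat[OF u u, of n] by blast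
  have b: "bs (\<lambda>k. cmod (e k) * cmod (pr u u k)) (\<delta> * KK n * (16 * Z (n - 1)))"
    by (rule Dom_pairing[OF De order_refl polarization[unfolded sq_def] u u])
  have "((\<lambda>k. Re (coef (SS n u u) k * cnj (pr u u k))) has_sum Re (cinner (SS n u u) (mul u (cj u)))) J"
    unfolding pr_def by (intro has_sum_Re coef_has_sum SS_Kinv uF)
  then have a1: "((\<lambda>k. 1 / L ^ n * Re (coef (SS n u u) k * cnj (pr u u k))) has_sum 1 / L ^ n * Re (cinner (SS n u u) (mul u (cj u)))) J"
    by (rule has_sum_cmult_right)
  have a2: "0 \<le> 1 / L ^ n * Re (cinner (SS n u u) (mul u (cj u)))"
    using SS_positive[OF uF(2) uF(2), of n] Lpos by simp
  have a3: "\<bar>1 / L ^ n * Re (coef (SS n u u) k * cnj (pr u u k)) - 2 * TT n (y k) * (cmod (pr u u k))\<^sup>2\<bar> \<le> cmod (e k) * cmod (pr u u k)" for k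
  proof -
    have "1 / L ^ n * Re (coef (SS n u u) k * cnj (pr u u k)) = Re (hat n u u k * cnj (pr u u k))"
      unfolding coef_SS using Lpos by (simp add: mult.assoc del: of_real_power)
    also have "hat n u u k * cnj (pr u u k) = e k * cnj (pr u u k) + complex_of_real (2 * TT n (y k)) * (pr u u k * cnj (pr u u k))"
      unfolding e_def by (simp add: algebra_simps)
    also have "Re \<dots> = Re (e k * cnj (pr u u k)) + 2 * TT n (y k) * (cmod (pr u u k))\<^sup>2"
      unfolding complex_norm_square[symmetric] of_real_mult[symmetric] plus_complex.sel Re_complex_of_real ..
    finally show ?thesis using abs_Re_le_cmod[of "e k * cnj (pr u u k)"] by (simp add: norm_mult)
  qed
  show ?thesis by (rule that[OF a1 a2 b _ a3]) simp
qed

text \<open>The pairings for n = 1, 2, 3 are added with the Fejer weights 3, 2, 1. The total is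
  nonnegative while \<open>TT_fejer\<close> makes the main terms negative off the low modes, so the
  low modes have to pay for everything else.\<close>

lemma low_dominates:
  assumes small: "\<delta> \<le> 1 / 1203200"
    and B: "\<And>u. u \<in> win1 \<Longrightarrow> bs (\<lambda>k. if lam k < 9/10 * L then (cmod (pr u u k))\<^sup>2 else 0) B"
  shows "Z 3 \<le> 1400 * B"
proof -
  have KKv: "KK 1 = 4" "KK 2 = 42" "KK 3 = 656" by (simp_all add: eval_nat_numeral)
  have "bs (\<lambda>k. 1/50 * sq 3 u u k) (14 * B + 12032 * \<delta> * Z 3)" if u: "u \<in> win1" for u
  proof -
    obtain G1 s1 e1 where 1: "(G1 has_sum s1) J" "s1 \<ge> 0" "bs e1 (\<delta> * KK 1 * (16 * Z (1 - 1)))" "\<And>k. k \<in> J \<Longrightarrow> 0 \<le> e1 k"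
      "\<And>k. k \<in> J \<Longrightarrow> \<bar>G1 k - 2 * TT 1 (y k) * (cmod (pr u u k))\<^sup>2\<bar> \<le> e1 k" by (rule positivity[OF u, of 1]) blast
    obtain G2 s2 e2 where 2: "(G2 has_sum s2) J" "s2 \<ge> 0" "bs e2 (\<delta> * KK 2 * (16 * Z (2 - 1)))" "\<And>k. k \<in> J \<Longrightarrow> 0 \<le> e2 k"
      "\<And>k. k \<in> J \<Longrightarrow> \<bar>G2 k - 2 * TT 2 (y k) * (cmod (pr u u k))\<^sup>2\<bar> \<le> e2 k" by (rule positivity[OF u, of 2]) blast
    obtain G3 s3 e3 where 3: "(G3 has_sum s3) J" "s3 \<ge> 0" "bs e3 (\<delta> * KK 3 * (16 * Z (3 - 1)))" "\<And>k. k \<in> J \<Longrightarrow> 0 \<le> e3 k"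
      "\<And>k. k \<in> J \<Longrightarrow> \<bar>G3 k - 2 * TT 3 (y k) * (cmod (pr u u k))\<^sup>2\<bar> \<le> e3 k" by (rule positivity[OF u, of 3]) blast
    define low where "low k = (if lam k < 9/10 * L then (cmod (pr u u k))\<^sup>2 else 0)" for k
    have bq: "bs (\<lambda>k. 14 * low k + (3 * e1 k + 2 * e2 k + 1 * e3 k))
      (14 * B + (3 * (\<delta> * KK 1 * (16 * Z (1 - 1))) + 2 * (\<delta> * KK 2 * (16 * Z (2 - 1))) + 1 * (\<delta> * KK 3 * (16 * Z (3 - 1)))))"
      unfolding low_def by (intro bs_add bs_cmult B u 1 2 3) auto
    \<comment> \<open>With \<open>KK\<close> equal to 4, 42, 656 the coefficients are 3 * 4 * 16 =
      192, 2 * 42 * 16 = 1344 and 656 * 16 = 10496, together 12032.\<close>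
    have "3 * (\<delta> * KK 1 * (16 * Z (1 - 1))) + 2 * (\<delta> * KK 2 * (16 * Z (2 - 1))) + 1 * (\<delta> * KK 3 * (16 * Z (3 - 1)))
       = \<delta> * (192 * Z 0 + 1344 * Z 1 + 10496 * Z 2)" unfolding KKv by (simp add: algebra_simps)
    also have "\<dots> \<le> \<delta> * (192 * Z 3 + 1344 * Z 3 + 10496 * Z 3)"
      using d Z_mono[of 0 3] Z_mono[of 1 3] Z_mono[of 2 3] by (intro mult_left_mono add_mono) auto
    also have "\<dots> = 12032 * \<delta> * Z 3" by simp
    finally have bq': "bs (\<lambda>k. 14 * low k + (3 * e1 k + 2 * e2 k + 1 * e3 k)) (14 * B + 12032 * \<delta> * Z 3)"
      by (intro bs_mono[OF bq]) auto
    have hs: "((\<lambda>k. 3 * G1 k + 2 * G2 k + G3 k) has_sum (3 * s1 + 2 * s2 + s3)) J"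
      by (intro has_sum_add has_sum_cmult_right 1 2 3)
    show ?thesis
    proof (rule bs_from_has_sum[OF hs _ bq'])
      show "3 * s1 + 2 * s2 + s3 \<ge> 0" using 1 2 3 by simp
      fix k assume k: "k \<in> J"
      show "14 * low k + (3 * e1 k + 2 * e2 k + 1 * e3 k) \<ge> 0" using 1(4)[OF k] 2(4)[OF k] 3(4)[OF k] by (simp add: low_def)
      show "0 \<le> 1/50 * sq 3 u u k" using sq_nonneg[OF k] by simp
      let ?a = "(cmod (pr u u k))\<^sup>2"
      have "2 * (3 * TT 1 (y k) + 2 * TT 2 (y k) + TT 3 (y k)) * ?a \<le> 2 * ((if y k < 9/10 then 7 else 0) - (1 + y k) ^ 3 / 100) * ?a"
        by (intro mult_right_mono mult_left_mono TT_fejer y_nonneg k) auto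
      also have "\<dots> = 14 * low k - 1/50 * sq 3 u u k"
        using Lpos unfolding low_def sq_def y_def by (simp add: field_simps)
      finally have "3 * (2 * TT 1 (y k) * ?a) + 2 * (2 * TT 2 (y k) * ?a) + 2 * TT 3 (y k) * ?a \<le> 14 * low k - 1/50 * sq 3 u u k"
        by (simp add: algebra_simps)
      then show "1/50 * sq 3 u u k + (3 * G1 k + 2 * G2 k + G3 k) \<le> 14 * low k + (3 * e1 k + 2 * e2 k + 1 * e3 k)"
        using 1(5)[OF k] 2(5)[OF k] 3(5)[OF k] by linarith
    qed
  qed
  then have "bs (\<lambda>k. 50 * (1/50 * sq 3 u u k)) (50 * (14 * B + 12032 * \<delta> * Z 3))" if "u \<in> win1" for u
    using that by (intro bs_cmult) auto
  then have "bs (sq 3 u u) (50 * (14 * B + 12032 * \<delta> * Z 3))" if "u \<in> win1" for u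
    using that by (auto intro: bs_mono)
  then have "Z 3 \<le> 50 * (14 * B + 12032 * \<delta> * Z 3)" by (rule Z_least)
  \<comment> \<open>50 * 12032 = 601600 is half of 1203200; absorbing half of \<open>Z 3\<close>
    doubles 50 * 14 = 700 to 1400.\<close>
  moreover have "601600 * \<delta> * Z 3 \<le> 1/2 * Z 3" using small Z_nonneg by (intro mult_right_mono) auto
  ultimately show ?thesis by simp
qed

text \<open>For odd N the leading part of 2 T_N is -y^N, so positivity bounds the N-th moment by the
  one before. Interpolating between orders 0 and N, with \<open>M\<close> chosen so that at most
  half of \<open>Z N\<close> returns, closes the estimate. Neither L nor \<delta> enters the
  constant.\<close>

lemma high_moments:
  assumes N: "odd N" and Kt: "Kt \<ge> 0" "\<And>y. y \<ge> 0 \<Longrightarrow> \<bar>2 * TT N y - (- y) ^ N\<bar> \<le> Kt * (1 + y) ^ (N - 1)"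
    and C: "C = Kt + 16 * KK N" and M: "M = 2 * 2 ^ N * (C + 1)"
  shows "Z N \<le> 2 * (2 ^ N + 2 ^ N * C * M ^ (N - 1)) * Z 0"
proof -
  have C0: "C \<ge> 0" using C Kt KK_nonneg by simp
  have M1: "M \<ge> 1" unfolding M using C0 by (smt (verit) mult_ge1_I one_le_power)
  have 1: "bs (\<lambda>k. y k ^ N * (cmod (pr u u k))\<^sup>2) (C * Z (N - 1))" if u: "u \<in> win1" for u
  proof -
    obtain G s e where g: "(G has_sum s) J" "s \<ge> 0" "bs e (\<delta> * KK N * (16 * Z (N - 1)))" "\<And>k. k \<in> J \<Longrightarrow> 0 \<le> e k"
      "\<And>k. k \<in> J \<Longrightarrow> \<bar>G k - 2 * TT N (y k) * (cmod (pr u u k))\<^sup>2\<bar> \<le> e k" by (rule positivity[OF u, of N]) blast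
    have "bs (\<lambda>k. Kt * sq (N - 1) u u k + e k) (Kt * Z (N - 1) + \<delta> * KK N * (16 * Z (N - 1)))"
      by (intro bs_add bs_cmult Z_upper u Kt g)
    moreover have "\<delta> * KK N * (16 * Z (N - 1)) \<le> 1 * KK N * (16 * Z (N - 1))"
      using d KK_nonneg Z_nonneg by (intro mult_right_mono) auto
    then have "Kt * Z (N - 1) + \<delta> * KK N * (16 * Z (N - 1)) \<le> C * Z (N - 1)"
      unfolding C by (simp add: algebra_simps)
    ultimately have q: "bs (\<lambda>k. Kt * sq (N - 1) u u k + e k) (C * Z (N - 1))" by (rule bs_mono[OF _ order_refl])
    show ?thesis
    proof (rule bs_from_has_sum[OF g(1,2) q])
      fix k assume k: "k \<in> J"
      let ?a = "(cmod (pr u u k))\<^sup>2"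
      show "0 \<le> Kt * sq (N - 1) u u k + e k" using Kt(1) sq_nonneg[OF k] g(4)[OF k] by simp
      show "0 \<le> y k ^ N * ?a" using y_nonneg[OF k] by simp
      have "2 * TT N (y k) + y k ^ N \<le> Kt * (1 + y k) ^ (N - 1)"
        using Kt(2)[OF y_nonneg[OF k]] N by (simp add: power_minus_odd)
      then have "(2 * TT N (y k) + y k ^ N) * ?a \<le> Kt * (1 + y k) ^ (N - 1) * ?a" by (intro mult_right_mono) auto
      then show "y k ^ N * ?a + G k \<le> Kt * sq (N - 1) u u k + e k"
        using g(5)[OF k] unfolding sq_def by (simp add: algebra_simps)
    qed
  qed
  have "Z N \<le> 2 ^ N * (Z 0 + C * Z (N - 1))"
  proof (rule Z_least)
    fix u assume u: "u \<in> win1"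
    have "bs (\<lambda>k. 2 ^ N * (sq 0 u u k + y k ^ N * (cmod (pr u u k))\<^sup>2)) (2 ^ N * (Z 0 + C * Z (N - 1)))"
      by (intro bs_cmult bs_add Z_upper u 1) simp
    then show "bs (sq N u u) (2 ^ N * (Z 0 + C * Z (N - 1)))"
    proof (rule bs_mono)
      fix k assume k: "k \<in> J"
      have "(1 + y k) ^ N \<le> 2 ^ N * (1 + y k ^ N)"
      proof (cases "y k \<le> 1")
        case True
        then have "(1 + y k) ^ N \<le> 2 ^ N" using y_nonneg[OF k] by (intro power_mono) auto
        also have "\<dots> \<le> 2 ^ N * (1 + y k ^ N)" using y_nonneg[OF k] by simp
        finally show ?thesis .
      next
        case False
        then have "(1 + y k) ^ N \<le> (2 * y k) ^ N" by (intro power_mono) auto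
        also have "\<dots> = 2 ^ N * y k ^ N" by (rule power_mult_distrib)
        also have "\<dots> \<le> 2 ^ N * (1 + y k ^ N)" by simp
        finally show ?thesis .
      qed
      from mult_right_mono[OF this, of "(cmod (pr u u k))\<^sup>2"]
      show "sq N u u k \<le> 2 ^ N * (sq 0 u u k + y k ^ N * (cmod (pr u u k))\<^sup>2)"
        unfolding sq_def by (simp add: algebra_simps)
    qed simp
  qed
  \<comment> \<open>Where 1 + y exceeds M, one more power gains a factor M; elsewhere the power is
    at most M^(N-1).\<close>
  also have "Z (N - 1) \<le> 1 / M * Z N + M ^ (N - 1) * Z 0"
  proof (rule Z_least)
    fix u assume u: "u \<in> win1"
    have "bs (\<lambda>k. 1 / M * sq N u u k + M ^ (N - 1) * sq 0 u u k) (1 / M * Z N + M ^ (N - 1) * Z 0)"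
      using M1 by (intro bs_add bs_cmult Z_upper u) auto
    then show "bs (sq (N - 1) u u) (1 / M * Z N + M ^ (N - 1) * Z 0)"
    proof (rule bs_mono)
      fix k assume k: "k \<in> J"
      have y: "y k \<ge> 0" by (rule y_nonneg[OF k])
      have "(1 + y k) ^ (N - 1) \<le> 1 / M * (1 + y k) ^ N + M ^ (N - 1)"
      proof (cases "1 + y k \<le> M")
        case True
        then have "(1 + y k) ^ (N - 1) \<le> M ^ (N - 1)" using y by (intro power_mono) auto
        also have "\<dots> \<le> 1 / M * (1 + y k) ^ N + M ^ (N - 1)" using y M1 by simp
        finally show ?thesis .
      next
        case False
        have "N = Suc (N - 1)" using N by (cases N) auto
        then have "(1 + y k) ^ N = (1 + y k) * (1 + y k) ^ (N - 1)" by (metis power_Suc)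
        moreover have "M * (1 + y k) ^ (N - 1) \<le> (1 + y k) * (1 + y k) ^ (N - 1)" using False y by (intro mult_right_mono) auto
        ultimately have "(1 + y k) ^ (N - 1) \<le> 1 / M * (1 + y k) ^ N" using M1 by (simp add: field_simps)
        then show ?thesis using M1 by (smt (verit) zero_le_power)
      qed
      from mult_right_mono[OF this, of "(cmod (pr u u k))\<^sup>2"]
      show "sq (N - 1) u u k \<le> 1 / M * sq N u u k + M ^ (N - 1) * sq 0 u u k"
        unfolding sq_def by (simp add: algebra_simps)
    qed simp
  qed
  finally have "Z N \<le> 2 ^ N * (Z 0 + C * (1 / M * Z N + M ^ (N - 1) * Z 0))"
    using C0 by (simp add: mult_left_mono)
  also have "\<dots> = (2 ^ N * C / M) * Z N + (2 ^ N + 2 ^ N * C * M ^ (N - 1)) * Z 0" by (simp add: algebra_simps)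
  also have "(2 ^ N * C / M) * Z N \<le> 1/2 * Z N"
  proof (rule mult_right_mono[OF _ Z_nonneg])
    have "2 * (2 ^ N * C) \<le> M" unfolding M by (simp add: algebra_simps)
    then show "2 ^ N * C / M \<le> 1 / 2" using M1 by (simp add: field_simps)
  qed
  finally show ?thesis by (simp add: algebra_simps)
qed

lemma norm_square_le_Z0: "u \<in> win1 \<Longrightarrow> (cnrm (mul u (cj u)))\<^sup>2 \<le> Z 0"
proof -
  assume u: "u \<in> win1"
  note uF = win_U0[OF win1_win(1)[OF u]]
  have "(sq 0 u u has_sum (cnrm (mul u (cj u)))\<^sup>2) J"
    using coef_norm_has_sum[OF mul_cj_Kinv[OF uF(1) uF(1)]] unfolding sq_def pr_def by simp
  then show ?thesis using bs_summable(2)[OF Z_upper[OF u, of 0] sq_nonneg] infsumI by fastforce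
qed

end

section \<open>From windows to sup norm bounds\<close>

context mrep
begin

definition rho :: real where "rho = 1 + 1 / 1203200"

text \<open>The prefactor is 1/\<delta>, so the condition \<open>1 \<le> \<delta> * L\<close> of
  \<open>window\<close> holds from the start.\<close>

definition Lam :: "nat \<Rightarrow> real" where "Lam n = 1203200 * rho ^ n"

text \<open>Note the shift: window \<open>Suc m\<close> starts at \<open>Lam m\<close>, while index
  0 collects the finitely many indices below \<open>Lam 0\<close>, where the bootstrap is not
  applied.\<close>

definition Sw :: "nat \<Rightarrow> nat set" where
  "Sw n = (case n of 0 \<Rightarrow> {i \<in> J. lam i < Lam 0} | Suc m \<Rightarrow> {i \<in> J. Lam m \<le> lam i \<and> lam i < Lam (Suc m)})"

lemma rho_gt_1: "rho > 1"
  by (simp add: rho_def)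

lemma Lam_mono: "m \<le> n \<Longrightarrow> Lam m \<le> Lam n"
  unfolding Lam_def using rho_gt_1 by (intro mult_left_mono power_increasing) auto

lemma Sw_J: "Sw n \<subseteq> J"
  unfolding Sw_def by (auto split: nat.splits)

lemma Sw_finite: "finite (Sw n)"
  by (rule finite_subset[OF _ lam_finite[of "Lam n"]]) (auto simp: Sw_def split: nat.splits)

lemma Sw_Union: "(\<Union>m<Suc n. Sw m) = {i \<in> J. lam i < Lam n}"
proof (induction n)
  case 0
  then show ?case by (simp add: Sw_def lessThan_Suc)
next
  case (Suc n)
  have "(\<Union>m<Suc (Suc n). Sw m) = {i \<in> J. lam i < Lam n} \<union> Sw (Suc n)"
    using Suc by (auto simp: lessThan_Suc)
  also have "\<dots> = {i \<in> J. lam i < Lam (Suc n)}"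
    using Lam_mono[of n "Suc n"] by (auto simp: Sw_def)
  finally show ?case .
qed

lemma Sw_disjoint: "m \<noteq> n \<Longrightarrow> Sw m \<inter> Sw n = {}"
proof -
  have *: "Sw m \<inter> Sw n = {}" if less: "m < n" for m n
  proof -
    obtain k where k: "n = Suc k" using less by (cases n) auto
    have "Sw m \<subseteq> {i \<in> J. lam i < Lam k}" using less k unfolding Sw_Union[symmetric] by auto
    then show ?thesis unfolding k by (auto simp: Sw_def)
  qed
  then show "m \<noteq> n \<Longrightarrow> Sw m \<inter> Sw n = {}" by (metis Int_commute linorder_neqE_nat)
qed

lemma Lam_unbounded: "\<exists>n. x < Lam n"
proof -
  obtain n where "x < rho ^ n" using real_arch_pow[OF rho_gt_1] by blast
  moreover have "rho ^ n \<le> Lam n" unfolding Lam_def using rho_gt_1 by simp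
  ultimately show ?thesis by (intro exI[of _ n]) simp
qed

lemma finite_subset_Sw: "finite A \<Longrightarrow> A \<subseteq> J \<Longrightarrow> \<exists>M. A \<subseteq> (\<Union>m<M. Sw m)"
proof -
  assume A: "finite A" "A \<subseteq> J"
  obtain n where n: "Max (insert 0 (lam ` A)) < Lam n" using Lam_unbounded by blast
  have "A \<subseteq> {i \<in> J. lam i < Lam n}"
    using A n Max_ge[of "insert 0 (lam ` A)"] by (fastforce intro: le_less_trans)
  then show ?thesis unfolding Sw_Union[symmetric] by blast
qed

lemma window_Sw: "window \<pi> I V mul one cj (Sw (Suc n)) (Lam n) (1 / 1203200)"
proof
  show "1 \<le> 1 / 1203200 * Lam n" unfolding Lam_def using rho_gt_1 by simp
  fix i assume i: "i \<in> Sw (Suc n)"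
  then show "Lam n \<le> lam i" by (simp add: Sw_def)
  have "Lam (Suc n) = (1 + 1 / 1203200) * Lam n" by (simp add: Lam_def rho_def)
  then show "lam i \<le> (1 + 1 / 1203200) * Lam n" using i by (simp add: Sw_def)
qed (use Sw_finite Sw_J in auto)

definition ball :: "nat \<Rightarrow> 'h set" where
  "ball n = {u \<in> wspan (Sw n). cnrm u \<le> 1}"

lemma ballD: "u \<in> ball n \<Longrightarrow> u \<in> wspan (Sw n)" "u \<in> ball n \<Longrightarrow> cnrm u \<le> 1" "u \<in> ball n \<Longrightarrow> u \<in> F"
    "u \<in> ball n \<Longrightarrow> u \<in> U0"
  using wspan_U0 unfolding ball_def by auto

lemma zero_ball: "0 \<in> ball n"
  unfolding ball_def using mr_csubspaceD(1)[OF wspan_subspace] by simp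

lemma ball_bs: "\<exists>B. \<forall>u\<in>ball n. bs (\<lambda>k. (1 + lam k) ^ N * (cmod (coef (mul u (cj u)) k))\<^sup>2) B"
proof -
  obtain B where B: "\<And>c. \<forall>i\<in>Sw n. cmod (c i) \<le> 1 \<Longrightarrow> bs (\<lambda>k. (1 + lam k) ^ N *
    (cmod (coef (mul (\<Sum>i\<in>Sw n. scC (c i) (ev i)) (cj (\<Sum>i\<in>Sw n. scC (c i) (ev i)))) k))\<^sup>2) B"
    using bs_spectral_uniform[OF Sw_finite Sw_J] by blast
  have "bs (\<lambda>k. (1 + lam k) ^ N * (cmod (coef (mul u (cj u)) k))\<^sup>2) B" if u: "u \<in> ball n" for u
  proof -
    have "\<forall>i\<in>Sw n. cmod (coef u i) \<le> 1"
    proof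
      fix i assume "i \<in> Sw n"
      then have "cnrm (ev i) = 1" using Sw_J ev_norm by blast
      then show "cmod (coef u i) \<le> 1" using cinner_Cauchy_Schwarz[of u "ev i"] ballD(2)[OF u] unfolding coef_def by simp
    qed
    then show ?thesis using B[of "coef u"] wspan_expand[OF Sw_finite Sw_J ballD(1)[OF u], symmetric] by simp
  qed
  then show ?thesis by blast
qed

lemma cnrm_le_bs:
  assumes u: "u \<in> U0" and B: "bs (\<lambda>k. (cmod (coef (mul u (cj u)) k))\<^sup>2) B"
  shows "(cnrm (mul u (cj u)))\<^sup>2 \<le> B"
  using bs_summable(2)[OF B] infsumI[OF coef_norm_has_sum[OF mul_cj_Kinv[OF u u]]] by simp

lemma bs_cnrm:
  assumes u: "u \<in> U0"
  shows "bs (\<lambda>k. (cmod (coef (mul u (cj u)) k))\<^sup>2) ((cnrm (mul u (cj u)))\<^sup>2)"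
  using bs_infsum[OF has_sum_imp_summable[OF coef_norm_has_sum[OF mul_cj_Kinv[OF u u]]]]
    infsumI[OF coef_norm_has_sum[OF mul_cj_Kinv[OF u u]]] by simp

definition Q :: "nat \<Rightarrow> real" where "Q n = Sup ((\<lambda>u. cnrm (mul u (cj u))) ` ball n)"

lemma Q_upper: "u \<in> ball n \<Longrightarrow> cnrm (mul u (cj u)) \<le> Q n"
  unfolding Q_def
proof (rule cSup_upper)
  obtain B where B: "\<And>u. u \<in> ball n \<Longrightarrow> bs (\<lambda>k. (cmod (coef (mul u (cj u)) k))\<^sup>2) B"
    using ball_bs[of n 0] by auto
  have "cnrm (mul u (cj u)) \<le> sqrt B" if "u \<in> ball n" for u
    using cnrm_le_bs[OF ballD(4)[OF that] B[OF that]] by (rule real_le_rsqrt)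
  then show "bdd_above ((\<lambda>u. cnrm (mul u (cj u))) ` ball n)" by (intro bdd_aboveI[of _ "sqrt B"]) auto
qed blast

lemma Q_least: "(\<And>u. u \<in> ball n \<Longrightarrow> cnrm (mul u (cj u)) \<le> B) \<Longrightarrow> Q n \<le> B"
  unfolding Q_def using zero_ball by (intro cSup_least) auto

lemma Q_nonneg: "0 \<le> Q n"
  using Q_upper[OF zero_ball] cnrm_nonneg order_trans by blast

definition P :: "nat \<Rightarrow> 'h \<Rightarrow> 'h" where "P n Y = (\<Sum>i\<in>Sw n. scC (coef Y i) (ev i))"

lemma P_wspan: "P n Y \<in> wspan (Sw n)"
proof -
  have "ev i \<in> U0" if "i \<in> Sw n" for i using that Sw_J ev_F ev_Kinv by blast
  then have "P n Y \<in> U0" unfolding P_def by (intro mr_csubspace_sum[OF U0_subspace] mr_csubspaceD[OF U0_subspace])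
  then show ?thesis unfolding wspan_def P_def using coef_sum_ev[OF Sw_finite Sw_J] by simp
qed

lemma P_cinner: "cinner (P n Y) X = (\<Sum>i\<in>Sw n. coef Y i * cnj (coef X i))"
  unfolding P_def cinner_sum_left cinner_scC_left coef_def[of X]
  by (intro sum.cong refl) (simp flip: cinner_commute)

lemma P_norm: "(cnrm (P n Y))\<^sup>2 = (\<Sum>i\<in>Sw n. (cmod (coef Y i))\<^sup>2)"
proof -
  have "coef (P n Y) i = coef Y i" if i: "i \<in> Sw n" for i
  proof -
    have "i \<in> J" using i Sw_J by blast
    then show ?thesis unfolding P_def using coef_sum_ev[OF Sw_finite[of n] Sw_J, of i "coef Y"] i by simp
  qed
  then show ?thesis unfolding wspan_norm[OF Sw_finite Sw_J P_wspan] by (intro sum.cong) auto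
qed

lemma scale_to_ball:
  assumes h: "h \<in> wspan (Sw n)"
  obtains h1 where "h1 \<in> ball n" "h = scC (complex_of_real (cnrm h)) h1"
proof (cases "h = 0")
  case True
  then show ?thesis using that[OF zero_ball] by simp
next
  case False
  let ?h = "scC (complex_of_real (1 / cnrm h)) h"
  have "?h \<in> wspan (Sw n)" by (intro mr_csubspaceD[OF wspan_subspace] h)
  moreover have "cnrm ?h \<le> 1" unfolding cnrm_scC norm_of_real by simp
  moreover have "h = scC (complex_of_real (cnrm h)) ?h"
    unfolding scC_scC using False by (simp add: scC_one flip: of_real_mult)
  ultimately show ?thesis using that unfolding ball_def by blast
qed

text \<open>With h the projection of u times \<open>cj u\<close>, the squared norm of h equals <u, u
  h>, hence is at most the norm of u h, and \<open>cnrm_mul_le\<close> bounds the latter after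
  normalising h. The trivial bound would be \<open>Q n\<close> squared; being linear in
  \<open>Q n\<close> is what closes the recursion.\<close>

lemma P_product_le:
  assumes u: "u \<in> ball n"
  shows "(cnrm (P m (mul u (cj u))))\<^sup>2 \<le> Q n * Q m"
proof -
  define Y where "Y = mul u (cj u)"
  define h where "h = P m Y"
  note uF = ballD(3)[OF u]
  have hF: "h \<in> F" unfolding h_def by (rule wspan_U0(2)[OF P_wspan])
  obtain h1 where h1: "h1 \<in> ball m" "h = scC (complex_of_real (cnrm h)) h1"
    by (rule scale_to_ball[OF P_wspan[of m Y], folded h_def])
  have uh: "(cnrm (mul u h1))\<^sup>2 \<le> Q n * Q m"
  proof -
    have "(cnrm (mul u h1))\<^sup>2 \<le> cnrm (mul u (cj u)) * cnrm (mul h1 (cj h1))"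
      by (rule cnrm_mul_le[OF uF ballD(3)[OF h1(1)]])
    also have "\<dots> \<le> Q n * Q m" by (intro mult_mono Q_upper u h1 Q_nonneg) auto
    finally show ?thesis .
  qed
  have "cinner h Y = complex_of_real ((cnrm h)\<^sup>2)"
    unfolding h_def P_cinner P_norm of_real_sum by (intro sum.cong refl) (simp only: complex_norm_square)
  then have "cinner Y h = complex_of_real ((cnrm h)\<^sup>2)" using cinner_commute[of Y h] by (simp only: complex_cnj_complex_of_real)
  then have "(cnrm h)\<^sup>2 = cmod (cinner Y h)" by (simp only: norm_of_real abs_power2)
  also have "cinner Y h = cinner u (mul u h)"
    unfolding Y_def mul_commute[OF uF cj_F[OF uF]] using cj_adjoint[OF cj_F[OF uF] uF hF] cj_cj[OF uF] by simp
  also have "cmod \<dots> \<le> cnrm u * cnrm (mul u h)" by (rule cinner_Cauchy_Schwarz)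
  also have "\<dots> \<le> 1 * cnrm (mul u h)" by (intro mult_right_mono ballD(2)[OF u]) simp
  also have "cnrm (mul u h) = cnrm h * cnrm (mul u h1)"
    by (subst h1(2)) (simp add: mul_scC_right[OF uF ballD(3)[OF h1(1)]] cnrm_scC)
  finally have le: "(cnrm h)\<^sup>2 \<le> cnrm h * cnrm (mul u h1)" by simp
  have "cnrm h \<le> cnrm (mul u h1)"
  proof (cases "cnrm h = 0")
    case False
    then have "cnrm h > 0" using cnrm_nonneg[of h] by linarith
    then show ?thesis using le by (simp add: power2_eq_square)
  qed simp
  then have "(cnrm h)\<^sup>2 \<le> (cnrm (mul u h1))\<^sup>2" by (intro power_mono) auto
  then show ?thesis using uh unfolding h_def Y_def by linarith
qed

lemma sum_Sw_Union: "sum f (\<Union>m<M. Sw m) = (\<Sum>m<M. sum f (Sw m))"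
  by (rule sum.UNION_disjoint) (use Sw_finite Sw_disjoint in auto)

text \<open>Modes below 9/10 of \<open>Lam n\<close> lie in the windows 0 to n. So
  \<open>low_dominates\<close> and \<open>P_product_le\<close> bound the square of
  \<open>Q (Suc n)\<close> by 1400 \<open>Q (Suc n)\<close> times the sum, and one factor
  cancels.\<close>

lemma Q_recursion: "Q (Suc n) \<le> 1400 * (\<Sum>m<Suc n. Q m)"
proof -
  interpret w: window \<pi> I V mul one cj "Sw (Suc n)" "Lam n" "1 / 1203200" by (rule window_Sw)
  have win1: "w.win1 = ball (Suc n)" unfolding w.win1_def w.win_def ball_def ..
  let ?B = "\<Sum>m<Suc n. Q (Suc n) * Q m"
  have low: "bs (\<lambda>k. if lam k < 9/10 * Lam n then (cmod (w.pr u u k))\<^sup>2 else 0) ?B" if u: "u \<in> w.win1" for u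
    unfolding bs_def
  proof (intro allI impI)
    fix A assume A: "finite A \<and> A \<subseteq> J"
    let ?f = "\<lambda>k. (cmod (coef (mul u (cj u)) k))\<^sup>2"
    have L: "9/10 * Lam n < Lam n" unfolding Lam_def using rho_gt_1 by simp
    have "(\<Sum>k\<in>A. if lam k < 9/10 * Lam n then (cmod (w.pr u u k))\<^sup>2 else 0) = sum ?f (A \<inter> {k. lam k < 9/10 * Lam n})"
      unfolding w.pr_def using A by (simp add: sum.inter_restrict)
    also have "\<dots> \<le> sum ?f (\<Union>m<Suc n. Sw m)"
    proof (rule sum_mono2)
      show "finite (\<Union>m<Suc n. Sw m)" using Sw_finite by blast
      show "A \<inter> {k. lam k < 9/10 * Lam n} \<subseteq> (\<Union>m<Suc n. Sw m)" unfolding Sw_Union using A L by auto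
    qed auto
    also have "\<dots> = (\<Sum>m<Suc n. (cnrm (P m (mul u (cj u))))\<^sup>2)" unfolding sum_Sw_Union P_norm ..
    also have "\<dots> \<le> ?B" by (intro sum_mono P_product_le) (use u win1 in simp)
    finally show "(\<Sum>k\<in>A. if lam k < 9/10 * Lam n then (cmod (w.pr u u k))\<^sup>2 else 0) \<le> ?B" .
  qed
  have Z: "w.Z 3 \<le> 1400 * ?B" by (rule w.low_dominates[OF _ low]) auto
  have "(cnrm (mul u (cj u)))\<^sup>2 \<le> 1400 * ?B" if "u \<in> ball (Suc n)" for u
    using w.norm_square_le_Z0[of u] w.Z_mono[of 0 3] Z that win1 by simp
  then have "cnrm (mul u (cj u)) \<le> sqrt (1400 * ?B)" if "u \<in> ball (Suc n)" for u
    using that by (intro real_le_rsqrt) auto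
  then have "Q (Suc n) \<le> sqrt (1400 * ?B)" by (rule Q_least)
  then have "(Q (Suc n))\<^sup>2 \<le> (sqrt (1400 * ?B))\<^sup>2" by (intro power_mono Q_nonneg)
  also have "\<dots> = Q (Suc n) * (1400 * (\<Sum>m<Suc n. Q m))"
  proof (subst real_sqrt_pow2)
    show "0 \<le> 1400 * ?B" by (intro mult_nonneg_nonneg sum_nonneg Q_nonneg) auto
    show "1400 * ?B = Q (Suc n) * (1400 * (\<Sum>m<Suc n. Q m))" by (simp only: sum_distrib_left[symmetric] mult.left_commute)
  qed
  finally have le: "Q (Suc n) * Q (Suc n) \<le> Q (Suc n) * (1400 * (\<Sum>m<Suc n. Q m))" by (simp add: power2_eq_square)
  show ?thesis
  proof (cases "Q (Suc n) = 0")
    case True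
    have "0 \<le> (\<Sum>m<Suc n. Q m)" by (intro sum_nonneg Q_nonneg)
    then show ?thesis unfolding True by simp
  next
    case False
    then have "Q (Suc n) > 0" using Q_nonneg[of "Suc n"] by linarith
    then show ?thesis using le by (rule mult_left_le_imp_le[rotated])
  qed
qed

text \<open>1401 is 1400 + 1: then 1400 times a partial geometric sum is
  \<open>1401 ^ n - 1\<close>.\<close>

lemma Q_growth: "Q n \<le> (Q 0 + 1) * 1401 ^ n"
proof (induction n rule: less_induct)
  case (less n)
  have c: "Q 0 + 1 > 0" using Q_nonneg[of 0] by linarith
  show ?case
  proof (cases n)
    case (Suc k)
    have geo: "1400 * (\<Sum>m<j. (Q 0 + 1) * 1401 ^ m) = (Q 0 + 1) * (1401 ^ j - 1)" for j :: nat
      by (induction j) (auto simp: algebra_simps)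
    have "Q n \<le> 1400 * (\<Sum>m<Suc k. Q m)" unfolding Suc by (rule Q_recursion)
    also have "\<dots> \<le> 1400 * (\<Sum>m<Suc k. (Q 0 + 1) * 1401 ^ m)"
      by (intro mult_left_mono sum_mono less) (auto simp: Suc)
    also have "\<dots> \<le> (Q 0 + 1) * 1401 ^ n" unfolding geo Suc using c by (intro mult_left_mono) auto
    finally show ?thesis .
  qed simp
qed

lemma high_moments_uniform:
  assumes N: "odd N"
  shows "\<exists>C\<ge>0. \<forall>n. \<forall>u\<in>ball (Suc n). bs (\<lambda>k. (1 + lam k / Lam n) ^ N * (cmod (coef (mul u (cj u)) k))\<^sup>2) (C * (Q (Suc n))\<^sup>2)"
proof -
  obtain p where p: "N = Suc p" using N by (cases N) auto
  obtain Kt where Kt: "Kt \<ge> 0" "\<And>y. y \<ge> 0 \<Longrightarrow> \<bar>2 * TT N y - (- y) ^ N\<bar> \<le> Kt * (1 + y) ^ (N - 1)"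
    using TT_leading[of p] unfolding p by auto
  define c where "c = Kt + 16 * KK N"
  define M where "M = 2 * 2 ^ N * (c + 1)"
  define C where "C = 2 * (2 ^ N + 2 ^ N * c * M ^ (N - 1))"
  have c0: "c \<ge> 0" using Kt KK_nonneg by (simp add: c_def)
  then have C0: "C \<ge> 0" unfolding C_def M_def by (intro mult_nonneg_nonneg add_nonneg_nonneg) auto
  have "bs (\<lambda>k. (1 + lam k / Lam n) ^ N * (cmod (coef (mul u (cj u)) k))\<^sup>2) (C * (Q (Suc n))\<^sup>2)" if u: "u \<in> ball (Suc n)" for n u
  proof -
    interpret w: window \<pi> I V mul one cj "Sw (Suc n)" "Lam n" "1 / 1203200" by (rule window_Sw)
    have win1: "w.win1 = ball (Suc n)" unfolding w.win1_def w.win_def ball_def ..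
    have "w.Z 0 \<le> (Q (Suc n))\<^sup>2"
    proof (rule w.Z_least)
      fix v assume "v \<in> w.win1"
      then have v: "v \<in> ball (Suc n)" using win1 by simp
      have "bs (\<lambda>k. (cmod (coef (mul v (cj v)) k))\<^sup>2) ((cnrm (mul v (cj v)))\<^sup>2)" by (rule bs_cnrm[OF ballD(4)[OF v]])
      then show "bs (w.sq 0 v v) ((Q (Suc n))\<^sup>2)"
        by (rule bs_mono) (auto simp: w.sq_def w.pr_def intro!: power_mono Q_upper v)
    qed
    then have "C * w.Z 0 \<le> C * (Q (Suc n))\<^sup>2" using C0 by (intro mult_left_mono)
    moreover have "w.Z N \<le> C * w.Z 0" unfolding C_def by (rule w.high_moments[OF N Kt c_def M_def])
    ultimately have le: "w.Z N \<le> C * (Q (Suc n))\<^sup>2" by linarith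
    have "bs (w.sq N u u) (w.Z N)" by (rule w.Z_upper) (use u win1 in simp)
    then show ?thesis by (rule bs_mono) (use le in \<open>auto simp: w.sq_def w.pr_def w.y_def\<close>)
  qed
  then show ?thesis using C0 by blast
qed

lemma P_norm_le_bs:
  assumes B: "bs (\<lambda>k. g k * (cmod (coef Y k))\<^sup>2) B" and g: "\<And>k. k \<in> Sw m \<Longrightarrow> r \<le> g k" and r: "r > 0"
  shows "(cnrm (P m Y))\<^sup>2 \<le> B / r"
proof -
  have "r * (cnrm (P m Y))\<^sup>2 = (\<Sum>k\<in>Sw m. r * (cmod (coef Y k))\<^sup>2)" unfolding P_norm sum_distrib_left ..
  also have "\<dots> \<le> (\<Sum>k\<in>Sw m. g k * (cmod (coef Y k))\<^sup>2)" by (intro sum_mono mult_right_mono g) auto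
  also have "\<dots> \<le> B" using B Sw_finite Sw_J unfolding bs_def by blast
  finally show ?thesis using r by (simp add: field_simps)
qed

text \<open>An odd moment order N with \<open>rho ^ N\<close> at least 2802 squared gives the factor
  1 / 2802^m in window n + m. Against the weights 1401^m of \<open>sup_bound\<close> this leaves a
  geometric series of ratio 1/2.\<close>

lemma P_decay:
  "\<exists>D\<ge>0. \<forall>n. \<forall>u\<in>ball n. \<forall>m. (m < n \<longrightarrow> cnrm (P m (mul u (cj u))) \<le> D * 1401 ^ n) \<and>
     (cnrm (P (n + m) (mul u (cj u))) \<le> D * 1401 ^ n / 2802 ^ m)"
proof -
  define c where "c = Q 0 + 1"
  have c: "c > 0" "\<And>n. Q n \<le> c * 1401 ^ n" using Q_nonneg[of 0] Q_growth by (auto simp: c_def)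
  obtain N0 where N0: "(2802::real)\<^sup>2 < rho ^ N0" using real_arch_pow[OF rho_gt_1] by blast
  define N where "N = 2 * N0 + 1"
  have N: "odd N" "(2802::real)\<^sup>2 \<le> rho ^ N"
  proof -
    have "rho ^ N0 \<le> rho ^ N" using rho_gt_1 unfolding N_def by (intro power_increasing) auto
    then show "(2802::real)\<^sup>2 \<le> rho ^ N" using N0 by linarith
  qed (simp add: N_def)
  obtain C where C: "C \<ge> 0" "\<And>n u. u \<in> ball (Suc n) \<Longrightarrow> bs (\<lambda>k. (1 + lam k / Lam n) ^ N * (cmod (coef (mul u (cj u)) k))\<^sup>2) (C * (Q (Suc n))\<^sup>2)"
    using high_moments_uniform[OF N(1)] by blast
  obtain B0 where B0: "\<And>u. u \<in> ball 0 \<Longrightarrow> bs (\<lambda>k. (1 + lam k) ^ N * (cmod (coef (mul u (cj u)) k))\<^sup>2) B0"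
    using ball_bs by blast
  have B0n: "B0 \<ge> 0" using bs_nonneg[OF B0[OF zero_ball]] .
  define D where "D = c + sqrt C * c + sqrt B0"
  have D: "c \<le> D" "sqrt C * c \<le> D" "sqrt B0 \<le> D" "0 \<le> D"
    using c(1) C(1) B0n unfolding D_def by auto
  have pw: "(2802::real) ^ (2 * m) \<le> rho ^ (N * m)" for m
  proof -
    have "((2802::real)\<^sup>2) ^ m \<le> (rho ^ N) ^ m" using N(2) by (intro power_mono) auto
    then show ?thesis by (simp add: power_mult)
  qed
  have sq_le: "x \<le> sqrt b * q / 2802 ^ m" if "x\<^sup>2 \<le> b * q\<^sup>2 / 2802 ^ (2 * m)" "b \<ge> 0" "q \<ge> 0" for x b q :: real and m
  proof (rule power2_le_imp_le)
    show "x\<^sup>2 \<le> (sqrt b * q / 2802 ^ m)\<^sup>2" using that by (simp add: power_divide power_mult_distrib power_even_eq)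
  qed (use that in auto)
  have dec: "cnrm (P (n + m) (mul u (cj u))) \<le> D * 1401 ^ n / 2802 ^ m" if u: "u \<in> ball n" for n m u
  proof (cases n)
    \<comment> \<open>The bottom window is not covered by \<open>high_moments_uniform\<close>; its
      ball is a single one, and \<open>ball_bs\<close> bounds its moments.\<close>
    case 0
    have u0: "u \<in> ball 0" using u 0 by simp
    have "(cnrm (P m (mul u (cj u))))\<^sup>2 \<le> B0 / 2802 ^ (2 * m)"
    proof (rule P_norm_le_bs[OF B0[OF u0]])
      fix k assume k: "k \<in> Sw m"
      then have l: "lam k \<ge> 0" using Sw_J lam_nonneg by blast
      have "rho ^ m \<le> 1 + lam k"
      proof (cases m)
        case (Suc j)
        have "rho ^ m \<le> Lam j" unfolding Suc Lam_def power_Suc using rho_gt_1 by (intro mult_right_mono) (auto simp: rho_def)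
        then show ?thesis using k unfolding Suc Sw_def by simp
      qed (use l in simp)
      then have "(rho ^ m) ^ N \<le> (1 + lam k) ^ N" using rho_gt_1 by (intro power_mono) auto
      then show "2802 ^ (2 * m) \<le> (1 + lam k) ^ N" using pw[of m] by (simp add: power_mult[symmetric] mult.commute)
    qed simp
    then have "cnrm (P m (mul u (cj u))) \<le> sqrt B0 * 1 / 2802 ^ m" using B0n by (intro sq_le) auto
    also have "\<dots> \<le> D * 1 / 2802 ^ m" using D by (intro divide_right_mono mult_right_mono) auto
    finally show ?thesis using 0 by simp
  next
    case (Suc j)
    have uS: "u \<in> ball (Suc j)" using u Suc by simp
    have Lj: "Lam j > 0" unfolding Lam_def using rho_gt_1 by simp
    have "(cnrm (P (n + m) (mul u (cj u))))\<^sup>2 \<le> C * (Q (Suc j))\<^sup>2 / 2802 ^ (2 * m)"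
    proof (rule P_norm_le_bs[OF C(2)[OF uS]])
      fix k assume k: "k \<in> Sw (n + m)"
      have "Lam (j + m) \<le> lam k" using k unfolding Suc by (simp add: Sw_def)
      moreover have "Lam (j + m) = rho ^ m * Lam j" by (simp add: Lam_def power_add)
      ultimately have "rho ^ m \<le> lam k / Lam j" using Lj by (simp add: pos_le_divide_eq)
      then have "(rho ^ m) ^ N \<le> (1 + lam k / Lam j) ^ N" using rho_gt_1 by (intro power_mono) auto
      then show "2802 ^ (2 * m) \<le> (1 + lam k / Lam j) ^ N" using pw[of m] by (simp add: power_mult[symmetric] mult.commute)
    qed simp
    then have "cnrm (P (n + m) (mul u (cj u))) \<le> sqrt C * Q n / 2802 ^ m" using C Q_nonneg Suc by (intro sq_le) auto
    also have "\<dots> \<le> sqrt C * (c * 1401 ^ n) / 2802 ^ m" using C(1) c(2) by (intro divide_right_mono mult_left_mono) auto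
    also have "\<dots> = (sqrt C * c) * 1401 ^ n / 2802 ^ m" by simp
    also have "\<dots> \<le> D * 1401 ^ n / 2802 ^ m" using D by (intro divide_right_mono mult_right_mono) auto
    finally show ?thesis .
  qed
  moreover have "cnrm (P m (mul u (cj u))) \<le> D * 1401 ^ n" if u: "u \<in> ball n" for n m u
  proof -
    have "(cnrm (P m (mul u (cj u))))\<^sup>2 \<le> (cnrm (mul u (cj u)))\<^sup>2 / 1"
    proof (rule P_norm_le_bs[where g="\<lambda>_. 1"])
      show "bs (\<lambda>k. 1 * (cmod (coef (mul u (cj u)) k))\<^sup>2) ((cnrm (mul u (cj u)))\<^sup>2)"
        unfolding mult_1_left by (rule bs_cnrm[OF ballD(4)[OF u]])
    qed simp_all
    then have "(cnrm (P m (mul u (cj u))))\<^sup>2 \<le> (cnrm (mul u (cj u)))\<^sup>2" by (simp only: div_by_1)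
    then have "cnrm (P m (mul u (cj u))) \<le> cnrm (mul u (cj u))" by (rule power2_le_imp_le[OF _ cnrm_nonneg])
    also have "\<dots> \<le> Q n" by (rule Q_upper[OF u])
    also have "\<dots> \<le> c * 1401 ^ n" by (rule c)
    also have "\<dots> \<le> D * 1401 ^ n" using D by (intro mult_right_mono) auto
    finally show ?thesis .
  qed
  ultimately show ?thesis using D(4) by blast
qed

text \<open>The supremum \<open>s\<close> over \<open>n\<close> and \<open>u\<close> is finite a priori; the inequality \<open>s\<^sup>2 \<le> 3 D \<parallel>b\<parallel> s\<close> then bounds it linearly in \<open>\<parallel>b\<parallel>\<close>.\<close>

lemma sup_bound: "\<exists>D\<ge>0. \<forall>n. \<forall>u\<in>ball n. \<forall>b\<in>F. cnrm (mul u b) \<le> D * 1401 ^ n * cnrm b"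
proof -
  obtain D where D0: "D \<ge> 0" and D1: "\<And>n u m. u \<in> ball n \<Longrightarrow> m < n \<Longrightarrow> cnrm (P m (mul u (cj u))) \<le> D * 1401 ^ n"
    and D2: "\<And>n u m. u \<in> ball n \<Longrightarrow> cnrm (P (n + m) (mul u (cj u))) \<le> D * 1401 ^ n / 2802 ^ m"
    using P_decay by blast
  \<comment> \<open>One of the three units comes from the windows m < n, the other two from the
    geometric tail with ratio 1401/2802.\<close>
  have sum_le: "(\<Sum>m<M. 1401 ^ m * cnrm (P m (mul u (cj u)))) \<le> 3 * D * (1401 ^ n)\<^sup>2" if u: "u \<in> ball n" for u n M
  proof -
    let ?f = "\<lambda>m. 1401 ^ m * cnrm (P m (mul u (cj u)))"
    have "(\<Sum>m<M. ?f m) \<le> (\<Sum>m<n + M. ?f m)" by (rule sum_mono2) auto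
    also have "\<dots> = (\<Sum>m<n. ?f m) + (\<Sum>m<M. ?f (n + m))" by (rule sum_lessThan_add)
    also have "(\<Sum>m<n. ?f m) \<le> (\<Sum>m<n. 1401 ^ m * (D * 1401 ^ n))" by (intro sum_mono mult_left_mono D1 u) auto
    also have "\<dots> = (\<Sum>m<n. 1401 ^ m) * (D * 1401 ^ n)" by (rule sum_distrib_right[symmetric])
    also have "\<dots> \<le> 1401 ^ n * (D * 1401 ^ n)"
    proof (rule mult_right_mono)
      show "(\<Sum>m<n. (1401::real) ^ m) \<le> 1401 ^ n"
      proof (induction n)
        case (Suc n)
        have "0 \<le> (1401::real) ^ n" by simp
        then show ?case using Suc by (simp del: zero_le_power)
      qed simp
    qed (use D0 in simp)
    also have "(\<Sum>m<M. ?f (n + m)) \<le> (\<Sum>m<M. (1401 ^ n)\<^sup>2 * D * (1/2) ^ m)"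
    proof (rule sum_mono)
      fix m
      have "?f (n + m) \<le> 1401 ^ (n + m) * (D * 1401 ^ n / 2802 ^ m)" by (intro mult_left_mono D2 u) simp
      also have "\<dots> = (1401 ^ n)\<^sup>2 * D * (1401 / 2802) ^ m" by (simp only: power_add power2_eq_square power_divide) simp
      finally show "?f (n + m) \<le> (1401 ^ n)\<^sup>2 * D * (1/2) ^ m" by simp
    qed
    also have "\<dots> = (1401 ^ n)\<^sup>2 * D * (\<Sum>m<M. (1/2) ^ m)" by (rule sum_distrib_left[symmetric])
    also have "\<dots> \<le> (1401 ^ n)\<^sup>2 * D * 2"
    proof (rule mult_left_mono)
      have "(\<Sum>m<M. (1/2::real) ^ m) = 2 - 2 * (1/2) ^ M" by (induction M) auto
      then show "(\<Sum>m<M. (1/2::real) ^ m) \<le> 2" by simp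
    qed (use D0 in simp)
    finally show ?thesis by (simp add: power2_eq_square)
  qed
  have main: "cnrm (mul u b) \<le> 3 * D * 1401 ^ n * cnrm b" if u: "u \<in> ball n" and b: "b \<in> F" for n u b
  proof -
    define T where "T = {cnrm (mul v b) / 1401 ^ j | v j. v \<in> ball j}"
    define s where "s = Sup T"
    \<comment> \<open>An a priori bound from \<open>cnrm_mul_le\<close>. It involves the product of
      b with \<open>cj b\<close> and serves only to make \<open>s\<close> finite.\<close>
    define K where "K = sqrt ((Q 0 + 1) * cnrm (mul b (cj b)))"
    have apriori: "cnrm (mul v b) / 1401 ^ j \<le> K" if v: "v \<in> ball j" for v j
    proof -
      have "(cnrm (mul v b))\<^sup>2 \<le> cnrm (mul v (cj v)) * cnrm (mul b (cj b))" by (rule cnrm_mul_le[OF ballD(3)[OF v] b])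
      also have "\<dots> \<le> ((Q 0 + 1) * 1401 ^ j) * cnrm (mul b (cj b))"
        using order_trans[OF Q_upper[OF v] Q_growth] by (rule mult_right_mono) simp
      also have "\<dots> \<le> ((Q 0 + 1) * (1401 ^ j)\<^sup>2) * cnrm (mul b (cj b))"
      proof (intro mult_right_mono mult_left_mono)
        show "(1401::real) ^ j \<le> (1401 ^ j)\<^sup>2" unfolding power2_eq_square by simp
      qed (use Q_nonneg[of 0] in auto)
      also have "\<dots> = (K * 1401 ^ j)\<^sup>2"
        using Q_nonneg[of 0] unfolding K_def power_mult_distrib by (simp add: mult_ac)
      finally have "cnrm (mul v b) \<le> K * 1401 ^ j"
        by (rule power2_le_imp_le) (use Q_nonneg[of 0] in \<open>simp add: K_def\<close>)
      then show ?thesis by (simp add: field_simps)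
    qed
    then have bdd: "bdd_above T" unfolding T_def by (intro bdd_aboveI[of _ K]) auto
    have s: "cnrm (mul v b) \<le> s * 1401 ^ j" if v: "v \<in> ball j" for v j
    proof -
      have "cnrm (mul v b) / 1401 ^ j \<le> s" unfolding s_def by (rule cSup_upper[OF _ bdd]) (use v in \<open>auto simp: T_def\<close>)
      then show ?thesis by (simp add: field_simps)
    qed
    have s0: "s \<ge> 0" using s[OF zero_ball, of 0] b by simp
    have sq: "(cnrm (mul v b))\<^sup>2 \<le> 3 * D * cnrm b * s * (1401 ^ j)\<^sup>2" if v: "v \<in> ball j" for v j
    proof -
      define Y X where "Y = mul v (cj v)" and "X = mul b (cj b)"
      note vF = ballD(3)[OF v]
      \<comment> \<open>The pairing of \<open>P m Y\<close> with b times \<open>cj b\<close> is that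
        of b times \<open>P m Y\<close> with b, so the supremum s bounds it again; this makes the
        inequality quadratic in s.\<close>
      have Ph: "cmod (cinner (P m Y) X) \<le> cnrm b * (s * (1401 ^ m * cnrm (P m Y)))" for m
      proof -
        obtain h1 where h1: "h1 \<in> ball m" "P m Y = scC (complex_of_real (cnrm (P m Y))) h1"
          by (rule scale_to_ball[OF P_wspan])
        have hF: "P m Y \<in> F" by (rule wspan_U0(2)[OF P_wspan])
        have "cinner X (P m Y) = cinner b (mul b (P m Y))"
          unfolding X_def mul_commute[OF b cj_F[OF b]] using cj_adjoint[OF cj_F[OF b] b hF] cj_cj[OF b] by simp
        then have "cmod (cinner (P m Y) X) = cmod (cinner b (mul b (P m Y)))"
          using cinner_commute[of X "P m Y"] by (metis complex_mod_cnj)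
        also have "\<dots> \<le> cnrm b * cnrm (mul b (P m Y))" by (rule cinner_Cauchy_Schwarz)
        also have "cnrm (mul b (P m Y)) = cnrm (P m Y) * cnrm (mul h1 b)"
          by (subst h1(2)) (simp add: mul_scC_right[OF b ballD(3)[OF h1(1)]] cnrm_scC mul_commute[OF b ballD(3)[OF h1(1)]])
        also have "cnrm b * (cnrm (P m Y) * cnrm (mul h1 b)) \<le> cnrm b * (cnrm (P m Y) * (s * 1401 ^ m))"
          by (intro mult_left_mono s h1) auto
        finally show ?thesis by (simp add: mult_ac)
      qed
      have bound: "cmod (\<Sum>k\<in>(\<Union>m<M. Sw m). coef Y k * cnj (coef X k)) \<le> 3 * D * cnrm b * s * (1401 ^ j)\<^sup>2" for M
      proof -
        have "(\<Sum>k\<in>(\<Union>m<M. Sw m). coef Y k * cnj (coef X k)) = (\<Sum>m<M. cinner (P m Y) X)"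
          unfolding sum_Sw_Union P_cinner ..
        then have "cmod (\<Sum>k\<in>(\<Union>m<M. Sw m). coef Y k * cnj (coef X k)) \<le> (\<Sum>m<M. cmod (cinner (P m Y) X))"
          by (simp add: norm_sum)
        also have "\<dots> \<le> (\<Sum>m<M. cnrm b * (s * (1401 ^ m * cnrm (P m Y))))" by (intro sum_mono Ph)
        also have "\<dots> = cnrm b * (s * (\<Sum>m<M. 1401 ^ m * cnrm (P m Y)))" by (simp add: sum_distrib_left)
        also have "\<dots> \<le> cnrm b * (s * (3 * D * (1401 ^ j)\<^sup>2))"
          unfolding Y_def using s0 by (intro mult_left_mono sum_le v) auto
        finally show ?thesis by (simp add: mult_ac)
      qed
      have YX: "cinner Y X = complex_of_real ((cnrm (mul v b))\<^sup>2)" unfolding Y_def X_def by (rule cnrm_mul[OF vF b])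
      have "cmod (cinner Y X) \<le> 3 * D * cnrm b * s * (1401 ^ j)\<^sup>2 + e" if e: "e > 0" for e
      proof -
        have "((\<lambda>k. coef Y k * cnj (coef X k)) has_sum cinner Y X) J"
          unfolding Y_def by (rule coef_has_sum[OF mul_cj_Kinv[OF ballD(4)[OF v] ballD(4)[OF v]]])
        then have lim: "((\<lambda>B. \<Sum>k\<in>B. coef Y k * cnj (coef X k)) \<longlongrightarrow> cinner Y X) (finite_subsets_at_top J)"
          unfolding has_sum_def .
        have "\<exists>A. finite A \<and> A \<subseteq> J \<and> (\<forall>B. finite B \<and> A \<subseteq> B \<and> B \<subseteq> J \<longrightarrow> dist (\<Sum>k\<in>B. coef Y k * cnj (coef X k)) (cinner Y X) < e)"
          using tendstoD[OF lim e] unfolding eventually_finite_subsets_at_top .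
        then obtain A where A0: "finite A \<and> A \<subseteq> J \<and>
          (\<forall>B. finite B \<and> A \<subseteq> B \<and> B \<subseteq> J \<longrightarrow> dist (\<Sum>k\<in>B. coef Y k * cnj (coef X k)) (cinner Y X) < e)" ..
        note A = conjunct1[OF A0] conjunct1[OF conjunct2[OF A0]] conjunct2[OF conjunct2[OF A0]]
        obtain M where M: "A \<subseteq> (\<Union>m<M. Sw m)" using finite_subset_Sw[OF A(1,2)] by blast
        have "dist (\<Sum>k\<in>(\<Union>m<M. Sw m). coef Y k * cnj (coef X k)) (cinner Y X) < e"
          using M Sw_finite Sw_J by (intro A(3)[rule_format]) blast
        then show ?thesis using bound[of M] norm_triangle_sub[of "cinner Y X" "\<Sum>k\<in>(\<Union>m<M. Sw m). coef Y k * cnj (coef X k)"]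
          by (simp add: dist_norm norm_minus_commute)
      qed
      then have "cmod (cinner Y X) \<le> 3 * D * cnrm b * s * (1401 ^ j)\<^sup>2" by (rule field_le_epsilon)
      then show ?thesis unfolding YX norm_of_real by simp
    qed
    have "s \<le> sqrt (3 * D * cnrm b * s)"
    proof -
      have ne: "T \<noteq> {}" unfolding T_def using zero_ball by blast
      have "x \<le> sqrt (3 * D * cnrm b * s)" if "x \<in> T" for x
      proof -
        obtain v j where v: "v \<in> ball j" "x = cnrm (mul v b) / 1401 ^ j" using \<open>x \<in> T\<close> unfolding T_def by blast
        have "x\<^sup>2 \<le> 3 * D * cnrm b * s"
          using sq[OF v(1)] unfolding v(2) power_divide by (simp add: divide_le_eq)
        then show ?thesis by (rule real_le_rsqrt)
      qed
      then show ?thesis using cSup_least[OF ne] unfolding s_def by blast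
    qed
    then have "s\<^sup>2 \<le> (sqrt (3 * D * cnrm b * s))\<^sup>2" using s0 by (intro power_mono)
    also have "\<dots> = 3 * D * cnrm b * s" using D0 s0 by simp
    finally have "s * s \<le> (3 * D * cnrm b) * s" by (simp add: power2_eq_square)
    then have "s \<le> 3 * D * cnrm b" using s0 D0 by (cases "s = 0") auto
    then have "s * 1401 ^ n \<le> 3 * D * cnrm b * 1401 ^ n" by (intro mult_right_mono) auto
    with s[OF u] have "cnrm (mul u b) \<le> 3 * D * cnrm b * 1401 ^ n" by (rule order_trans)
    then show ?thesis by (simp only: mult_ac)
  qed
  then show ?thesis using D0 by (intro exI[of _ "3 * D"]) auto
qed

end

section \<open>The norm \<open>\<parallel>f(\<Delta>) \<alpha>\<parallel>\<close>\<close>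

context mrep
begin

lemma eig_vectors_subspace: "mr_csubspace {v \<in> Hinf \<pi>. Cas v = scC z v}"
  unfolding mr_csubspace_def
proof (intro conjI ballI allI)
  have "Cas (scC 0 0) = scC 0 (Cas 0)" by (rule op_scC(4)[OF Hinf_0])
  then show "0 \<in> {v \<in> Hinf \<pi>. Cas v = scC z v}" using Hinf_0 by simp
qed (auto simp: op_add op_scC Hinf_add Hinf_scC scC_add_right scC_scC mult.commute)

lemma eig_space_diff:
  assumes x: "x \<in> eig_space \<pi> l" and y: "y \<in> eig_space \<pi> l"
  shows "x - y \<in> eig_space \<pi> l"
  unfolding eig_space_def cclosure_def
proof (intro CollectI allI impI)
  let ?E = "{v \<in> Hinf \<pi>. Cas v = scC (complex_of_real l) v}"
  fix e :: real assume "e > 0"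
  then have "e / 2 > 0" by simp
  then obtain s t where s: "s \<in> ?E" "cnrm (x - s) < e / 2" and t: "t \<in> ?E" "cnrm (y - t) < e / 2"
    using x y unfolding eig_space_def cclosure_def by fast
  have "s - t \<in> ?E" by (rule mr_csubspaceD(5)[OF eig_vectors_subspace s(1) t(1)])
  moreover have "cnrm ((x - y) - (s - t)) < e"
  proof -
    have "(x - y) - (s - t) = (x - s) - (y - t)" by simp
    then show ?thesis using cnrm_triangle_diff[of "x - s" "y - t"] s(2) t(2) by (metis field_sum_of_halves add_strict_mono le_less_trans)
  qed
  ultimately show "\<exists>s\<in>?E. cnrm (x - y - s) < e" by blast
qed

text \<open>Symmetry of the Casimir gives orthogonality to smooth eigenvectors. An element of the
  closure with nonzero inner product would be closer to such an eigenvector than Cauchy-Schwarz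
  allows.\<close>

lemma ev_eig_space_orthogonal:
  assumes k: "k \<in> J" and l: "lam k \<noteq> l" and s: "s \<in> eig_space \<pi> l"
  shows "cinner (ev k) s = 0"
proof (rule ccontr)
  assume n: "cinner (ev k) s \<noteq> 0"
  have orth: "cinner (ev k) t = 0" if t: "t \<in> Hinf \<pi>" "Cas t = scC (complex_of_real l) t" for t
  proof -
    have "complex_of_real (lam k) * cinner (ev k) t = complex_of_real l * cinner (ev k) t"
      using op_adjoint(4)[OF ev_Hinf[OF k] t(1)] unfolding casimir_ev[OF k] t(2) by (simp only: cinner_scC_left cinner_scC_right complex_cnj_complex_of_real)
    then show ?thesis using l by simp
  qed
  obtain t where t: "t \<in> Hinf \<pi>" "Cas t = scC (complex_of_real l) t" "cnrm (s - t) < cmod (cinner (ev k) s)"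
    using s n unfolding eig_space_def cclosure_def by (smt (verit, best) mem_Collect_eq zero_less_norm_iff)
  have "cinner (ev k) s = cinner (ev k) (s - t)" using orth[OF t(1,2)] by (simp add: cinner_diff_right)
  then show False using cinner_Cauchy_Schwarz[of "ev k" "s - t"] ev_norm[OF k] t(3) by simp
qed

lemma ev_eig_space: "k \<in> J \<Longrightarrow> ev k \<in> {v \<in> Hinf \<pi>. Cas v = scC (complex_of_real (lam k)) v}"
  using ev_Hinf casimir_ev by blast

text \<open>\<open>eig_space\<close> may contain far more than spherical vectors. The matching part
  of the sum is still its projection, because the other terms are orthogonal to the whole closed
  eigenspace.\<close>

lemma cproj_eig_space:
  assumes A: "finite A" "A \<subseteq> J"
  shows "cproj (eig_space \<pi> l) (\<Sum>k\<in>A. scC (c k) (ev k)) = (\<Sum>k\<in>{k \<in> A. lam k = l}. scC (c k) (ev k))"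
proof (rule cproj_eqI)
  let ?E = "{v \<in> Hinf \<pi>. Cas v = scC (complex_of_real l) v}"
  have "scC (c k) (ev k) \<in> ?E" if "k \<in> {k \<in> A. lam k = l}" for k
    using mr_csubspaceD(3)[OF eig_vectors_subspace ev_eig_space[of k]] that A by blast
  then have "(\<Sum>k\<in>{k \<in> A. lam k = l}. scC (c k) (ev k)) \<in> ?E"
    by (rule mr_csubspace_sum[OF eig_vectors_subspace])
  then show "(\<Sum>k\<in>{k \<in> A. lam k = l}. scC (c k) (ev k)) \<in> eig_space \<pi> l"
    unfolding eig_space_def using cclosure_subset by (rule subsetD[rotated])
  fix s assume s: "s \<in> eig_space \<pi> l"
  have "(\<Sum>k\<in>A. scC (c k) (ev k)) = (\<Sum>k\<in>{k \<in> A. lam k = l}. scC (c k) (ev k)) + (\<Sum>k\<in>A - {k \<in> A. lam k = l}. scC (c k) (ev k))"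
    using sum.subset_diff[of "{k \<in> A. lam k = l}" A "\<lambda>k. scC (c k) (ev k)"] A by (simp add: add.commute)
  then have "cinner ((\<Sum>k\<in>A. scC (c k) (ev k)) - (\<Sum>k\<in>{k \<in> A. lam k = l}. scC (c k) (ev k))) s
      = (\<Sum>k\<in>A - {k \<in> A. lam k = l}. c k * cinner (ev k) s)"
    by (simp add: cinner_sum_left cinner_scC_left)
  also have "\<dots> = 0"
    by (rule sum.neutral) (use ev_eig_space_orthogonal[OF _ _ s] A in auto)
  finally show "cinner ((\<Sum>k\<in>A. scC (c k) (ev k)) - (\<Sum>k\<in>{k \<in> A. lam k = l}. scC (c k) (ev k))) s = 0" .
qed (rule eig_space_diff)

lemma cnrm_sum_ev:
  assumes A: "finite A" "A \<subseteq> J"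
  shows "(cnrm (\<Sum>k\<in>A. scC (c k) (ev k)))\<^sup>2 = (\<Sum>k\<in>A. (cmod (c k))\<^sup>2)"
proof -
  let ?u = "\<Sum>k\<in>A. scC (c k) (ev k)"
  have coef: "coef ?u k = c k" if "k \<in> A" for k using coef_sum_ev[OF A, of k c] that A by auto
  then have "(\<Sum>k\<in>A. scC (coef ?u k) (ev k)) = ?u" by (intro sum.cong) auto
  then show ?thesis using cnrm_residual_coef[OF A, of ?u] coef by simp
qed

text \<open>Several indices may share an eigenvalue, so the terms are regrouped along
  \<open>lam\<close>; all but finitely many reals contribute zero to the infinite sum.\<close>

lemma fDelta_norm_sum_ev:
  assumes A: "finite A" "A \<subseteq> J"
  shows "fDelta_norm \<pi> f (\<Sum>k\<in>A. scC (c k) (ev k)) = sqrt (\<Sum>k\<in>A. (cmod (f (lam k)))\<^sup>2 * (cmod (c k))\<^sup>2)"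
proof -
  let ?v = "\<Sum>k\<in>A. scC (c k) (ev k)"
  have pr: "(cnrm (cproj (eig_space \<pi> l) ?v))\<^sup>2 = (\<Sum>k\<in>{k \<in> A. lam k = l}. (cmod (c k))\<^sup>2)" for l
    unfolding cproj_eig_space[OF A] by (rule cnrm_sum_ev) (use A in auto)
  have "(\<Sum>\<^sub>\<infinity>l. (cmod (f l))\<^sup>2 * (cnrm (cproj (eig_space \<pi> l) ?v))\<^sup>2)
      = (\<Sum>\<^sub>\<infinity>l\<in>lam ` A. (cmod (f l))\<^sup>2 * (\<Sum>k\<in>{k \<in> A. lam k = l}. (cmod (c k))\<^sup>2))"
    unfolding pr
  proof (rule infsum_cong_neutral)
    fix l assume "l \<in> UNIV - lam ` A"
    then have "{k \<in> A. lam k = l} = {}" by blast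
    then show "(cmod (f l))\<^sup>2 * (\<Sum>k\<in>{k \<in> A. lam k = l}. (cmod (c k))\<^sup>2) = 0" by (simp only: sum.empty mult_zero_right)
  qed auto
  also have "\<dots> = (\<Sum>l\<in>lam ` A. (cmod (f l))\<^sup>2 * (\<Sum>k\<in>{k \<in> A. lam k = l}. (cmod (c k))\<^sup>2))"
    using A by (intro infsum_finite) simp
  also have "\<dots> = (\<Sum>l\<in>lam ` A. \<Sum>k\<in>{k \<in> A. lam k = l}. (cmod (f (lam k)))\<^sup>2 * (cmod (c k))\<^sup>2)"
    unfolding sum_distrib_left by (intro sum.cong) auto
  also have "\<dots> = (\<Sum>k\<in>A. (cmod (f (lam k)))\<^sup>2 * (cmod (c k))\<^sup>2)"
    by (rule sum.image_gen[OF A(1), symmetric])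
  finally show ?thesis unfolding fDelta_norm_def by simp
qed

text \<open>Window m > 0 starts at \<open>Lam (m - 1)\<close>, which is at least
  \<open>rho ^ m\<close>. So m is at most a multiple of \<open>log_plus\<close>, and
  \<open>2802 ^ m\<close> is polynomial in the eigenvalue. Since \<open>log_plus\<close> is at least
  ln 2, an exponent linear in it is bounded by a multiple of its square.\<close>

lemma window_weight_le:
  assumes D: "D \<ge> 0"
  shows "\<exists>A\<ge>0. \<forall>m. \<forall>k\<in>Sw m. 2 * D\<^sup>2 * (2802 ^ m)\<^sup>2 \<le> (exp (A * (log_plus (lam k))\<^sup>2))\<^sup>2"
proof -
  define A1 where "A1 = ln 2802 / (ln rho * ln 2)"
  \<comment> \<open>Adding 1 keeps the logarithm defined and nonnegative for D = 0.\<close>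
  define A2 where "A2 = ln (2 * D\<^sup>2 + 1) / (2 * (ln 2)\<^sup>2)"
  have lr: "ln rho > 0" using rho_gt_1 by simp
  have nn: "A1 \<ge> 0" "A2 \<ge> 0" unfolding A1_def A2_def using lr by auto
  have "2 * D\<^sup>2 * (2802 ^ m)\<^sup>2 \<le> (exp ((A1 + A2) * (log_plus (lam k))\<^sup>2))\<^sup>2" if k: "k \<in> Sw m" for m k
  proof -
    define L where "L = log_plus (lam k)"
    have L2: "ln 2 \<le> L" unfolding L_def log_plus_def by simp
    have l2: "ln (2::real) > 0" by simp
    have L0: "L > 0" using L2 l2 by linarith
    have m: "real m * ln rho \<le> L"
    proof (cases m)
      case (Suc j)
      have "rho ^ m \<le> Lam j" unfolding Suc Lam_def power_Suc using rho_gt_1 by (intro mult_right_mono) (auto simp: rho_def)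
      also have "\<dots> \<le> max (lam k) 2" using k unfolding Suc Sw_def by (simp add: le_max_iff_disj)
      finally have "ln (rho ^ m) \<le> L" unfolding L_def log_plus_def using rho_gt_1 by (intro ln_mono) auto
      then show ?thesis using rho_gt_1 by (simp add: ln_realpow)
    qed (use L0 in simp)
    have "real m * ln 2802 \<le> A1 * L\<^sup>2"
    proof -
      have "real m * ln 2802 = (real m * ln rho) * ln 2 * A1" unfolding A1_def using lr l2 by (simp add: field_simps)
      also have "\<dots> \<le> L * L * A1" using m L2 l2 L0 nn lr by (intro mult_right_mono mult_mono) auto
      finally show ?thesis by (simp add: power2_eq_square mult_ac)
    qed
    moreover have "ln (2 * D\<^sup>2 + 1) \<le> 2 * (A2 * L\<^sup>2)"
    proof -
      have "ln (2 * D\<^sup>2 + 1) = 2 * (A2 * (ln 2)\<^sup>2)" unfolding A2_def using l2 by (simp add: field_simps)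
      also have "\<dots> \<le> 2 * (A2 * L\<^sup>2)" using nn L2 l2 by (intro mult_left_mono power_mono) auto
      finally show ?thesis .
    qed
    ultimately have le: "ln (2 * D\<^sup>2 + 1) + 2 * (real m * ln 2802) \<le> 2 * ((A1 + A2) * L\<^sup>2)" by (simp add: algebra_simps)
    have p: "2 * D\<^sup>2 + 1 > 0" by (simp add: add_nonneg_pos)
    have pw: "exp (2 * (real m * ln 2802)) = (2802 ^ m)\<^sup>2"
      by (simp add: exp_double exp_of_nat_mult)
    have "2 * D\<^sup>2 * (2802 ^ m)\<^sup>2 \<le> (2 * D\<^sup>2 + 1) * (2802 ^ m)\<^sup>2" by (intro mult_right_mono) auto
    also have "\<dots> = exp (ln (2 * D\<^sup>2 + 1) + 2 * (real m * ln 2802))" unfolding exp_add pw using p by simp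
    also have "\<dots> \<le> exp (2 * ((A1 + A2) * L\<^sup>2))" using le by simp
    also have "\<dots> = (exp ((A1 + A2) * L\<^sup>2))\<^sup>2" by (rule exp_double)
    finally show ?thesis unfolding L_def .
  qed
  then show ?thesis using nn by (intro exI[of _ "A1 + A2"]) auto
qed

text \<open>Splitting 1401^m into (1/2)^m and 2802^m reserves a square-summable factor for
  Cauchy-Schwarz; its constant 4/3 is rounded up to the 2 in
  \<open>window_weight_le\<close>.\<close>

lemma norm_mul_le_fDelta:
  "\<exists>A\<ge>0. \<forall>\<alpha>\<in>U0. \<forall>b\<in>F. cnrm (mul \<alpha> b) \<le> fDelta_norm \<pi> (\<lambda>l. complex_of_real (exp (A * (log_plus l)\<^sup>2))) \<alpha> * cnrm b"
proof -
  obtain D where D: "D \<ge> 0 \<and> (\<forall>n. \<forall>u\<in>ball n. \<forall>b\<in>F. cnrm (mul u b) \<le> D * 1401 ^ n * cnrm b)"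
    using sup_bound ..
  obtain A where A: "A \<ge> 0 \<and> (\<forall>m. \<forall>k\<in>Sw m. 2 * D\<^sup>2 * (2802 ^ m)\<^sup>2 \<le> (exp (A * (log_plus (lam k))\<^sup>2))\<^sup>2)"
    using window_weight_le[OF conjunct1[OF D]] ..
  let ?f = "\<lambda>l. complex_of_real (exp (A * (log_plus l)\<^sup>2))"
  have "cnrm (mul \<alpha> b) \<le> fDelta_norm \<pi> ?f \<alpha> * cnrm b" if a: "\<alpha> \<in> U0" and b: "b \<in> F" for \<alpha> b
  proof -
    obtain S where S: "finite S" "S \<subseteq> J" "\<alpha> = (\<Sum>i\<in>S. scC (coef \<alpha> i) (ev i))"
      using Kinv_F_expand[of \<alpha>] a by blast
    obtain M where M: "S \<subseteq> (\<Union>m<M. Sw m)" using finite_subset_Sw[OF S(1,2)] by blast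
    define T where "T = (\<Union>m<M. Sw m)"
    have T: "finite T" "T \<subseteq> J" unfolding T_def using Sw_finite Sw_J by auto
    have off: "coef \<alpha> i = 0" if i: "i \<in> T - S" for i
    proof -
      have "i \<in> J" using i T by blast
      then have "coef (\<Sum>i\<in>S. scC (coef \<alpha> i) (ev i)) i = 0" using coef_sum_ev[OF S(1,2), of i "coef \<alpha>"] i by simp
      then show ?thesis using S(3) by simp
    qed
    have aT: "\<alpha> = (\<Sum>i\<in>T. scC (coef \<alpha> i) (ev i))"
    proof -
      have "(\<Sum>i\<in>S. scC (coef \<alpha> i) (ev i)) = (\<Sum>i\<in>T. scC (coef \<alpha> i) (ev i))"
        using M off T(1) unfolding T_def[symmetric] by (intro sum.mono_neutral_left) auto
      then show ?thesis using S(3) by simp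
    qed
    have aP: "\<alpha> = (\<Sum>m<M. P m \<alpha>)" using aT unfolding T_def sum_Sw_Union P_def .
    have part: "cnrm (mul (P m \<alpha>) b) \<le> D * 1401 ^ m * cnrm b * cnrm (P m \<alpha>)" for m
    proof -
      obtain h where h: "h \<in> ball m" "P m \<alpha> = scC (complex_of_real (cnrm (P m \<alpha>))) h"
        by (rule scale_to_ball[OF P_wspan])
      have "cnrm (mul (P m \<alpha>) b) = cnrm (P m \<alpha>) * cnrm (mul h b)"
        by (subst h(2)) (simp add: mul_scC_left[OF ballD(3)[OF h(1)] b] cnrm_scC)
      also have "\<dots> \<le> cnrm (P m \<alpha>) * (D * 1401 ^ m * cnrm b)" by (intro mult_left_mono conjunct2[OF D, rule_format] h b) simp
      finally show ?thesis by (simp add: mult_ac)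
    qed
    have PF: "P m \<alpha> \<in> F" for m by (rule wspan_U0(2)[OF P_wspan])
    have "cnrm (mul \<alpha> b) = cnrm (\<Sum>m<M. mul (P m \<alpha>) b)"
      by (subst aP) (simp add: mul_sum_left[OF PF b])
    also have "\<dots> \<le> (\<Sum>m<M. cnrm (mul (P m \<alpha>) b))" by (rule cnrm_sum_le)
    also have "\<dots> \<le> (\<Sum>m<M. D * 1401 ^ m * cnrm b * cnrm (P m \<alpha>))" by (intro sum_mono part)
    also have "\<dots> = (\<Sum>m<M. D * cnrm b * ((1/2) ^ m * (2802 ^ m * cnrm (P m \<alpha>))))"
    proof (rule sum.cong)
      fix m
      have "(1/2) ^ m * (2802::real) ^ m = 1401 ^ m" by (simp flip: power_mult_distrib)
      then show "D * 1401 ^ m * cnrm b * cnrm (P m \<alpha>) = D * cnrm b * ((1/2) ^ m * (2802 ^ m * cnrm (P m \<alpha>)))"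
        by (simp only: mult_ac flip: \<open>(1/2) ^ m * (2802::real) ^ m = 1401 ^ m\<close>)
    qed simp
    also have "\<dots> = D * cnrm b * (\<Sum>m<M. (1/2) ^ m * (2802 ^ m * cnrm (P m \<alpha>)))" by (rule sum_distrib_left[symmetric])
    finally have le: "cnrm (mul \<alpha> b) \<le> D * cnrm b * (\<Sum>m<M. (1/2) ^ m * (2802 ^ m * cnrm (P m \<alpha>)))" .
    have CS: "(\<Sum>m<M. (1/2) ^ m * (2802 ^ m * cnrm (P m \<alpha>)))\<^sup>2 \<le> 2 * (\<Sum>m<M. (2802 ^ m * cnrm (P m \<alpha>))\<^sup>2)"
    proof -
      have "(\<Sum>m<M. ((1/2::real) ^ m)\<^sup>2) = (\<Sum>m<M. (1/4) ^ m)"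
        by (intro sum.cong refl) (simp add: power2_eq_square flip: power_mult_distrib)
      also have "\<dots> = 4/3 - 4/3 * (1/4) ^ M" by (induction M) auto
      also have "\<dots> \<le> 2" by (rule order_trans[of _ "4/3"]) auto
      finally have g: "(\<Sum>m<M. ((1/2::real) ^ m)\<^sup>2) \<le> 2" .
      have "(\<Sum>m<M. (1/2) ^ m * (2802 ^ m * cnrm (P m \<alpha>)))\<^sup>2 \<le> (\<Sum>m<M. ((1/2) ^ m)\<^sup>2) * (\<Sum>m<M. (2802 ^ m * cnrm (P m \<alpha>))\<^sup>2)"
        by (rule Cauchy_Schwarz_ineq_sum)
      also have "\<dots> \<le> 2 * (\<Sum>m<M. (2802 ^ m * cnrm (P m \<alpha>))\<^sup>2)" using g by (intro mult_right_mono sum_nonneg) auto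
      finally show ?thesis .
    qed
    have weights: "2 * D\<^sup>2 * (\<Sum>m<M. (2802 ^ m * cnrm (P m \<alpha>))\<^sup>2) \<le> (fDelta_norm \<pi> ?f \<alpha>)\<^sup>2"
    proof -
      have "2 * D\<^sup>2 * (\<Sum>m<M. (2802 ^ m * cnrm (P m \<alpha>))\<^sup>2)
          = (\<Sum>m<M. \<Sum>k\<in>Sw m. 2 * D\<^sup>2 * (2802 ^ m)\<^sup>2 * (cmod (coef \<alpha> k))\<^sup>2)"
        unfolding power_mult_distrib P_norm sum_distrib_left by (simp only: mult.assoc)
      also have "\<dots> \<le> (\<Sum>m<M. \<Sum>k\<in>Sw m. (cmod (?f (lam k)))\<^sup>2 * (cmod (coef \<alpha> k))\<^sup>2)"
      proof (intro sum_mono mult_right_mono)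
        fix m k assume "k \<in> Sw m"
        then show "2 * D\<^sup>2 * (2802 ^ m)\<^sup>2 \<le> (cmod (?f (lam k)))\<^sup>2" unfolding norm_of_real abs_exp_cancel by (rule conjunct2[OF A, rule_format])
      qed simp
      also have "\<dots> = (\<Sum>k\<in>T. (cmod (?f (lam k)))\<^sup>2 * (cmod (coef \<alpha> k))\<^sup>2)" unfolding T_def sum_Sw_Union ..
      also have "\<dots> = (fDelta_norm \<pi> ?f (\<Sum>k\<in>T. scC (coef \<alpha> k) (ev k)))\<^sup>2"
        unfolding fDelta_norm_sum_ev[OF T] by (rule real_sqrt_pow2[symmetric]) (intro sum_nonneg mult_nonneg_nonneg zero_le_power2)
      finally show ?thesis using aT by simp
    qed
    have f0: "0 \<le> fDelta_norm \<pi> ?f \<alpha>"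
      unfolding fDelta_norm_def by (intro real_sqrt_ge_zero infsum_nonneg mult_nonneg_nonneg zero_le_power2)
    have "(cnrm (mul \<alpha> b))\<^sup>2 \<le> (D * cnrm b * (\<Sum>m<M. (1/2) ^ m * (2802 ^ m * cnrm (P m \<alpha>))))\<^sup>2"
      using le by (intro power_mono) auto
    also have "\<dots> = (D\<^sup>2 * (cnrm b)\<^sup>2) * (\<Sum>m<M. (1/2) ^ m * (2802 ^ m * cnrm (P m \<alpha>)))\<^sup>2" by (simp only: power_mult_distrib)
    also have "\<dots> \<le> (D\<^sup>2 * (cnrm b)\<^sup>2) * (2 * (\<Sum>m<M. (2802 ^ m * cnrm (P m \<alpha>))\<^sup>2))" by (intro mult_left_mono CS) simp
    also have "\<dots> = (2 * D\<^sup>2 * (\<Sum>m<M. (2802 ^ m * cnrm (P m \<alpha>))\<^sup>2)) * (cnrm b)\<^sup>2" by (simp only: mult_ac)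
    also have "\<dots> \<le> (fDelta_norm \<pi> ?f \<alpha>)\<^sup>2 * (cnrm b)\<^sup>2" by (intro mult_right_mono weights) simp
    finally have "(cnrm (mul \<alpha> b))\<^sup>2 \<le> (fDelta_norm \<pi> ?f \<alpha> * cnrm b)\<^sup>2" by (simp only: power_mult_distrib)
    then show ?thesis by (rule power2_le_imp_le) (intro mult_nonneg_nonneg f0 cnrm_nonneg)
  qed
  then show ?thesis using conjunct1[OF A] by (intro exI[of _ A]) simp
qed

lemma Linf_norm_le:
  assumes C: "C \<ge> 0" and le: "\<And>b. b \<in> F \<Longrightarrow> cnrm (mul a b) \<le> C * cnrm b"
  shows "Linf_norm \<pi> I V mul a \<le> ereal C"
  unfolding Linf_norm_def using C le unfolding F_def by (intro Inf_lower) simp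

end

theorem theorem11p7:
  fixes \<pi> :: "sl2 \<Rightarrow> 'h::mr_chilbert \<Rightarrow> 'h"
    and I :: "nat set" and V :: "nat \<Rightarrow> 'h set"
    and mul :: "'h \<Rightarrow> 'h \<Rightarrow> 'h" and one :: 'h and cj :: "'h \<Rightarrow> 'h"
  assumes "mult_rep \<pi> I V mul one cj"
  shows "\<exists>A::real. A \<ge> 0 \<and>
           (\<forall>\<alpha>\<in>Hfin \<pi> I V. (\<forall>t. \<pi> (sl2_rot t) \<alpha> = \<alpha>) \<longrightarrow>
              Linf_norm \<pi> I V mul \<alpha>
                \<le> ereal (fDelta_norm \<pi> (\<lambda>l. complex_of_real (exp (A * (log_plus l)\<^sup>2))) \<alpha>))"
proof -
  interpret mrep \<pi> I V mul one cj using assms by (rule mrep.intro)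
  obtain A where A: "A \<ge> 0 \<and> (\<forall>\<alpha>\<in>U0. \<forall>b\<in>F.
      cnrm (mul \<alpha> b) \<le> fDelta_norm \<pi> (\<lambda>l. complex_of_real (exp (A * (log_plus l)\<^sup>2))) \<alpha> * cnrm b)"
    using norm_mul_le_fDelta ..
  have "Linf_norm \<pi> I V mul \<alpha> \<le> ereal (fDelta_norm \<pi> (\<lambda>l. complex_of_real (exp (A * (log_plus l)\<^sup>2))) \<alpha>)"
    if "\<alpha> \<in> Hfin \<pi> I V" "\<forall>t. \<pi> (sl2_rot t) \<alpha> = \<alpha>" for \<alpha>
  proof (rule Linf_norm_le)
    show "0 \<le> fDelta_norm \<pi> (\<lambda>l. complex_of_real (exp (A * (log_plus l)\<^sup>2))) \<alpha>"
      unfolding fDelta_norm_def by (intro real_sqrt_ge_zero infsum_nonneg mult_nonneg_nonneg zero_le_power2)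
  qed (use that in \<open>intro conjunct2[OF A, rule_format]; simp add: F_def Kinv_def\<close>)
  then show ?thesis using conjunct1[OF A] by (intro exI[of _ A] conjI ballI impI)
qed

end
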